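(* Let $S$ be a finite set of places of $\mathbb{Q}$ with $\infty\in S$, and let $\omega_S$ be a real valued character of $\mathbb{Q}_S^\times/(\mathbb{Q}_S^\times)^2$. Then for $\underline{s}=(s_1,s_2)\in\mathbb{C}^2$ with $\mathrm{Re}(s_1)>1$, $\mathrm{Re}(s_2)>1$, $$\tilde\xi^S(\underline{s},\omega_S)=\zeta^S(s_1)\,\zeta^S(2s_1+2s_2-1)\sum_{\chi}\frac{L^S(s_2,\chi)}{L^S(2s_1+s_2,\chi)\,(f_\chi^S)^{s_1}},$$ where $\chi$ runs over all real valued characters $\chi=\otimes_v\chi_v$ of $\mathbb{Q}^\times\mathbb{R}_{>0}\backslash\mathbb{A}^\times$ such that $\otimes_{v\in S}\chi_v=\omega_S$.
   Context: $\mathbb{A}$ is the adele ring of $\mathbb{Q}$, $\mathbb{Q}_S=\prod_{v\in S}\mathbb{Q}_v$, and $|x|_S=\prod_{v\in S}|x_v|_v$ for $x\in\mathbb{Q}_S^\times$. $G=\mathrm{GL}(1)\times\{\begin{pmatrix}1&0\\ *&*\end{pmatrix}\in\mathrm{GL}(2)\}$ acts on the space $V$ of symmetric $2\times 2$ matrices by $(a,h)\cdot x=a\,h\,x\,{}^t h$. For $x=\begin{pmatrix}x_1&x_{12}\\ x_{12}&x_2\end{pmatrix}$ put $P_1(x)=x_1$, $P_2(x)=x_{12}^2-x_1x_2$, and $V^0=\{x\in V: P_1(x)\ne 0,\ P_2(x)\neq 0\}$. $V(\mathbb{Z}_p)$ denotes the symmetric matrices with entries in $\mathbb{Z}_p$.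 For $\delta_S\in\mathbb{Q}_S^\times/(\mathbb{Q}_S^\times)^2$ let $V^0(\mathbb{Q}_S,\delta_S)=\{x\in V^0(\mathbb{Q}_S): P_2(x)\in\delta_S(\mathbb{Q}_S^\times)^2\}$, $L_S(\delta_S)=V(\mathbb{Q})\cap\big(V^0(\mathbb{Q}_S,\delta_S)\prod_{p\notin S}V(\mathbb{Z}_p)\big)$, $\Gamma_S=G(\mathbb{Q})\cap\big(G(\mathbb{Q}_S)\prod_{p\notin S}G(\mathbb{Z}_p)\big)$, $\Gamma_{S,x}=\{\gamma\in\Gamma_S:\gamma\cdot x=x\}$, and $$\xi^S(\underline{s},\delta_S)=\sum_{x\in\Gamma_S\backslash L_S(\delta_S)}\frac{1}{\#(\Gamma_{S,x})}\frac{1}{|P_1(x)|_S^{s_1}|P_2(x)|_S^{s_2}},$$ which converges absolutely for $\mathrm{Re}(s_1)>1$, $\mathrm{Re}(s_2)>1$. For $\omega_S$ a character of $\mathbb{Q}_S^\times/(\mathbb{Q}_S^\times)^2$, $$\tilde\xi^S(\underline{s},\omega_S)=\frac{2^{|S|+1}}{|\mathbb{Q}_S^\times/(\mathbb{Q}_S^\times)^2|\,|2|_S}\sum_{\delta_S\in\mathbb{Q}_S^\times/(\mathbb{Q}_S^\times)^2}\omega_S(\delta_S)\,\xi^S(\underline{s},\delta_S).$$ For a character $\chi=\otimes_v\chi_v$ of $\mathbb{Q}^\times\mathbb{R}_{>0}\backslash\mathbb{A}^\times$, $L^S(s,\chi)=\prod_{p\notin S}L_p(s,\chi_p)$ with $L_p(s,\chi_p)=(1-\chi_p(p)p^{-s})^{-1}$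 if $\chi_p$ is unramified and $L_p(s,\chi_p)=1$ if $\chi_p$ is ramified; $\zeta^S(s)=L^S(s,\mathbf{1})$ for the trivial character $\mathbf 1$. $f_\chi=\prod_{p}p^{f(\chi_p)}$ is the conductor of $\chi$ and $f_\chi^S=\prod_{p\notin S}p^{f(\chi_p)}$ its prime-to-$S$ part. *)

theory Defs
  imports "HOL-Analysis.Analysis" "HOL-Algebra.Algebra" "HOL-Algebra.Algebraic_Closure_Type"
begin

section \<open>Completions of the rationals\<close>

hide_const (open) Divisibility.prime
no_notation fps_nth (infixl \<open>$\<close> 75)

datatype place = InfPlace | FinPlace nat

definition places :: "place set" where
  "places = insert InfPlace {FinPlace p | p. prime p}"

fun rat_abs :: "place \<Rightarrow> rat \<Rightarrow> real" where
  "rat_abs InfPlace q = \<bar>real_of_rat q\<bar>"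
| "rat_abs (FinPlace p) q =
     (if q = 0 then 0
      else real p powi (int (multiplicity (int p) (snd (quotient_of q)))
                        - int (multiplicity (int p) (fst (quotient_of q)))))"

definition cauchy_ring :: "place \<Rightarrow> (nat \<Rightarrow> rat) ring" where
  "cauchy_ring v =
     \<lparr>carrier = {a. \<forall>e>0. \<exists>N. \<forall>m\<ge>N. \<forall>n\<ge>N. rat_abs v (a m - a n) < e},
      monoid.mult = (\<lambda>a b n. a n * b n), one = (\<lambda>_. 1), ring.zero = (\<lambda>_. 0), add = (\<lambda>a b n. a n + b n)\<rparr>"

definition null_seqs :: "place \<Rightarrow> (nat \<Rightarrow> rat) set" where
  "null_seqs v = {a. (\<lambda>n. rat_abs v (a n)) \<longlonglongrightarrow> 0}"

text \<open>The field \<open>\<rat>\<^sub>v\<close> is the completion of \<open>\<rat>\<close> at \<open>v\<close>, for the infinite place as well: this gives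
  all of them a common type, so that they can be the factors of a product over places.
  Its elements are the cosets of the null sequences.\<close>
definition Qv :: "place \<Rightarrow> (nat \<Rightarrow> rat) set ring" where
  "Qv v = cauchy_ring v Quot null_seqs v"

definition emb :: "place \<Rightarrow> rat \<Rightarrow> (nat \<Rightarrow> rat) set" where
  "emb v q = null_seqs v +>\<^bsub>cauchy_ring v\<^esub> (\<lambda>_. q)"

definition Qv_abs :: "place \<Rightarrow> (nat \<Rightarrow> rat) set \<Rightarrow> real" where
  "Qv_abs v x = (THE r. \<forall>a\<in>x. (\<lambda>n. rat_abs v (a n)) \<longlonglongrightarrow> r)"

text \<open>The canonical isomorphism from the completion at the infinite place to the reals.\<close>
definition Qinf_to_real :: "(nat \<Rightarrow> rat) set \<Rightarrow> real" where
  "Qinf_to_real x = (THE r. \<forall>a\<in>x. (\<lambda>n. real_of_rat (a n)) \<longlonglongrightarrow> r)"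

text \<open>The value 0 outside the carrier is there because \<open>Metric_space\<close> wants a symmetric, nonnegative
  distance on the whole type.\<close>
definition Qv_dist :: "place \<Rightarrow> (nat \<Rightarrow> rat) set \<Rightarrow> (nat \<Rightarrow> rat) set \<Rightarrow> real" where
  "Qv_dist v x y =
     (if x \<in> carrier (Qv v) \<and> y \<in> carrier (Qv v) then Qv_abs v (x \<ominus>\<^bsub>Qv v\<^esub> y) else 0)"

definition Qv_topology :: "place \<Rightarrow> (nat \<Rightarrow> rat) set topology" where
  "Qv_topology v = Metric_space.mtopology (carrier (Qv v)) (Qv_dist v)"

definition Zp :: "nat \<Rightarrow> (nat \<Rightarrow> rat) set ring" where
  "Zp p = (Qv (FinPlace p))
            \<lparr>carrier := {x \<in> carrier (Qv (FinPlace p)). Qv_abs (FinPlace p) x \<le> 1}\<rparr>"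

section \<open>Finite products of completions, adeles and ideles\<close>

definition QS :: "place set \<Rightarrow> (place \<Rightarrow> (nat \<Rightarrow> rat) set) ring" where
  "QS S = \<lparr>carrier = (\<Pi>\<^sub>E v\<in>S. carrier (Qv v)),
           monoid.mult = (\<lambda>x y. \<lambda>v\<in>S. x v \<otimes>\<^bsub>Qv v\<^esub> y v), one = (\<lambda>v\<in>S. \<one>\<^bsub>Qv v\<^esub>),
           ring.zero = (\<lambda>v\<in>S. \<zero>\<^bsub>Qv v\<^esub>), add = (\<lambda>x y. \<lambda>v\<in>S. x v \<oplus>\<^bsub>Qv v\<^esub> y v)\<rparr>"

definition diag :: "place set \<Rightarrow> rat \<Rightarrow> place \<Rightarrow> (nat \<Rightarrow> rat) set" where
  "diag S q = (\<lambda>v\<in>S. emb v q)"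

definition S_abs :: "place set \<Rightarrow> (place \<Rightarrow> (nat \<Rightarrow> rat) set) \<Rightarrow> real" where
  "S_abs S x = (\<Prod>v\<in>S. Qv_abs v (x v))"

definition QS_squares :: "place set \<Rightarrow> (place \<Rightarrow> (nat \<Rightarrow> rat) set) set" where
  "QS_squares S = {x \<otimes>\<^bsub>QS S\<^esub> x | x. x \<in> Units (QS S)}"

definition square_classes :: "place set \<Rightarrow> (place \<Rightarrow> (nat \<Rightarrow> rat) set) set monoid" where
  "square_classes S = units_of (QS S) Mod QS_squares S"

definition adeles :: "(place \<Rightarrow> (nat \<Rightarrow> rat) set) ring" where
  "adeles = (QS places)
     \<lparr>carrier := {x \<in> carrier (QS places). finite {p. prime p \<and> x (FinPlace p) \<notin> carrier (Zp p)}}\<rparr>"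

text \<open>The restricted product topology with respect to the subgroups of integral units.\<close>
definition idele_topology :: "(place \<Rightarrow> (nat \<Rightarrow> rat) set) topology" where
  "idele_topology = topology_generated_by
     {Pi\<^sub>E places U | U. (\<forall>v\<in>places. openin (Qv_topology v) (U v) \<and> U v \<subseteq> Units (Qv v)) \<and>
                      finite {p. prime p \<and> U (FinPlace p) \<noteq> Units (Zp p)}}"

definition idele_at :: "place \<Rightarrow> (nat \<Rightarrow> rat) set \<Rightarrow> place \<Rightarrow> (nat \<Rightarrow> rat) set" where
  "idele_at v x = (\<lambda>w\<in>places. if w = v then x else \<one>\<^bsub>Qv w\<^esub>)"

section \<open>Characters and their L-functions\<close>

definition real_character :: "('a, 'b) monoid_scheme \<Rightarrow> ('a \<Rightarrow> complex) \<Rightarrow> bool" where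
  "real_character G chi \<longleftrightarrow>
     chi \<in> hom G (units_of ring_of_type_algebra) \<and> (\<forall>x\<in>carrier G. chi x \<in> \<real>)"

text \<open>Real valued characters of \<open>\<rat>\<^sup>\<times>\<real>\<^sub>>\<^sub>0\A\<^sup>\<times>\<close>, as functions on the ideles. They are extensional,
  so that each character is counted once in a sum over characters.\<close>
definition real_idele_class_characters :: "((place \<Rightarrow> (nat \<Rightarrow> rat) set) \<Rightarrow> complex) set" where
  "real_idele_class_characters =
     {chi \<in> extensional (Units adeles).
        real_character (units_of adeles) chi \<and>
        continuous_map idele_topology euclidean chi \<and>
        (\<forall>q. q \<noteq> 0 \<longrightarrow> chi (diag places q) = 1) \<and>
        (\<forall>x\<in>Units (Qv InfPlace). Qinf_to_real x > 0 \<longrightarrow> chi (idele_at InfPlace x) = 1)}"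

definition trivial_character :: "(place \<Rightarrow> (nat \<Rightarrow> rat) set) \<Rightarrow> complex" where
  "trivial_character = (\<lambda>x\<in>Units adeles. 1)"

definition local_component ::
  "((place \<Rightarrow> (nat \<Rightarrow> rat) set) \<Rightarrow> complex) \<Rightarrow> place \<Rightarrow> (nat \<Rightarrow> rat) set \<Rightarrow> complex" where
  "local_component chi v x = chi (idele_at v x)"

definition unramified :: "((place \<Rightarrow> (nat \<Rightarrow> rat) set) \<Rightarrow> complex) \<Rightarrow> nat \<Rightarrow> bool" where
  "unramified chi p \<longleftrightarrow> (\<forall>u\<in>Units (Zp p). local_component chi (FinPlace p) u = 1)"

text \<open>The exponent \<open>f(\<chi>\<^sub>p)\<close>: the set of units \<open>u\<close> with \<open>|u - 1| \<le> p\<^sup>-\<^sup>n\<close> is the full unit group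
  for \<open>n = 0\<close> and \<open>1 + p\<^sup>n\<int>\<^sub>p\<close> for \<open>n \<ge> 1\<close>.\<close>
definition conductor_exponent :: "((place \<Rightarrow> (nat \<Rightarrow> rat) set) \<Rightarrow> complex) \<Rightarrow> nat \<Rightarrow> nat" where
  "conductor_exponent chi p =
     (LEAST n. \<forall>u\<in>Units (Zp p).
        Qv_abs (FinPlace p) (u \<ominus>\<^bsub>Qv (FinPlace p)\<^esub> \<one>\<^bsub>Qv (FinPlace p)\<^esub>) \<le> 1 / real p ^ n \<longrightarrow>
        local_component chi (FinPlace p) u = 1)"

definition conductor_outside :: "place set \<Rightarrow> ((place \<Rightarrow> (nat \<Rightarrow> rat) set) \<Rightarrow> complex) \<Rightarrow> nat" where
  "conductor_outside S chi =
     (\<Prod>p | prime p \<and> FinPlace p \<notin> S \<and> conductor_exponent chi p \<noteq> 0. p ^ conductor_exponent chi p)"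

definition local_L :: "nat \<Rightarrow> complex \<Rightarrow> ((place \<Rightarrow> (nat \<Rightarrow> rat) set) \<Rightarrow> complex) \<Rightarrow> complex" where
  "local_L p s chi =
     (if unramified chi p
      then inverse (1 - local_component chi (FinPlace p) (emb (FinPlace p) (of_nat p))
                        * of_nat p powr (- s))
      else 1)"

definition L_outside ::
  "place set \<Rightarrow> complex \<Rightarrow> ((place \<Rightarrow> (nat \<Rightarrow> rat) set) \<Rightarrow> complex) \<Rightarrow> complex" where
  "L_outside S s chi = prodinf (\<lambda>p. if prime p \<and> FinPlace p \<notin> S then local_L p s chi else 1)"

definition zeta_outside :: "place set \<Rightarrow> complex \<Rightarrow> complex" where
  "zeta_outside S s = L_outside S s trivial_character"

text \<open>The real valued characters \<open>\<chi>\<close> with \<open>\<Otimes>\<^bsub>v\<in>S\<^esub> \<chi>\<^sub>v = \<omega>\<close>.\<close>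
definition characters_over ::
  "place set \<Rightarrow> ((place \<Rightarrow> (nat \<Rightarrow> rat) set) set \<Rightarrow> complex)
    \<Rightarrow> ((place \<Rightarrow> (nat \<Rightarrow> rat) set) \<Rightarrow> complex) set" where
  "characters_over S \<omega> =
     {chi \<in> real_idele_class_characters.
        \<forall>x\<in>Units (QS S). (\<Prod>v\<in>S. local_component chi v (x v))
                            = \<omega> (QS_squares S #>\<^bsub>units_of (QS S)\<^esub> x)}"

section \<open>The prehomogeneous vector space\<close>

text \<open>Matrices over a ring \<open>R\<close> given by a carrier: the class-based matrix product is not available.\<close>

definition mat2_mult :: "('a, 'b) ring_scheme \<Rightarrow> 'a^2^2 \<Rightarrow> 'a^2^2 \<Rightarrow> 'a^2^2" where
  "mat2_mult R A B = (\<chi> i j. \<Oplus>\<^bsub>R\<^esub>k\<in>UNIV. A $ i $ k \<otimes>\<^bsub>R\<^esub> B $ k $ j)"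

definition mat2 :: "('a, 'b) ring_scheme \<Rightarrow> ('a^2^2) monoid" where
  "mat2 R = \<lparr>carrier = {A. \<forall>i j. A $ i $ j \<in> carrier R}, monoid.mult = mat2_mult R,
             one = (\<chi> i j. if i = j then \<one>\<^bsub>R\<^esub> else \<zero>\<^bsub>R\<^esub>)\<rparr>"

definition GR :: "('a, 'b) ring_scheme \<Rightarrow> ('a \<times> ('a^2^2)) monoid" where
  "GR R = units_of R \<times>\<times>
          (units_of (mat2 R))\<lparr>carrier := {h \<in> Units (mat2 R). h $ 1 $ 1 = \<one>\<^bsub>R\<^esub> \<and> h $ 1 $ 2 = \<zero>\<^bsub>R\<^esub>}\<rparr>"

definition G_act :: "('a, 'b) ring_scheme \<Rightarrow> ('a \<times> ('a^2^2)) \<Rightarrow> 'a^2^2 \<Rightarrow> 'a^2^2" where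
  "G_act R g x = map_matrix (\<lambda>t. fst g \<otimes>\<^bsub>R\<^esub> t)
                   (mat2_mult R (mat2_mult R (snd g) x) (transpose (snd g)))"

definition VR :: "('a, 'b) ring_scheme \<Rightarrow> ('a^2^2) set" where
  "VR R = {x \<in> carrier (mat2 R). transpose x = x}"

definition P1 :: "'a^2^2 \<Rightarrow> 'a" where
  "P1 x = x $ 1 $ 1"

definition P2 :: "('a, 'b) ring_scheme \<Rightarrow> 'a^2^2 \<Rightarrow> 'a" where
  "P2 R x = x $ 1 $ 2 \<otimes>\<^bsub>R\<^esub> x $ 1 $ 2 \<ominus>\<^bsub>R\<^esub> x $ 1 $ 1 \<otimes>\<^bsub>R\<^esub> x $ 2 $ 2"

text \<open>Points over \<open>\<rat>\<^sub>S\<close> of the open subvariety where \<open>P\<^sub>1\<close> and \<open>P\<^sub>2\<close> do not vanish: they are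
  nonzero in every factor, that is, they are units of the product ring.\<close>
definition V0_QS :: "place set \<Rightarrow> ((place \<Rightarrow> (nat \<Rightarrow> rat) set)^2^2) set" where
  "V0_QS S = {x \<in> VR (QS S). P1 x \<in> Units (QS S) \<and> P2 (QS S) x \<in> Units (QS S)}"

definition V0_QS_class ::
  "place set \<Rightarrow> (place \<Rightarrow> (nat \<Rightarrow> rat) set) set \<Rightarrow> ((place \<Rightarrow> (nat \<Rightarrow> rat) set)^2^2) set" where
  "V0_QS_class S \<delta> = {x \<in> V0_QS S. P2 (QS S) x \<in> \<delta>}"

abbreviation ratring :: "rat ring" where
  "ratring \<equiv> ring_of_type_algebra"

definition L_set :: "place set \<Rightarrow> (place \<Rightarrow> (nat \<Rightarrow> rat) set) set \<Rightarrow> (rat^2^2) set" where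
  "L_set S \<delta> = {x \<in> VR ratring.
     map_matrix (diag S) x \<in> V0_QS_class S \<delta> \<and>
     (\<forall>p. prime p \<and> FinPlace p \<notin> S \<longrightarrow> map_matrix (emb (FinPlace p)) x \<in> VR (Zp p))}"

definition Gamma :: "place set \<Rightarrow> (rat \<times> (rat^2^2)) monoid" where
  "Gamma S = (GR ratring)\<lparr>carrier := {g \<in> carrier (GR ratring).
     map_prod (diag S) (map_matrix (diag S)) g \<in> carrier (GR (QS S)) \<and>
     (\<forall>p. prime p \<and> FinPlace p \<notin> S \<longrightarrow>
        map_prod (emb (FinPlace p)) (map_matrix (emb (FinPlace p))) g \<in> carrier (GR (Zp p)))}\<rparr>"

section \<open>The zeta functions\<close>

definition xi_orbits :: "place set \<Rightarrow> (place \<Rightarrow> (nat \<Rightarrow> rat) set) set \<Rightarrow> (rat^2^2) set set" where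
  "xi_orbits S \<delta> = orbits (Gamma S) (L_set S \<delta>) (G_act ratring)"

definition xi_summand :: "place set \<Rightarrow> complex \<Rightarrow> complex \<Rightarrow> rat^2^2 \<Rightarrow> complex" where
  "xi_summand S s1 s2 x =
     1 / of_nat (card (stabilizer (Gamma S) (G_act ratring) x)) *
     (1 / (of_real (S_abs S (diag S (P1 x))) powr s1 *
           of_real (S_abs S (diag S (P2 ratring x))) powr s2))"

text \<open>The summand is constant on orbits, so any representative may be chosen.\<close>
definition xi_orbit_summand :: "place set \<Rightarrow> complex \<Rightarrow> complex \<Rightarrow> (rat^2^2) set \<Rightarrow> complex" where
  "xi_orbit_summand S s1 s2 B = xi_summand S s1 s2 (SOME x. x \<in> B)"

definition xi ::
  "place set \<Rightarrow> complex \<Rightarrow> complex \<Rightarrow> (place \<Rightarrow> (nat \<Rightarrow> rat) set) set \<Rightarrow> complex" where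
  "xi S s1 s2 \<delta> = (\<Sum>\<^sub>\<infinity>B\<in>xi_orbits S \<delta>. xi_orbit_summand S s1 s2 B)"

definition xi_tilde ::
  "place set \<Rightarrow> complex \<Rightarrow> complex \<Rightarrow> ((place \<Rightarrow> (nat \<Rightarrow> rat) set) set \<Rightarrow> complex) \<Rightarrow> complex" where
  "xi_tilde S s1 s2 \<omega> =
     2 ^ (card S + 1) / (of_nat (order (square_classes S)) * of_real (S_abs S (diag S 2))) *
     (\<Sum>\<delta>\<in>carrier (square_classes S). \<omega> \<delta> * xi S s1 s2 \<delta>)"

end

theory Submission
  imports Defs "HOL-Number_Theory.Number_Theory"
begin

text \<open>
  Let \<open>N(d, n)\<close> be the number of square roots of \<open>d\<close> modulo \<open>n\<close>. Every orbit contains a form with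
  \<open>P\<^sub>1 = n\<close> and \<open>P\<^sub>2 = e m\<close>, where \<open>n, m\<close> are positive integers prime to \<open>S\<close> and \<open>e\<close> runs over representatives of
  the \<open>S\<close>-units modulo squares; such a form is given by a square root \<open>b\<close> of \<open>e m\<close> modulo \<open>n\<close>, the forms
  of \<open>b\<close> and \<open>b'\<close> are equivalent iff \<open>b' \<equiv> \<plusminus>b\<close>, and the stabilizer has order 2 if \<open>b \<equiv> -b\<close> and is
  trivial otherwise. Hence \<open>\<Sum>\<^sub>\<delta> \<omega>(\<delta>) \<xi>(\<delta>) = 1/2 \<Sum> \<omega>(e m) N(e m, n) n\<^sup>-\<^sup>s\<^sup>1 m\<^sup>-\<^sup>s\<^sup>2\<close>.
  Splitting a common square factor \<open>g\<^sup>2\<close> off \<open>m\<close> and \<open>n\<close> multiplies \<open>N\<close> by \<open>g\<close> and yields the factor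
  \<open>\<zeta>(2s\<^sub>1 + 2s\<^sub>2 - 1)\<close>. For coprime \<open>m, n\<close> the number \<open>N(e m, n)\<close> is the sum of \<open>\<psi>(e m)\<close> over the quadratic
  characters \<open>\<psi>\<close> modulo \<open>n\<close>; summing over \<open>e\<close> selects, by orthogonality, those \<open>\<psi>\<close> that agree with \<open>\<omega>\<close> on
  the \<open>S\<close>-units, and as \<open>\<rat>\<close> has class number one they are exactly the restrictions of the idele class
  characters \<open>\<chi>\<close> over \<open>\<omega>\<close> with conductor dividing \<open>n\<close>. The constants match because
  \<open>|\<rat>\<^sub>S\<^sup>\<times>/(\<rat>\<^sub>S\<^sup>\<times>)\<^sup>2| |2|\<^sub>S = 4\<^bsup>|S|\<^esup>\<close>.
\<close>

section \<open>Valuations of rational numbers\<close>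

text \<open>The obstacle is that \<open>m\<close> and \<open>n\<close> need not be coprime, whereas
  character sums count square roots of units only. Once common squares are removed, the pairs that
  still contribute are tame: a common prime divides \<open>n\<close> exactly once. The common part
  \<open>k\<close> is then squarefree and prime to \<open>n / k\<close>. Dropping it from
  \<open>n\<close> changes neither the number of square roots nor the character sum, because
  \<open>chi m\<close> vanishes unless \<open>m\<close> is prime to the conductor; so the identity
  for coprime pairs extends to tame ones. The denominator L(2 s1 + s2, chi) undoes tameness: every
  pair (N, M) is uniquely (r^2 n, r m) with (n, m) tame, so multiplying the tame sum by this
  L-series yields a sum over all pairs, which factors. The interchange of the sums over forms and
  over characters rests on the bound 2 tau(n), valid both for the square roots in the tame case and
  for the characters of conductor dividing n. A character over omega is only assumed to have real
  values; the values 1 and -1 come from the finite groups through which it factors away from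
  S.\<close>

definition vp :: "nat \<Rightarrow> rat \<Rightarrow> int" where
  "vp p q = int (multiplicity (int p) (fst (quotient_of q)))
            - int (multiplicity (int p) (snd (quotient_of q)))"

text \<open>Cross multiplication with the reduced fraction. The definition reads the valuation off
  lowest terms; from here on any representation as a fraction will do.\<close>

lemma vp_frac:
  assumes p: "prime p" and ab: "a \<noteq> 0" "b \<noteq> 0"
  shows "vp p (of_int a / of_int b) = int (multiplicity (int p) a) - int (multiplicity (int p) b)"
proof -
  obtain c d where cd: "quotient_of (of_int a / of_int b) = (c, d)" by fastforce
  have d: "d > 0" using cd quotient_of_denom_pos by blast
  have "of_int a / of_int b = (of_int c / of_int d :: rat)" using cd quotient_of_div by blast
  hence "(of_int (a * d) :: rat) = of_int (c * b)" using ab d by (simp add: field_simps)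
  hence eq: "a * d = c * b" by (simp only: of_int_eq_iff)
  hence c: "c \<noteq> 0" using ab d by auto
  have "multiplicity (int p) (a * d) = multiplicity (int p) (c * b)" using eq by simp
  moreover have "prime_elem (int p)" using p by auto
  ultimately have "multiplicity (int p) a + multiplicity (int p) d
      = multiplicity (int p) c + multiplicity (int p) b"
    using ab c d by (simp add: prime_elem_multiplicity_mult_distrib)
  thus ?thesis by (simp add: vp_def cd)
qed

lemma rat_frac_cases:
  fixes q :: rat
  obtains a b where "q = of_int a / of_int b" "b > 0" "coprime a b"
  using quotient_of_div[of q] quotient_of_denom_pos[of q] quotient_of_coprime[of q]
  by (metis prod.collapse)

lemma vp_of_int: "prime p \<Longrightarrow> a \<noteq> 0 \<Longrightarrow> vp p (of_int a) = int (multiplicity (int p) a)"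
  using vp_frac[of p a 1] by simp

lemma multiplicity_int_of_nat:
  assumes "prime p" "a \<noteq> 0"
  shows "multiplicity (int p) (int a) = multiplicity p a"
proof (rule multiplicity_eqI)
  show "int p ^ multiplicity p a dvd int a"
    by (metis multiplicity_dvd of_nat_dvd_iff of_nat_power)
  have "\<not> p ^ Suc (multiplicity p a) dvd a"
    using assms by (subst power_dvd_iff_le_multiplicity) auto
  thus "\<not> int p ^ Suc (multiplicity p a) dvd int a"
    by (metis of_nat_dvd_iff of_nat_power)
qed

lemma vp_of_nat: "prime p \<Longrightarrow> a \<noteq> 0 \<Longrightarrow> vp p (of_nat a) = int (multiplicity p a)"
  using vp_of_int[of p "int a"] multiplicity_int_of_nat[of p a] by simp

lemma vp_mult:
  assumes "prime p" "q \<noteq> 0" "r \<noteq> 0"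
  shows "vp p (q * r) = vp p q + vp p r"
proof -
  obtain a b where q: "q = of_int a / of_int b" "b > 0" by (rule rat_frac_cases[of q])
  obtain c d where r: "r = of_int c / of_int d" "d > 0" by (rule rat_frac_cases[of r])
  have nz: "a \<noteq> 0" "c \<noteq> 0" "b \<noteq> 0" "d \<noteq> 0" using q r assms by auto
  have qr: "q * r = of_int (a * c) / of_int (b * d)" by (simp add: q r)
  have "prime_elem (int p)" using assms by auto
  then show ?thesis
    using nz assms vp_frac[of p "a * c" "b * d"] vp_frac[of p a b] vp_frac[of p c d]
    unfolding qr[symmetric] q(1)[symmetric] r(1)[symmetric]
    by (auto simp: prime_elem_multiplicity_mult_distrib)
qed

lemma vp_1 [simp]: "vp p 1 = 0"
  by (simp add: vp_def)

lemma vp_neg_1 [simp]: "vp p (-1) = 0"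
  by (simp add: vp_def)

lemma vp_inverse: "prime p \<Longrightarrow> q \<noteq> 0 \<Longrightarrow> vp p (inverse q) = - vp p q"
  using vp_mult[of p q "inverse q"] by simp

lemma vp_divide: "prime p \<Longrightarrow> q \<noteq> 0 \<Longrightarrow> r \<noteq> 0 \<Longrightarrow> vp p (q / r) = vp p q - vp p r"
  using vp_mult[of p q "inverse r"] vp_inverse[of p r] by (simp add: divide_inverse)

lemma vp_power: "prime p \<Longrightarrow> q \<noteq> 0 \<Longrightarrow> vp p (q ^ n) = int n * vp p q"
  by (induction n) (auto simp: vp_mult algebra_simps)

lemma vp_power_int: "prime p \<Longrightarrow> q \<noteq> 0 \<Longrightarrow> vp p (q powi n) = n * vp p q"
  by (cases n rule: int_cases3) (auto simp: power_int_minus vp_power vp_inverse)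

lemma vp_prod:
  "prime p \<Longrightarrow> (\<And>i. i \<in> I \<Longrightarrow> f i \<noteq> 0) \<Longrightarrow> vp p (prod f I) = (\<Sum>i\<in>I. vp p (f i))"
  by (induction I rule: infinite_finite_induct) (auto simp: vp_mult)

lemma vp_prime: "prime p \<Longrightarrow> prime q \<Longrightarrow> vp p (of_nat q) = (if p = q then 1 else 0)"
  by (auto simp: vp_of_nat prime_multiplicity_other prime_gt_0_nat multiplicity_prime
      intro: prime_multiplicity_other)

text \<open>Over a common denominator \<open>B\<close> the claim says that both numerators, hence
  their sum, are divisible by p^(k + v(B)). The case \<open>q + r = 0\<close> has to be excluded
  because \<open>vp\<close> takes the value 0, not infinity, at 0.\<close>

lemma vp_add_ge:
  assumes p: "prime p" and nz: "q \<noteq> 0" "r \<noteq> 0" "q + r \<noteq> 0" and k: "k \<le> vp p q" "k \<le> vp p r"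
  shows "k \<le> vp p (q + r)"
proof -
  obtain a b where q: "q = of_int a / of_int b" "b > 0" by (rule rat_frac_cases[of q])
  obtain c d where r: "r = of_int c / of_int d" "d > 0" by (rule rat_frac_cases[of r])
  define A where "A = a * d" define C where "C = c * b" define B where "B = b * d"
  have q': "q = of_int A / of_int B" and r': "r = of_int C / of_int B"
    using q r by (auto simp: A_def B_def C_def field_simps)
  have s': "q + r = of_int (A + C) / of_int B" unfolding q' r' by (simp add: add_divide_distrib)
  have nz': "A \<noteq> 0" "C \<noteq> 0" "B \<noteq> 0" "A + C \<noteq> 0"
    using nz q' r' s' by auto
  let ?m = "multiplicity (int p)"
  have pe: "\<not> is_unit (int p)" using p by auto
  have kA: "k + int (?m B) \<le> int (?m A)" "k + int (?m B) \<le> int (?m C)"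
    using k nz' p unfolding q' r' by (auto simp: vp_frac)
  let ?j = "nat (k + int (?m B))"
  have "int p ^ ?j dvd A" "int p ^ ?j dvd C"
    using kA by (auto intro!: multiplicity_dvd')
  hence "int p ^ ?j dvd A + C" by simp
  hence "?j \<le> ?m (A + C)" using nz' pe by (intro multiplicity_geI) auto
  thus ?thesis unfolding s' vp_frac[OF p nz'(4,3)] by linarith
qed

section \<open>The absolute values of the rationals at all places\<close>

lemma rat_abs_fin: "rat_abs (FinPlace p) q = (if q = 0 then 0 else real p powi (- vp p q))"
  by (simp add: vp_def)

lemma places_fin [simp]: "FinPlace p \<in> places \<longleftrightarrow> prime p"
  by (auto simp: places_def)

lemma places_inf [simp]: "InfPlace \<in> places"
  by (auto simp: places_def)

lemma place_cases:
  assumes "v \<in> places"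
  obtains "v = InfPlace" | p where "v = FinPlace p" "prime p"
  using assms by (auto simp: places_def)

lemma rat_abs_0 [simp]: "rat_abs v 0 = 0"
  by (cases v) auto

lemma rat_abs_1 [simp]: "rat_abs v 1 = 1"
  by (cases v) auto

lemma rat_abs_nonneg [simp]: "rat_abs v q \<ge> 0"
  by (cases v) auto

lemma rat_abs_eq_0_iff [simp]: "v \<in> places \<Longrightarrow> rat_abs v q = 0 \<longleftrightarrow> q = 0"
  by (cases v) (auto simp: prime_gt_0_nat)

lemma rat_abs_mult: "v \<in> places \<Longrightarrow> rat_abs v (q * r) = rat_abs v q * rat_abs v r"
proof (elim place_cases)
  fix p assume "v = FinPlace p" "prime p"
  thus ?thesis by (simp only: rat_abs_fin)
    (auto simp: vp_mult power_int_add [symmetric] prime_gt_0_nat algebra_simps simp del: rat_abs.simps)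
qed (auto simp: of_rat_mult abs_mult)

lemma rat_abs_inverse: "v \<in> places \<Longrightarrow> rat_abs v (inverse q) = inverse (rat_abs v q)"
  using rat_abs_mult[of v q "inverse q"] by (cases "q = 0") (auto simp: field_simps)

lemma rat_abs_uminus [simp]: "rat_abs v (- q) = rat_abs v q"
proof (cases v)
  case (FinPlace p)
  have "quotient_of (- q) = (let (a, b) = quotient_of q in (- a, b))"
    by (rule rat_uminus_code)
  then show ?thesis by (simp add: FinPlace case_prod_beta)
qed (auto simp: of_rat_minus)

lemma rat_abs_ultra:
  assumes p: "prime p" shows "rat_abs (FinPlace p) (q + r) \<le> max (rat_abs (FinPlace p) q) (rat_abs (FinPlace p) r)"
proof (cases "q = 0 \<or> r = 0 \<or> q + r = 0")
  case True
  thus ?thesis by (auto simp del: rat_abs.simps simp: le_max_iff_disj)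
next
  case False
  let ?k = "min (vp p q) (vp p r)"
  have "?k \<le> vp p (q + r)" using False p by (intro vp_add_ge) auto
  hence "real p powi (- vp p (q + r)) \<le> real p powi (- ?k)"
    using prime_ge_1_nat[OF p] by (intro power_int_increasing) auto
  also have "\<dots> \<le> max (real p powi (- vp p q)) (real p powi (- vp p r))"
    by (auto simp: min_def)
finally show ?thesis using False unfolding rat_abs_fin by (simp del: max.bounded_iff le_max_iff_disj)
qed

lemma rat_abs_triangle:
  assumes "v \<in> places" shows "rat_abs v (q + r) \<le> rat_abs v q + rat_abs v r"
  using assms
proof (cases rule: place_cases)
  case (2 p)
  show ?thesis using rat_abs_ultra[OF 2(2), of q r] rat_abs_nonneg[of v q] rat_abs_nonneg[of v r]
    unfolding 2(1) by linarith
next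
  case 1
  show ?thesis using abs_triangle_ineq[of "real_of_rat q" "real_of_rat r"] by (simp add: 1 of_rat_add)
qed

lemma rat_abs_minus_commute: "rat_abs v (q - r) = rat_abs v (r - q)"
  using rat_abs_uminus[of v "q - r"] by simp

lemma rat_abs_diff_abs: "v \<in> places \<Longrightarrow> \<bar>rat_abs v q - rat_abs v r\<bar> \<le> rat_abs v (q - r)"
  using rat_abs_triangle[of v "q - r" r] rat_abs_triangle[of v "r - q" q]
    rat_abs_minus_commute[of v q r] by auto

declare rat_abs.simps(2) [simp del]

section \<open>Counting square roots modulo n\<close>

definition sqrts :: "int \<Rightarrow> nat \<Rightarrow> int set" where
  "sqrts d n = {b \<in> {0..<int n}. int n dvd b\<^sup>2 - d}"

definition nsqrt :: "int \<Rightarrow> nat \<Rightarrow> nat" where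
  "nsqrt d n = card (sqrts d n)"

text \<open>Weaker than coprimality: a prime of \<open>m\<close> may divide \<open>n\<close>, but
  only once. The same condition terminates two different reductions: taking \<open>g\<^sup>2\<close>
  out of both \<open>m\<close> and \<open>n\<close>, and taking \<open>r\<close> out of
  \<open>m\<close> together with \<open>r\<^sup>2\<close> out of \<open>n\<close>.\<close>

definition tame :: "nat \<Rightarrow> nat \<Rightarrow> bool" where
  "tame m n \<longleftrightarrow> (\<forall>p. prime p \<and> p dvd m \<longrightarrow> \<not> p\<^sup>2 dvd n)"

lemma finite_sqrts [simp]: "finite (sqrts d n)"
  by (rule finite_subset[of _ "{0..<int n}"]) (auto simp: sqrts_def)

text \<open>Division with remainder cuts the interval into \<open>g\<close> blocks of length
  \<open>n\<close>, each containing the same number of solutions.\<close>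

lemma card_periodic:
  fixes P :: "int \<Rightarrow> bool"
  assumes n: "n > 0" and per: "\<And>b. P (b mod int n) \<longleftrightarrow> P b"
  shows "card {b \<in> {0..<int (g * n)}. P b} = g * card {b \<in> {0..<int n}. P b}"
proof -
  let ?B = "{b \<in> {0..<int n}. P b}"
  have "bij_betw (\<lambda>(i, b). i * int n + b) ({0..<int g} \<times> ?B) {b \<in> {0..<int (g * n)}. P b}"
  proof (rule bij_betwI[where g = "\<lambda>b. (b div int n, b mod int n)"])
    show "(\<lambda>(i, b). i * int n + b) \<in> {0..<int g} \<times> ?B \<rightarrow> {b \<in> {0..<int (g * n)}. P b}"
    proof safe
      fix i b assume ib: "i \<in> {0..<int g}" "b \<in> {0..<int n}" "P b"
      have "i * int n \<le> (int g - 1) * int n" using ib by (intro mult_right_mono) auto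
      thus "i * int n + b \<in> {0..<int (g * n)}" using ib by (auto simp: algebra_simps)
      show "P (i * int n + b)" using per[of "i * int n + b"] ib by simp
    qed
    show "(\<lambda>b. (b div int n, b mod int n)) \<in> {b \<in> {0..<int (g * n)}. P b} \<rightarrow> {0..<int g} \<times> ?B"
    proof -
      have "b div int n < int g" if b: "b < int (g * n)" for b
      proof (rule ccontr)
        assume "\<not> b div int n < int g"
        hence "int g * int n \<le> (b div int n) * int n" by (intro mult_right_mono) auto
        also have "\<dots> \<le> b" using n pos_mod_sign[of "int n" b] div_mult_mod_eq[of b "int n"] by linarith
        finally show False using b by simp
      qed
      thus ?thesis using n per by (auto simp: pos_imp_zdiv_nonneg_iff)
    qed
  qed (use n in auto)
  hence "card {b \<in> {0..<int (g * n)}. P b} = card ({0..<int g} \<times> ?B)" by (simp add: bij_betw_same_card)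
  thus ?thesis by (simp add: card_cartesian_product)
qed

lemma dvd_square_mod: "int n dvd (b mod int n)\<^sup>2 - d \<longleftrightarrow> int n dvd b\<^sup>2 - d"
  by (simp add: mod_eq_dvd_iff[symmetric] power_mod)

text \<open>If c^2 is congruent to g^2 d modulo g^2 n, then g divides c. Writing c = g b, the number
  b is taken modulo g n while the condition on it depends only on b modulo n; this discrepancy is
  the factor \<open>g\<close>.\<close>

lemma nsqrt_scale:
  assumes g: "g > 0" and n: "n > 0"
  shows "nsqrt (int g ^ 2 * d) (g\<^sup>2 * n) = g * nsqrt d n"
proof -
  have "bij_betw (\<lambda>b. int g * b) {b \<in> {0..<int (g * n)}. int n dvd b\<^sup>2 - d} (sqrts (int g ^ 2 * d) (g\<^sup>2 * n))"
    unfolding bij_betw_def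
  proof
    show "inj_on (\<lambda>b. int g * b) {b \<in> {0..<int (g * n)}. int n dvd b\<^sup>2 - d}" using g by (auto simp: inj_on_def)
    show "(\<lambda>b. int g * b) ` {b \<in> {0..<int (g * n)}. int n dvd b\<^sup>2 - d} = sqrts (int g ^ 2 * d) (g\<^sup>2 * n)"
    proof (intro equalityI subsetI)
      fix c assume "c \<in> (\<lambda>b. int g * b) ` {b \<in> {0..<int (g * n)}. int n dvd b\<^sup>2 - d}"
      then obtain b where b: "c = int g * b" "0 \<le> b" "b < int (g * n)" "int n dvd b\<^sup>2 - d" by auto
      have "int g * b < int g * int (g * n)" using b g by (intro mult_strict_left_mono) auto
      moreover have "c\<^sup>2 - int g ^ 2 * d = int g ^ 2 * (b\<^sup>2 - d)" using b by (simp add: power2_eq_square algebra_simps)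
      ultimately show "c \<in> sqrts (int g ^ 2 * d) (g\<^sup>2 * n)"
        using b by (auto simp: sqrts_def power2_eq_square mult_ac)
    next
      fix c assume c: "c \<in> sqrts (int g ^ 2 * d) (g\<^sup>2 * n)"
      hence dv: "int g ^ 2 * int n dvd c\<^sup>2 - int g ^ 2 * d" by (simp add: sqrts_def)
      hence "int g ^ 2 dvd (c\<^sup>2 - int g ^ 2 * d) + int g ^ 2 * d"
        by (intro dvd_add) (auto intro: dvd_mult_left)
      hence "int g dvd c" by (simp add: pow_divides_pow_iff)
      then obtain b where b: "c = int g * b" by (auto simp: dvd_def)
      have "int g * b < int g * int (g * n)" using c b by (simp add: sqrts_def power2_eq_square mult_ac)
      hence "b < int (g * n)" using g by (simp add: mult_less_cancel_left)
      moreover have "0 \<le> int g * b" using c b by (simp add: sqrts_def)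
      hence "0 \<le> b" using g by (simp add: zero_le_mult_iff)
      moreover have "c\<^sup>2 - int g ^ 2 * d = int g ^ 2 * (b\<^sup>2 - d)" using b by (simp add: power2_eq_square algebra_simps)
      hence "int n dvd b\<^sup>2 - d" using dv g by simp
      ultimately show "c \<in> (\<lambda>b. int g * b) ` {b \<in> {0..<int (g * n)}. int n dvd b\<^sup>2 - d}" using b by auto
    qed
  qed
  hence "nsqrt (int g ^ 2 * d) (g\<^sup>2 * n) = card {b \<in> {0..<int (g * n)}. int n dvd b\<^sup>2 - d}"
    by (simp add: nsqrt_def bij_betw_same_card)
  also have "\<dots> = g * nsqrt d n"
    unfolding nsqrt_def sqrts_def using n dvd_square_mod by (rule card_periodic)
  finally show ?thesis .
qed

text \<open>The numerical maximum \<open>r\<close> does it: \<open>lcm r s\<close> is again a member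
  and is at least \<open>r\<close>, so it equals \<open>r\<close>. This gives greatest elements for
  divisibility in the two reductions to tame pairs.\<close>

lemma dvd_witness_unique:
  fixes A B :: "nat \<Rightarrow> bool"
  assumes fin: "finite {r. A r}" and ne: "A r0" and pos: "\<And>r. A r \<Longrightarrow> r > 0"
    and lcm: "\<And>r s. A r \<Longrightarrow> A s \<Longrightarrow> A (lcm r s)"
  obtains r where "A r" "\<And>s. A s \<Longrightarrow> s dvd r"
proof -
  define r where "r = Max {r. A r}"
  have r: "A r" using Max_in[OF fin] ne by (auto simp: r_def)
  have "s dvd r" if s: "A s" for s
  proof -
    have "lcm r s \<le> r" using Max_ge[OF fin] lcm[OF r s] by (auto simp: r_def)
    moreover have "r dvd lcm r s" by simp
    ultimately have "lcm r s = r" using pos[OF lcm[OF r s]] by (meson dvd_imp_le le_antisym)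
    thus ?thesis by (metis dvd_lcm2)
  qed
  thus ?thesis using that r by blast
qed

text \<open>Squaring commutes with lcm, since it commutes with gcd and gcd times lcm is the
  product.\<close>

lemma lcm_square_dvd:
  fixes r s n :: nat assumes "r\<^sup>2 dvd n" "s\<^sup>2 dvd n" shows "(lcm r s)\<^sup>2 dvd n"
proof -
  have "(gcd r s)\<^sup>2 * (lcm r s)\<^sup>2 = (gcd r s)\<^sup>2 * lcm (r\<^sup>2) (s\<^sup>2)"
    using prod_gcd_lcm_nat[of r s] prod_gcd_lcm_nat[of "r\<^sup>2" "s\<^sup>2"]
    by (simp add: gcd_exp flip: power_mult_distrib)
  hence "(lcm r s)\<^sup>2 = lcm (r\<^sup>2) (s\<^sup>2)" by (cases "r = 0 \<and> s = 0") auto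
  thus ?thesis using assms by simp
qed

text \<open>If \<open>p\<close> divides \<open>m\<close> and \<open>p\<^sup>2\<close> divides \<open>n\<close>, then \<open>p\<close> divides every square root modulo \<open>n\<close>.\<close>
lemma nsqrt_stratify:
  assumes m: "m > 0" and n: "n > 0" and e: "e \<noteq> 0" and ce: "\<And>p. prime p \<Longrightarrow> p dvd n \<Longrightarrow> \<not> int p dvd e"
  shows "nsqrt (e * int m) n
    = (\<Sum>g | g\<^sup>2 dvd m \<and> g\<^sup>2 dvd n. if tame (m div g\<^sup>2) (n div g\<^sup>2) then g * nsqrt (e * int (m div g\<^sup>2)) (n div g\<^sup>2) else 0)"
proof -
  let ?A = "\<lambda>g. g\<^sup>2 dvd m \<and> g\<^sup>2 dvd n"
  have pos: "g > 0" if "?A g" for g using that m by (cases g) auto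
  have fin: "finite {g. ?A g}"
  proof (rule finite_subset)
    show "{g. ?A g} \<subseteq> {..m}"
    proof safe
      fix g assume "g\<^sup>2 dvd m"
      hence "g\<^sup>2 \<le> m" using m by (rule dvd_imp_le)
      thus "g \<le> m" using self_le_power[of g 2] by (cases g) auto
    qed
  qed simp
  \<comment> \<open>The greatest \<open>g\<close> for divisibility whose square divides both
    numbers. It is the only index that can contribute to the sum.\<close>
  obtain g where g: "?A g" "\<And>h. ?A h \<Longrightarrow> h dvd g"
    using dvd_witness_unique[of ?A 1, OF fin _ pos] lcm_square_dvd by auto
  obtain m' n' where mn: "m = g\<^sup>2 * m'" "n = g\<^sup>2 * n'" using g(1) by (auto simp: dvd_def)
  have pos': "g > 0" "m' > 0" "n' > 0" using mn m n by auto
  \<comment> \<open>For any other \<open>h\<close>, a prime of \<open>g / h\<close> still divides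
    both quotients to the second power.\<close>
  have zero: "\<not> tame (m div h\<^sup>2) (n div h\<^sup>2)" if h: "?A h" "h \<noteq> g" for h
  proof -
    obtain k where k: "g = h * k" using g(2)[OF h(1)] by (auto simp: dvd_def)
    have "k \<noteq> 1" using h k by auto
    then obtain p where p: "prime p" "p dvd k" using prime_factor_nat by blast
    have h0: "h > 0" using pos h by blast
    have "m div h\<^sup>2 = k\<^sup>2 * m'" "n div h\<^sup>2 = k\<^sup>2 * n'"
      using h0 by (simp_all add: mn k power_mult_distrib mult.assoc)
    moreover have "p\<^sup>2 dvd k\<^sup>2" using p by (simp add: dvd_power_same)
    ultimately show ?thesis using p by (auto simp: tame_def power2_eq_square intro!: exI[of _ p])
  qed
  have "(\<Sum>h | ?A h. if tame (m div h\<^sup>2) (n div h\<^sup>2) then h * nsqrt (e * int (m div h\<^sup>2)) (n div h\<^sup>2) else 0)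
      = (\<Sum>h\<in>{g}. if tame (m div h\<^sup>2) (n div h\<^sup>2) then h * nsqrt (e * int (m div h\<^sup>2)) (n div h\<^sup>2) else 0)"
    by (rule sum.mono_neutral_right) (use fin g(1) zero in auto)
  also have "\<dots> = (if tame m' n' then g * nsqrt (e * int m') n' else 0)" using pos' by (simp add: mn)
  also have "\<dots> = g * nsqrt (e * int m') n'"
  proof (cases "tame m' n'")
    \<comment> \<open>Here both sides vanish: by maximality of \<open>g\<close> the offending prime
      divides \<open>m'\<close> exactly once, but a square root modulo \<open>n'\<close> would be
      divisible by \<open>p\<close>, which forces p^2 to divide \<open>e * m'\<close>.\<close>
    case False
    then obtain p where p: "prime p" "p dvd m'" "p\<^sup>2 dvd n'" by (auto simp: tame_def)
    have "\<not> p\<^sup>2 dvd m'"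
    proof
      assume "p\<^sup>2 dvd m'"
      hence "?A (g * p)" using p by (simp add: mn power_mult_distrib)
      hence "g * p dvd g" by (rule g(2))
      thus False using pos' p by auto
    qed
    hence np: "\<not> int p ^ 2 dvd int m'" by (metis int_dvd_int_iff of_nat_power)
    have pn: "p dvd n" using p(3) mn by (metis dvd_mult dvd_trans dvd_triv_left power2_eq_square)
    have "sqrts (e * int m') n' = {}"
    proof (rule ccontr)
      assume "sqrts (e * int m') n' \<noteq> {}"
      then obtain b where "int n' dvd b\<^sup>2 - e * int m'" by (auto simp: sqrts_def)
      moreover have pn': "int p ^ 2 dvd int n'" using p(3) by (metis int_dvd_int_iff of_nat_power)
      ultimately have d: "int p ^ 2 dvd b\<^sup>2 - e * int m'" by (rule dvd_trans[rotated])
      have "int p dvd (b\<^sup>2 - e * int m') + e * int m'"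
        using d p(2) by (intro dvd_add dvd_mult) (auto intro: dvd_trans simp: power2_eq_square)
      hence "int p dvd b" using p(1) by (simp add: prime_dvd_power_iff)
      hence "int p ^ 2 dvd b\<^sup>2" by (simp add: dvd_power_same)
      hence "int p ^ 2 dvd b\<^sup>2 - (b\<^sup>2 - e * int m')" using d by (rule dvd_diff)
      hence dd: "int p ^ 2 dvd e * int m'" by simp
      have "coprime (int p) e" using p(1) ce[OF p(1) pn] by (intro prime_imp_coprime) auto
      hence "coprime (int p ^ 2) e" by simp
      hence "int p ^ 2 dvd int m'" using dd by (simp add: coprime_dvd_mult_right_iff)
      thus False using np by simp
    qed
    thus ?thesis using False by (simp add: nsqrt_def)
  qed simp
  also have "\<dots> = nsqrt (e * int m) n"
    using nsqrt_scale[OF pos'(1,3), of "e * int m'"] by (simp add: mn mult_ac)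
  finally show ?thesis by simp
qed

text \<open>\<open>k = gcd m n\<close> has all these properties: a prime dividing both
  \<open>m\<close> and \<open>n / k\<close> also divides \<open>k\<close>, so its square divides
  \<open>n\<close>, which tameness forbids; a square factor of \<open>k\<close> is excluded in the
  same way.\<close>

lemma tame_split:
  assumes "m > 0" "n > 0" "tame m n"
  obtains k l where "n = k * l" "coprime k l" "k dvd m" "coprime l m" "squarefree k" "l > 0"
proof -
  define k where "k = gcd m n"
  obtain l where l: "n = k * l" using gcd_dvd2[of m n] unfolding k_def by (auto simp: dvd_def)
  have k: "k dvd m" "k dvd n" by (auto simp: k_def)
  have "coprime l m"
  proof (rule ccontr)
    assume "\<not> coprime l m"
    hence "gcd l m \<noteq> 1" by (metis coprime_iff_gcd_eq_1)
    then obtain p where "prime p" "p dvd gcd l m" using prime_factor_nat by blast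
    hence p: "prime p" "p dvd l" "p dvd m" by auto
    have "p dvd n" using p l by simp
    hence "p dvd k" using p by (simp add: k_def)
    hence "p * p dvd n" unfolding l using p by (intro mult_dvd_mono)
    thus False using p assms(3) by (auto simp: tame_def power2_eq_square)
  qed
  moreover have "squarefree k"
  proof (rule ccontr)
    assume "\<not> squarefree k"
    then obtain x where x: "x\<^sup>2 dvd k" "\<not> is_unit x" by (auto simp: squarefree_def)
    then obtain p where p: "prime p" "p dvd x" using prime_factor_nat by auto
    have "p\<^sup>2 dvd k" using x p by (meson dvd_power_same dvd_trans)
    moreover have "p dvd k" using p x by (metis dvd_trans dvd_power zero_less_numeral)
    ultimately show False using p assms(3) k by (auto simp: tame_def intro: dvd_trans)
  qed
  moreover have "coprime k l" using \<open>coprime l m\<close> k(1) by (meson coprime_commute coprime_divisors dvd_refl)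
  ultimately show ?thesis using that l k(1) assms(2) by auto
qed

text \<open>With g = gcd k b, the cofactor k / g divides g as well, so its square divides
  \<open>k\<close> and it is 1.\<close>

lemma squarefree_dvd_square:
  fixes k b :: nat
  assumes "k dvd b\<^sup>2" "squarefree k"
  shows "k dvd b"
proof -
  have k0: "k > 0" using assms(2) by (cases k) auto
  define g where "g = gcd k b"
  have g0: "g > 0" using k0 by (simp add: g_def)
  obtain l c where lc: "k = g * l" "b = g * c" "coprime l c"
    using gcd_coprime_exists[of k b] g0 unfolding g_def by (auto simp: mult.commute)
  have "g * l dvd g * (g * c\<^sup>2)" using assms(1) by (simp add: lc power2_eq_square mult_ac)
  hence "l dvd g * c\<^sup>2" using g0 by simp
  moreover have "coprime l (c\<^sup>2)" using lc by simp
  ultimately have "l dvd g" by (simp add: coprime_dvd_mult_left_iff)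
  hence "l\<^sup>2 dvd k" by (simp add: lc power2_eq_square)
  hence "l dvd 1" using assms(2) by (rule squarefreeD[rotated])
  thus ?thesis by (simp add: lc)
qed

text \<open>Modulo a squarefree \<open>k\<close> that divides \<open>d\<close>, the class of 0 is
  the only square root of \<open>d\<close>. By the Chinese remainder theorem a root modulo
  \<open>k * l\<close> is therefore the same as a root modulo \<open>l\<close>.\<close>

lemma nsqrt_coprime_part:
  assumes kl: "coprime k l" "k > 0" "l > 0" "squarefree k" and d: "int k dvd d"
  shows "nsqrt d (k * l) = nsqrt d l"
proof -
  have kdvd: "int k dvd b" if "int k dvd b\<^sup>2 - d" for b
  proof -
    have "int k dvd (b\<^sup>2 - d) + d" using that d by (rule dvd_add)
    hence "int k dvd int ((nat \<bar>b\<bar>)\<^sup>2)" by simp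
    hence "k dvd (nat \<bar>b\<bar>)\<^sup>2" by (simp only: int_dvd_int_iff)
    hence "k dvd nat \<bar>b\<bar>" using kl(4) by (rule squarefree_dvd_square)
    thus ?thesis using int_dvd_int_iff[of k "nat \<bar>b\<bar>"] by simp
  qed
  have "bij_betw (\<lambda>b. b mod int l) (sqrts d (k * l)) (sqrts d l)"
    unfolding bij_betw_def
  proof
    show "inj_on (\<lambda>b. b mod int l) (sqrts d (k * l))"
    proof (rule inj_onI)
      fix b c assume b: "b \<in> sqrts d (k * l)" and c: "c \<in> sqrts d (k * l)" and eq: "b mod int l = c mod int l"
      have "int k * int l dvd b\<^sup>2 - d" "int k * int l dvd c\<^sup>2 - d" using b c by (auto simp: sqrts_def)
      hence "int k dvd b" "int k dvd c" using kdvd dvd_mult_left by blast+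
      hence "int k dvd b - c" by simp
      moreover have "int l dvd b - c" using eq by (simp add: mod_eq_dvd_iff)
      moreover have "coprime (int k) (int l)" using kl by simp
      ultimately have "int k * int l dvd b - c" by (simp add: divides_mult)
      hence "b mod (int k * int l) = c mod (int k * int l)" by (simp add: mod_eq_dvd_iff)
      thus "b = c" using b c by (simp add: sqrts_def)
    qed
    show "(\<lambda>b. b mod int l) ` sqrts d (k * l) = sqrts d l"
    proof (intro equalityI subsetI)
      fix c assume "c \<in> (\<lambda>b. b mod int l) ` sqrts d (k * l)"
      then obtain b where b: "b \<in> sqrts d (k * l)" "c = b mod int l" by auto
      have "int l dvd b\<^sup>2 - d" using b by (auto simp: sqrts_def intro: dvd_mult_right)
      hence "int l dvd c\<^sup>2 - d" unfolding b(2) dvd_square_mod .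
      thus "c \<in> sqrts d l" using kl b by (auto simp: sqrts_def)
    next
      fix c assume c: "c \<in> sqrts d l"
      have "coprime (int l) (int k)" using kl by (simp add: coprime_commute)
      then obtain x where "[x = c] (mod int l)" "[x = 0] (mod int k)"
        using binary_chinese_remainder_int by blast
      hence x: "int l dvd x - c" "int k dvd x" by (auto simp: cong_iff_dvd_diff)
      define b where "b = x mod int (k * l)"
      have "int k dvd x\<^sup>2 - d" using x d by (auto simp: power2_eq_square)
      moreover have "x mod int l = c mod int l" using x by (simp add: mod_eq_dvd_iff)
      hence "(x mod int l)\<^sup>2 mod int l = (c mod int l)\<^sup>2 mod int l" by simp
      hence "int l dvd x\<^sup>2 - c\<^sup>2" by (simp add: power_mod mod_eq_dvd_iff)
      hence "int l dvd (x\<^sup>2 - c\<^sup>2) + (c\<^sup>2 - d)" using c by (intro dvd_add) (auto simp: sqrts_def)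
      moreover have "coprime (int k) (int l)" using kl by simp
      ultimately have "int (k * l) dvd x\<^sup>2 - d" by (simp add: divides_mult)
      hence "b \<in> sqrts d (k * l)" using kl dvd_square_mod[of "k * l" x d] by (auto simp: sqrts_def b_def)
      moreover have "b mod int l = c" using x c
        by (auto simp: b_def mod_mod_cancel mod_eq_dvd_iff sqrts_def \<open>x mod int l = c mod int l\<close>)
      ultimately show "c \<in> (\<lambda>b. b mod int l) ` sqrts d (k * l)" by force
    qed
  qed
  thus ?thesis by (simp add: nsqrt_def bij_betw_same_card)
qed

definition tau :: "nat \<Rightarrow> nat" where "tau n = card {e. e dvd n}"

text \<open>A root b is encoded by e = gcd(b - 1, n) and by the half of the interval in which it
  lies. With n = e k, the factor k divides b + 1, so two roots with the same e agree modulo e and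
  modulo k. As gcd(e, k) divides 2, n divides twice their difference, and the second component then
  decides. The bound is crude at primes dividing n but treats p = 2 without a special case.\<close>

lemma nsqrt_one_le: assumes n: "n > 0" shows "nsqrt 1 n \<le> 2 * tau n"
proof -
  define f where "f = (\<lambda>b. (nat (gcd (b - 1) (int n)), 2 * b < int n))"
  have "inj_on f (sqrts 1 n)"
  proof (rule inj_onI)
    fix b c assume b: "b \<in> sqrts 1 n" and c: "c \<in> sqrts 1 n" and eq: "f b = f c"
    define e where "e = gcd (b - 1) (int n)"
    have e: "e = gcd (c - 1) (int n)" using eq by (simp add: f_def e_def eq_nat_nat_iff)
    obtain k where k: "int n = e * k" using gcd_dvd2[of "b - 1" "int n"] by (auto simp: e_def dvd_def)
    have e0: "e > 0" using n by (simp add: e_def)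
    have k0: "k > 0" using n k e0 by (metis of_nat_0_less_iff zero_less_mult_pos)
    have kd: "k dvd x + 1" if x: "x \<in> sqrts 1 n" "e = gcd (x - 1) (int n)" for x
    proof -
      obtain y where y: "x - 1 = e * y" using x(2) by (metis dvdE gcd_dvd1)
      have "e * gcd y k = e" using x(2) unfolding y k using e0 by (simp add: gcd_mult_distrib_int[symmetric])
      hence cop: "coprime k y" using e0 by (simp add: coprime_iff_gcd_eq_1 gcd.commute)
      have "x\<^sup>2 - 1 = (x - 1) * (x + 1)" by (simp add: power2_eq_square algebra_simps)
      hence "x\<^sup>2 - 1 = e * (y * (x + 1))" unfolding y by (simp add: mult.assoc)
      hence "e * k dvd e * (y * (x + 1))" using x(1) k by (simp add: sqrts_def)
      hence "k dvd y * (x + 1)" using e0 by simp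
      thus ?thesis using cop by (simp add: coprime_dvd_mult_right_iff)
    qed
    have "k dvd (b + 1) - (c + 1)" using kd[OF b e_def] kd[OF c e] by (rule dvd_diff)
    hence kbc: "k dvd b - c" by simp
    have "e dvd b - 1" "e dvd c - 1" by (simp add: e_def) (simp add: e)
    hence "e dvd (b - 1) - (c - 1)" by (rule dvd_diff)
    hence ebc: "e dvd b - c" by simp
    have "gcd e k dvd 2"
    proof -
      have "gcd e k dvd b + 1" using kd[OF b e_def] gcd_dvd2 by (rule dvd_trans[rotated])
      moreover have "gcd e k dvd b - 1" using \<open>e dvd b - 1\<close> gcd_dvd1 by (rule dvd_trans[rotated])
      ultimately have "gcd e k dvd (b + 1) - (b - 1)" by (rule dvd_diff)
      thus ?thesis by simp
    qed
    hence "int n dvd 2 * (b - c)"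
    proof -
      have "gcd e k * lcm e k = int n" using e0 k0 k by (simp add: gcd_mult_lcm abs_mult)
      hence "int n = gcd e k * lcm e k" ..
      also have "\<dots> dvd 2 * (b - c)"
        using \<open>gcd e k dvd 2\<close> kbc ebc by (intro mult_dvd_mono lcm_least)
      finally show ?thesis .
    qed
    hence "int n dvd 2 * b - 2 * c" by (simp add: algebra_simps)
    moreover have "\<bar>2 * b - 2 * c\<bar> < int n" using b c eq by (auto simp: sqrts_def f_def)
    ultimately have "2 * b - 2 * c = 0" by (metis dvd_imp_le_int linorder_not_less abs_of_nat)
    thus "b = c" by simp
  qed
  moreover have "f ` sqrts 1 n \<subseteq> {e. e dvd n} \<times> UNIV"
    by (auto simp: f_def nat_dvd_iff)
  moreover have "finite ({e. e dvd n} \<times> (UNIV :: bool set))" using n by simp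
  ultimately have "card (sqrts 1 n) \<le> card ({e. e dvd n} \<times> (UNIV :: bool set))"
    by (rule card_inj_on_le)
  thus ?thesis by (simp add: nsqrt_def tau_def card_cartesian_product)
qed

section \<open>Quadratic characters of a finite abelian group\<close>

text \<open>The homomorphisms to {1, -1}. They are extensional so that cardinalities and sums over
  the set count each of them once.\<close>

definition quad_chars :: "('a, 'b) monoid_scheme \<Rightarrow> ('a \<Rightarrow> complex) set" where
  "quad_chars G = {\<psi> \<in> extensional (carrier G). (\<forall>x\<in>carrier G. \<psi> x \<in> {1, -1}) \<and>
     (\<forall>x\<in>carrier G. \<forall>y\<in>carrier G. \<psi> (x \<otimes>\<^bsub>G\<^esub> y) = \<psi> x * \<psi> y)}"

context comm_group
begin

lemma quad_char_one: "\<psi> \<in> quad_chars G \<Longrightarrow> \<psi> \<one> = 1"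
  using one_closed r_one[OF one_closed] unfolding quad_chars_def by fastforce

text \<open>Take a subgroup \<open>H\<close> maximal among those that contain all squares but not
  \<open>u\<close>. For \<open>a\<close> outside \<open>H\<close> the union of \<open>H\<close> and
  its coset by \<open>a\<close> is a subgroup, because a^2 lies in \<open>H\<close>; by maximality
  it contains \<open>u\<close>, whence \<open>a \<otimes> u\<close> lies in \<open>H\<close>. So
  \<open>H\<close> has index 2, and the character with kernel \<open>H\<close> takes the value -1 at
  \<open>u\<close>.\<close>

lemma quad_char_separates:
  assumes fin: "finite (carrier G)" and u: "u \<in> carrier G" and ns: "\<And>x. x \<in> carrier G \<Longrightarrow> u \<noteq> x \<otimes> x"
  obtains \<psi> where "\<psi> \<in> quad_chars G" "\<psi> u = -1"
proof -
  define Sq where "Sq = (\<lambda>x. x \<otimes> x) ` carrier G"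
  define Q where "Q = (\<lambda>H. subgroup H G \<and> Sq \<subseteq> H \<and> u \<notin> H)"
  have "subgroup Sq G"
  proof (rule subgroupI)
    fix a b assume "a \<in> Sq" "b \<in> Sq"
    then obtain x y where xy: "x \<in> carrier G" "a = x \<otimes> x" "y \<in> carrier G" "b = y \<otimes> y" by (auto simp: Sq_def)
    have "a \<otimes> b = (x \<otimes> y) \<otimes> (x \<otimes> y)" using xy by (simp add: m_ac)
    thus "a \<otimes> b \<in> Sq" using xy by (auto simp: Sq_def)
    have "inv a = inv x \<otimes> inv x" using xy by (simp add: inv_mult)
    thus "inv a \<in> Sq" using xy by (auto simp: Sq_def)
  qed (auto simp: Sq_def)
  hence Q0: "Q Sq" using ns by (auto simp: Q_def Sq_def)
  have finQ: "finite {H. Q H}"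
    by (rule finite_subset[of _ "Pow (carrier G)"]) (auto simp: Q_def fin dest: subgroup.subset)
  have "\<exists>H. Q H \<and> (\<forall>H'. Q H' \<longrightarrow> H \<subseteq> H' \<longrightarrow> H' = H)"
    using finite_has_maximal[OF finQ] Q0 by auto
  then obtain H where H: "subgroup H G" "Sq \<subseteq> H" "u \<notin> H" and Hmax: "\<And>H'. Q H' \<Longrightarrow> H \<subseteq> H' \<Longrightarrow> H' = H"
    by (auto simp: Q_def)
  have four: "(x \<otimes> u) \<otimes> (y \<otimes> u) = (u \<otimes> u) \<otimes> (x \<otimes> y)" if "x \<in> carrier G" "y \<in> carrier G" for x y
    using that u by (simp add: m_ac)
  interpret H: subgroup H G by (rule H(1))
  have HG: "x \<in> carrier G" if "x \<in> H" for x using that by (rule H.mem_carrier)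
  have sqH: "x \<otimes> x \<in> H" if "x \<in> carrier G" for x using that H(2) by (auto simp: Sq_def)
  have cancel: "y \<in> H" if "x \<in> H" "y \<in> carrier G" "x \<otimes> y \<in> H" for x y
  proof -
    have "inv x \<otimes> (x \<otimes> y) \<in> H" using that by blast
    thus ?thesis using that HG by (simp add: m_assoc[symmetric])
  qed
  have key: "a \<otimes> u \<in> H" if a: "a \<in> carrier G" "a \<notin> H" for a
  proof -
    define H' where "H' = H \<union> (\<lambda>h. a \<otimes> h) ` H"
    have "subgroup H' G"
    proof (rule subgroupI)
      show "H' \<subseteq> carrier G" using a HG by (auto simp: H'_def)
      show "H' \<noteq> {}" using H.one_closed unfolding H'_def by blast
    next
      fix x assume "x \<in> H'"
      thus "inv x \<in> H'"
      proof (unfold H'_def, safe)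
        fix h assume h: "h \<in> H" "inv (a \<otimes> h) \<notin> (\<lambda>h. a \<otimes> h) ` H"
        have "inv (a \<otimes> h) = a \<otimes> (inv (a \<otimes> a) \<otimes> inv h)"
          using a HG[OF h(1)] by (simp add: inv_mult m_ac) (simp add: m_assoc[symmetric])
        moreover have "inv (a \<otimes> a) \<otimes> inv h \<in> H" using h sqH a by blast
        ultimately show "inv (a \<otimes> h) \<in> H" using h by blast
      qed auto
    next
      fix x y assume "x \<in> H'" "y \<in> H'"
      thus "x \<otimes> y \<in> H'"
      proof (unfold H'_def, safe)
        fix h k assume "h \<in> H" "k \<in> H" "h \<otimes> (a \<otimes> k) \<notin> (\<lambda>h. a \<otimes> h) ` H"
        moreover from this have "h \<otimes> (a \<otimes> k) = a \<otimes> (h \<otimes> k)" using a HG by (simp add: m_ac)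
        ultimately show "h \<otimes> (a \<otimes> k) \<in> H" by auto
      next
        fix h k assume "h \<in> H" "k \<in> H" "a \<otimes> h \<otimes> k \<notin> (\<lambda>h. a \<otimes> h) ` H"
        moreover from this have "a \<otimes> h \<otimes> k = a \<otimes> (h \<otimes> k)" using a HG by (simp add: m_ac)
        ultimately show "a \<otimes> h \<otimes> k \<in> H" by auto
      next
        fix h k assume hk: "h \<in> H" "k \<in> H"
        have "a \<otimes> h \<otimes> (a \<otimes> k) = (a \<otimes> a) \<otimes> (h \<otimes> k)" using a HG hk by (simp add: m_ac)
        thus "a \<otimes> h \<otimes> (a \<otimes> k) \<in> H" using hk sqH a by auto
      qed auto
    qed
    moreover have "H' \<noteq> H" using a H.one_closed r_one[OF a(1)] unfolding H'_def by (metis UnI2 image_eqI)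
    ultimately have "u \<in> H'" using Hmax[of H'] H(2) by (auto simp: Q_def H'_def)
    then obtain h where h: "h \<in> H" "u = a \<otimes> h" using H(3) by (auto simp: H'_def)
    have "a \<otimes> u = (a \<otimes> a) \<otimes> h" using h a HG by (simp add: m_assoc)
    thus ?thesis using h sqH a by auto
  qed
  \<comment> \<open>The product of \<open>x \<otimes> u\<close> and \<open>y \<otimes> u\<close> is
    x y times the square of \<open>u\<close>, which lies in \<open>H\<close>: the complement of
    \<open>H\<close> is a single coset.\<close>
  have key2: "x \<otimes> y \<in> H" if "x \<in> carrier G" "y \<in> carrier G" "x \<notin> H" "y \<notin> H" for x y
  proof -
    have "(x \<otimes> u) \<otimes> (y \<otimes> u) \<in> H" using key that by blast
    hence "(u \<otimes> u) \<otimes> (x \<otimes> y) \<in> H" unfolding four[OF that(1,2)] .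
    thus ?thesis using cancel[OF sqH[OF u]] that(1,2) m_closed by blast
  qed
  define \<psi> :: "'a \<Rightarrow> complex" where "\<psi> = (\<lambda>x\<in>carrier G. if x \<in> H then 1 else -1)"
  have "\<psi> (x \<otimes> y) = \<psi> x * \<psi> y" if xy: "x \<in> carrier G" "y \<in> carrier G" for x y
  proof -
    have "x \<otimes> y \<in> H" if "x \<in> H" "y \<in> H" using that by blast
    moreover have "x \<otimes> y \<notin> H" if "x \<in> H" "y \<notin> H" using cancel that xy by blast
    moreover have "x \<otimes> y \<notin> H" if "x \<notin> H" "y \<in> H" using cancel[of y x] that xy m_comm by auto
    ultimately show ?thesis using key2[OF xy] xy by (auto simp: \<psi>_def)
  qed
  hence "\<psi> \<in> quad_chars G" by (auto simp: quad_chars_def \<psi>_def)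
  moreover have "\<psi> u = -1" using u H(3) by (simp add: \<psi>_def)
  ultimately show ?thesis by (rule that)
qed

lemma finite_quad_chars: assumes "finite (carrier G)" shows "finite (quad_chars G)"
proof (rule finite_subset)
  show "quad_chars G \<subseteq> (\<Pi>\<^sub>E x\<in>carrier G. {1, -1})" by (auto simp: quad_chars_def PiE_def)
qed (use assms in \<open>auto intro: finite_PiE\<close>)

lemma quad_char_mult:
  assumes "\<phi> \<in> quad_chars G" "\<psi> \<in> quad_chars G"
  shows "(\<lambda>x\<in>carrier G. \<phi> x * \<psi> x) \<in> quad_chars G"
proof -
  have "\<phi> x * \<psi> x \<in> {1, -1}" if "x \<in> carrier G" for x
    using assms that by (auto simp: quad_chars_def) (metis minus_equation_iff mult_1 mult_minus1)+
  thus ?thesis using assms by (simp add: quad_chars_def)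
qed

text \<open>Multiplication by a character with values 1 and -1 is an involution, hence its own
  inverse.\<close>

lemma quad_char_shift:
  assumes "\<phi> \<in> quad_chars G"
  shows "bij_betw (\<lambda>\<psi>. \<lambda>x\<in>carrier G. \<phi> x * \<psi> x) (quad_chars G) (quad_chars G)"
proof (rule bij_betwI[where g = "\<lambda>\<psi>. \<lambda>x\<in>carrier G. \<phi> x * \<psi> x"])
  show "(\<lambda>x\<in>carrier G. \<phi> x * (\<lambda>x\<in>carrier G. \<phi> x * \<psi> x) x) = \<psi>" if "\<psi> \<in> quad_chars G" for \<psi>
  proof
    fix x show "(\<lambda>x\<in>carrier G. \<phi> x * (\<lambda>x\<in>carrier G. \<phi> x * \<psi> x) x) x = \<psi> x"
      using that assms by (cases "x \<in> carrier G") (auto simp: quad_chars_def extensional_def)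
  qed
  thus "(\<lambda>x\<in>carrier G. \<phi> x * (\<lambda>x\<in>carrier G. \<phi> x * \<psi> x) x) = \<psi>" if "\<psi> \<in> quad_chars G" for \<psi>
    using that by blast
qed (use quad_char_mult assms in auto)

text \<open>Double counting: \<open>\<Sum>\<^sub>u \<Sum>\<^sub>\<psi> \<psi>(u)\<close> gives the number of characters.\<close>
lemma quad_char_sum:
  assumes fin: "finite (carrier G)" and u: "u \<in> carrier G"
  shows "(\<Sum>\<psi>\<in>quad_chars G. \<psi> u) = of_nat (card {b \<in> carrier G. b \<otimes> b = u})"
proof -
  define Sq where "Sq = (\<lambda>x. x \<otimes> x) ` carrier G"
  have finC: "finite (quad_chars G)" by (rule finite_quad_chars[OF fin])
  \<comment> \<open>Shifting the sum by a character that separates \<open>v\<close> from the squares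
    changes its sign.\<close>
  have zero: "(\<Sum>\<psi>\<in>quad_chars G. \<psi> v) = 0" if v: "v \<in> carrier G" "v \<notin> Sq" for v
  proof -
    obtain \<phi> where \<phi>: "\<phi> \<in> quad_chars G" "\<phi> v = -1"
      using quad_char_separates[OF fin v(1)] v(2) by (auto simp: Sq_def)
    have "(\<Sum>\<psi>\<in>quad_chars G. \<psi> v) = (\<Sum>\<psi>\<in>quad_chars G. (\<lambda>x\<in>carrier G. \<phi> x * \<psi> x) v)"
      by (rule sum.reindex_bij_betw[OF quad_char_shift[OF \<phi>(1)], symmetric])
    also have "\<dots> = - (\<Sum>\<psi>\<in>quad_chars G. \<psi> v)" using \<phi> v by (simp add: sum_negf)
    finally show ?thesis by simp
  qed
  have square: "\<psi> v = 1" if v: "\<psi> \<in> quad_chars G" "v \<in> Sq" for v \<psi>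
  proof -
    obtain x where "x \<in> carrier G" "v = x \<otimes> x" using v by (auto simp: Sq_def)
    moreover from this have "\<psi> x \<in> {1, -1}" "\<psi> (x \<otimes> x) = \<psi> x * \<psi> x" using v by (auto simp: quad_chars_def)
    ultimately show ?thesis by auto
  qed
  have one: "(\<Sum>\<psi>\<in>quad_chars G. \<psi> v) = of_nat (card (quad_chars G))" if "v \<in> Sq" for v
  proof -
    have "(\<Sum>\<psi>\<in>quad_chars G. \<psi> v) = (\<Sum>\<psi>\<in>quad_chars G. 1)"
      by (rule sum.cong) (use square that in auto)
    thus ?thesis by simp
  qed
  have SqG: "Sq \<subseteq> carrier G" by (auto simp: Sq_def)
  have "(\<Sum>v\<in>carrier G. \<Sum>\<psi>\<in>quad_chars G. \<psi> v) = (\<Sum>v\<in>Sq. \<Sum>\<psi>\<in>quad_chars G. \<psi> v)"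
    by (rule sum.mono_neutral_right) (use fin SqG zero in auto)
  also have "\<dots> = of_nat (card Sq * card (quad_chars G))" by (simp add: one)
  finally have dc1: "(\<Sum>v\<in>carrier G. \<Sum>\<psi>\<in>quad_chars G. \<psi> v) = of_nat (card Sq * card (quad_chars G))" .
  define triv :: "'a \<Rightarrow> complex" where "triv = (\<lambda>x\<in>carrier G. 1)"
  have trivC: "triv \<in> quad_chars G" by (auto simp: triv_def quad_chars_def)
  have orth: "(\<Sum>v\<in>carrier G. \<psi> v) = 0" if \<psi>: "\<psi> \<in> quad_chars G" "\<psi> \<noteq> triv" for \<psi>
  proof -
    obtain a where a: "a \<in> carrier G" "\<psi> a \<noteq> 1"
      using \<psi> by (metis (no_types, lifting) extensionalityI mem_Collect_eq quad_chars_def restrict_apply' restrict_extensional triv_def)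
    hence am: "\<psi> a = -1" using \<psi> by (auto simp: quad_chars_def)
    have bij: "bij_betw (\<lambda>x. a \<otimes> x) (carrier G) (carrier G)"
      by (rule bij_betwI[where g = "\<lambda>x. inv a \<otimes> x"]) (use a in \<open>auto simp: m_assoc[symmetric]\<close>)
    have "(\<Sum>v\<in>carrier G. \<psi> v) = (\<Sum>v\<in>carrier G. \<psi> (a \<otimes> v))"
      by (rule sum.reindex_bij_betw[OF bij, symmetric])
    also have "\<dots> = (\<Sum>v\<in>carrier G. - \<psi> v)" using \<psi> a am by (intro sum.cong) (auto simp: quad_chars_def)
    also have "\<dots> = - (\<Sum>v\<in>carrier G. \<psi> v)" by (simp add: sum_negf)
    finally show ?thesis by simp
  qed
  have "(\<Sum>v\<in>carrier G. \<Sum>\<psi>\<in>quad_chars G. \<psi> v) = (\<Sum>\<psi>\<in>quad_chars G. \<Sum>v\<in>carrier G. \<psi> v)" by (rule sum.swap)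
  also have "\<dots> = (\<Sum>\<psi>\<in>{triv}. \<Sum>v\<in>carrier G. \<psi> v)"
    by (rule sum.mono_neutral_right) (use finC trivC orth in auto)
  also have "\<dots> = of_nat (card (carrier G))" by (simp add: triv_def)
  finally have "of_nat (card Sq * card (quad_chars G)) = (of_nat (card (carrier G)) :: complex)" using dc1 by simp
  hence card1: "card Sq * card (quad_chars G) = card (carrier G)" by (simp only: of_nat_eq_iff)
  let ?F = "\<lambda>v. {b \<in> carrier G. b \<otimes> b = v}"
  \<comment> \<open>The nonempty fibres of squaring are cosets of the 2-torsion subgroup, so they
    all have its size. With the double count this makes the number of characters equal to the order
    of the 2-torsion.\<close>
  have fib: "card (?F v) = card (?F \<one>)" if "v \<in> Sq" for v
  proof -
    obtain c where c: "c \<in> carrier G" "v = c \<otimes> c" using \<open>v \<in> Sq\<close> by (auto simp: Sq_def)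
    have "bij_betw (\<lambda>b. c \<otimes> b) (?F \<one>) (?F v)"
    proof (rule bij_betwI[where g = "\<lambda>b. inv c \<otimes> b"])
      show "(\<lambda>b. c \<otimes> b) \<in> ?F \<one> \<rightarrow> ?F v"
      proof safe
        fix b assume b: "b \<in> carrier G" "b \<otimes> b = \<one>"
        have "c \<otimes> b \<otimes> (c \<otimes> b) = (c \<otimes> c) \<otimes> (b \<otimes> b)" using b(1) c by (simp add: m_ac)
        thus "c \<otimes> b \<otimes> (c \<otimes> b) = v" using b c by simp
      qed (use c in auto)
      show "(\<lambda>b. inv c \<otimes> b) \<in> ?F v \<rightarrow> ?F \<one>"
      proof safe
        fix b assume b: "b \<in> carrier G" "v = b \<otimes> b"
        have "inv c \<otimes> b \<otimes> (inv c \<otimes> b) = inv (c \<otimes> c) \<otimes> (b \<otimes> b)" using b(1) c by (simp add: m_ac inv_mult)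
        thus "inv c \<otimes> b \<otimes> (inv c \<otimes> b) = \<one>" using b c by simp
      qed (use c in auto)
    qed (use c in \<open>auto simp: m_assoc[symmetric]\<close>)
    thus ?thesis by (simp add: bij_betw_same_card)
  qed
  have "card (carrier G) = (\<Sum>v\<in>Sq. card (?F v))"
  proof -
    have "carrier G = (\<Union>v\<in>Sq. ?F v)" by (auto simp: Sq_def)
    also have "card \<dots> = (\<Sum>v\<in>Sq. card (?F v))"
      by (rule card_UN_disjoint) (use fin SqG in \<open>auto intro: finite_subset\<close>)
    finally show ?thesis .
  qed
  hence card2: "card (carrier G) = card Sq * card (?F \<one>)" using fib by simp
  have "\<one> \<in> Sq" using r_one[OF one_closed] by (force simp: Sq_def)
  hence "card Sq > 0" using fin SqG by (auto simp: card_gt_0_iff intro: finite_subset)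
  hence card3: "card (quad_chars G) = card (?F \<one>)" using card1 card2 by simp
  show ?thesis
  proof (cases "u \<in> Sq")
    case True thus ?thesis using one[OF True] card3 fib[OF True] by simp
  next
    case False
    hence F: "?F u = {}" by (auto simp: Sq_def)
    show ?thesis using zero[OF u False] unfolding F by simp
  qed
qed

end

text \<open>Least residues are used instead of classes. Writing the unit as
  \<open>1 mod int n\<close> makes the case n = 1 correct: the group is then {0}.\<close>

definition unit_group_mod :: "nat \<Rightarrow> int monoid" where
  "unit_group_mod n = \<lparr>carrier = {r \<in> {0..<int n}. coprime r (int n)},
     monoid.mult = (\<lambda>a b. a * b mod int n), one = 1 mod int n\<rparr>"

lemma unit_group_mod_comm_group: assumes n: "n > 0" shows "comm_group (unit_group_mod n)"
proof (rule comm_groupI)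
  fix x assume x: "x \<in> carrier (unit_group_mod n)"
  then obtain y where y: "[x * y = 1] (mod int n)"
    using cong_solve_coprime_int[of x "int n"] by (auto simp: unit_group_mod_def)
  hence "coprime (x * y) (int n)" by (metis cong_imp_coprime cong_sym coprime_1_left)
  hence "coprime (y mod int n) (int n)" using n by (simp add: coprime_mod_left_iff)
  moreover have "y mod int n * x mod int n = 1 mod int n"
    using y by (simp add: cong_def mod_mult_left_eq mod_mult_right_eq mult.commute)
  ultimately show "\<exists>y\<in>carrier (unit_group_mod n). y \<otimes>\<^bsub>unit_group_mod n\<^esub> x = \<one>\<^bsub>unit_group_mod n\<^esub>"
    using n by (intro bexI[of _ "y mod int n"]) (auto simp: unit_group_mod_def)
qed (use n in \<open>auto simp: unit_group_mod_def mod_mult_left_eq mod_mult_right_eq mult_ac\<close>)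

lemma finite_unit_group_mod: "finite (carrier (unit_group_mod n))"
  by (rule finite_subset[of _ "{0..<int n}"]) (auto simp: unit_group_mod_def)

abbreviation qchars :: "nat \<Rightarrow> (int \<Rightarrow> complex) set" where
  "qchars n \<equiv> quad_chars (unit_group_mod n)"

lemma qchars_sum:
  assumes n: "n > 0" and u: "coprime u (int n)"
  shows "(\<Sum>\<psi>\<in>qchars n. \<psi> (u mod int n)) = of_nat (nsqrt u n)"
proof -
  interpret comm_group "unit_group_mod n" by (rule unit_group_mod_comm_group[OF n])
  have "{b \<in> carrier (unit_group_mod n). b \<otimes>\<^bsub>unit_group_mod n\<^esub> b = u mod int n} = sqrts u n"
  proof (intro equalityI subsetI)
    fix b assume b: "b \<in> sqrts u n"
    hence eq: "b\<^sup>2 mod int n = u mod int n" by (simp add: sqrts_def mod_eq_dvd_iff)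
    hence "coprime (b\<^sup>2) (int n)" using u by (metis coprime_mod_left_iff n of_nat_0_less_iff less_irrefl)
    hence "coprime b (int n)" by simp
    thus "b \<in> {b \<in> carrier (unit_group_mod n). b \<otimes>\<^bsub>unit_group_mod n\<^esub> b = u mod int n}"
      using b eq by (simp add: unit_group_mod_def sqrts_def power2_eq_square)
  qed (auto simp: unit_group_mod_def sqrts_def mod_eq_dvd_iff power2_eq_square)
  moreover have "finite (carrier (unit_group_mod n))" by (rule finite_unit_group_mod)
  moreover have "u mod int n \<in> carrier (unit_group_mod n)" using n u by (simp add: unit_group_mod_def)
  ultimately show ?thesis using quad_char_sum[of "u mod int n"] by (simp add: nsqrt_def)
qed

lemma finite_qchars: "n > 0 \<Longrightarrow> finite (qchars n)"
  by (rule comm_group.finite_quad_chars[OF unit_group_mod_comm_group]) (auto simp: finite_unit_group_mod)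

text \<open>Evaluated at u = 1, the character sum counts the characters themselves, so their number
  is the number of square roots of 1.\<close>

lemma card_qchars_le: assumes n: "n > 0" shows "card (qchars n) \<le> 2 * tau n"
proof -
  interpret comm_group "unit_group_mod n" by (rule unit_group_mod_comm_group[OF n])
  have "(of_nat (card (qchars n)) :: complex) = (\<Sum>\<psi>\<in>qchars n. \<psi> (1 mod int n))"
  proof -
    have "\<psi> (1 mod int n) = 1" if "\<psi> \<in> qchars n" for \<psi>
      using quad_char_one[OF that] by (simp add: unit_group_mod_def)
    hence "(\<Sum>\<psi>\<in>qchars n. \<psi> (1 mod int n)) = (\<Sum>\<psi>\<in>qchars n. 1)" by (intro sum.cong) auto
    thus ?thesis by simp
  qed
  also have "\<dots> = of_nat (nsqrt 1 n)" by (rule qchars_sum[OF n]) simp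
  finally have "card (qchars n) = nsqrt 1 n" by (simp only: of_nat_eq_iff)
  thus ?thesis using nsqrt_one_le[OF n] by simp
qed

section \<open>Dirichlet series and Euler products\<close>

no_notation Infinite_Set_Sum.abs_summable_on (infix \<open>abs'_summable'_on\<close> 50)

definition nterm :: "complex \<Rightarrow> nat \<Rightarrow> complex" where
  "nterm s n = of_nat n powr (- s)"

lemma nterm_mult: "nterm s (m * n) = nterm s m * nterm s n"
  by (simp add: nterm_def powr_times_real)

lemma nterm_1 [simp]: "nterm s 1 = 1" "nterm s (Suc 0) = 1"
  by (simp_all add: nterm_def)

lemma nterm_add: "n > 0 \<Longrightarrow> nterm (s + t) n = nterm s n * nterm t n"
  by (simp add: nterm_def powr_add minus_add add.commute flip: powr_add)

lemma nterm_square: "nterm s (n\<^sup>2) = nterm s n * nterm s n"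
  by (simp add: power2_eq_square nterm_mult)

lemma norm_nterm: "norm (nterm s n) = real n powr (- Re s)"
  by (simp add: nterm_def norm_powr_real_powr)

lemma nterm_minus_one: "n > 0 \<Longrightarrow> nterm (s - 1) n = of_nat n * nterm s n"
  by (simp add: nterm_def powr_diff powr_minus divide_inverse)

lemma real_nterm_summable: assumes "\<sigma> > 1" shows "(\<lambda>n. real n powr (- \<sigma>)) summable_on A"
proof -
  have "summable (\<lambda>n. real n powr (- \<sigma>))" using assms by (simp add: summable_real_powr_iff)
  hence "(\<lambda>n. real n powr (- \<sigma>)) summable_on UNIV" by (intro summable_nonneg_imp_summable_on) auto
  thus ?thesis by (rule summable_on_subset_banach) simp
qed

lemma nterm_abs_summable: "Re s > 1 \<Longrightarrow> nterm s abs_summable_on A"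
  by (simp add: norm_nterm real_nterm_summable)

lemma abs_summable_times:
  fixes f :: "'a \<Rightarrow> 'c::{real_normed_field,banach}" and g :: "'b \<Rightarrow> 'c"
  assumes "f abs_summable_on A" "g abs_summable_on B"
  shows "(\<lambda>(x, y). f x * g y) abs_summable_on (A \<times> B)"
proof (subst Infinite_Sum.abs_summable_on_Sigma_iff, intro conjI ballI)
  show "(\<lambda>y. case (x, y) of (x, y) \<Rightarrow> f x * g y) abs_summable_on B" for x
    using summable_on_cmult_right[OF assms(2), of "norm (f x)"] by (simp add: norm_mult)
  have "infsum (\<lambda>y. norm (case (x, y) of (x, y) \<Rightarrow> f x * g y)) B = norm (f x) * infsum (\<lambda>y. norm (g y)) B" for x
    by (simp add: norm_mult infsum_cmult_right')
  thus "(\<lambda>x. infsum (\<lambda>y. norm (case (x, y) of (x, y) \<Rightarrow> f x * g y)) B) abs_summable_on A"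
    using summable_on_cmult_left[OF assms(1), of "infsum (\<lambda>y. norm (g y)) B"]
    by (simp add: norm_mult abs_mult infsum_nonneg)
qed

lemma infsum_times:
  fixes f :: "'a \<Rightarrow> 'c::{real_normed_field,banach}" and g :: "'b \<Rightarrow> 'c"
  assumes "f abs_summable_on A" "g abs_summable_on B"
  shows "infsum (\<lambda>(x, y). f x * g y) (A \<times> B) = infsum f A * infsum g B"
proof -
  have "infsum (\<lambda>(x, y). f x * g y) (A \<times> B) = infsum (\<lambda>x. infsum (\<lambda>y. f x * g y) B) A"
    using abs_summable_summable[OF abs_summable_times[OF assms]] by (simp add: infsum_Sigma'_banach)
  also have "\<dots> = infsum f A * infsum g B"
    by (simp add: infsum_cmult_right' infsum_cmult_left')
  finally show ?thesis .
qed

lemma abs_summable_sub: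
  fixes f :: "'a \<Rightarrow> 'b::banach"
  shows "f abs_summable_on B \<Longrightarrow> A \<subseteq> B \<Longrightarrow> f abs_summable_on A"
  by (rule summable_on_subset_banach)

text \<open>A finite set \<open>Y\<close> carries all but e/2 of the sum of the norms, and as soon
  as \<open>A k\<close> contains \<open>Y\<close> the remainder is below e. The sets
  \<open>A k\<close> may be infinite, as the smooth numbers in an Euler product are.\<close>

lemma infsum_exhaust:
  fixes f :: "'a \<Rightarrow> complex" and A :: "nat \<Rightarrow> 'a set"
  assumes f: "f abs_summable_on M" and sub: "\<And>k. A k \<subseteq> M"
    and ex: "\<And>Y. finite Y \<Longrightarrow> Y \<subseteq> M \<Longrightarrow> eventually (\<lambda>k. Y \<subseteq> A k) sequentially"
  shows "(\<lambda>k. infsum f (A k)) \<longlonglongrightarrow> infsum f M"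
proof (rule LIMSEQ_I)
  fix e :: real assume e: "e > 0"
  have "((\<lambda>x. norm (f x)) has_sum infsum (\<lambda>x. norm (f x)) M) M" using f by (rule has_sum_infsum)
  from has_sum_finite_approximation[OF this, of "e / 2"] obtain Y where Y: "finite Y" "Y \<subseteq> M" "dist (sum (\<lambda>x. norm (f x)) Y) (infsum (\<lambda>x. norm (f x)) M) \<le> e / 2"
    using e by auto
  obtain K where K: "\<And>k. k \<ge> K \<Longrightarrow> Y \<subseteq> A k" using ex[OF Y(1,2)] by (auto simp: eventually_sequentially)
  have "norm (infsum f (A k) - infsum f M) < e" if k: "k \<ge> K" for k
  proof -
    have s1: "(\<lambda>x. norm (f x)) summable_on A k" by (rule summable_on_subset_banach[OF f sub])
    have s2: "(\<lambda>x. norm (f x)) summable_on (M - A k)" using summable_on_subset_banach[OF f, of "M - A k"] by blast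
    note s = s1 s2
    have M: "A k \<union> (M - A k) = M" using sub by auto
    have "infsum f M = infsum f (A k) + infsum f (M - A k)"
      using infsum_Un_disjoint[OF abs_summable_summable[OF s(1)] abs_summable_summable[OF s(2)]] M by auto
    hence "norm (infsum f (A k) - infsum f M) = norm (infsum f (M - A k))" by simp
    also have "\<dots> \<le> infsum (\<lambda>x. norm (f x)) (M - A k)" by (rule norm_infsum_bound[OF s2])
    also have "\<dots> = infsum (\<lambda>x. norm (f x)) M - infsum (\<lambda>x. norm (f x)) (A k)"
      using infsum_Un_disjoint[OF s] M by auto
    finally have "norm (infsum f (A k) - infsum f M) \<le> infsum (\<lambda>x. norm (f x)) M - infsum (\<lambda>x. norm (f x)) (A k)" .
    moreover have "infsum (\<lambda>x. norm (f x)) (A k) \<ge> sum (\<lambda>x. norm (f x)) Y"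
      using K[OF k] Y(1) s(1) by (intro finite_sum_le_infsum) auto
    ultimately show ?thesis using Y(3) e unfolding dist_real_def by linarith
  qed
  thus "\<exists>no. \<forall>n\<ge>no. norm (infsum f (A n) - infsum f M) < e" by blast
qed

definition coprime_nats :: "nat set \<Rightarrow> nat set" where
  "coprime_nats P = {n. n > 0 \<and> (\<forall>p\<in>P. \<not> p dvd n)}"

lemma coprime_nats_mult: "(\<And>p. p \<in> P \<Longrightarrow> prime p) \<Longrightarrow> m * n \<in> coprime_nats P \<longleftrightarrow> m \<in> coprime_nats P \<and> n \<in> coprime_nats P"
  by (auto simp: coprime_nats_def prime_dvd_mult_iff)

lemma coprime_nats_power: "(\<And>p. p \<in> P \<Longrightarrow> prime p) \<Longrightarrow> n \<in> coprime_nats P \<Longrightarrow> n ^ k \<in> coprime_nats P"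
  by (auto simp: coprime_nats_def prime_dvd_power_iff dest: prime_dvd_power)

lemma coprime_nats_dvd: "n \<in> coprime_nats P \<Longrightarrow> d dvd n \<Longrightarrow> d \<in> coprime_nats P"
  by (auto simp: coprime_nats_def intro: dvd_trans intro!: Nat.gr0I)

lemma one_coprime_nats: assumes "\<And>p. p \<in> P \<Longrightarrow> prime p" shows "1 \<in> coprime_nats P"
proof -
  have "p \<noteq> 1" if "p \<in> P" for p using assms[OF that] by auto
  thus ?thesis by (auto simp: coprime_nats_def)
qed

text \<open>\<open>A k\<close> consists of the indices all of whose prime factors are below
  \<open>k\<close>; passing to \<open>k + 1\<close> multiplies the sum by a geometric series in
  \<open>h k\<close> or leaves it unchanged. The bound 1/2 on primes gives |F p - 1| \<le> 2 |h p|,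
  so the product converges absolutely, and a convergent product of nonzero factors is nonzero. For
  Re s > 1 this bound comes from p^(-1) \<le> 1/2.\<close>

lemma euler_product:
  fixes h :: "nat \<Rightarrow> complex"
  assumes P: "\<And>p. p \<in> P \<Longrightarrow> prime p"
    and h1: "h 1 = 1" and hm: "\<And>m n. m > 0 \<Longrightarrow> n > 0 \<Longrightarrow> h (m * n) = h m * h n"
    and sm: "h abs_summable_on coprime_nats P"
    and half: "\<And>p. prime p \<Longrightarrow> norm (h p) \<le> 1 / 2"
  defines "F \<equiv> (\<lambda>p. if prime p \<and> p \<notin> P then inverse (1 - h p) else 1)"
  shows "prodinf F = infsum h (coprime_nats P)" "infsum h (coprime_nats P) \<noteq> 0"
proof -
  define A where "A = (\<lambda>k. {n \<in> coprime_nats P. \<forall>p. prime p \<longrightarrow> p dvd n \<longrightarrow> p < k})"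
  have hp: "h (k ^ j) = h k ^ j" if "k > 0" for k j using that h1 hm by (induction j) auto
  have Asub: "A k \<subseteq> coprime_nats P" for k by (auto simp: A_def)
  have partial: "(\<Prod>p<k. F p) = infsum h (A k)" for k
  proof (induction k)
    case 0
    have "A 0 = {1}"
    proof -
      have "n = 1" if "n \<in> A 0" for n using that prime_factor_nat[of n] by (auto simp: A_def)
      thus ?thesis using one_coprime_nats[OF P] by (auto simp: A_def)
    qed
    thus ?case using h1 by simp
  next
    case (Suc k)
    show ?case
    proof (cases "prime k \<and> k \<notin> P")
      case False
      have "A (Suc k) = A k"
      proof -
        have "p < k" if "n \<in> A (Suc k)" "prime p" "p dvd n" for n p
        proof -
          have "p < Suc k" "p \<notin> P" using that by (auto simp: A_def coprime_nats_def)
          thus ?thesis using False that by (cases "p = k") auto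
        qed
        moreover have "A k \<subseteq> A (Suc k)" unfolding A_def using less_SucI by blast
        ultimately show ?thesis using A_def by blast
      qed
      moreover have "F k = 1" using False by (auto simp: F_def)
      ultimately show ?thesis using Suc by simp
    next
      case True
      have k0: "k > 0" and k1: "k > 1" using True prime_gt_0_nat prime_gt_1_nat by auto
      have kM: "k \<in> coprime_nats P" using True P k0 by (auto simp: coprime_nats_def dest: primes_dvd_imp_eq)
      have ndvd: "\<not> k dvd m" if "m \<in> A k" for m using that True by (auto simp: A_def)
      \<comment> \<open>Splitting off the full power of the prime \<open>k\<close>.\<close>
      have bij: "bij_betw (\<lambda>(m, j). m * k ^ j) (A k \<times> UNIV) (A (Suc k))"
      proof (rule bij_betwI[where g = "\<lambda>n. (n div k ^ multiplicity k n, multiplicity k n)"])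
        show "(\<lambda>(m, j). m * k ^ j) \<in> A k \<times> UNIV \<rightarrow> A (Suc k)"
        proof safe
          fix m j assume m: "m \<in> A k"
          have "p < Suc k" if "prime p" "p dvd m * k ^ j" for p
          proof -
            have "p dvd m \<or> p dvd k" using that by (auto simp: prime_dvd_mult_iff dest: prime_dvd_power)
            thus ?thesis using that m k0 by (auto simp: A_def dest: dvd_imp_le)
          qed
          thus "m * k ^ j \<in> A (Suc k)"
            using m coprime_nats_mult[OF P] coprime_nats_power[OF P kM] by (auto simp: A_def)
        qed
        show "(\<lambda>n. (n div k ^ multiplicity k n, multiplicity k n)) \<in> A (Suc k) \<rightarrow> A k \<times> UNIV"
        proof safe
          fix n assume n: "n \<in> A (Suc k)"
          let ?q = "n div k ^ multiplicity k n"
          have n0: "n > 0" using n by (auto simp: A_def coprime_nats_def)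
          have qd: "?q dvd n" using multiplicity_dvd[of k n] by (metis dvd_div_mult_self dvd_triv_left)
          have nk: "\<not> k dvd ?q" using n0 k1 by (intro multiplicity_decompose) auto
          have "p < k" if "prime p" "p dvd ?q" for p
          proof -
            have "p < Suc k" using that n qd by (auto simp: A_def intro: dvd_trans)
            moreover have "p \<noteq> k" using nk that by auto
            ultimately show ?thesis by simp
          qed
          thus "?q \<in> A k" using n qd coprime_nats_dvd by (auto simp: A_def)
        qed auto
        show "(\<lambda>n. (n div k ^ multiplicity k n, multiplicity k n)) ((\<lambda>(m, j). m * k ^ j) x) = x"
          if x: "x \<in> A k \<times> UNIV" for x
        proof -
          obtain m j where mj: "x = (m, j)" "m \<in> A k" using x by auto
          have "m > 0" using mj by (auto simp: A_def coprime_nats_def)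
          hence "multiplicity k (m * k ^ j) = j"
            using ndvd[OF mj(2)] k1 True
            by (auto simp: prime_elem_multiplicity_mult_distrib not_dvd_imp_multiplicity_0 multiplicity_same_power)
          thus ?thesis using mj k0 by simp
        qed
      qed (simp add: multiplicity_dvd)
      have eq: "h (case x of (m, j) \<Rightarrow> m * k ^ j) = (case x of (m, j) \<Rightarrow> h m * h k ^ j)" if "x \<in> A k \<times> UNIV" for x
        using that k0 hp[OF k0] by (auto simp: A_def coprime_nats_def hm)
      have nk: "norm (h k) < 1" using half[of k] True by simp
      have geo: "(\<lambda>j. h k ^ j) abs_summable_on UNIV"
        using nk by (intro summable_nonneg_imp_summable_on) (auto simp: norm_power summable_geometric)
      have "infsum h (A (Suc k)) = infsum (\<lambda>x. h (case x of (m, j) \<Rightarrow> m * k ^ j)) (A k \<times> UNIV)"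
        by (rule infsum_reindex_bij_betw[OF bij, symmetric])
      also have "\<dots> = infsum (\<lambda>(m, j). h m * h k ^ j) (A k \<times> UNIV)" using eq by (intro infsum_cong) auto
      also have "\<dots> = infsum h (A k) * infsum (\<lambda>j. h k ^ j) UNIV"
        using sm Asub geo by (intro infsum_times) (auto intro: abs_summable_sub)
      also have "infsum (\<lambda>j. h k ^ j) UNIV = inverse (1 - h k)"
      proof (rule infsumI)
        have "(\<lambda>j. h k ^ j) sums (1 / (1 - h k))" using nk by (rule geometric_sums)
        thus "((\<lambda>j. h k ^ j) has_sum inverse (1 - h k)) UNIV"
          using nk by (intro norm_summable_imp_has_sum) (auto simp: norm_power summable_geometric inverse_eq_divide)
      qed
      finally show ?thesis using Suc True by (simp add: F_def)
    qed
  qed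
  have "eventually (\<lambda>k. Y \<subseteq> A k) sequentially" if Y: "finite Y" "Y \<subseteq> coprime_nats P" for Y
  proof -
    have "Y \<subseteq> A k" if k: "k > Max (insert 0 Y)" for k
    proof
      fix n assume n: "n \<in> Y"
      have "n \<le> Max (insert 0 Y)" using Y n by (intro Max_ge) auto
      moreover have "n > 0" using Y n by (auto simp: coprime_nats_def)
      ultimately show "n \<in> A k" using Y n k by (auto simp: A_def dest!: dvd_imp_le)
    qed
    thus ?thesis unfolding eventually_sequentially by (meson Suc_le_lessD)
  qed
  hence lim: "(\<lambda>k. \<Prod>p<k. F p) \<longlonglongrightarrow> infsum h (coprime_nats P)"
    unfolding partial using sm Asub by (intro infsum_exhaust) auto
  have Fnz: "F p \<noteq> 0" for p
  proof (cases "prime p \<and> p \<notin> P")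
    case True
    hence "h p \<noteq> 1" using half[of p] by auto
    thus ?thesis by (simp add: F_def)
  qed (auto simp: F_def)
  have cp: "convergent_prod F"
  proof (rule abs_convergent_prod_imp_convergent_prod)
    define g where "g = (\<lambda>p. if prime p \<and> p \<notin> P then norm (h p) else 0)"
    have "(\<lambda>n. norm (h n)) summable_on {p. prime p \<and> p \<notin> P}"
      by (rule summable_on_subset_banach[OF sm]) (auto simp: coprime_nats_def prime_gt_0_nat dest: P primes_dvd_imp_eq)
    hence "g summable_on UNIV"
      by (rule summable_on_cong_neutral[THEN iffD1, rotated -1]) (auto simp: g_def)
    hence g: "summable g" by (rule summable_on_imp_summable)
    have "norm (F p - 1) \<le> 2 * g p" for p
    proof (cases "prime p \<and> p \<notin> P")
      case True
      have hp: "norm (h p) \<le> 1 / 2" using half True by auto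
      have n1: "norm (1 - h p) \<ge> 1 / 2" using norm_triangle_ineq2[of 1 "h p"] hp by simp
      hence nz: "1 - h p \<noteq> 0" by auto
      have "F p - 1 = h p * inverse (1 - h p)" using True nz by (simp add: F_def field_simps)
      hence "norm (F p - 1) = norm (h p) * inverse (norm (1 - h p))" by (simp add: norm_mult norm_inverse)
      also have "\<dots> \<le> norm (h p) * 2"
        using n1 le_imp_inverse_le[OF n1] by (intro mult_left_mono) auto
      finally show ?thesis using True by (simp add: g_def)
    qed (auto simp: F_def g_def)
    hence "summable (\<lambda>p. norm (F p - 1))"
      by (intro summable_comparison_test'[OF summable_mult[OF g, of 2], of 0]) auto
    thus "abs_convergent_prod F" by (simp add: abs_convergent_prod_conv_summable)
  qed
  have "(\<lambda>k. \<Prod>p\<le>k. F p) \<longlonglongrightarrow> prodinf F" by (rule convergent_prod_LIMSEQ[OF cp])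
  moreover have "(\<lambda>k. \<Prod>p\<le>k. F p) \<longlonglongrightarrow> infsum h (coprime_nats P)"
    using LIMSEQ_Suc[OF lim] by (simp add: lessThan_Suc_atMost)
  ultimately show eq: "prodinf F = infsum h (coprime_nats P)" by (rule LIMSEQ_unique)
  show "infsum h (coprime_nats P) \<noteq> 0"
    unfolding eq[symmetric] using prodinf_nonzero[OF cp] Fnz by blast
qed

text \<open>The divisor function is the coefficient sequence of the square of the zeta series: the
  double series over (a, b) is regrouped by the product a b.\<close>

lemma tau_summable:
  assumes \<sigma>: "\<sigma> > 1"
  shows "(\<lambda>n. real (tau n) * real n powr (- \<sigma>)) summable_on {0<..}"
proof -
  let ?t = "\<lambda>n::nat. real n powr (- \<sigma>)"
  have "?t abs_summable_on {0<..}" using real_nterm_summable[OF \<sigma>] by simp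
  from abs_summable_times[OF this this]
  have s: "(\<lambda>x. case x of (a, b) \<Rightarrow> ?t a * ?t b) summable_on ({0<..} \<times> {0<..})" by (rule abs_summable_summable)
  have bij: "bij_betw (\<lambda>(n, a). (a, n div a)) (Sigma {0<..} (\<lambda>n::nat. {a. a dvd n})) ({0<..} \<times> {0<..})"
    by (rule bij_betwI[where g = "\<lambda>(a, b). (a * b, a)"]) (auto elim!: dvdE)
  have "(\<lambda>x. case (case x of (n, a) \<Rightarrow> (a, n div a)) of (a, b) \<Rightarrow> ?t a * ?t b)
      summable_on Sigma {0<..} (\<lambda>n. {a. a dvd n})"
    using s by (subst summable_on_reindex_bij_betw[OF bij])
  also have "?this \<longleftrightarrow> (\<lambda>(n, a). ?t n) summable_on Sigma {0<..} (\<lambda>n. {a. a dvd n})"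
    by (rule summable_on_cong) (auto simp: powr_mult[symmetric] simp flip: of_nat_mult)
  finally have "(\<lambda>n. infsum (\<lambda>a. ?t n) {a. a dvd n}) summable_on {0<..}" by (rule summable_on_Sigma_banach)
  thus ?thesis by (rule summable_on_cong[THEN iffD1, rotated]) (simp add: tau_def)
qed

text \<open>The count is a sum of at most 2 tau(n) signs.\<close>

lemma nsqrt_le:
  assumes "n > 0" "coprime u (int n)" shows "nsqrt u n \<le> 2 * tau n"
proof -
  have "real (nsqrt u n) = norm (\<Sum>\<psi>\<in>qchars n. \<psi> (u mod int n))" by (simp add: qchars_sum[OF assms])
  also have "\<dots> \<le> (\<Sum>\<psi>\<in>qchars n. 1)"
  proof (rule sum_norm_le)
    fix \<psi> assume "\<psi> \<in> qchars n"
    moreover have "u mod int n \<in> carrier (unit_group_mod n)" using assms by (simp add: unit_group_mod_def)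
    ultimately have "\<psi> (u mod int n) \<in> {1, -1}" by (auto simp: quad_chars_def)
    thus "norm (\<psi> (u mod int n)) \<le> 1" by auto
  qed
  finally show ?thesis using card_qchars_le[OF assms(1)] by simp
qed

lemma tau_mono: "m dvd n \<Longrightarrow> n > 0 \<Longrightarrow> tau m \<le> tau n"
  unfolding tau_def by (intro card_mono) (auto intro: dvd_trans)

text \<open>Removing the part of \<open>n\<close> that is common with \<open>m\<close> leaves the
  square roots of a unit modulo a divisor \<open>l\<close> of \<open>n\<close>.\<close>

lemma nsqrt_tame_le:
  assumes m: "m > 0" and n: "n > 0" and t: "tame m n" and ce: "\<And>p. prime p \<Longrightarrow> p dvd n \<Longrightarrow> \<not> int p dvd e"
  shows "nsqrt (e * int m) n \<le> 2 * tau n"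
proof -
  obtain k l where kl: "n = k * l" "coprime k l" "k dvd m" "coprime l m" "squarefree k" "l > 0"
    using tame_split[OF m n t] .
  have k0: "k > 0" using kl n by auto
  have ce': "coprime e (int l)"
  proof (rule ccontr)
    assume "\<not> coprime e (int l)"
    hence "gcd e (int l) \<noteq> 1" by (metis coprime_iff_gcd_eq_1)
    hence "nat (gcd e (int l)) \<noteq> 1" by (metis gcd_ge_0_int int_nat_eq of_nat_1)
    then obtain p where p: "prime p" "p dvd nat (gcd e (int l))" using prime_factor_nat by blast
    hence "int p dvd gcd e (int l)" by (metis gcd_ge_0_int int_dvd_int_iff int_nat_eq)
    hence "int p dvd e" "p dvd l" by auto
    thus False using ce[OF p(1)] kl by auto
  qed
  have "nsqrt (e * int m) n = nsqrt (e * int m) l"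
    unfolding kl(1) using kl k0 by (intro nsqrt_coprime_part) auto
  also have "\<dots> \<le> 2 * tau l"
    using ce' kl by (intro nsqrt_le) (auto simp: coprime_commute)
  also have "\<dots> \<le> 2 * tau n" using tau_mono[of l n] kl n by auto
  finally show ?thesis .
qed

text \<open>\<open>r\<close> must be the greatest divisor, in the sense of divisibility, of
  \<open>M\<close> whose square divides \<open>N\<close>: for a smaller \<open>h\<close>, a prime of
  \<open>r / h\<close> divides \<open>M / h\<close> and its square divides
  \<open>N / h\<^sup>2\<close>. The unequal exponents 1 and 2 are what produces the argument 2 s1 +
  s2 below.\<close>

lemma tame_decompose_unique:
  assumes M: "(M::nat) > 0" and N: "N > 0"
  shows "\<exists>!r. r dvd M \<and> r\<^sup>2 dvd N \<and> tame (M div r) (N div r\<^sup>2)"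
proof -
  let ?A = "\<lambda>r. r dvd M \<and> r\<^sup>2 dvd N"
  have pos: "r > 0" if "?A r" for r using that M by (auto intro!: Nat.gr0I)
  have "finite {r. ?A r}" by (rule finite_subset[of _ "{r. r dvd M}"]) (use M in auto)
  then obtain r where r: "?A r" "\<And>h. ?A h \<Longrightarrow> h dvd r"
    using dvd_witness_unique[of ?A 1, OF _ _ pos] lcm_square_dvd by auto
  obtain M' N' where MN: "M = r * M'" "N = r\<^sup>2 * N'" using r(1) by (auto simp: dvd_def)
  have r0: "r > 0" using pos r by blast
  have "tame M' N'" unfolding tame_def
  proof safe
    fix p assume p: "prime p" "p dvd M'" "p\<^sup>2 dvd N'"
    have "?A (r * p)" using p by (simp add: MN power_mult_distrib)
    hence "r * p dvd r" by (rule r(2))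
    thus False using r0 p by auto
  qed
  hence "tame (M div r) (N div r\<^sup>2)" using MN r0 by simp
  moreover have "h = r" if h: "?A h" "tame (M div h) (N div h\<^sup>2)" for h
  proof (rule ccontr)
    assume "h \<noteq> r"
    obtain k where k: "r = h * k" using r(2)[OF h(1)] by (auto simp: dvd_def)
    have "k \<noteq> 1" using \<open>h \<noteq> r\<close> k by auto
    then obtain p where p: "prime p" "p dvd k" using prime_factor_nat by blast
    have h0: "h > 0" using pos h by blast
    have "M div h = k * M'" "N div h\<^sup>2 = k\<^sup>2 * N'"
      using h0 by (simp_all add: MN k power_mult_distrib mult.assoc)
    moreover have "p\<^sup>2 dvd k\<^sup>2" using p by (simp add: dvd_power_same)
    ultimately show False using p h(2) by (auto simp: tame_def)
  qed
  ultimately show ?thesis using r(1) by blast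
qed

section \<open>The double Dirichlet series\<close>

definition sL :: "nat set \<Rightarrow> complex \<Rightarrow> (nat \<Rightarrow> complex) \<Rightarrow> complex" where
  "sL P s a = infsum (\<lambda>m. a m * nterm s m) (coprime_nats P)"

text \<open>The hypothesis \<open>key\<close> is the arithmetic input: a sum over the characters of conductor dividing
  \<open>n\<close> counts square roots modulo \<open>n\<close>.\<close>
locale dirichlet_data =
  fixes P :: "nat set" and C :: "'c set" and f :: "'c \<Rightarrow> nat" and chi :: "'c \<Rightarrow> nat \<Rightarrow> complex"
    and E :: "'e set" and ev :: "'e \<Rightarrow> int" and w :: "'e \<Rightarrow> nat \<Rightarrow> complex" and c :: complex
  assumes P: "\<And>p. p \<in> P \<Longrightarrow> prime p"
    and f: "\<And>x. x \<in> C \<Longrightarrow> f x \<in> coprime_nats P"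
    and chi_1: "\<And>x. x \<in> C \<Longrightarrow> chi x 1 = 1"
    and chi_mult: "\<And>x m n. x \<in> C \<Longrightarrow> m > 0 \<Longrightarrow> n > 0 \<Longrightarrow> chi x (m * n) = chi x m * chi x n"
    and chi_0: "\<And>x m. x \<in> C \<Longrightarrow> \<not> coprime m (f x) \<Longrightarrow> chi x m = 0"
    and chi_le: "\<And>x m. x \<in> C \<Longrightarrow> norm (chi x m) \<le> 1"
    and finE: "finite E" and ev_0: "\<And>e. e \<in> E \<Longrightarrow> ev e \<noteq> 0"
    and ev_P: "\<And>e p. e \<in> E \<Longrightarrow> prime p \<Longrightarrow> p \<notin> P \<Longrightarrow> \<not> int p dvd ev e"
    and w_le: "\<And>e m. e \<in> E \<Longrightarrow> norm (w e m) \<le> 1"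
    and w_square: "\<And>e g m. e \<in> E \<Longrightarrow> g > 0 \<Longrightarrow> m > 0 \<Longrightarrow> w e (g\<^sup>2 * m) = w e m"
    and cond_fin: "\<And>n. n \<in> coprime_nats P \<Longrightarrow> finite {x \<in> C. f x dvd n}"
    and cond_card: "\<And>n. n \<in> coprime_nats P \<Longrightarrow> card {x \<in> C. f x dvd n} \<le> 2 * tau n"
    and key: "\<And>m n. m \<in> coprime_nats P \<Longrightarrow> n \<in> coprime_nats P \<Longrightarrow> coprime m n \<Longrightarrow>
      c * (\<Sum>x\<in>{x \<in> C. f x dvd n}. chi x m) = (\<Sum>e\<in>E. w e m * of_nat (nsqrt (ev e * int m) n))"
begin

abbreviation "Q \<equiv> coprime_nats P"

lemma Q_pos: "n \<in> Q \<Longrightarrow> n > 0"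
  by (simp add: coprime_nats_def)

lemma Q_mult [simp]: "m * n \<in> Q \<longleftrightarrow> m \<in> Q \<and> n \<in> Q"
  by (rule coprime_nats_mult[OF P])

lemma Q_square [simp]: "n\<^sup>2 \<in> Q \<longleftrightarrow> n \<in> Q"
  by (simp add: power2_eq_square)

lemma ev_n: "e \<in> E \<Longrightarrow> n \<in> Q \<Longrightarrow> prime p \<Longrightarrow> p dvd n \<Longrightarrow> \<not> int p dvd ev e"
  using ev_P by (auto simp: coprime_nats_def)

text \<open>Neither side sees the part \<open>k\<close> that \<open>n\<close> has in common with
  \<open>m\<close>. A character contributes only if its conductor is prime to \<open>m\<close>,
  hence to \<open>k\<close>, so dividing \<open>n\<close> amounts to dividing \<open>l\<close>; and
  the square roots modulo \<open>n\<close> correspond to those modulo \<open>l\<close>.\<close>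

lemma key_tame:
  assumes m: "m \<in> Q" and n: "n \<in> Q" and t: "tame m n"
  shows "c * (\<Sum>x\<in>{x \<in> C. f x dvd n}. chi x m) = (\<Sum>e\<in>E. w e m * of_nat (nsqrt (ev e * int m) n))"
proof -
  obtain k l where kl: "n = k * l" "coprime k l" "k dvd m" "coprime l m" "squarefree k" "l > 0"
    using tame_split[OF Q_pos[OF m] Q_pos[OF n] t] .
  have k0: "k > 0" using kl Q_pos[OF n] by auto
  have lQ: "l \<in> Q" using n kl by simp
  have "(\<Sum>x\<in>{x \<in> C. f x dvd n}. chi x m) = (\<Sum>x\<in>{x \<in> C. f x dvd l}. chi x m)"
  proof (rule sum.mono_neutral_right)
    show "finite {x \<in> C. f x dvd n}" by (rule cond_fin[OF n])
    show "\<forall>x\<in>{x \<in> C. f x dvd n} - {x \<in> C. f x dvd l}. chi x m = 0"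
    proof
      fix x assume x: "x \<in> {x \<in> C. f x dvd n} - {x \<in> C. f x dvd l}"
      show "chi x m = 0"
      proof (rule ccontr)
        assume nz: "chi x m \<noteq> 0"
        have "coprime m (f x)" using chi_0 x nz by blast
        hence "coprime (f x) k" using kl(3) by (meson coprime_commute coprime_divisors dvd_refl)
        hence "f x dvd l" using x unfolding kl(1) by (auto simp: coprime_dvd_mult_right_iff)
        with x show False by blast
      qed
    qed
  qed (auto simp: kl)
  hence "c * (\<Sum>x\<in>{x \<in> C. f x dvd n}. chi x m) = (\<Sum>e\<in>E. w e m * of_nat (nsqrt (ev e * int m) l))"
    using key[OF m lQ] kl by (simp add: coprime_commute)
  also have "\<dots> = (\<Sum>e\<in>E. w e m * of_nat (nsqrt (ev e * int m) n))"
    unfolding kl(1) using kl k0 by (intro sum.cong refl) (subst nsqrt_coprime_part; simp)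
  finally show ?thesis .
qed

lemma chi_abs_summable: "x \<in> C \<Longrightarrow> Re s > 1 \<Longrightarrow> (\<lambda>m. chi x m * nterm s m) abs_summable_on A"
  by (rule Infinite_Sum.abs_summable_on_comparison_test[OF nterm_abs_summable])
    (auto simp: norm_mult intro!: mult_left_le_one_le chi_le)

text \<open>The Euler product does not vanish in the region of absolute convergence; this permits
  the division by the value at 2 s1 + s2.\<close>

lemma chi_L_nonzero: assumes x: "x \<in> C" and s: "Re s > 1" shows "sL P s (chi x) \<noteq> 0"
  unfolding sL_def
proof (rule euler_product(2)[OF P])
  show "norm (chi x p * nterm s p) \<le> 1 / 2" if p: "prime p" for p
  proof -
    have "norm (chi x p * nterm s p) \<le> real p powr (- Re s)"
      using chi_le[OF x, of p] by (simp add: norm_mult norm_nterm mult_left_le_one_le)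
    also have "\<dots> \<le> real p powr (- 1)" using s prime_ge_2_nat[OF p] by (intro powr_mono) auto
    also have "\<dots> \<le> 1 / 2" using prime_ge_2_nat[OF p] by (simp add: powr_minus field_simps)
    finally show ?thesis .
  qed
qed (use x s chi_abs_summable in \<open>auto simp: chi_1[OF x, simplified] chi_mult nterm_mult\<close>)

context
  fixes s1 s2 :: complex
  assumes s1: "Re s1 > 1" and s2: "Re s2 > 1"
begin

definition tt :: "nat \<Rightarrow> nat \<Rightarrow> complex" where "tt n m = nterm s1 n * nterm s2 m"

text \<open>The tame part of the series \<open>W\<close>, that is, what remains of it once common
  squares have been summed out.\<close>

definition Y0 :: "'e \<times> nat \<times> nat \<Rightarrow> complex" where
  "Y0 = (\<lambda>(e, n, m). if tame m n then w e m * of_nat (nsqrt (ev e * int m) n) * tt n m else 0)"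

lemma tau_tt_summable: "(\<lambda>(n, m). of_nat (tau n) * tt n m) abs_summable_on Q \<times> Q"
proof -
  have "(\<lambda>n. norm (of_nat (tau n) * nterm s1 n)) summable_on Q"
    using summable_on_subset_banach[OF tau_summable[OF s1], of Q] Q_pos
    by (auto simp: norm_mult norm_nterm)
  from abs_summable_times[OF this nterm_abs_summable[OF s2, of Q]]
  show ?thesis by (simp add: tt_def mult.assoc case_prod_unfold)
qed

lemma Y0_summable: "Y0 abs_summable_on E \<times> Q \<times> Q"
proof -
  have "(\<lambda>e. 2 :: complex) abs_summable_on E" using finE by simp
  from abs_summable_times[OF this tau_tt_summable] show ?thesis
  proof (rule Infinite_Sum.abs_summable_on_comparison_test)
    fix z assume "z \<in> E \<times> Q \<times> Q"
    then obtain e n m where z: "z = (e, n, m)" "e \<in> E" "n \<in> Q" "m \<in> Q" by auto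
    have "norm (Y0 z) \<le> real (2 * tau n) * norm (tt n m)"
    proof (cases "tame m n")
      case True
      have "nsqrt (ev e * int m) n \<le> 2 * tau n"
        using z True ev_n by (intro nsqrt_tame_le) (auto dest: Q_pos)
      hence "real (nsqrt (ev e * int m) n) \<le> real (2 * tau n)" by (simp only: of_nat_le_iff)
      hence "norm (w e m) * real (nsqrt (ev e * int m) n) * norm (tt n m) \<le> 1 * real (2 * tau n) * norm (tt n m)"
        using w_le[OF z(2)] by (intro mult_mono) auto
      thus ?thesis using True by (simp add: Y0_def z(1) norm_mult)
    qed (simp add: Y0_def z(1))
    thus "norm (Y0 z) \<le> norm (case z of (x, y) \<Rightarrow> 2 * (case y of (n, m) \<Rightarrow> of_nat (tau n) * tt n m))"
      by (simp add: z norm_mult)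
  qed
qed

text \<open>Up to the factor 1/2 coming from orbits and stabilizers, the series of the zeta function
  summed over all square classes.\<close>

definition W :: "'e \<times> nat \<times> nat \<Rightarrow> complex" where
  "W = (\<lambda>(e, n, m). w e m * of_nat (nsqrt (ev e * int m) n) * tt n m)"

lemma stratify_bij:
  "bij_betw (\<lambda>(g, e, n, m). ((e, g\<^sup>2 * n, g\<^sup>2 * m), g)) (Q \<times> E \<times> Q \<times> Q)
     (Sigma (E \<times> Q \<times> Q) (\<lambda>(e, N, M). {g. g\<^sup>2 dvd M \<and> g\<^sup>2 dvd N}))"
  by (rule bij_betwI[where g = "\<lambda>((e, N, M), g). (g, e, N div g\<^sup>2, M div g\<^sup>2)"])
    (auto simp: Q_pos elim!: dvdE dest: Q_pos)

text \<open>Taking g^2 out of both variables contributes g from the count of roots and g^(-2 s1 - 2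
  s2) from the Dirichlet terms, hence the zeta series at 2 s1 + 2 s2 - 1. Summability is obtained
  from the factored side: the product series converges absolutely, is reindexed as \<open>H\<close>,
  and is then summed over the finitely many \<open>g\<close>.\<close>

lemma W_sum:
  "W abs_summable_on E \<times> Q \<times> Q"
  "infsum W (E \<times> Q \<times> Q) = infsum (nterm (2 * s1 + 2 * s2 - 1)) Q * infsum Y0 (E \<times> Q \<times> Q)"
proof -
  let ?S = "Sigma (E \<times> Q \<times> Q) (\<lambda>(e, N, M). {g. g\<^sup>2 dvd M \<and> g\<^sup>2 dvd N})"
  define s3 where "s3 = 2 * s1 + 2 * s2 - 1"
  have s3: "Re s3 > 1" using s1 s2 by (simp add: s3_def)
  \<comment> \<open>The stratified summand at (e, N, M) and \<open>g\<close>; summing it over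
    \<open>g\<close> gives back \<open>W\<close> by \<open>nsqrt_stratify\<close>.\<close>
  define H where "H = (\<lambda>((e, N, M), g). if tame (M div g\<^sup>2) (N div g\<^sup>2)
    then w e M * of_nat (g * nsqrt (ev e * int (M div g\<^sup>2)) (N div g\<^sup>2)) * tt N M else 0)"
  have HY: "H (case x of (g, e, n, m) \<Rightarrow> ((e, g\<^sup>2 * n, g\<^sup>2 * m), g)) = (case x of (g, y) \<Rightarrow> nterm s3 g * Y0 y)"
    if "x \<in> Q \<times> E \<times> Q \<times> Q" for x
  proof -
    obtain g e n m where x: "x = (g, e, n, m)" "g \<in> Q" "e \<in> E" "n \<in> Q" "m \<in> Q" using \<open>x \<in> _\<close> by auto
    have g0: "g > 0" using x Q_pos by auto
    have "tt (g\<^sup>2 * n) (g\<^sup>2 * m) = (nterm s1 g * nterm s1 g * (nterm s2 g * nterm s2 g)) * tt n m"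
      by (simp add: tt_def nterm_mult nterm_square)
    also have "nterm s1 g * nterm s1 g * (nterm s2 g * nterm s2 g) = nterm (2 * s1 + 2 * s2) g"
      unfolding mult_2 nterm_add[OF g0] by (simp only: mult_ac)
    finally have "of_nat g * tt (g\<^sup>2 * n) (g\<^sup>2 * m) = nterm s3 g * tt n m"
      unfolding s3_def nterm_minus_one[OF g0] by simp
    hence "w e m * of_nat (g * nsqrt (ev e * int m) n) * tt (g\<^sup>2 * n) (g\<^sup>2 * m)
        = nterm s3 g * (w e m * of_nat (nsqrt (ev e * int m) n) * tt n m)"
      by (simp add: mult_ac)
    thus ?thesis using g0 x w_square[OF x(3) g0 Q_pos[OF x(5)]] by (simp add: H_def Y0_def)
  qed
  have "(\<lambda>(g, y). nterm s3 g * Y0 y) summable_on Q \<times> E \<times> Q \<times> Q"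
    by (rule abs_summable_summable[OF abs_summable_times[OF nterm_abs_summable[OF s3] Y0_summable]])
  also have "?this \<longleftrightarrow> (\<lambda>x. H (case x of (g, e, n, m) \<Rightarrow> ((e, g\<^sup>2 * n, g\<^sup>2 * m), g))) summable_on Q \<times> E \<times> Q \<times> Q"
    using HY by (intro summable_on_cong) auto
  also have "\<dots> \<longleftrightarrow> H summable_on ?S" by (rule summable_on_reindex_bij_betw[OF stratify_bij])
  finally have Hs: "H summable_on ?S" .
  have inner: "infsum (\<lambda>g. H (y, g)) (case y of (e, N, M) \<Rightarrow> {g. g\<^sup>2 dvd M \<and> g\<^sup>2 dvd N}) = W y"
    if "y \<in> E \<times> Q \<times> Q" for y
  proof -
    obtain e N M where y: "y = (e, N, M)" "e \<in> E" "N \<in> Q" "M \<in> Q" using \<open>y \<in> _\<close> by auto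
    let ?G = "{g. g\<^sup>2 dvd M \<and> g\<^sup>2 dvd N}"
    have M0: "M > 0" using y Q_pos by auto
    have "finite ?G"
    proof (rule finite_subset)
      show "?G \<subseteq> {..M}"
      proof safe
        fix g assume "g\<^sup>2 dvd M"
        hence "g\<^sup>2 \<le> M" using M0 by (rule dvd_imp_le)
        thus "g \<le> M" using self_le_power[of g 2] by (cases g) auto
      qed
    qed simp
    hence "infsum (\<lambda>g. H (y, g)) ?G = (\<Sum>g\<in>?G. H (y, g))" by simp
    also have "\<dots> = (\<Sum>g\<in>?G. w e M * of_nat (if tame (M div g\<^sup>2) (N div g\<^sup>2) then g * nsqrt (ev e * int (M div g\<^sup>2)) (N div g\<^sup>2) else 0) * tt N M)"
      by (intro sum.cong refl) (auto simp: H_def y)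
    also have "\<dots> = w e M * of_nat (nsqrt (ev e * int M) N) * tt N M"
      using nsqrt_stratify[OF M0 Q_pos[OF y(3)] ev_0[OF y(2)], OF ev_n[OF y(2,3)]]
      by (simp add: sum_distrib_left sum_distrib_right)
    finally show ?thesis by (simp add: W_def y)
  qed
  have Hs': "(\<lambda>(y, g). H (y, g)) summable_on ?S" using Hs by (simp add: case_prod_eta)
  have "(\<lambda>y. infsum (\<lambda>g. H (y, g)) (case y of (e, N, M) \<Rightarrow> {g. g\<^sup>2 dvd M \<and> g\<^sup>2 dvd N})) summable_on E \<times> Q \<times> Q"
    using Hs' by (rule summable_on_Sigma_banach)
  hence "W summable_on E \<times> Q \<times> Q" using inner by (subst (asm) summable_on_cong[where g = W]) auto
  thus "W abs_summable_on E \<times> Q \<times> Q" using summable_on_iff_abs_summable_on_complex by blast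
  have "infsum W (E \<times> Q \<times> Q) = infsum (\<lambda>y. infsum (\<lambda>g. H (y, g)) (case y of (e, N, M) \<Rightarrow> {g. g\<^sup>2 dvd M \<and> g\<^sup>2 dvd N})) (E \<times> Q \<times> Q)"
    using inner by (intro infsum_cong) auto
  also have "\<dots> = infsum H ?S" by (rule infsum_Sigma_banach[OF Hs])
  also have "\<dots> = infsum (\<lambda>x. H (case x of (g, e, n, m) \<Rightarrow> ((e, g\<^sup>2 * n, g\<^sup>2 * m), g))) (Q \<times> E \<times> Q \<times> Q)"
    by (rule infsum_reindex_bij_betw[OF stratify_bij, symmetric])
  also have "\<dots> = infsum (\<lambda>(g, y). nterm s3 g * Y0 y) (Q \<times> E \<times> Q \<times> Q)"
    using HY by (intro infsum_cong) auto
  also have "\<dots> = infsum (nterm s3) Q * infsum Y0 (E \<times> Q \<times> Q)"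
    by (rule infsum_times[OF nterm_abs_summable[OF s3] Y0_summable])
  finally show "infsum W (E \<times> Q \<times> Q) = infsum (nterm (2 * s1 + 2 * s2 - 1)) Q * infsum Y0 (E \<times> Q \<times> Q)"
    by (simp add: s3_def)
qed

definition Z0 :: "'c \<Rightarrow> nat \<times> nat \<Rightarrow> complex" where
  "Z0 x = (\<lambda>(n, m). if f x dvd n \<and> tame m n then chi x m * tt n m else 0)"

text \<open>The order of summation matters: for a fixed pair only the characters with
  \<open>f x dvd n\<close> count, at most 2 tau(n) of them, and the remaining series over pairs is
  dominated by the divisor bound.\<close>

lemma Z0_summable: "(\<lambda>(x, y). Z0 x y) abs_summable_on C \<times> Q \<times> Q"
proof -
  have "(\<lambda>(y, x). Z0 x y) abs_summable_on Sigma (Q \<times> Q) (\<lambda>(n, m). {x \<in> C. f x dvd n})"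
  proof (subst Infinite_Sum.abs_summable_on_Sigma_iff, intro conjI ballI)
    fix y assume "y \<in> Q \<times> Q"
    thus "(\<lambda>x. case (y, x) of (y, x) \<Rightarrow> Z0 x y) abs_summable_on (case y of (n, m) \<Rightarrow> {x \<in> C. f x dvd n})"
      using cond_fin by (auto intro!: summable_on_finite)
  next
    have "(\<lambda>(n, m). 2 * (of_nat (tau n) * tt n m)) abs_summable_on Q \<times> Q"
      using summable_on_cmult_right[OF tau_tt_summable, of 2] by (simp add: norm_mult case_prod_unfold)
    thus "(\<lambda>y. infsum (\<lambda>x. norm (case (y, x) of (y, x) \<Rightarrow> Z0 x y)) (case y of (n, m) \<Rightarrow> {x \<in> C. f x dvd n})) abs_summable_on Q \<times> Q"
    proof (rule Infinite_Sum.abs_summable_on_comparison_test)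
      fix y assume "y \<in> Q \<times> Q"
      then obtain n m where y: "y = (n, m)" "n \<in> Q" "m \<in> Q" by auto
      have "(\<Sum>x\<in>{x \<in> C. f x dvd n}. norm (Z0 x y)) \<le> (\<Sum>x\<in>{x \<in> C. f x dvd n}. norm (tt n m))"
        using chi_le by (intro sum_mono) (auto simp: Z0_def y norm_mult intro!: mult_left_le_one_le)
      also have "\<dots> = real (card {x \<in> C. f x dvd n}) * norm (tt n m)" by simp
      also have "\<dots> \<le> real (2 * tau n) * norm (tt n m)"
        using cond_card[OF y(2)] by (intro mult_right_mono of_nat_mono) auto
      finally show "norm (infsum (\<lambda>x. norm (case (y, x) of (y, x) \<Rightarrow> Z0 x y)) (case y of (n, m) \<Rightarrow> {x \<in> C. f x dvd n}))
          \<le> norm (case y of (n, m) \<Rightarrow> 2 * (of_nat (tau n) * tt n m))"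
        using cond_fin[OF y(2)] by (simp add: y norm_mult sum_nonneg)
    qed
  qed
  \<comment> \<open>\<open>Z0 x\<close> vanishes at pairs whose first entry is not a multiple of
    \<open>f x\<close>, so the index set may be enlarged to all of \<open>C\<close>.\<close>
  hence "(\<lambda>z. norm (case z of (y, x) \<Rightarrow> Z0 x y)) summable_on (Q \<times> Q) \<times> C"
    by (rule summable_on_cong_neutral[THEN iffD1, rotated -1]) (auto simp: Z0_def split: if_splits)
  hence "(\<lambda>z. norm (case prod.swap z of (y, x) \<Rightarrow> Z0 x y)) summable_on C \<times> (Q \<times> Q)"
    by (subst summable_on_reindex_bij_betw[where g = prod.swap and B = "(Q \<times> Q) \<times> C" and f = "\<lambda>z. norm (case z of (y, x) \<Rightarrow> Z0 x y)"])
      (auto simp: bij_betw_def inj_on_def)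
  thus ?thesis by (simp add: case_prod_unfold)
qed

text \<open>The sum over pairs is moved outside on both sides; for each single pair the inner finite
  sums agree by \<open>key_tame\<close>.\<close>

lemma Y0_eq_Z0: "infsum Y0 (E \<times> Q \<times> Q) = c * infsum (\<lambda>x. infsum (Z0 x) (Q \<times> Q)) C"
proof -
  have Ys: "(\<lambda>(e, y). Y0 (e, y)) summable_on E \<times> Q \<times> Q"
    using abs_summable_summable[OF Y0_summable] by (simp add: case_prod_eta)
  have Zs: "(\<lambda>(x, y). Z0 x y) summable_on C \<times> (Q \<times> Q)" by (rule abs_summable_summable[OF Z0_summable])
  have "infsum Y0 (E \<times> Q \<times> Q) = infsum (\<lambda>e. infsum (\<lambda>y. Y0 (e, y)) (Q \<times> Q)) E"
    using infsum_Sigma'_banach[OF Ys] by (simp add: case_prod_eta)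
  also have "\<dots> = infsum (\<lambda>y. infsum (\<lambda>e. Y0 (e, y)) E) (Q \<times> Q)" by (rule infsum_swap_banach[OF Ys])
  also have "\<dots> = infsum (\<lambda>y. c * infsum (\<lambda>x. Z0 x y) C) (Q \<times> Q)"
  proof (rule infsum_cong)
    fix y assume "y \<in> Q \<times> Q"
    then obtain n m where y: "y = (n, m)" "n \<in> Q" "m \<in> Q" by auto
    have "infsum (\<lambda>x. Z0 x y) C = infsum (\<lambda>x. Z0 x y) {x \<in> C. f x dvd n}"
      by (rule infsum_cong_neutral) (auto simp: Z0_def y)
    also have "\<dots> = (\<Sum>x\<in>{x \<in> C. f x dvd n}. Z0 x y)" using cond_fin[OF y(2)] by simp
    also have "\<dots> = (if tame m n then (\<Sum>x\<in>{x \<in> C. f x dvd n}. chi x m) * tt n m else 0)"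
      by (auto simp: Z0_def y sum_distrib_right intro!: sum.cong)
    finally have "c * infsum (\<lambda>x. Z0 x y) C = (if tame m n then (c * (\<Sum>x\<in>{x \<in> C. f x dvd n}. chi x m)) * tt n m else 0)"
      by (auto simp: mult.assoc)
    also have "\<dots> = (\<Sum>e\<in>E. Y0 (e, y))"
      using key_tame[OF y(3,2)] by (auto simp: Y0_def y sum_distrib_right mult.assoc)
    finally show "infsum (\<lambda>e. Y0 (e, y)) E = c * infsum (\<lambda>x. Z0 x y) C" using finE by simp
  qed
  also have "\<dots> = c * infsum (\<lambda>y. infsum (\<lambda>x. Z0 x y) C) (Q \<times> Q)" by (rule infsum_cmult_right')
  also have "infsum (\<lambda>y. infsum (\<lambda>x. Z0 x y) C) (Q \<times> Q) = infsum (\<lambda>x. infsum (Z0 x) (Q \<times> Q)) C"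
    by (rule infsum_swap_banach[OF Zs, symmetric])
  finally show ?thesis .
qed

text \<open>Multiplying by the L-series in \<open>r\<close> fills in the pairs that are not tame, by
  the unique decomposition (N, M) = (r^2 n, r m). As \<open>r\<close> is prime to the conductor,
  \<open>f x\<close> divides r^2 n exactly when it divides n. In the resulting sum over all pairs
  the variables separate: the multiples of \<open>f x\<close> give the zeta series times the power
  of the conductor, and \<open>M\<close> gives the L-series at s2.\<close>

lemma Z0_eq:
  assumes x: "x \<in> C"
  shows "infsum (Z0 x) (Q \<times> Q) * sL P (2 * s1 + s2) (chi x)
    = infsum (nterm s1) Q * sL P s2 (chi x) * nterm s1 (f x)"
proof -
  define s3 where "s3 = 2 * s1 + s2"
  have s3: "Re s3 > 1" using s1 s2 by (simp add: s3_def)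
  define T where "T = {(n, m) \<in> Q \<times> Q. f x dvd n \<and> tame m n \<and> coprime m (f x)}"
  define R where "R = {r \<in> Q. coprime r (f x)}"
  define B where "B = {(N, M) \<in> Q \<times> Q. f x dvd N \<and> coprime M (f x)}"
  have cop: "coprime m (f x)" if "chi x m \<noteq> 0" for m using chi_0[OF x] that by blast
  have fx0: "f x > 0" using f[OF x] Q_pos by auto
  have Zs: "Z0 x abs_summable_on Q \<times> Q"
  proof (rule Infinite_Sum.abs_summable_on_comparison_test)
    show "(\<lambda>(n, m). nterm s1 n * nterm s2 m) abs_summable_on Q \<times> Q"
      by (intro abs_summable_times nterm_abs_summable s1 s2)
    show "norm (Z0 x y) \<le> norm (case y of (n, m) \<Rightarrow> nterm s1 n * nterm s2 m)" if "y \<in> Q \<times> Q" for y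
      using chi_le[OF x] by (auto simp: Z0_def tt_def norm_mult intro!: mult_left_le_one_le split: prod.splits)
  qed
  have bij: "bij_betw (\<lambda>((n, m), r). (r\<^sup>2 * n, r * m)) (T \<times> R) B"
    unfolding bij_betw_def
  proof
    have pos: "n > 0" "m > 0" "r > 0" if "((n, m), r) \<in> T \<times> R" for n m r
      using that Q_pos by (auto simp: T_def R_def)
    show "inj_on (\<lambda>((n, m), r). (r\<^sup>2 * n, r * m)) (T \<times> R)"
    proof (rule inj_onI)
      fix z z'
      assume zz: "z \<in> T \<times> R" "z' \<in> T \<times> R" "(\<lambda>((n, m), r). (r\<^sup>2 * n, r * m)) z = (\<lambda>((n, m), r). (r\<^sup>2 * n, r * m)) z'"
      obtain n m r n' m' r' where z: "z = ((n, m), r)" "z' = ((n', m'), r')" by (metis prod.exhaust)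
      have a: "(n, m) \<in> T" "r \<in> R" "(n', m') \<in> T" "r' \<in> R" and eq: "r\<^sup>2 * n = r'\<^sup>2 * n'" "r * m = r' * m'"
        using zz unfolding z by auto
      note p = pos[of n m r] pos[of n' m' r']
      have "r dvd r * m \<and> r\<^sup>2 dvd r\<^sup>2 * n \<and> tame (r * m div r) (r\<^sup>2 * n div r\<^sup>2)"
        using a p by (auto simp: T_def)
      moreover have "r' dvd r * m \<and> r'\<^sup>2 dvd r\<^sup>2 * n \<and> tame (r * m div r') (r\<^sup>2 * n div r'\<^sup>2)"
        unfolding eq using a p by (auto simp: T_def)
      moreover have "r * m > 0" "r\<^sup>2 * n > 0" using p a by auto
      ultimately have "r = r'" using tame_decompose_unique[of "r * m" "r\<^sup>2 * n"] by blast
      thus "z = z'" using eq a p unfolding z by auto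
    qed
    show "(\<lambda>((n, m), r). (r\<^sup>2 * n, r * m)) ` (T \<times> R) = B"
    proof (intro equalityI subsetI)
      fix z assume "z \<in> B"
      then obtain N M where z: "z = (N, M)" "N \<in> Q" "M \<in> Q" "f x dvd N" "coprime M (f x)" by (auto simp: B_def)
      obtain r where r: "r dvd M" "r\<^sup>2 dvd N" "tame (M div r) (N div r\<^sup>2)"
        using tame_decompose_unique[of M N] z Q_pos by blast
      obtain m n where mn: "M = r * m" "N = r\<^sup>2 * n" using r by (auto simp: dvd_def)
      have r0: "r > 0" using mn z Q_pos[OF z(3)] by auto
      have cop: "coprime r (f x)" "coprime m (f x)" using z(5) mn by auto
      hence "coprime (f x) (r\<^sup>2)" by (simp add: coprime_commute)
      hence "f x dvd n" using z(4) unfolding mn by (simp add: coprime_dvd_mult_right_iff)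
      hence "((n, m), r) \<in> T \<times> R" using r z mn r0 cop by (simp add: T_def R_def)
      thus "z \<in> (\<lambda>((n, m), r). (r\<^sup>2 * n, r * m)) ` (T \<times> R)" unfolding z(1) mn by force
    qed (auto simp: T_def R_def B_def)
  qed
  have "infsum (Z0 x) (Q \<times> Q) = infsum (Z0 x) T"
    by (intro infsum_cong_neutral) (auto simp: T_def Z0_def split: if_splits dest: cop)
  moreover have "sL P s3 (chi x) = infsum (\<lambda>r. chi x r * nterm s3 r) R"
    unfolding sL_def by (intro infsum_cong_neutral) (auto simp: R_def dest: cop)
  ultimately have "infsum (Z0 x) (Q \<times> Q) * sL P s3 (chi x) = infsum (Z0 x) T * infsum (\<lambda>r. chi x r * nterm s3 r) R" by simp
  also have "\<dots> = infsum (\<lambda>(y, r). Z0 x y * (chi x r * nterm s3 r)) (T \<times> R)"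
    by (rule infsum_times[symmetric]) (auto intro!: chi_abs_summable x s3 abs_summable_sub[OF Zs] simp: T_def)
  also have "\<dots> = infsum (\<lambda>z. (\<lambda>(N, M). chi x M * tt N M) ((\<lambda>((n, m), r). (r\<^sup>2 * n, r * m)) z)) (T \<times> R)"
  proof (rule infsum_cong)
    fix z assume "z \<in> T \<times> R"
    then obtain n m r where z: "z = ((n, m), r)" "(n, m) \<in> T" "r \<in> R" by auto
    have pos: "n > 0" "m > 0" "r > 0" using z Q_pos by (auto simp: T_def R_def)
    have "nterm s3 r = nterm s1 r * nterm s1 r * nterm s2 r"
      unfolding s3_def mult_2 nterm_add[OF pos(3)] ..
    hence "chi x (r * m) * tt (r\<^sup>2 * n) (r * m) = chi x m * tt n m * (chi x r * nterm s3 r)"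
      using pos x by (simp add: tt_def nterm_mult nterm_square chi_mult)
    thus "(case z of (y, r) \<Rightarrow> Z0 x y * (chi x r * nterm s3 r))
        = (\<lambda>(N, M). chi x M * tt N M) ((\<lambda>((n, m), r). (r\<^sup>2 * n, r * m)) z)"
      using z by (auto simp: Z0_def T_def)
  qed
  also have "\<dots> = infsum (\<lambda>(N, M). chi x M * tt N M) B" by (rule infsum_reindex_bij_betw[OF bij])
  also have "\<dots> = infsum (\<lambda>(N, M). (if f x dvd N then nterm s1 N else 0) * (chi x M * nterm s2 M)) (Q \<times> Q)"
    by (intro infsum_cong_neutral) (auto simp: B_def tt_def mult_ac split: if_splits dest: cop)
  also have "\<dots> = infsum (\<lambda>N. if f x dvd N then nterm s1 N else 0) Q * infsum (\<lambda>M. chi x M * nterm s2 M) Q"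
    by (rule infsum_times[OF _ chi_abs_summable[OF x s2]])
      (rule Infinite_Sum.abs_summable_on_comparison_test[OF nterm_abs_summable[OF s1]], simp)
  also have "infsum (\<lambda>N. if f x dvd N then nterm s1 N else 0) Q = infsum (nterm s1) {N \<in> Q. f x dvd N}"
    by (rule infsum_cong_neutral) auto
  also have "\<dots> = infsum (\<lambda>N. nterm s1 (f x * N)) Q"
  proof (rule infsum_reindex_bij_betw[symmetric])
    show "bij_betw ((*) (f x)) Q {N \<in> Q. f x dvd N}"
      by (rule bij_betwI[where g = "\<lambda>N. N div f x"]) (use fx0 f[OF x] in \<open>auto elim!: dvdE\<close>)
  qed
  also have "\<dots> = nterm s1 (f x) * infsum (nterm s1) Q" by (simp add: nterm_mult infsum_cmult_right')
  finally show ?thesis by (simp add: s3_def sL_def mult_ac)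
qed

theorem double_series:
  "W abs_summable_on E \<times> Q \<times> Q"
  "(\<lambda>x. sL P s2 (chi x) / (sL P (2 * s1 + s2) (chi x) * of_nat (f x) powr s1)) summable_on C"
  "infsum W (E \<times> Q \<times> Q) = c * (infsum (nterm s1) Q * infsum (nterm (2 * s1 + 2 * s2 - 1)) Q *
     infsum (\<lambda>x. sL P s2 (chi x) / (sL P (2 * s1 + s2) (chi x) * of_nat (f x) powr s1)) C)"
proof -
  show "W abs_summable_on E \<times> Q \<times> Q" by (rule W_sum)
  let ?z = "infsum (nterm s1) Q"
  \<comment> \<open>Nonvanishing lets the summability of \<open>?z * F x\<close> over the characters
    pass to \<open>F\<close>.\<close>
  have z: "?z \<noteq> 0"
  proof (rule euler_product(2)[OF P])
    show "norm (nterm s1 p) \<le> 1 / 2" if p: "prime p" for p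
    proof -
      have "norm (nterm s1 p) \<le> real p powr (- 1)"
        unfolding norm_nterm using s1 prime_ge_2_nat[OF p] by (intro powr_mono) auto
      also have "\<dots> \<le> 1 / 2" using prime_ge_2_nat[OF p] by (simp add: powr_minus field_simps)
      finally show ?thesis .
    qed
  qed (auto simp: nterm_mult nterm_abs_summable s1)
  define F where "F = (\<lambda>x. sL P s2 (chi x) / (sL P (2 * s1 + s2) (chi x) * of_nat (f x) powr s1))"
  have ZF: "infsum (Z0 x) (Q \<times> Q) = ?z * F x" if x: "x \<in> C" for x
  proof -
    have nz: "sL P (2 * s1 + s2) (chi x) \<noteq> 0" using s1 s2 by (intro chi_L_nonzero x) simp
    have "nterm s1 (f x) = 1 / of_nat (f x) powr s1" by (simp add: nterm_def powr_minus divide_inverse)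
    hence "infsum (Z0 x) (Q \<times> Q) = ?z * sL P s2 (chi x) * (1 / of_nat (f x) powr s1) / sL P (2 * s1 + s2) (chi x)"
      using Z0_eq[OF x] nz by (metis nonzero_mult_div_cancel_right)
    thus ?thesis by (simp add: F_def)
  qed
  have "(\<lambda>x. infsum (Z0 x) (Q \<times> Q)) summable_on C"
    by (rule summable_on_Sigma_banach[OF abs_summable_summable[OF Z0_summable]])
  hence "(\<lambda>x. ?z * F x) summable_on C" using ZF by (subst (asm) summable_on_cong) auto
  thus "F summable_on C" using z by (simp add: summable_on_cmult_right')
  have "infsum (\<lambda>x. infsum (Z0 x) (Q \<times> Q)) C = ?z * infsum F C"
    using ZF by (simp add: infsum_cmult_right' cong: infsum_cong)
  thus "infsum W (E \<times> Q \<times> Q) = c * (?z * infsum (nterm (2 * s1 + 2 * s2 - 1)) Q * infsum F C)"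
    unfolding W_sum(2) Y0_eq_Z0 by simp
qed

end

end

section \<open>The completions as valued fields\<close>

text \<open>The arguments here use only the properties of an absolute value on the rationals, so the
  real and the p-adic completions are handled together.\<close>

locale completion =
  fixes v :: place
  assumes place [simp]: "v \<in> places"
begin

abbreviation "K \<equiv> Qv v"

definition cau :: "(nat \<Rightarrow> rat) \<Rightarrow> bool" where
  "cau a \<longleftrightarrow> (\<forall>e>0. \<exists>N. \<forall>m\<ge>N. \<forall>n\<ge>N. rat_abs v (a m - a n) < e)"

lemma carrier_cauchy_ring: "carrier (cauchy_ring v) = Collect cau"
  by (auto simp: cauchy_ring_def cau_def)

lemma cauchy_ring_simps [simp]:
  "x \<oplus>\<^bsub>cauchy_ring v\<^esub> y = (\<lambda>n. x n + y n)"
  "x \<otimes>\<^bsub>cauchy_ring v\<^esub> y = (\<lambda>n. x n * y n)"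
  "\<zero>\<^bsub>cauchy_ring v\<^esub> = (\<lambda>_. 0)" "\<one>\<^bsub>cauchy_ring v\<^esub> = (\<lambda>_. 1)"
  by (simp_all add: cauchy_ring_def)

lemma cau_const [simp, intro]: "cau (\<lambda>_. q)"
  by (simp add: cau_def)

lemma cau_uminus: "cau a \<Longrightarrow> cau (\<lambda>n. - a n)"
  by (simp add: cau_def rat_abs_minus_commute)

lemma cau_add: assumes "cau a" "cau b" shows "cau (\<lambda>n. a n + b n)"
  unfolding cau_def
proof safe
  fix e :: real assume "e > 0"
  obtain N1 where N1: "\<And>m n. m \<ge> N1 \<Longrightarrow> n \<ge> N1 \<Longrightarrow> rat_abs v (a m - a n) < e / 2"
    using assms(1) \<open>e > 0\<close> unfolding cau_def by (meson half_gt_zero)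
  obtain N2 where N2: "\<And>m n. m \<ge> N2 \<Longrightarrow> n \<ge> N2 \<Longrightarrow> rat_abs v (b m - b n) < e / 2"
    using assms(2) \<open>e > 0\<close> unfolding cau_def by (meson half_gt_zero)
  show "\<exists>N. \<forall>m\<ge>N. \<forall>n\<ge>N. rat_abs v (a m + b m - (a n + b n)) < e"
  proof (intro exI[of _ "max N1 N2"] allI impI)
    fix m n assume "m \<ge> max N1 N2" "n \<ge> max N1 N2"
    hence "rat_abs v (a m - a n) < e / 2" "rat_abs v (b m - b n) < e / 2"
      using N1 N2 by auto
    moreover have "rat_abs v ((a m - a n) + (b m - b n)) \<le> rat_abs v (a m - a n) + rat_abs v (b m - b n)"
      by (rule rat_abs_triangle) simp
    ultimately show "rat_abs v (a m + b m - (a n + b n)) < e" by (simp add: algebra_simps)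
  qed
qed

lemma cau_diff: "cau a \<Longrightarrow> cau b \<Longrightarrow> cau (\<lambda>n. a n - b n)"
  using cau_add[of a "\<lambda>n. - b n"] cau_uminus[of b] by simp

lemma cau_abs_Cauchy: assumes "cau a" shows "Cauchy (\<lambda>n. rat_abs v (a n))"
  unfolding Cauchy_def dist_real_def
  using assms rat_abs_diff_abs[OF place] unfolding cau_def by (meson le_less_trans)

lemma cau_abs_convergent: "cau a \<Longrightarrow> convergent (\<lambda>n. rat_abs v (a n))"
  using cau_abs_Cauchy real_Cauchy_convergent by blast

lemma cau_bounded: assumes "cau a" obtains B where "B > 0" "\<And>n. rat_abs v (a n) \<le> B"
proof -
  have "Bseq (\<lambda>n. rat_abs v (a n))" using cau_abs_convergent[OF assms] by (rule convergent_imp_Bseq)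
  then obtain B where "B > 0" "\<forall>n. norm (rat_abs v (a n)) \<le> B" by (auto simp: Bseq_def)
  thus ?thesis using that by auto
qed

lemma cau_mult: assumes "cau a" "cau b" shows "cau (\<lambda>n. a n * b n)"
  unfolding cau_def
proof safe
  fix e :: real assume "e > 0"
  obtain A where A: "A > 0" "\<And>n. rat_abs v (a n) \<le> A" using cau_bounded[OF assms(1)] by blast
  obtain B where B: "B > 0" "\<And>n. rat_abs v (b n) \<le> B" using cau_bounded[OF assms(2)] by blast
  have "e / (2 * B) > 0" "e / (2 * A) > 0" using \<open>e > 0\<close> A B by auto
  then obtain N1 N2 where N1: "\<And>m n. m \<ge> N1 \<Longrightarrow> n \<ge> N1 \<Longrightarrow> rat_abs v (a m - a n) < e / (2 * B)"
    and N2: "\<And>m n. m \<ge> N2 \<Longrightarrow> n \<ge> N2 \<Longrightarrow> rat_abs v (b m - b n) < e / (2 * A)"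
    using assms unfolding cau_def by meson
  show "\<exists>N. \<forall>m\<ge>N. \<forall>n\<ge>N. rat_abs v (a m * b m - a n * b n) < e"
  proof (intro exI[of _ "max N1 N2"] allI impI)
    fix m n assume mn: "m \<ge> max N1 N2" "n \<ge> max N1 N2"
    have "a m * b m - a n * b n = (a m - a n) * b m + a n * (b m - b n)" by (simp add: algebra_simps)
    hence "rat_abs v (a m * b m - a n * b n)
        \<le> rat_abs v (a m - a n) * rat_abs v (b m) + rat_abs v (a n) * rat_abs v (b m - b n)"
      using rat_abs_triangle[OF place] by (metis rat_abs_mult[OF place])
    also have "\<dots> \<le> rat_abs v (a m - a n) * B + A * rat_abs v (b m - b n)"
      using A B by (intro add_mono mult_mono) auto
    also have "\<dots> < e / (2 * B) * B + A * (e / (2 * A))"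
      using A B N1[of m n] N2[of m n] mn by (intro add_strict_mono mult_strict_left_mono mult_strict_right_mono) auto
    also have "\<dots> = e" using A B by (simp add: field_simps)
    finally show "rat_abs v (a m * b m - a n * b n) < e" .
  qed
qed

lemma null_iff: "a \<in> null_seqs v \<longleftrightarrow> (\<lambda>n. rat_abs v (a n)) \<longlonglongrightarrow> 0"
  by (simp add: null_seqs_def)

lemma null_add: assumes "a \<in> null_seqs v" "b \<in> null_seqs v" shows "(\<lambda>n. a n + b n) \<in> null_seqs v"
proof -
  have "(\<lambda>n. rat_abs v (a n) + rat_abs v (b n)) \<longlonglongrightarrow> 0"
    using assms tendsto_add[of _ 0 sequentially _ 0] by (simp add: null_iff)
  thus ?thesis unfolding null_iff
    by (rule Lim_null_comparison[rotated]) (auto intro!: always_eventually rat_abs_triangle)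
qed

lemma null_uminus: "a \<in> null_seqs v \<Longrightarrow> (\<lambda>n. - a n) \<in> null_seqs v"
  by (simp add: null_iff)

lemma null_diff: "a \<in> null_seqs v \<Longrightarrow> b \<in> null_seqs v \<Longrightarrow> (\<lambda>n. a n - b n) \<in> null_seqs v"
  using null_add[of a "\<lambda>n. - b n"] null_uminus by simp

lemma null_mult: assumes "a \<in> null_seqs v" "cau b" shows "(\<lambda>n. a n * b n) \<in> null_seqs v"
proof -
  obtain B where B: "B > 0" "\<And>n. rat_abs v (b n) \<le> B" using cau_bounded[OF assms(2)] by blast
  have "(\<lambda>n. rat_abs v (a n) * B) \<longlonglongrightarrow> 0"
    using assms(1) tendsto_mult_right[of _ 0 sequentially B] by (simp add: null_iff)
  thus ?thesis unfolding null_iff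
    by (rule Lim_null_comparison[rotated])
      (auto intro!: always_eventually mult_left_mono B simp: rat_abs_mult)
qed

lemma null_imp_cau: assumes "a \<in> null_seqs v" shows "cau a"
  unfolding cau_def
proof safe
  fix e :: real assume "e > 0"
  hence "eventually (\<lambda>n. rat_abs v (a n) < e / 2) sequentially"
    using assms unfolding null_iff by (intro order_tendstoD(2)[of _ 0]) auto
  then obtain N where N: "\<And>n. n \<ge> N \<Longrightarrow> rat_abs v (a n) < e / 2"
    by (auto simp: eventually_sequentially)
  have "rat_abs v (a m - a n) < e" if "m \<ge> N" "n \<ge> N" for m n
    using N[OF that(1)] N[OF that(2)] rat_abs_triangle[OF place, of "a m" "- a n"] by simp
  thus "\<exists>N. \<forall>m\<ge>N. \<forall>n\<ge>N. rat_abs v (a m - a n) < e" by blast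
qed

lemma cring_cauchy_ring: "cring (cauchy_ring v)"
proof (intro cringI abelian_groupI comm_monoidI)
  fix x assume "x \<in> carrier (cauchy_ring v)"
  thus "\<exists>y\<in>carrier (cauchy_ring v). y \<oplus>\<^bsub>cauchy_ring v\<^esub> x = \<zero>\<^bsub>cauchy_ring v\<^esub>"
    by (intro bexI[of _ "\<lambda>n. - x n"]) (auto simp: carrier_cauchy_ring cau_uminus)
qed (auto simp: carrier_cauchy_ring cau_add cau_mult algebra_simps)

sublocale R: cring "cauchy_ring v"
  by (rule cring_cauchy_ring)

lemma cauchy_a_inv: "cau a \<Longrightarrow> \<ominus>\<^bsub>cauchy_ring v\<^esub> a = (\<lambda>n. - a n)"
  by (rule R.minus_equality) (auto simp: carrier_cauchy_ring cau_uminus)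

lemma null_ideal: "ideal (null_seqs v) (cauchy_ring v)"
proof (rule idealI)
  show "subgroup (null_seqs v) (add_monoid (cauchy_ring v))"
  proof (rule group.subgroupI)
    show "group (add_monoid (cauchy_ring v))" by (rule R.a_group)
    have "(\<lambda>_. 0) \<in> null_seqs v" by (simp add: null_iff)
    thus "null_seqs v \<noteq> {}" by blast
    fix a assume "a \<in> null_seqs v"
    thus "inv\<^bsub>add_monoid (cauchy_ring v)\<^esub> a \<in> null_seqs v"
      using cauchy_a_inv[of a] null_imp_cau null_uminus by (simp add: a_inv_def)
  qed (auto simp: carrier_cauchy_ring null_imp_cau null_add)
next
  fix a x assume "a \<in> null_seqs v" "x \<in> carrier (cauchy_ring v)"
  thus "x \<otimes>\<^bsub>cauchy_ring v\<^esub> a \<in> null_seqs v" "a \<otimes>\<^bsub>cauchy_ring v\<^esub> x \<in> null_seqs v"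
    using null_mult[of a x] by (auto simp: carrier_cauchy_ring mult.commute)
qed (rule R.ring_axioms)

sublocale K: cring "Qv v"
  unfolding Qv_def by (rule ideal.quotient_is_cring[OF null_ideal]) (rule cring_cauchy_ring)

definition cls :: "(nat \<Rightarrow> rat) \<Rightarrow> (nat \<Rightarrow> rat) set" where
  "cls a = null_seqs v +>\<^bsub>cauchy_ring v\<^esub> a"

lemma cls_def': "cls a = {b. (\<lambda>n. b n - a n) \<in> null_seqs v}"
proof -
  have "cls a = {b. \<exists>h\<in>null_seqs v. b = (\<lambda>n. h n + a n)}"
    unfolding cls_def a_r_coset_def' cauchy_ring_simps by blast
  also have "\<dots> = {b. (\<lambda>n. b n - a n) \<in> null_seqs v}"
  proof (intro Collect_cong iffI)
    fix b assume "(\<lambda>n. b n - a n) \<in> null_seqs v"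
    thus "\<exists>h\<in>null_seqs v. b = (\<lambda>n. h n + a n)" by (intro bexI[of _ "\<lambda>n. b n - a n"]) auto
  qed auto
  finally show ?thesis .
qed

lemma cls_refl: "a \<in> cls a"
  by (simp add: cls_def' null_iff)

lemma cls_eq_iff: "cls a = cls b \<longleftrightarrow> (\<lambda>n. a n - b n) \<in> null_seqs v"
proof
  assume "cls a = cls b"
  thus "(\<lambda>n. a n - b n) \<in> null_seqs v" using cls_refl[of a] by (simp add: cls_def')
next
  assume *: "(\<lambda>n. a n - b n) \<in> null_seqs v"
  have "(\<lambda>n. c n - b n) \<in> null_seqs v \<longleftrightarrow> (\<lambda>n. c n - a n) \<in> null_seqs v" for c
    using null_add[of "\<lambda>n. c n - a n", OF _ *] null_diff[of "\<lambda>n. c n - b n", OF _ *] by auto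
  thus "cls a = cls b" unfolding cls_def' by blast
qed

lemma K_carrier: "carrier K = {cls a | a. cau a}"
  by (auto simp: Qv_def FactRing_def A_RCOSETS_def' cls_def carrier_cauchy_ring)

lemma K_cases: assumes "x \<in> carrier K" obtains a where "cau a" "x = cls a"
  using assms by (auto simp: K_carrier)

lemma cls_closed [simp, intro]: "cau a \<Longrightarrow> cls a \<in> carrier K"
  by (auto simp: K_carrier)

lemma K_add: "cau a \<Longrightarrow> cau b \<Longrightarrow> cls a \<oplus>\<^bsub>K\<^esub> cls b = cls (\<lambda>n. a n + b n)"
  using ideal.a_rcos_sum[OF null_ideal, of a b] by (simp add: Qv_def FactRing_def cls_def carrier_cauchy_ring)

lemma K_mult: "cau a \<Longrightarrow> cau b \<Longrightarrow> cls a \<otimes>\<^bsub>K\<^esub> cls b = cls (\<lambda>n. a n * b n)"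
  using ideal.rcoset_mult_add[OF null_ideal, of a b] by (simp add: Qv_def FactRing_def cls_def carrier_cauchy_ring)

lemma K_one: "\<one>\<^bsub>K\<^esub> = cls (\<lambda>_. 1)"
  by (simp add: Qv_def FactRing_def cls_def)

lemma K_zero: "\<zero>\<^bsub>K\<^esub> = cls (\<lambda>_. 0)"
  by (simp add: Qv_def FactRing_def cls_def')

lemma K_uminus: "cau a \<Longrightarrow> \<ominus>\<^bsub>K\<^esub> cls a = cls (\<lambda>n. - a n)"
  by (rule K.minus_equality) (auto simp: cau_uminus K_add K_zero)

lemma K_minus: "cau a \<Longrightarrow> cau b \<Longrightarrow> cls a \<ominus>\<^bsub>K\<^esub> cls b = cls (\<lambda>n. a n - b n)"
  by (simp add: a_minus_def K_uminus K_add cau_uminus)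

text \<open>Representatives of one class differ by a null sequence, so their absolute values have
  the same limit and the description in \<open>Qv_abs\<close> is well defined.\<close>

lemma Qv_abs_unique: assumes "cau a" "(\<lambda>n. rat_abs v (a n)) \<longlonglongrightarrow> r" shows "Qv_abs v (cls a) = r"
proof -
  have *: "(\<lambda>n. rat_abs v (b n)) \<longlonglongrightarrow> r" if "b \<in> cls a" for b
  proof -
    have "(\<lambda>n. rat_abs v (b n - a n)) \<longlonglongrightarrow> 0" using that by (simp add: cls_def' null_iff)
    hence "(\<lambda>n. rat_abs v (b n) - rat_abs v (a n)) \<longlonglongrightarrow> 0"
      by (rule Lim_null_comparison[rotated]) (auto intro!: always_eventually rat_abs_diff_abs)
    from tendsto_add[OF this assms(2)] show ?thesis by simp
  qed
  show ?thesis unfolding Qv_abs_def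
    by (rule the_equality) (use * cls_refl LIMSEQ_unique assms in blast)+
qed

lemma Qv_abs_tendsto: assumes "cau a" shows "(\<lambda>n. rat_abs v (a n)) \<longlonglongrightarrow> Qv_abs v (cls a)"
  using cau_abs_convergent[OF assms] Qv_abs_unique[OF assms] by (auto simp: convergent_def)

lemma emb_cls: "emb v q = cls (\<lambda>_. q)"
  by (simp add: emb_def cls_def)

lemma emb_closed [simp, intro]: "emb v q \<in> carrier K"
  by (simp add: emb_cls)

lemma emb_add: "emb v (q + r) = emb v q \<oplus>\<^bsub>K\<^esub> emb v r"
  and emb_mult: "emb v (q * r) = emb v q \<otimes>\<^bsub>K\<^esub> emb v r"
  and emb_diff: "emb v (q - r) = emb v q \<ominus>\<^bsub>K\<^esub> emb v r"
  and emb_0 [simp]: "emb v 0 = \<zero>\<^bsub>K\<^esub>"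
  and emb_1 [simp]: "emb v 1 = \<one>\<^bsub>K\<^esub>"
  by (simp_all add: emb_cls K_add K_mult K_minus K_one K_zero)

lemma Qv_abs_emb [simp]: "Qv_abs v (emb v q) = rat_abs v q"
  by (simp add: emb_cls Qv_abs_unique)

lemma Qv_abs_nonneg [simp]: assumes "x \<in> carrier K" shows "Qv_abs v x \<ge> 0"
proof -
  obtain a where "cau a" "x = cls a" using K_cases[OF assms] .
  thus ?thesis using Qv_abs_tendsto[of a] LIMSEQ_le_const[of _ "Qv_abs v x" 0] by auto
qed

lemma Qv_abs_mult:
  assumes "x \<in> carrier K" "y \<in> carrier K"
  shows "Qv_abs v (x \<otimes>\<^bsub>K\<^esub> y) = Qv_abs v x * Qv_abs v y"
proof -
  obtain a where a: "cau a" "x = cls a" using K_cases[OF assms(1)] .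
  obtain b where b: "cau b" "y = cls b" using K_cases[OF assms(2)] .
  show ?thesis unfolding a b K_mult[OF a(1) b(1)]
    using a b tendsto_mult[OF Qv_abs_tendsto[of a] Qv_abs_tendsto[of b]]
    by (intro Qv_abs_unique cau_mult) (auto simp: rat_abs_mult)
qed

lemma Qv_abs_eq_0_iff: assumes "x \<in> carrier K" shows "Qv_abs v x = 0 \<longleftrightarrow> x = \<zero>\<^bsub>K\<^esub>"
proof -
  obtain a where a: "cau a" "x = cls a" using K_cases[OF assms] .
  have "x = \<zero>\<^bsub>K\<^esub> \<longleftrightarrow> (\<lambda>n. rat_abs v (a n)) \<longlonglongrightarrow> 0"
    by (simp add: a K_zero cls_eq_iff null_iff)
  also have "\<dots> \<longleftrightarrow> Qv_abs v x = 0"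
    using a Qv_abs_tendsto[of a] LIMSEQ_unique by auto
  finally show ?thesis by simp
qed

lemma Qv_abs_add:
  assumes "x \<in> carrier K" "y \<in> carrier K"
  shows "Qv_abs v (x \<oplus>\<^bsub>K\<^esub> y) \<le> Qv_abs v x + Qv_abs v y"
proof -
  obtain a where a: "cau a" "x = cls a" using K_cases[OF assms(1)] .
  obtain b where b: "cau b" "y = cls b" using K_cases[OF assms(2)] .
  show ?thesis unfolding a b K_add[OF a(1) b(1)]
    by (rule LIMSEQ_le[OF Qv_abs_tendsto[OF cau_add[OF a(1) b(1)]]
          tendsto_add[OF Qv_abs_tendsto[OF a(1)] Qv_abs_tendsto[OF b(1)]]])
      (auto intro!: rat_abs_triangle exI[of _ 0])
qed

lemma Qv_abs_uminus: assumes "x \<in> carrier K" shows "Qv_abs v (\<ominus>\<^bsub>K\<^esub> x) = Qv_abs v x"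
proof -
  obtain a where a: "cau a" "x = cls a" using K_cases[OF assms] .
  show ?thesis unfolding a K_uminus[OF a(1)] using Qv_abs_tendsto[OF a(1)]
    by (intro Qv_abs_unique cau_uminus a) simp
qed

lemma Qv_abs_minus_commute:
  assumes "x \<in> carrier K" "y \<in> carrier K"
  shows "Qv_abs v (x \<ominus>\<^bsub>K\<^esub> y) = Qv_abs v (y \<ominus>\<^bsub>K\<^esub> x)"
proof -
  have "x \<ominus>\<^bsub>K\<^esub> y = \<ominus>\<^bsub>K\<^esub> (y \<ominus>\<^bsub>K\<^esub> x)"
    using assms by (simp add: a_minus_def K.minus_add K.add.m_comm)
  thus ?thesis using assms by (simp add: Qv_abs_uminus)
qed

lemma Qv_abs_zero [simp]: "Qv_abs v \<zero>\<^bsub>K\<^esub> = 0"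
  using Qv_abs_eq_0_iff by auto

lemma Qv_abs_one [simp]: "Qv_abs v \<one>\<^bsub>K\<^esub> = 1"
  using Qv_abs_emb[of 1] by simp

lemma dense: assumes "x \<in> carrier K" "e > 0" obtains q where "Qv_abs v (x \<ominus>\<^bsub>K\<^esub> emb v q) < e"
proof -
  obtain a where a: "cau a" "x = cls a" using K_cases[OF assms(1)] .
  have "e / 2 > 0" using assms by simp
  then obtain N where N: "\<And>m n. m \<ge> N \<Longrightarrow> n \<ge> N \<Longrightarrow> rat_abs v (a m - a n) < e / 2"
    using a unfolding cau_def by meson
  have "x \<ominus>\<^bsub>K\<^esub> emb v (a N) = cls (\<lambda>n. a n - a N)" by (simp add: a emb_cls K_minus)
  moreover have "Qv_abs v (cls (\<lambda>n. a n - a N)) \<le> e / 2"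
    by (rule LIMSEQ_le_const2[OF Qv_abs_tendsto])
      (use a N in \<open>auto intro!: cau_diff exI[of _ N] less_imp_le\<close>)
  ultimately have "Qv_abs v (x \<ominus>\<^bsub>K\<^esub> emb v (a N)) < e" using assms(2) by simp
  thus ?thesis by (rule that)
qed

text \<open>A nonzero class stays away from 0 from some index on, by at least half its absolute
  value; termwise inverses of such a sequence are again Cauchy.\<close>

lemma K_inverse_ex: assumes "x \<in> carrier K" "x \<noteq> \<zero>\<^bsub>K\<^esub>" shows "\<exists>y\<in>carrier K. x \<otimes>\<^bsub>K\<^esub> y = \<one>\<^bsub>K\<^esub>"
proof -
  obtain a where a: "cau a" "x = cls a" using K_cases[OF assms(1)] .
  define c where "c = Qv_abs v x / 2"
  have "Qv_abs v x > 0" using assms Qv_abs_nonneg[of x] Qv_abs_eq_0_iff[of x] by linarith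
  hence c: "c > 0" "c < Qv_abs v x" by (auto simp: c_def)
  have ev: "eventually (\<lambda>n. rat_abs v (a n) > c) sequentially"
    using Qv_abs_tendsto[OF a(1)] c a by (auto dest: order_tendstoD)
  then obtain N where N: "\<And>n. n \<ge> N \<Longrightarrow> rat_abs v (a n) > c" by (auto simp: eventually_sequentially)
  \<comment> \<open>Initial terms that vanish are inverted to 0. They affect finitely many terms,
    which a null sequence absorbs.\<close>
  define b where "b = (\<lambda>n. inverse (a n))"
  have b: "cau b" unfolding cau_def
  proof safe
    fix e :: real assume "e > 0"
    hence "e * c\<^sup>2 > 0" using c by simp
    then obtain M where M: "\<And>m n. m \<ge> M \<Longrightarrow> n \<ge> M \<Longrightarrow> rat_abs v (a m - a n) < e * c\<^sup>2"
      using a(1) unfolding cau_def by meson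
    have "rat_abs v (b m - b n) < e" if "m \<ge> max M N" "n \<ge> max M N" for m n
    proof -
      have gt: "rat_abs v (a m) > c" "rat_abs v (a n) > c" using N that by auto
      hence nz: "a m \<noteq> 0" "a n \<noteq> 0" using c by auto
      have "(b m - b n) * (a m * a n) = a n - a m" using nz by (simp add: b_def field_simps)
      hence "rat_abs v (b m - b n) * (rat_abs v (a m) * rat_abs v (a n)) = rat_abs v (a m - a n)"
        by (metis rat_abs_mult[OF place] rat_abs_minus_commute)
      also have "\<dots> < e * c\<^sup>2" using M that by auto
      also have "\<dots> \<le> e * (rat_abs v (a m) * rat_abs v (a n))"
        unfolding power2_eq_square using gt c \<open>e > 0\<close> by (intro mult_left_mono mult_mono) auto
      finally show ?thesis using gt c by (subst (asm) mult_less_cancel_right_pos) auto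
    qed
    thus "\<exists>N. \<forall>m\<ge>N. \<forall>n\<ge>N. rat_abs v (b m - b n) < e" by blast
  qed
  have "(\<lambda>n. a n * b n - 1) \<in> null_seqs v"
    unfolding null_iff
  proof (rule tendsto_eventually, rule eventually_mono[OF ev])
    fix n assume "rat_abs v (a n) > c"
    hence "a n \<noteq> 0" using c by auto
    thus "rat_abs v (a n * b n - 1) = 0" by (simp add: b_def)
  qed
  hence "x \<otimes>\<^bsub>K\<^esub> cls b = \<one>\<^bsub>K\<^esub>" by (simp add: a b K_mult K_one cls_eq_iff)
  thus ?thesis using b by blast
qed

lemma K_one_not_zero: "\<one>\<^bsub>K\<^esub> \<noteq> \<zero>\<^bsub>K\<^esub>"
  using Qv_abs_one Qv_abs_zero by (metis zero_neq_one)

sublocale K: field "Qv v"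
  by (rule K.cring_fieldI2) (use K_one_not_zero K_inverse_ex in auto)

lemma K_Units: "Units K = carrier K - {\<zero>\<^bsub>K\<^esub>}"
  by (rule K.field_Units)

lemma unit_closed [simp]: "x \<in> Units K \<Longrightarrow> x \<in> carrier K"
  by auto

lemma unit_abs_pos: "x \<in> Units K \<Longrightarrow> Qv_abs v x > 0"
  using Qv_abs_nonneg[of x] Qv_abs_eq_0_iff[of x] by (fastforce simp: K_Units)

lemma unit_iff_abs: "x \<in> Units K \<longleftrightarrow> x \<in> carrier K \<and> Qv_abs v x > 0"
  using unit_abs_pos by (auto simp: K_Units)

lemma emb_eq_0_iff: "emb v q = \<zero>\<^bsub>K\<^esub> \<longleftrightarrow> q = 0"
  using Qv_abs_eq_0_iff[of "emb v q"] by simp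

lemma emb_eq_iff: "emb v q = emb v r \<longleftrightarrow> q = r"
  by (simp add: emb_cls cls_eq_iff null_iff tendsto_const_iff)

lemma emb_unit_iff [simp]: "emb v q \<in> Units K \<longleftrightarrow> q \<noteq> 0"
  by (simp add: K_Units emb_eq_0_iff)

lemma Qv_abs_inv: assumes "x \<in> Units K" shows "Qv_abs v (inv\<^bsub>K\<^esub> x) = inverse (Qv_abs v x)"
proof -
  have "Qv_abs v (x \<otimes>\<^bsub>K\<^esub> inv\<^bsub>K\<^esub> x) = Qv_abs v x * Qv_abs v (inv\<^bsub>K\<^esub> x)"
    using assms by (intro Qv_abs_mult) auto
  thus ?thesis using assms unit_abs_pos[OF assms] by (auto simp: field_simps)
qed

end

context completion
begin

lemma minus_split:
  assumes "x \<in> carrier K" "y \<in> carrier K" "z \<in> carrier K"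
  shows "x \<ominus>\<^bsub>K\<^esub> z = (x \<ominus>\<^bsub>K\<^esub> y) \<oplus>\<^bsub>K\<^esub> (y \<ominus>\<^bsub>K\<^esub> z)"
proof -
  obtain a where a: "cau a" "x = cls a" using K_cases[OF assms(1)] .
  obtain b where b: "cau b" "y = cls b" using K_cases[OF assms(2)] .
  obtain c where c: "cau c" "z = cls c" using K_cases[OF assms(3)] .
  show ?thesis using a b c by (simp add: K_minus K_add cau_diff)
qed

lemma minus_minus_cancel:
  assumes "x \<in> carrier K" "y \<in> carrier K"
  shows "x \<ominus>\<^bsub>K\<^esub> (x \<ominus>\<^bsub>K\<^esub> y) = y" "y \<oplus>\<^bsub>K\<^esub> (x \<ominus>\<^bsub>K\<^esub> y) = x"
proof -
  obtain a where a: "cau a" "x = cls a" using K_cases[OF assms(1)] .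
  obtain b where b: "cau b" "y = cls b" using K_cases[OF assms(2)] .
  show "x \<ominus>\<^bsub>K\<^esub> (x \<ominus>\<^bsub>K\<^esub> y) = y" "y \<oplus>\<^bsub>K\<^esub> (x \<ominus>\<^bsub>K\<^esub> y) = x"
    using a b by (simp_all add: K_minus K_add cau_diff)
qed

text \<open>Identifies an element with the class of a Cauchy sequence of rationals converging to it.
  A square root built from successive approximations is recognised in this way.\<close>

lemma cls_eqI_tendsto:
  assumes x: "x \<in> carrier K" and r: "cau r" and lim: "(\<lambda>n. Qv_abs v (x \<ominus>\<^bsub>K\<^esub> emb v (r n))) \<longlonglongrightarrow> 0"
  shows "x = cls r"
proof -
  have le: "Qv_abs v (x \<ominus>\<^bsub>K\<^esub> cls r) \<le> e" if "e > 0" for e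
  proof -
    have "e / 2 > 0" using that by simp
    then obtain N where N: "\<And>m n. m \<ge> N \<Longrightarrow> n \<ge> N \<Longrightarrow> rat_abs v (r m - r n) < e / 2"
      using r unfolding cau_def by meson
    have "eventually (\<lambda>n. Qv_abs v (x \<ominus>\<^bsub>K\<^esub> emb v (r n)) < e / 2) sequentially"
      using order_tendstoD(2)[OF lim \<open>e / 2 > 0\<close>] .
    then obtain M where M: "\<And>n. n \<ge> M \<Longrightarrow> Qv_abs v (x \<ominus>\<^bsub>K\<^esub> emb v (r n)) < e / 2"
      by (auto simp: eventually_sequentially)
    define n where "n = max M N"
    have "emb v (r n) \<ominus>\<^bsub>K\<^esub> cls r = cls (\<lambda>m. r n - r m)" using r by (simp add: emb_cls K_minus)
    moreover have "Qv_abs v (cls (\<lambda>m. r n - r m)) \<le> e / 2"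
      by (rule LIMSEQ_le_const2[OF Qv_abs_tendsto])
        (use r N in \<open>auto intro!: cau_diff exI[of _ N] less_imp_le simp: n_def\<close>)
    ultimately have "Qv_abs v (emb v (r n) \<ominus>\<^bsub>K\<^esub> cls r) \<le> e / 2" by simp
    moreover have "x \<ominus>\<^bsub>K\<^esub> cls r = (x \<ominus>\<^bsub>K\<^esub> emb v (r n)) \<oplus>\<^bsub>K\<^esub> (emb v (r n) \<ominus>\<^bsub>K\<^esub> cls r)"
      using x r by (intro minus_split) auto
    hence "Qv_abs v (x \<ominus>\<^bsub>K\<^esub> cls r) \<le> Qv_abs v (x \<ominus>\<^bsub>K\<^esub> emb v (r n)) + Qv_abs v (emb v (r n) \<ominus>\<^bsub>K\<^esub> cls r)"
      using x r by (simp add: Qv_abs_add)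
    ultimately show ?thesis using M[of n] by (simp add: n_def)
  qed
  have "Qv_abs v (x \<ominus>\<^bsub>K\<^esub> cls r) \<le> 0" by (rule field_le_epsilon) (use le in auto)
  hence "x \<ominus>\<^bsub>K\<^esub> cls r = \<zero>\<^bsub>K\<^esub>"
    using x r Qv_abs_nonneg[of "x \<ominus>\<^bsub>K\<^esub> cls r"] Qv_abs_eq_0_iff[of "x \<ominus>\<^bsub>K\<^esub> cls r"]
      antisym[of "Qv_abs v (x \<ominus>\<^bsub>K\<^esub> cls r)" 0] by simp
  thus ?thesis using x r by simp
qed

definition is_square :: "(nat \<Rightarrow> rat) set \<Rightarrow> bool" where
  "is_square x \<longleftrightarrow> (\<exists>y\<in>Units K. x = y \<otimes>\<^bsub>K\<^esub> y)"

lemma unit_cancel: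
  assumes "x \<in> carrier K" "y \<in> Units K" shows "y \<otimes>\<^bsub>K\<^esub> (inv\<^bsub>K\<^esub> y \<otimes>\<^bsub>K\<^esub> x) = x" "inv\<^bsub>K\<^esub> y \<otimes>\<^bsub>K\<^esub> (y \<otimes>\<^bsub>K\<^esub> x) = x"
  using assms by (simp_all flip: K.m_assoc)

lemma Qv_abs_quotient_minus_one:
  assumes "x \<in> carrier K" "y \<in> Units K"
  shows "Qv_abs v (x \<otimes>\<^bsub>K\<^esub> inv\<^bsub>K\<^esub> y \<ominus>\<^bsub>K\<^esub> \<one>\<^bsub>K\<^esub>) = Qv_abs v (x \<ominus>\<^bsub>K\<^esub> y) / Qv_abs v y"
proof -
  have "x \<otimes>\<^bsub>K\<^esub> inv\<^bsub>K\<^esub> y \<ominus>\<^bsub>K\<^esub> \<one>\<^bsub>K\<^esub> = (x \<ominus>\<^bsub>K\<^esub> y) \<otimes>\<^bsub>K\<^esub> inv\<^bsub>K\<^esub> y"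
    using assms by (simp add: a_minus_def K.l_distr K.l_minus)
  thus ?thesis using assms by (simp add: Qv_abs_mult Qv_abs_inv divide_inverse)
qed

end

section \<open>The p-adic fields and their unit groups\<close>

lemma powi_le_iff: "1 < (x :: real) \<Longrightarrow> x powi m \<le> x powi n \<longleftrightarrow> m \<le> n"
  using power_int_increasing[of m n x] power_int_strict_increasing[of n m x] by force

locale padic =
  fixes p :: nat
  assumes prime_p: "prime p"
begin

sublocale completion "FinPlace p"
  by unfold_locales (simp add: prime_p)

abbreviation nrm :: "(nat \<Rightarrow> rat) set \<Rightarrow> real" where "nrm x \<equiv> Qv_abs (FinPlace p) x"

lemma p_not_unit: "\<not> int p dvd 1"
  using prime_p by auto

lemma p_gt_1: "real p > 1" "p > 0" "p > 1"
  using prime_p prime_gt_1_nat prime_gt_0_nat by auto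

lemma nrm_ultra:
  assumes "x \<in> carrier K" "y \<in> carrier K"
  shows "nrm (x \<oplus>\<^bsub>K\<^esub> y) \<le> max (nrm x) (nrm y)"
proof -
  obtain a where a: "cau a" "x = cls a" using K_cases[OF assms(1)] .
  obtain b where b: "cau b" "y = cls b" using K_cases[OF assms(2)] .
  show ?thesis unfolding a b K_add[OF a(1) b(1)]
    by (rule LIMSEQ_le[OF Qv_abs_tendsto[OF cau_add[OF a(1) b(1)]]
          tendsto_max[OF Qv_abs_tendsto[OF a(1)] Qv_abs_tendsto[OF b(1)]]])
      (intro exI[of _ 0] allI impI rat_abs_ultra prime_p)
qed

lemma nrm_ultra_minus:
  assumes "x \<in> carrier K" "y \<in> carrier K"
  shows "nrm (x \<ominus>\<^bsub>K\<^esub> y) \<le> max (nrm x) (nrm y)"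
  using nrm_ultra[of x "\<ominus>\<^bsub>K\<^esub> y"] assms by (simp add: a_minus_def Qv_abs_uminus)

lemma nrm_ultra_trans:
  assumes "x \<in> carrier K" "y \<in> carrier K" "z \<in> carrier K" "nrm (x \<ominus>\<^bsub>K\<^esub> y) \<le> e" "nrm (y \<ominus>\<^bsub>K\<^esub> z) \<le> e"
  shows "nrm (x \<ominus>\<^bsub>K\<^esub> z) \<le> e"
proof -
  have "x \<ominus>\<^bsub>K\<^esub> z = (x \<ominus>\<^bsub>K\<^esub> y) \<oplus>\<^bsub>K\<^esub> (y \<ominus>\<^bsub>K\<^esub> z)"
    using assms by (intro minus_split)
  thus ?thesis using nrm_ultra[of "x \<ominus>\<^bsub>K\<^esub> y" "y \<ominus>\<^bsub>K\<^esub> z"] assms by simp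
qed

lemma nrm_eq_of_close:
  assumes "x \<in> carrier K" "y \<in> carrier K" "nrm (x \<ominus>\<^bsub>K\<^esub> y) < nrm x"
  shows "nrm y = nrm x"
proof -
  have "y = x \<ominus>\<^bsub>K\<^esub> (x \<ominus>\<^bsub>K\<^esub> y)" "x = y \<oplus>\<^bsub>K\<^esub> (x \<ominus>\<^bsub>K\<^esub> y)"
    using assms by (simp_all add: minus_minus_cancel)
  hence "nrm y \<le> max (nrm x) (nrm (x \<ominus>\<^bsub>K\<^esub> y))" "nrm x \<le> max (nrm y) (nrm (x \<ominus>\<^bsub>K\<^esub> y))"
    using nrm_ultra_minus[of x "x \<ominus>\<^bsub>K\<^esub> y"] nrm_ultra[of y "x \<ominus>\<^bsub>K\<^esub> y"] assms by auto
  thus ?thesis using assms(3) by auto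
qed

lemma rat_abs_nonzero: "q \<noteq> 0 \<Longrightarrow> rat_abs (FinPlace p) q = real p powi (- vp p q)"
  by (simp only: rat_abs_fin if_False)

lemma rat_abs_le_iff: "q \<noteq> 0 \<Longrightarrow> rat_abs (FinPlace p) q \<le> 1 / real p ^ k \<longleftrightarrow> int k \<le> vp p q"
proof -
  have "1 / real p ^ k = real p powi (- int k)" by (simp add: power_int_minus field_simps)
  thus "q \<noteq> 0 \<Longrightarrow> ?thesis" unfolding rat_abs_nonzero
    using powi_le_iff[OF p_gt_1(1), of "- vp p q" "- int k"] by simp
qed

lemma rat_abs_int_le_iff: "rat_abs (FinPlace p) (of_int a) \<le> 1 / real p ^ k \<longleftrightarrow> int p ^ k dvd a"
proof (cases "a = 0")
  case False
  thus ?thesis using prime_p p_not_unit power_dvd_iff_le_multiplicity[OF False p_not_unit, of k]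
    by (simp add: rat_abs_le_iff vp_of_int del: rat_abs.simps)
qed (simp del: rat_abs.simps)

lemma rat_abs_le_1_iff: "q \<noteq> 0 \<Longrightarrow> rat_abs (FinPlace p) q \<le> 1 \<longleftrightarrow> vp p q \<ge> 0"
  using rat_abs_le_iff[of q 0] by simp

lemma rat_abs_eq_1_iff: "q \<noteq> 0 \<Longrightarrow> rat_abs (FinPlace p) q = 1 \<longleftrightarrow> vp p q = 0"
  unfolding rat_abs_nonzero
  using powi_le_iff[OF p_gt_1(1), of "- vp p q" 0] powi_le_iff[OF p_gt_1(1), of 0 "- vp p q"]
  unfolding power_int_0_right by linarith

lemma rat_abs_int_le_1: "rat_abs (FinPlace p) (of_int a) \<le> 1"
  using rat_abs_int_le_iff[of a 0] by simp

lemma rat_abs_int_eq_1_iff: "rat_abs (FinPlace p) (of_int a) = 1 \<longleftrightarrow> \<not> int p dvd a"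
proof (cases "a = 0")
  case False
  have "rat_abs (FinPlace p) (of_int a) = 1 \<longleftrightarrow> multiplicity (int p) a = 0"
    using False prime_p by (subst rat_abs_eq_1_iff) (auto simp: vp_of_int)
  also have "\<dots> \<longleftrightarrow> \<not> int p dvd a"
    using multiplicity_eq_zero_iff[OF False p_not_unit] .
  finally show ?thesis .
qed (simp del: rat_abs.simps)

text \<open>The value group is discrete: a rational closer to \<open>x\<close> than the size of
  \<open>x\<close> has the same absolute value, and that is a power of \<open>p\<close>.\<close>

lemma unit_value: assumes "x \<in> Units K" obtains k where "nrm x = real p powi k"
proof -
  obtain q where q: "nrm (x \<ominus>\<^bsub>K\<^esub> emb (FinPlace p) q) < nrm x"
    using dense[of x "nrm x"] assms unit_abs_pos[OF assms] by auto
  have "rat_abs (FinPlace p) q = nrm x" using nrm_eq_of_close[OF _ _ q] assms by simp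
  moreover have "q \<noteq> 0" using calculation unit_abs_pos[OF assms] by auto
  ultimately show ?thesis using that by (metis rat_abs_nonzero)
qed

lemma Zp_simps:
  "carrier (Zp p) = {x \<in> carrier K. nrm x \<le> 1}"
  "x \<otimes>\<^bsub>Zp p\<^esub> y = x \<otimes>\<^bsub>K\<^esub> y" "\<one>\<^bsub>Zp p\<^esub> = \<one>\<^bsub>K\<^esub>"
  by (simp_all add: Zp_def)

lemma Zp_Units: "Units (Zp p) = {x \<in> carrier K. nrm x = 1}"
proof (intro equalityI subsetI)
  fix x assume "x \<in> Units (Zp p)"
  then obtain y where xy: "x \<in> carrier K" "nrm x \<le> 1" "y \<in> carrier K" "nrm y \<le> 1" "x \<otimes>\<^bsub>K\<^esub> y = \<one>\<^bsub>K\<^esub>"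
    unfolding Units_def Zp_simps by blast
  have "nrm x * nrm y = 1" using Qv_abs_mult[of x y] xy by simp
  moreover have "nrm x * nrm y \<le> nrm x * 1" using xy by (intro mult_left_mono) auto
  ultimately have "nrm x = 1" using xy(2) by linarith
  thus "x \<in> {x \<in> carrier K. nrm x = 1}" using xy by simp
next
  fix x assume x: "x \<in> {x \<in> carrier K. nrm x = 1}"
  hence u: "x \<in> Units K" by (simp add: unit_iff_abs)
  have "nrm (inv\<^bsub>K\<^esub> x) = 1" using Qv_abs_inv[OF u] x by simp
  thus "x \<in> Units (Zp p)" using u x
    unfolding Units_def[of "Zp p"] Zp_simps by (auto intro!: bexI[of _ "inv\<^bsub>K\<^esub> x"])
qed

lemma Zp_Units_subset: "Units (Zp p) \<subseteq> Units K"
  by (auto simp: Zp_Units unit_iff_abs)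

text \<open>A rational close to an integral element has a denominator prime to \<open>p\<close>;
  replacing this denominator by an inverse of it modulo p^k gives an integer that is just as
  close.\<close>

lemma int_approx:
  assumes x: "x \<in> carrier K" "nrm x \<le> 1"
  obtains a :: int where "nrm (x \<ominus>\<^bsub>K\<^esub> emb (FinPlace p) (of_int a)) \<le> 1 / real p ^ k"
proof -
  have pk: "1 / real p ^ k > 0" "1 / real p ^ k \<le> 1" using p_gt_1 by auto
  obtain q where q: "nrm (x \<ominus>\<^bsub>K\<^esub> emb (FinPlace p) q) < 1 / real p ^ k" using dense[OF x(1) pk(1)] .
  have "emb (FinPlace p) q = x \<ominus>\<^bsub>K\<^esub> (x \<ominus>\<^bsub>K\<^esub> emb (FinPlace p) q)"
    using x by (simp add: minus_minus_cancel)
  hence "nrm (emb (FinPlace p) q) \<le> max (nrm x) (nrm (x \<ominus>\<^bsub>K\<^esub> emb (FinPlace p) q))"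
    using nrm_ultra_minus[of x "x \<ominus>\<^bsub>K\<^esub> emb (FinPlace p) q"] x by simp
  hence q1: "rat_abs (FinPlace p) q \<le> 1" using x q pk unfolding Qv_abs_emb by linarith
  obtain a b where ab: "q = of_int a / of_int b" "b > 0" "coprime a b" by (rule rat_frac_cases[of q])
  have nb: "\<not> int p dvd b"
  proof
    assume pb: "int p dvd b"
    hence "\<not> int p dvd a" using ab(3) prime_p by (meson coprime_common_divisor not_prime_unit prime_nat_int_transfer)
    hence "a \<noteq> 0" "multiplicity (int p) a = 0" by (auto intro: not_dvd_imp_multiplicity_0)
    moreover have "multiplicity (int p) b > 0" using pb ab multiplicity_eq_zero_iff[OF _ p_not_unit, of b] by auto
    ultimately have "vp p q < 0" using vp_frac[of p a b] ab prime_p by simp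
    thus False using q1 rat_abs_le_1_iff[of q] ab \<open>a \<noteq> 0\<close> by auto
  qed
  hence "coprime (int p) b" using prime_p by (intro prime_imp_coprime) auto
  hence "coprime b (int p ^ k)" by (simp add: coprime_commute)
  then obtain c where "[b * c = 1] (mod int p ^ k)" using cong_solve_coprime_int by blast
  hence dv: "int p ^ k dvd b * c - 1" by (simp add: cong_iff_dvd_diff)
  have "q - of_int (a * c) = - (of_int a * of_int (b * c - 1)) / of_int b"
    using ab by (simp add: field_simps)
  hence "rat_abs (FinPlace p) (q - of_int (a * c)) * rat_abs (FinPlace p) (of_int b)
      = rat_abs (FinPlace p) (of_int a) * rat_abs (FinPlace p) (of_int (b * c - 1))"
    using ab by (metis (no_types, opaque_lifting) rat_abs_mult[OF place] less_irrefl nonzero_eq_divide_eq of_int_eq_0_iff rat_abs_uminus)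
  moreover have "rat_abs (FinPlace p) (of_int b) = 1" using nb by (simp only: rat_abs_int_eq_1_iff not_False_eq_True)
  moreover have "rat_abs (FinPlace p) (of_int a) * rat_abs (FinPlace p) (of_int (b * c - 1)) \<le> 1 * (1 / real p ^ k)"
    using dv rat_abs_int_le_1 rat_abs_int_le_iff by (intro mult_mono) (auto simp del: rat_abs.simps of_int_diff of_int_mult)
  ultimately have "rat_abs (FinPlace p) (q - of_int (a * c)) \<le> 1 / real p ^ k" by simp
  hence "nrm (emb (FinPlace p) q \<ominus>\<^bsub>K\<^esub> emb (FinPlace p) (of_int (a * c))) \<le> 1 / real p ^ k"
    by (simp only: Qv_abs_emb flip: emb_diff)
  hence "nrm (x \<ominus>\<^bsub>K\<^esub> emb (FinPlace p) (of_int (a * c))) \<le> 1 / real p ^ k"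
    by (intro nrm_ultra_trans[OF x(1) _ _ less_imp_le[OF q]]) auto
  thus ?thesis using that by blast
qed

end

text \<open>The hypothesis \<open>2 = p\<^sup>e * u\<close> lets one statement cover \<open>p = 2\<close> (\<open>e = 1\<close>) and odd \<open>p\<close> (\<open>e = 0\<close>).\<close>
lemma hensel_square:
  fixes a p u :: int
  assumes p: "prime p" and two: "2 = p ^ e * u" "\<not> p dvd u" and a: "p ^ (2 * e + 1) dvd a - 1"
  shows "\<exists>c. p ^ (n + 2 * e + 1) dvd c\<^sup>2 - a \<and> p ^ (e + 1) dvd c - 1"
proof (induction n)
  case 0
  show ?case using a by (intro exI[of _ 1]) (auto simp: dvd_diff_commute)
next
  case (Suc n)
  then obtain c where c: "p ^ (n + 2 * e + 1) dvd c\<^sup>2 - a" "p ^ (e + 1) dvd c - 1" by blast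
  then obtain m where m: "c\<^sup>2 - a = p ^ (n + 2 * e + 1) * m" by (auto simp: dvd_def)
  have "p dvd c - 1" using c(2) by (meson dvd_trans dvd_power zero_less_one add_gr_0 Suc_eq_plus1 zero_less_Suc)
  hence "\<not> p dvd c" using p not_prime_unit dvd_diff_right_iff[of p c 1] by (metis dvd_diff_commute dvd_diff_left_iff)
  hence "coprime p (u * c)" using two p by (intro prime_imp_coprime) (auto simp: prime_dvd_mult_iff)
  hence "coprime (u * c) p" by (simp add: coprime_commute)
  then obtain w where "[u * c * w = 1] (mod p)" using cong_solve_coprime_int by blast
  hence w: "p dvd u * c * w - 1" by (simp add: cong_iff_dvd_diff)
  \<comment> \<open>Newton step c + t P with P = p^(n + e + 1). Since 2 = p^e u, the linear term is
    P p^e u c t, and t is chosen so that m + u c t is divisible by p. The quadratic term is harmless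
    because 2(n + e + 1) is at least the required exponent n + 2 e + 2.\<close>
  define t where "t = - m * w"
  define P where "P = p ^ (n + e + 1)"
  have e: "p ^ (n + 2 * e + 1) = P * p ^ e"
    unfolding P_def power_add[symmetric] by (rule arg_cong[where f = "power p"]) simp
  have "(c + t * P)\<^sup>2 - a = P * p ^ e * m + 2 * c * t * P + t\<^sup>2 * P\<^sup>2"
    using m unfolding e by (simp add: power2_eq_square algebra_simps)
  also have "2 * c * t * P = P * p ^ e * (u * c * t)" unfolding two(1) by (simp add: algebra_simps)
  also have "P * p ^ e * m + P * p ^ e * (u * c * t) = - (P * p ^ e * m * (u * c * w - 1))"
    by (simp add: t_def algebra_simps)
  finally have eq: "(c + t * P)\<^sup>2 - a = - (P * p ^ e * m * (u * c * w - 1)) + t\<^sup>2 * P\<^sup>2" .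
  have "P * p ^ e * p dvd P * p ^ e * m * (u * c * w - 1)"
    using w by (metis dvd_triv_left mult_dvd_mono dvd_refl mult.assoc)
  moreover have "P * p ^ e * p dvd P\<^sup>2"
  proof -
    have "P * p ^ e * p = p ^ (n + e + 1 + e + 1)" unfolding P_def power_add by simp
    moreover have "P\<^sup>2 = p ^ ((n + e + 1) * 2)" unfolding P_def power_mult ..
    ultimately show ?thesis by (simp only:) (rule le_imp_power_dvd, simp)
  qed
  ultimately have "P * p ^ e * p dvd (c + t * P)\<^sup>2 - a" unfolding eq by simp
  moreover have "p ^ (Suc n + 2 * e + 1) = P * p ^ e * p" unfolding e[symmetric] by (simp flip: power_Suc2)
  moreover have "p ^ (e + 1) dvd P" by (simp add: P_def le_imp_power_dvd)
  hence "p ^ (e + 1) dvd (c - 1) + t * P" using c(2) by (intro dvd_add dvd_mult)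
  hence "p ^ (e + 1) dvd c + t * P - 1" by (simp add: algebra_simps)
  ultimately show ?case by metis
qed

context padic
begin

lemma two_split: obtains e u where "2 = int p ^ e * u" "\<not> int p dvd u" "e = (if p = 2 then 1 else 0)"
proof (cases "p = 2")
  case False
  hence "\<not> int p dvd 2" using prime_p by (metis int_dvd_int_iff of_nat_numeral primes_dvd_imp_eq two_is_prime_nat)
  thus ?thesis using that[of 0 2] False by auto
qed (use that[of 1 1] in auto)

text \<open>The exponents 3 and 1 are 2 e + 1 in Hensel's lemma. The integer roots
  \<open>c n\<close> of better and better approximations are chosen independently of each other;
  being congruent to 1 modulo p^(e + 1), they nevertheless all approximate the same root, so they
  form a Cauchy sequence whose limit is the square root.\<close>

lemma square_of_close_to_one:
  assumes x: "x \<in> carrier K" and close: "nrm (x \<ominus>\<^bsub>K\<^esub> \<one>\<^bsub>K\<^esub>) \<le> 1 / real p ^ (if p = 2 then 3 else 1)"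
  shows "is_square x"
proof -
  obtain e u where e: "2 = int p ^ e * u" "\<not> int p dvd u" "e = (if p = 2 then 1 else 0)" by (rule two_split)
  have close': "nrm (x \<ominus>\<^bsub>K\<^esub> \<one>\<^bsub>K\<^esub>) \<le> 1 / real p ^ (2 * e + 1)" using close e(3) by (auto split: if_splits)
  have pk1: "1 / real p ^ (k + 1) < 1" for k using p_gt_1(1) by (simp add: one_less_power del: power_Suc)
  have "nrm (\<one>\<^bsub>K\<^esub> \<ominus>\<^bsub>K\<^esub> x) < nrm \<one>\<^bsub>K\<^esub>"
    using le_less_trans[OF close' pk1] x Qv_abs_minus_commute[of x "\<one>\<^bsub>K\<^esub>"] by simp
  hence nx: "nrm x = 1" using nrm_eq_of_close[of "\<one>\<^bsub>K\<^esub>" x] x by simp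
  have "\<exists>c::int. nrm (x \<ominus>\<^bsub>K\<^esub> emb (FinPlace p) (of_int (c\<^sup>2))) \<le> 1 / real p ^ n \<and> int p ^ (e + 1) dvd c - 1" for n
  proof -
    let ?N = "n + 2 * e + 1"
    obtain a where a: "nrm (x \<ominus>\<^bsub>K\<^esub> emb (FinPlace p) (of_int a)) \<le> 1 / real p ^ ?N"
      using int_approx[of x ?N] x nx by auto
    have mono: "1 / real p ^ ?N \<le> 1 / real p ^ (2 * e + 1)" "1 / real p ^ ?N \<le> 1 / real p ^ n"
      using p_gt_1 by (auto intro!: divide_left_mono power_increasing simp del: power_Suc)
    have "nrm (emb (FinPlace p) (of_int a) \<ominus>\<^bsub>K\<^esub> emb (FinPlace p) 1) \<le> 1 / real p ^ (2 * e + 1)"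
    proof (rule nrm_ultra_trans[OF _ x])
      show "nrm (emb (FinPlace p) (of_int a) \<ominus>\<^bsub>K\<^esub> x) \<le> 1 / real p ^ (2 * e + 1)"
        using a mono(1) Qv_abs_minus_commute[OF x emb_closed[of "of_int a"]] by linarith
      show "nrm (x \<ominus>\<^bsub>K\<^esub> emb (FinPlace p) 1) \<le> 1 / real p ^ (2 * e + 1)"
        using close' unfolding emb_1 .
    qed auto
    hence "rat_abs (FinPlace p) (of_int (a - 1)) \<le> 1 / real p ^ (2 * e + 1)"
      unfolding emb_diff[symmetric] Qv_abs_emb by simp
    hence "int p ^ (2 * e + 1) dvd a - 1" by (simp only: rat_abs_int_le_iff)
    then obtain c where c: "int p ^ ?N dvd c\<^sup>2 - a" "int p ^ (e + 1) dvd c - 1"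
      using hensel_square[OF _ e(1,2), of a n] prime_p by (metis prime_nat_int_transfer)
    have "rat_abs (FinPlace p) (of_int a - of_int (c\<^sup>2)) \<le> 1 / real p ^ ?N"
      using c(1) rat_abs_int_le_iff[of "a - c\<^sup>2" ?N] by (simp add: dvd_diff_commute del: rat_abs.simps)
    hence "nrm (emb (FinPlace p) (of_int a) \<ominus>\<^bsub>K\<^esub> emb (FinPlace p) (of_int (c\<^sup>2))) \<le> 1 / real p ^ ?N"
      unfolding emb_diff[symmetric] Qv_abs_emb .
    hence "nrm (x \<ominus>\<^bsub>K\<^esub> emb (FinPlace p) (of_int (c\<^sup>2))) \<le> 1 / real p ^ ?N"
      by (intro nrm_ultra_trans[OF x _ _ a]) auto
    thus ?thesis using c(2) mono by (intro exI[of _ c]) auto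
  qed
  then obtain c :: "nat \<Rightarrow> int" where
    c: "\<And>n. nrm (x \<ominus>\<^bsub>K\<^esub> emb (FinPlace p) (of_int ((c n)\<^sup>2))) \<le> 1 / real p ^ n" "\<And>n. int p ^ (e + 1) dvd c n - 1"
    by metis
  \<comment> \<open>Excludes that \<open>c m\<close> and \<open>c n\<close> approximate opposite
    roots. The sum has absolute value exactly p^(-e), so a small difference of squares forces a
    small difference.\<close>
  have abs_sum: "rat_abs (FinPlace p) (of_int (c m + c n)) = 1 / real p ^ e" for m n
  proof -
    have "int p ^ (e + 1) dvd (c m - 1) + (c n - 1)" using c(2) by (intro dvd_add)
    then obtain k where k: "c m + c n = 2 + int p ^ (e + 1) * k" by (auto simp: dvd_def algebra_simps)
    have "c m + c n = int p ^ e * (u + int p * k)" unfolding k e(1) by (simp add: algebra_simps)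
    hence "rat_abs (FinPlace p) (of_int (c m + c n)) =
        rat_abs (FinPlace p) (of_int (int p ^ e)) * rat_abs (FinPlace p) (of_int (u + int p * k))"
      by (simp only: of_int_mult rat_abs_mult[OF place])
    also have "\<not> int p dvd u + int p * k" using e(2) by (simp add: dvd_add_left_iff)
    hence "rat_abs (FinPlace p) (of_int (u + int p * k)) = 1" by (simp only: rat_abs_int_eq_1_iff not_False_eq_True)
    also have "rat_abs (FinPlace p) (of_int (int p ^ e)) = 1 / real p ^ e"
    proof -
      have "vp p (of_nat p ^ e) = int e" using prime_p p_gt_1 by (simp add: vp_power vp_prime)
      thus ?thesis using p_gt_1
        by (simp add: rat_abs_nonzero power_int_minus field_simps del: rat_abs.simps)
    qed
    finally show ?thesis by simp
  qed
  have diff: "rat_abs (FinPlace p) (of_int (c m) - of_int (c n)) \<le> real p ^ e / real p ^ n" if "n \<le> m" for m n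
  proof -
    have mono: "1 / real p ^ m \<le> 1 / real p ^ n"
      using p_gt_1 that by (auto intro!: divide_left_mono power_increasing)
    have "nrm (emb (FinPlace p) (of_int ((c m)\<^sup>2)) \<ominus>\<^bsub>K\<^esub> emb (FinPlace p) (of_int ((c n)\<^sup>2))) \<le> 1 / real p ^ n"
    proof (rule nrm_ultra_trans[OF _ x])
      show "nrm (emb (FinPlace p) (of_int ((c m)\<^sup>2)) \<ominus>\<^bsub>K\<^esub> x) \<le> 1 / real p ^ n"
        using c(1)[of m] mono Qv_abs_minus_commute[OF x emb_closed[of "of_int ((c m)\<^sup>2)"]] by linarith
    qed (use c(1)[of n] in auto)
    hence "rat_abs (FinPlace p) (of_int ((c m)\<^sup>2) - of_int ((c n)\<^sup>2)) \<le> 1 / real p ^ n"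
      unfolding emb_diff[symmetric] Qv_abs_emb .
    also have "(of_int ((c m)\<^sup>2) - of_int ((c n)\<^sup>2) :: rat) = (of_int (c m) - of_int (c n)) * of_int (c m + c n)"
      by (simp add: power2_eq_square algebra_simps)
    finally have "rat_abs (FinPlace p) (of_int (c m) - of_int (c n)) * (1 / real p ^ e) \<le> 1 / real p ^ n"
      by (simp only: rat_abs_mult[OF place] abs_sum)
    thus ?thesis using p_gt_1 by (simp add: field_simps del: rat_abs.simps)
  qed
  have tend0: "(\<lambda>n. C / real p ^ n) \<longlonglongrightarrow> 0" for C
    using p_gt_1 by (intro LIMSEQ_divide_realpow_zero) auto
  have cauc: "cau (\<lambda>n. of_int (c n))"
    unfolding cau_def
  proof safe
    fix \<epsilon> :: real assume "\<epsilon> > 0"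
    then obtain N where N: "\<And>n. n \<ge> N \<Longrightarrow> real p ^ e / real p ^ n < \<epsilon>"
      using order_tendstoD(2)[OF tend0[of "real p ^ e"]] by (auto simp: eventually_sequentially)
    have "rat_abs (FinPlace p) (of_int (c m) - of_int (c n)) < \<epsilon>" if "m \<ge> N" "n \<ge> N" for m n
      using diff[of n m] diff[of m n] N[OF that(1)] N[OF that(2)]
        rat_abs_minus_commute[of "FinPlace p" "of_int (c m)" "of_int (c n)"]
      by (cases "n \<le> m") (auto simp del: rat_abs.simps)
    thus "\<exists>N. \<forall>m\<ge>N. \<forall>n\<ge>N. rat_abs (FinPlace p) (of_int (c m) - of_int (c n)) < \<epsilon>" by blast
  qed
  define y where "y = cls (\<lambda>n. of_int (c n))"
  have y: "y \<in> carrier K" using cauc by (simp add: y_def)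
  have "y \<otimes>\<^bsub>K\<^esub> y = cls (\<lambda>n. of_int ((c n)\<^sup>2))"
    using cauc by (simp add: y_def K_mult power2_eq_square)
  also have "\<dots> = x"
  proof (rule cls_eqI_tendsto[symmetric, OF x])
    show "cau (\<lambda>n. of_int ((c n)\<^sup>2))" using cau_mult[OF cauc cauc] by (simp add: power2_eq_square)
    show "(\<lambda>n. nrm (x \<ominus>\<^bsub>K\<^esub> emb (FinPlace p) (of_int ((c n)\<^sup>2)))) \<longlonglongrightarrow> 0"
      using tend0[of 1] by (rule Lim_null_comparison[rotated]) (use c(1) x in \<open>auto intro!: always_eventually simp del: of_int_power\<close>)
  qed
  finally have yy: "x = y \<otimes>\<^bsub>K\<^esub> y" by simp
  moreover have "y \<in> Units K" using y yy nx by (auto simp: K_Units)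
  ultimately show ?thesis unfolding is_square_def by blast
qed

end

section \<open>Square classes\<close>

locale real_place
begin

sublocale inf: completion InfPlace
  by unfold_locales simp

lemma Qinf_tendsto:
  assumes a: "inf.cau a" shows "(\<lambda>n. real_of_rat (a n)) \<longlonglongrightarrow> Qinf_to_real (inf.cls a)"
proof -
  have "Cauchy (\<lambda>n. real_of_rat (a n))"
    using a unfolding inf.cau_def Cauchy_def dist_real_def by (simp flip: of_rat_diff)
  then obtain r where r: "(\<lambda>n. real_of_rat (a n)) \<longlonglongrightarrow> r"
    using real_Cauchy_convergent convergent_def by blast
  have *: "(\<lambda>n. real_of_rat (b n)) \<longlonglongrightarrow> r" if "b \<in> inf.cls a" for b
  proof -
    have "(\<lambda>n. \<bar>real_of_rat (b n - a n)\<bar>) \<longlonglongrightarrow> 0"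
      using that by (simp add: inf.cls_def' inf.null_iff)
    hence "(\<lambda>n. real_of_rat (b n) - real_of_rat (a n)) \<longlonglongrightarrow> 0"
      by (simp add: tendsto_rabs_zero_iff of_rat_diff)
    from tendsto_add[OF this r] show ?thesis by simp
  qed
  have "Qinf_to_real (inf.cls a) = r" unfolding Qinf_to_real_def
    by (rule the_equality) (use * inf.cls_refl LIMSEQ_unique r in blast)+
  thus ?thesis using r by simp
qed

lemma Qinf_eqI:
  assumes "inf.cau a" "(\<lambda>n. real_of_rat (a n)) \<longlonglongrightarrow> r" shows "Qinf_to_real (inf.cls a) = r"
  using Qinf_tendsto[OF assms(1)] assms(2) LIMSEQ_unique by blast

lemma Qinf_emb [simp]: "Qinf_to_real (emb InfPlace q) = of_rat q"
  unfolding inf.emb_cls by (rule Qinf_eqI) auto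

lemma Qinf_one [simp]: "Qinf_to_real \<one>\<^bsub>Qv InfPlace\<^esub> = 1"
  using Qinf_emb[of 1] by simp

lemma Qinf_mult:
  assumes "x \<in> carrier (Qv InfPlace)" "y \<in> carrier (Qv InfPlace)"
  shows "Qinf_to_real (x \<otimes>\<^bsub>Qv InfPlace\<^esub> y) = Qinf_to_real x * Qinf_to_real y"
proof -
  obtain a where a: "inf.cau a" "x = inf.cls a" using inf.K_cases[OF assms(1)] .
  obtain b where b: "inf.cau b" "y = inf.cls b" using inf.K_cases[OF assms(2)] .
  show ?thesis unfolding a b inf.K_mult[OF a(1) b(1)]
    using tendsto_mult[OF Qinf_tendsto[OF a(1)] Qinf_tendsto[OF b(1)]]
    by (intro Qinf_eqI inf.cau_mult a b) (simp add: of_rat_mult)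
qed

lemma Qinf_minus:
  assumes "x \<in> carrier (Qv InfPlace)" "y \<in> carrier (Qv InfPlace)"
  shows "Qinf_to_real (x \<ominus>\<^bsub>Qv InfPlace\<^esub> y) = Qinf_to_real x - Qinf_to_real y"
proof -
  obtain a where a: "inf.cau a" "x = inf.cls a" using inf.K_cases[OF assms(1)] .
  obtain b where b: "inf.cau b" "y = inf.cls b" using inf.K_cases[OF assms(2)] .
  show ?thesis unfolding a b inf.K_minus[OF a(1) b(1)]
    using tendsto_diff[OF Qinf_tendsto[OF a(1)] Qinf_tendsto[OF b(1)]]
    by (intro Qinf_eqI inf.cau_diff a b) (simp add: of_rat_diff)
qed

lemma Qinf_abs: assumes "x \<in> carrier (Qv InfPlace)" shows "Qv_abs InfPlace x = \<bar>Qinf_to_real x\<bar>"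
proof -
  obtain a where a: "inf.cau a" "x = inf.cls a" using inf.K_cases[OF assms(1)] .
  show ?thesis unfolding a using tendsto_rabs[OF Qinf_tendsto[OF a(1)]]
    by (intro inf.Qv_abs_unique a) simp
qed

lemma inf_unit_nonzero: "x \<in> Units (Qv InfPlace) \<Longrightarrow> Qinf_to_real x \<noteq> 0"
  using inf.unit_abs_pos[of x] Qinf_abs[of x] by auto

text \<open>Rationals approximating the real square root form a Cauchy sequence; the square of its
  class has the same real value as \<open>x\<close>, so the difference has absolute value 0.\<close>

lemma inf_square:
  assumes x: "x \<in> Units (Qv InfPlace)" and pos: "Qinf_to_real x > 0"
  shows "inf.is_square x"
proof -
  have "\<exists>q. \<bar>sqrt (Qinf_to_real x) - real_of_rat q\<bar> < 1 / real (Suc n)" for n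
  proof -
    obtain q where "sqrt (Qinf_to_real x) - 1 / real (Suc n) < real_of_rat q" "real_of_rat q < sqrt (Qinf_to_real x)"
      using of_rat_dense[of "sqrt (Qinf_to_real x) - 1 / real (Suc n)" "sqrt (Qinf_to_real x)"] by auto
    thus ?thesis by (intro exI[of _ q]) auto
  qed
  then obtain c where c: "\<And>n. \<bar>sqrt (Qinf_to_real x) - real_of_rat (c n)\<bar> < 1 / real (Suc n)" by metis
  have "(\<lambda>n. real_of_rat (c n) - sqrt (Qinf_to_real x)) \<longlonglongrightarrow> 0"
    by (rule Lim_null_comparison[OF _ LIMSEQ_inverse_real_of_nat])
      (use c in \<open>auto intro!: always_eventually less_imp_le simp: abs_minus_commute inverse_eq_divide\<close>)
  hence lim: "(\<lambda>n. real_of_rat (c n)) \<longlonglongrightarrow> sqrt (Qinf_to_real x)" using Lim_null by blast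
  hence "Cauchy (\<lambda>n. real_of_rat (c n))" by (rule LIMSEQ_imp_Cauchy)
  hence cauc: "inf.cau c" unfolding inf.cau_def Cauchy_def dist_real_def by (simp flip: of_rat_diff)
  define y where "y = inf.cls c"
  have y: "y \<in> carrier (Qv InfPlace)" using cauc by (simp add: y_def)
  have "Qinf_to_real (y \<otimes>\<^bsub>Qv InfPlace\<^esub> y) = Qinf_to_real x"
    using y pos Qinf_eqI[OF cauc lim] by (simp add: Qinf_mult y_def)
  hence "Qv_abs InfPlace (x \<ominus>\<^bsub>Qv InfPlace\<^esub> y \<otimes>\<^bsub>Qv InfPlace\<^esub> y) = 0"
    using x y by (simp add: Qinf_abs Qinf_minus)
  hence yy: "x = y \<otimes>\<^bsub>Qv InfPlace\<^esub> y" using x y by (simp add: inf.Qv_abs_eq_0_iff)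
  moreover have "y \<in> Units (Qv InfPlace)" using y yy x by (auto simp: inf.K_Units)
  ultimately show ?thesis unfolding inf.is_square_def by blast
qed

end

context completion
begin

lemma is_square_one: "is_square \<one>\<^bsub>K\<^esub>"
  unfolding is_square_def by (rule bexI[of _ "\<one>\<^bsub>K\<^esub>"]) auto

text \<open>A set of rational numbers representing each class of units modulo squares exactly once.
  Taking representatives in the rationals lets the count be organised place by place.\<close>

definition square_reps :: "rat set \<Rightarrow> bool" where
  "square_reps R \<longleftrightarrow> finite R \<and> 0 \<notin> R \<and>
     (\<forall>x\<in>Units K. \<exists>!r. r \<in> R \<and> (\<exists>y\<in>Units K. x = emb v r \<otimes>\<^bsub>K\<^esub> (y \<otimes>\<^bsub>K\<^esub> y)))"

end

context real_place
begin

lemma inf_square_reps: "inf.square_reps {1, -1}"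
  unfolding inf.square_reps_def
proof (intro conjI ballI ex_ex1I)
  fix x assume x: "x \<in> Units (Qv InfPlace)"
  let ?s = "if Qinf_to_real x > 0 then 1 else -1 :: rat"
  have "Qinf_to_real (emb InfPlace ?s \<otimes>\<^bsub>Qv InfPlace\<^esub> x) > 0"
    using x inf_unit_nonzero[OF x] by (auto simp: Qinf_mult)
  hence "inf.is_square (emb InfPlace ?s \<otimes>\<^bsub>Qv InfPlace\<^esub> x)"
    using x by (intro inf_square) auto
  then obtain y where y: "y \<in> Units (Qv InfPlace)" "emb InfPlace ?s \<otimes>\<^bsub>Qv InfPlace\<^esub> x = y \<otimes>\<^bsub>Qv InfPlace\<^esub> y"
    unfolding inf.is_square_def by blast
  have "emb InfPlace ?s \<otimes>\<^bsub>Qv InfPlace\<^esub> (emb InfPlace ?s \<otimes>\<^bsub>Qv InfPlace\<^esub> x)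
      = emb InfPlace (?s * ?s) \<otimes>\<^bsub>Qv InfPlace\<^esub> x"
    using x by (simp only: inf.emb_mult) (simp add: inf.K.m_assoc)
  also have "\<dots> = x" using x by simp
  finally have "x = emb InfPlace ?s \<otimes>\<^bsub>Qv InfPlace\<^esub> (y \<otimes>\<^bsub>Qv InfPlace\<^esub> y)" using y by simp
  thus "\<exists>r. r \<in> {1, -1} \<and> (\<exists>y\<in>Units (Qv InfPlace). x = emb InfPlace r \<otimes>\<^bsub>Qv InfPlace\<^esub> (y \<otimes>\<^bsub>Qv InfPlace\<^esub> y))"
    using y(1) by (intro exI[of _ ?s] conjI bexI[of _ y]) (auto split: if_splits)
next
  fix x r r' assume x: "x \<in> Units (Qv InfPlace)"
  have sgn: "sgn (Qinf_to_real x) = sgn (of_rat r)"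
    if r: "r \<in> {1, -1} \<and> (\<exists>y\<in>Units (Qv InfPlace). x = emb InfPlace r \<otimes>\<^bsub>Qv InfPlace\<^esub> (y \<otimes>\<^bsub>Qv InfPlace\<^esub> y))" for r
  proof -
    obtain y where y: "y \<in> Units (Qv InfPlace)" "x = emb InfPlace r \<otimes>\<^bsub>Qv InfPlace\<^esub> (y \<otimes>\<^bsub>Qv InfPlace\<^esub> y)"
      using r by blast
    have yc: "y \<in> carrier (Qv InfPlace)" using y(1) by auto
    have "Qinf_to_real x = of_rat r * (Qinf_to_real y * Qinf_to_real y)"
      unfolding y(2) using yc by (simp only: Qinf_mult inf.emb_closed inf.K.m_closed Qinf_emb)
    moreover have "Qinf_to_real y * Qinf_to_real y > 0"
      using inf_unit_nonzero[OF y(1)] by (simp add: zero_less_mult_iff) linarith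
    ultimately show ?thesis by (simp only: sgn_mult[of "of_rat r"]) simp
  qed
  assume "r \<in> {1, -1} \<and> (\<exists>y\<in>Units (Qv InfPlace). x = emb InfPlace r \<otimes>\<^bsub>Qv InfPlace\<^esub> (y \<otimes>\<^bsub>Qv InfPlace\<^esub> y))"
    "r' \<in> {1, -1} \<and> (\<exists>y\<in>Units (Qv InfPlace). x = emb InfPlace r' \<otimes>\<^bsub>Qv InfPlace\<^esub> (y \<otimes>\<^bsub>Qv InfPlace\<^esub> y))"
  with sgn[of r] sgn[of r'] show "r = r'" by auto
qed auto

end

text \<open>If all nonzero residues were squares, squaring would permute the finite set of nonzero
  residues; but 1 and p - 1 have the same square.\<close>

lemma quadratic_nonresidue_ex:
  fixes p :: nat assumes p: "prime p" "p > 2" shows "\<exists>g. \<not> QuadRes (int p) g \<and> \<not> int p dvd g"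
proof (rule ccontr)
  assume neg: "\<not> ?thesis"
  let ?f = "\<lambda>b. b\<^sup>2 mod int p"
  let ?A = "{1..<int p}"
  have "?A \<subseteq> ?f ` ?A"
  proof
    fix a assume a: "a \<in> ?A"
    hence na: "\<not> int p dvd a" using zdvd_not_zless by auto
    then obtain y where y: "[y\<^sup>2 = a] (mod int p)" using neg unfolding QuadRes_def by blast
    have "(y mod int p)\<^sup>2 mod int p = a" using y a by (simp add: cong_def power_mod)
    moreover have "y mod int p \<noteq> 0"
      using na y by (metis cong_dvd_iff dvd_eq_mod_eq_0 dvd_power zero_less_numeral dvd_trans)
    hence "y mod int p \<in> ?A" using p pos_mod_sign[of "int p" y] pos_mod_bound[of "int p" y] by auto
    ultimately show "a \<in> ?f ` ?A" by (metis image_eqI)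
  qed
  hence "card ?A \<le> card (?f ` ?A)" by (intro card_mono) auto
  hence "inj_on ?f ?A" by (intro eq_card_imp_inj_on antisym card_image_le) auto
  moreover have "(int p - 1)\<^sup>2 = 1 + int p * (int p - 2)" by (simp add: power2_eq_square algebra_simps)
  hence "?f (int p - 1) = ?f 1" by simp
  ultimately have "int p - 1 = 1" using p by (elim inj_onD) auto
  thus False using p by simp
qed

context padic
begin

text \<open>\<open>E\<close> is the precision from which closeness to 1 implies being a square. At p
  = 2 it is 3: odd squares are 1 modulo 8, so 1, 3, 5, 7 are the classes. At odd p the classes are 1
  and a nonresidue \<open>g\<close>.\<close>

lemma unit_residue_reps:
  defines "E \<equiv> (if p = 2 then 3 else 1 :: nat)"
  obtains U :: "int set" where "finite U" "card U = (if p = 2 then 4 else 2)" "\<And>s. s \<in> U \<Longrightarrow> \<not> int p dvd s"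
    "\<And>a. \<not> int p dvd a \<Longrightarrow> \<exists>s\<in>U. \<exists>b. \<not> int p dvd b \<and> int p ^ E dvd a - s * b\<^sup>2"
    "\<And>s s' b. s \<in> U \<Longrightarrow> s' \<in> U \<Longrightarrow> int p ^ E dvd s - s' * b\<^sup>2 \<Longrightarrow> s = s'"
proof (cases "p = 2")
  case True
  have sq: "b\<^sup>2 mod 8 = 1" if "odd b" for b :: int
  proof -
    have "b mod 8 = 1 \<or> b mod 8 = 3 \<or> b mod 8 = 5 \<or> b mod 8 = 7" using that by presburger
    hence "(b mod 8)\<^sup>2 mod 8 = 1" by auto
    thus ?thesis by (simp add: power_mod)
  qed
  show ?thesis
  proof (rule that[of "{1, 3, 5, 7}"])
    fix a :: int assume "\<not> int p dvd a"
    hence "a mod 8 \<in> {1, 3, 5, 7}" unfolding True by simp presburger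
    moreover have "int p ^ E dvd a - (a mod 8) * 1\<^sup>2" by (simp add: True E_def)
    ultimately show "\<exists>s\<in>{1, 3, 5, 7}. \<exists>b. \<not> int p dvd b \<and> int p ^ E dvd a - s * b\<^sup>2"
      using True by (intro bexI[of _ "a mod 8"] exI[of _ 1]) auto
  next
    fix s s' b :: int assume s: "s \<in> {1, 3, 5, 7}" "s' \<in> {1, 3, 5, 7}" "int p ^ E dvd s - s' * b\<^sup>2"
    hence d: "s mod 8 = (s' * b\<^sup>2) mod 8" by (simp add: True E_def mod_eq_dvd_iff)
    have "odd b"
    proof
      assume "even b"
      hence "even (s' * b\<^sup>2)" by simp
      hence "even (s mod 8)" unfolding d by (rule dvd_mod) simp
      thus False using s(1) by auto
    qed
    have "s mod 8 = (s' * (b\<^sup>2 mod 8)) mod 8" unfolding d by (simp add: mod_mult_right_eq)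
    thus "s = s'" using s(1,2) unfolding sq[OF \<open>odd b\<close>] by auto
  qed (auto simp: True)
next
  case False
  hence p2: "p > 2" using prime_p prime_ge_2_nat[of p] by auto
  obtain g where g: "\<not> QuadRes (int p) g" "\<not> int p dvd g" using quadratic_nonresidue_ex[OF prime_p p2] by blast
  have res: "\<exists>b. \<not> int p dvd b \<and> int p dvd a - b\<^sup>2" if a: "QuadRes (int p) a" "\<not> int p dvd a" for a
  proof -
    obtain y where y: "[y\<^sup>2 = a] (mod int p)" using a(1) unfolding QuadRes_def by blast
    hence "int p dvd a - y\<^sup>2" by (simp add: cong_iff_dvd_diff dvd_diff_commute)
    moreover have "\<not> int p dvd y"
    proof
      assume "int p dvd y"
      hence "int p dvd y\<^sup>2" by (simp add: power2_eq_square)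
      thus False using calculation a(2) dvd_diff_left_iff[of "int p" "y\<^sup>2" a] dvd_diffD by blast
    qed
    ultimately show ?thesis by blast
  qed
  \<comment> \<open>Euler's criterion gives multiplicativity modulo \<open>p\<close>; as the two
    sides differ by at most 2 < p, they are equal.\<close>
  have leg: "Legendre (a * b) (int p) = Legendre a (int p) * Legendre b (int p)" for a b
  proof -
    have "[Legendre (a * b) (int p) = (a * b) ^ ((p - 1) div 2)] (mod int p)"
      using euler_criterion[OF prime_p p2] .
    also have "(a * b) ^ ((p - 1) div 2) = a ^ ((p - 1) div 2) * b ^ ((p - 1) div 2)" by (simp add: power_mult_distrib)
    also have "[\<dots> = Legendre a (int p) * Legendre b (int p)] (mod int p)"
      using euler_criterion[OF prime_p p2] by (intro cong_mult) (auto simp: cong_sym)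
    finally have c: "int p dvd Legendre (a * b) (int p) - Legendre a (int p) * Legendre b (int p)"
      by (simp add: cong_iff_dvd_diff)
    have "Legendre x (int p) \<in> {-1, 0, 1}" for x by (auto simp: Legendre_def)
    from this[of "a * b"] this[of a] this[of b]
    have "\<bar>Legendre (a * b) (int p) - Legendre a (int p) * Legendre b (int p)\<bar> \<le> 2" by auto
    thus ?thesis using c p2 zdvd_not_zless[of "\<bar>Legendre (a * b) (int p) - Legendre a (int p) * Legendre b (int p)\<bar>" "int p"]
      by auto
  qed
  have leg_eq: "Legendre x (int p) = (if int p dvd x then 0 else if QuadRes (int p) x then 1 else -1)" for x
    by (simp add: Legendre_def cong_0_iff)
  have sq1: "Legendre (b\<^sup>2) (int p) = 1" if "\<not> int p dvd b" for b
    using that prime_p leg_eq[of b] leg[of b b] by (simp add: power2_eq_square split: if_splits)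
  show ?thesis
  proof (rule that[of "{1, g}"])
    have "1 \<noteq> g" using g(1) by (auto simp: QuadRes_def dest: spec[of _ 1])
    thus "card {1, g} = (if p = 2 then 4 else 2)" using False by simp
    fix a :: int assume a: "\<not> int p dvd a"
    show "\<exists>s\<in>{1, g}. \<exists>b. \<not> int p dvd b \<and> int p ^ E dvd a - s * b\<^sup>2"
    proof (cases "QuadRes (int p) a")
      case True
      then show ?thesis using res[OF True a] False by (simp add: E_def)
    next
      case nq: False
      have nd: "\<not> int p dvd a * g" using a g prime_p by (simp add: prime_dvd_mult_iff)
      have "Legendre (a * g) (int p) = 1" using leg[of a g] a g nq by (simp add: leg_eq)
      hence "QuadRes (int p) (a * g)" using nd by (simp add: leg_eq split: if_splits)
      then obtain c where c: "\<not> int p dvd c" "int p dvd a * g - c\<^sup>2" using res[OF _ nd] by blast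
      have "coprime (int p) g" using g prime_p by (intro prime_imp_coprime) auto
      hence "coprime g (int p)" by (simp add: coprime_commute)
      then obtain h where "[g * h = 1] (mod int p)" using cong_solve_coprime_int by blast
      hence h: "int p dvd g * h - 1" by (simp add: cong_iff_dvd_diff)
      have nh: "\<not> int p dvd h"
      proof
        assume "int p dvd h"
        hence "int p dvd g * h - (g * h - 1)" by (rule dvd_diff[OF dvd_mult h])
        also have "g * h - (g * h - 1) = 1" by simp
        finally show False using p_not_unit by contradiction
      qed
      have "a - g * (h * c)\<^sup>2 = (a * g - c\<^sup>2) * (g * h\<^sup>2) - a * ((g * h - 1) * (g * h + 1))"
        by (simp add: power2_eq_square algebra_simps)
      also have "int p dvd \<dots>" by (intro dvd_diff dvd_mult2 dvd_mult c h)
      finally have "int p dvd a - g * (h * c)\<^sup>2" .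
      moreover have "\<not> int p dvd h * c" using nh c prime_p by (simp add: prime_dvd_mult_iff)
      ultimately show ?thesis using False by (auto simp: E_def)
    qed
  next
    fix s s' b assume s: "s \<in> {1, g}" "s' \<in> {1, g}" "int p ^ E dvd s - s' * b\<^sup>2"
    hence d: "int p dvd s - s' * b\<^sup>2" using False by (simp add: E_def)
    have ns: "\<not> int p dvd s" "\<not> int p dvd s'" using s g p_not_unit by auto
    have nb: "\<not> int p dvd b"
    proof
      assume "int p dvd b"
      hence "int p dvd s' * b\<^sup>2" by (simp add: power2_eq_square)
      hence "int p dvd (s - s' * b\<^sup>2) + s' * b\<^sup>2" using d by (intro dvd_add)
      thus False using ns by simp
    qed
    have "[s = s' * b\<^sup>2] (mod int p)" using d by (simp add: cong_iff_dvd_diff)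
    hence "[y = s] (mod int p) \<longleftrightarrow> [y = s' * b\<^sup>2] (mod int p)"
      "[s = y] (mod int p) \<longleftrightarrow> [s' * b\<^sup>2 = y] (mod int p)" for y
      by (meson cong_sym cong_trans)+
    hence "Legendre s (int p) = Legendre (s' * b\<^sup>2) (int p)"
      unfolding Legendre_def QuadRes_def by (simp only:)
    hence "Legendre s (int p) = Legendre s' (int p)" using leg sq1[OF nb] by simp
    moreover have "Legendre 1 (int p) = 1" "Legendre g (int p) = -1"
      using g p_not_unit sq1[of 1] by (auto simp: leg_eq)
    ultimately show "s = s'" using s(1,2) by auto
  qed (use g p_not_unit in auto)
qed

lemma rat_abs_p_power: "rat_abs (FinPlace p) (of_nat p powi k) = real p powi (- k)"
  using p_gt_1 prime_p by (simp add: rat_abs_nonzero vp_power_int vp_prime)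

lemma square_approx:
  assumes z: "z \<in> carrier K" "nrm z \<le> 1" and b: "nrm (z \<ominus>\<^bsub>K\<^esub> emb (FinPlace p) (of_int b)) \<le> e"
  shows "nrm (z \<otimes>\<^bsub>K\<^esub> z \<ominus>\<^bsub>K\<^esub> emb (FinPlace p) (of_int (b\<^sup>2))) \<le> e"
proof -
  obtain a where a: "cau a" "z = cls a" using K_cases[OF z(1)] .
  let ?b = "emb (FinPlace p) (of_int b)"
  have "z \<otimes>\<^bsub>K\<^esub> z \<ominus>\<^bsub>K\<^esub> emb (FinPlace p) (of_int (b\<^sup>2)) = (z \<ominus>\<^bsub>K\<^esub> ?b) \<otimes>\<^bsub>K\<^esub> (z \<oplus>\<^bsub>K\<^esub> ?b)"
    using a by (simp add: emb_cls K_mult K_minus K_add cau_mult cau_diff cau_add power2_eq_square algebra_simps)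
  hence "nrm (z \<otimes>\<^bsub>K\<^esub> z \<ominus>\<^bsub>K\<^esub> emb (FinPlace p) (of_int (b\<^sup>2))) = nrm (z \<ominus>\<^bsub>K\<^esub> ?b) * nrm (z \<oplus>\<^bsub>K\<^esub> ?b)"
    using z by (simp add: Qv_abs_mult)
  also have "\<dots> \<le> e * 1"
    using z b nrm_ultra[of z ?b] rat_abs_int_le_1[of b] order.trans[OF Qv_abs_nonneg b]
    by (intro mult_mono) auto
  finally show ?thesis by simp
qed

lemma emb_close_iff:
  "nrm (emb (FinPlace p) (of_int a) \<ominus>\<^bsub>K\<^esub> emb (FinPlace p) (of_int b)) \<le> 1 / real p ^ k \<longleftrightarrow> int p ^ k dvd a - b"
  unfolding emb_diff[symmetric] Qv_abs_emb of_int_diff[symmetric] rat_abs_int_le_iff ..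

lemma close_int_unit:
  assumes x: "x \<in> carrier K" "nrm x = 1" and a: "nrm (x \<ominus>\<^bsub>K\<^esub> emb (FinPlace p) (of_int a)) \<le> 1 / real p ^ k" and k: "k > 0"
  shows "\<not> int p dvd a"
proof -
  have "1 / real p ^ k < 1" using p_gt_1(1) k by (simp add: one_less_power)
  hence "nrm (emb (FinPlace p) (of_int a)) = nrm x" using a x by (intro nrm_eq_of_close) auto
  thus ?thesis using x rat_abs_int_eq_1_iff[of a] by simp
qed

text \<open>A square class is determined by the parity of the valuation and by the class of the unit
  part, whence the representatives s p^i with \<open>i\<close> in {0, 1}. Their number is twice that
  of the unit classes.\<close>

lemma padic_square_reps:
  obtains R where "square_reps R" "card R = (if p = 2 then 8 else 4)"
proof -
  define E where "E = (if p = 2 then 3 else 1 :: nat)"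
  have E0: "E > 0" by (simp add: E_def)
  obtain U where U: "finite U" "card U = (if p = 2 then 4 else 2)" "\<And>s. s \<in> U \<Longrightarrow> \<not> int p dvd s"
    "\<And>a. \<not> int p dvd a \<Longrightarrow> \<exists>s\<in>U. \<exists>b. \<not> int p dvd b \<and> int p ^ E dvd a - s * b\<^sup>2"
    "\<And>s s' b. s \<in> U \<Longrightarrow> s' \<in> U \<Longrightarrow> int p ^ E dvd s - s' * b\<^sup>2 \<Longrightarrow> s = s'"
    by (rule unit_residue_reps[folded E_def]) (rule that, assumption+)
  define f where "f = (\<lambda>(s, i). of_int s * of_nat p powi i :: rat)"
  define R where "R = f ` (U \<times> {0, 1})"
  let ?emb = "emb (FinPlace p)"
  have Unz: "s \<noteq> 0" if "s \<in> U" for s using U(3)[OF that] by auto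
  have fnz: "f (s, i) \<noteq> 0" if "s \<in> U" for s i using Unz[OF that] p_gt_1 by (simp add: f_def)
  have absf: "rat_abs (FinPlace p) (f (s, i)) = real p powi (- i)" if "s \<in> U" for s i
  proof -
    have "rat_abs (FinPlace p) (of_int s) = 1" using U(3)[OF that] rat_abs_int_eq_1_iff by blast
    thus ?thesis unfolding f_def case_prod_conv rat_abs_mult[OF place] rat_abs_p_power by simp
  qed
  have uniq: "s = s' \<and> i = j"
    if s: "s \<in> U" "s' \<in> U" and ij: "i \<in> {0, 1}" "j \<in> {0, 1}" and z: "z \<in> Units K"
      and eq: "?emb (f (s, i)) = ?emb (f (s', j)) \<otimes>\<^bsub>K\<^esub> (z \<otimes>\<^bsub>K\<^esub> z)" for s s' i j z
  proof -
    obtain k where k: "nrm z = real p powi k" using unit_value[OF z] .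
    have "rat_abs (FinPlace p) (f (s, i)) = rat_abs (FinPlace p) (f (s', j)) * (nrm z * nrm z)"
      using arg_cong[OF eq, of nrm] z by (simp add: Qv_abs_mult)
    hence "real p powi (- i) = real p powi (- j + (k + k))"
      unfolding absf[OF s(1)] absf[OF s(2)] k using p_gt_1(2) power_int_add[of "real p"] by (metis of_nat_0_eq_iff less_irrefl)
    \<comment> \<open>The valuations differ by the even number 2 k while \<open>i\<close> and
      \<open>j\<close> lie in {0, 1}; so k = 0 and \<open>z\<close> is an integral unit, which may
      be approximated by an integer.\<close>
    hence "- i = - j + (k + k)"
      using powi_le_iff[OF p_gt_1(1)] by (metis order_antisym order_refl)
    hence "k = 0 \<and> i = j" using ij by (auto; presburger)
    hence k0: "k = 0" and ij': "i = j" by auto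
    have nz: "nrm z = 1" using k k0 by simp
    obtain b where b: "nrm (z \<ominus>\<^bsub>K\<^esub> ?emb (of_int b)) \<le> 1 / real p ^ E" using int_approx[of z E] z nz by auto
    have "?emb (of_nat p powi i) \<otimes>\<^bsub>K\<^esub> ?emb (of_int s) = ?emb (of_nat p powi i) \<otimes>\<^bsub>K\<^esub> (?emb (of_int s') \<otimes>\<^bsub>K\<^esub> (z \<otimes>\<^bsub>K\<^esub> z))"
      using eq z unfolding f_def ij' by (simp add: emb_mult K.m_ac)
    hence seq: "?emb (of_int s) = ?emb (of_int s') \<otimes>\<^bsub>K\<^esub> (z \<otimes>\<^bsub>K\<^esub> z)"
      using z p_gt_1 by (subst (asm) K.Units_l_cancel) auto
    have "?emb (of_int s) \<ominus>\<^bsub>K\<^esub> ?emb (of_int (s' * b\<^sup>2))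
        = ?emb (of_int s') \<otimes>\<^bsub>K\<^esub> (z \<otimes>\<^bsub>K\<^esub> z \<ominus>\<^bsub>K\<^esub> ?emb (of_int (b\<^sup>2)))"
      using z unfolding seq of_int_mult emb_mult by (simp add: a_minus_def K.r_distr K.r_minus)
    hence "nrm (?emb (of_int s) \<ominus>\<^bsub>K\<^esub> ?emb (of_int (s' * b\<^sup>2)))
        = rat_abs (FinPlace p) (of_int s') * nrm (z \<otimes>\<^bsub>K\<^esub> z \<ominus>\<^bsub>K\<^esub> ?emb (of_int (b\<^sup>2)))"
      using z by (simp add: Qv_abs_mult)
    also have "\<dots> \<le> 1 * (1 / real p ^ E)"
      using z nz b by (intro mult_mono rat_abs_int_le_1 square_approx) auto
    finally have "int p ^ E dvd s - s' * b\<^sup>2" unfolding emb_close_iff mult_1 .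
    thus ?thesis using U(5)[OF s] ij' by blast
  qed
  have "inj_on f (U \<times> {0, 1})"
  proof (rule inj_onI)
    fix u u' assume u: "u \<in> U \<times> {0, 1}" "u' \<in> U \<times> {0, 1}" "f u = f u'"
    have "fst u = fst u' \<and> snd u = snd u'"
      using u by (intro uniq[of _ _ _ _ "\<one>\<^bsub>K\<^esub>"]) (auto simp: mem_Times_iff)
    thus "u = u'" by (simp add: prod_eq_iff)
  qed
  hence "card R = card U * 2" unfolding R_def by (simp add: card_image card_cartesian_product)
  hence cR: "card R = (if p = 2 then 8 else 4)" using U(2) by auto
  have "square_reps R" unfolding square_reps_def
  proof (intro conjI ballI ex_ex1I)
    show "finite R" using U(1) by (simp add: R_def)
    show "0 \<notin> R" using fnz by (auto simp: R_def)
    fix x assume x: "x \<in> Units K"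
    {
      obtain k0 where "nrm x = real p powi k0" using unit_value[OF x] .
      then obtain k where k: "nrm x = real p powi (- k)" by (metis minus_minus)
      define x' where "x' = ?emb (of_nat p powi (- k)) \<otimes>\<^bsub>K\<^esub> x"
      have x': "x' \<in> carrier K" "nrm x' = 1"
        using x k p_gt_1 by (simp_all add: x'_def Qv_abs_mult rat_abs_p_power flip: power_int_add)
      obtain a where a: "nrm (x' \<ominus>\<^bsub>K\<^esub> ?emb (of_int a)) \<le> 1 / real p ^ E" using int_approx[of x' E] x' by auto
      have "\<not> int p dvd a" using close_int_unit[OF x' a E0] .
      then obtain s b where s: "s \<in> U" "\<not> int p dvd b" "int p ^ E dvd a - s * b\<^sup>2" using U(4) by blast
      have nsb: "\<not> int p dvd s * b\<^sup>2" using s U(3)[of s] prime_p by (auto simp: prime_dvd_mult_iff prime_dvd_power_iff)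
      let ?w = "?emb (of_int (s * b\<^sup>2))"
      have w: "?w \<in> Units K" "nrm ?w = 1"
        using nsb rat_abs_int_eq_1_iff[of "s * b\<^sup>2"] by (auto simp del: of_int_mult of_int_power)
      have "nrm (x' \<ominus>\<^bsub>K\<^esub> ?w) \<le> 1 / real p ^ E"
        by (rule nrm_ultra_trans[OF x'(1) _ _ a]) (auto simp only: emb_close_iff s(3) emb_closed)
      hence "nrm (x' \<otimes>\<^bsub>K\<^esub> inv\<^bsub>K\<^esub> ?w \<ominus>\<^bsub>K\<^esub> \<one>\<^bsub>K\<^esub>) \<le> 1 / real p ^ E"
        using Qv_abs_quotient_minus_one[OF x'(1) w(1)] w(2) by simp
      hence "is_square (x' \<otimes>\<^bsub>K\<^esub> inv\<^bsub>K\<^esub> ?w)"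
        using x' w by (intro square_of_close_to_one) (auto simp: E_def)
      then obtain y where y: "y \<in> Units K" "x' \<otimes>\<^bsub>K\<^esub> inv\<^bsub>K\<^esub> ?w = y \<otimes>\<^bsub>K\<^esub> y" by (auto simp: is_square_def)
      have x'_eq: "x' = ?w \<otimes>\<^bsub>K\<^esub> (y \<otimes>\<^bsub>K\<^esub> y)"
        unfolding y(2)[symmetric] using unit_cancel(1)[OF x'(1) w(1)] x' w by (simp add: K.m_comm)
      have i: "k mod 2 \<in> {0, 1}" by auto
      \<comment> \<open>The square part of p^k s b^2: the even part of the power of \<open>p\<close>
        together with \<open>b\<close>. Only s p^(k mod 2) is left outside.\<close>
      define c :: rat where "c = of_nat p powi (k div 2) * of_int b"
      have c: "c \<noteq> 0" using s p_gt_1 by (auto simp: c_def)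
      have "(of_nat p :: rat) powi k = of_nat p powi (k mod 2 + (k div 2 + k div 2))" by (rule arg_cong) simp
      also have "\<dots> = of_nat p powi (k mod 2) * (of_nat p powi (k div 2) * of_nat p powi (k div 2))"
        using p_gt_1(2) power_int_add[of "rat_of_nat p"] by (metis of_nat_0_eq_iff less_irrefl)
      finally have pk: "of_nat p powi k * of_int (s * b\<^sup>2) = f (s, k mod 2) * (c * c)"
        by (simp add: f_def c_def power2_eq_square algebra_simps)
      have "x = ?emb (of_nat p powi k * of_nat p powi (- k)) \<otimes>\<^bsub>K\<^esub> x"
        using x p_gt_1 by (simp flip: power_int_add)
      also have "\<dots> = ?emb (of_nat p powi k) \<otimes>\<^bsub>K\<^esub> x'"
        using x unfolding x'_def emb_mult by (simp add: K.m_assoc)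
      also have "\<dots> = ?emb (of_nat p powi k * of_int (s * b\<^sup>2)) \<otimes>\<^bsub>K\<^esub> (y \<otimes>\<^bsub>K\<^esub> y)"
        unfolding x'_eq emb_mult using y by (simp add: K.m_assoc)
      also have "\<dots> = ?emb (f (s, k mod 2)) \<otimes>\<^bsub>K\<^esub> ((?emb c \<otimes>\<^bsub>K\<^esub> y) \<otimes>\<^bsub>K\<^esub> (?emb c \<otimes>\<^bsub>K\<^esub> y))"
        unfolding pk emb_mult using y by (simp add: K.m_ac)
      finally show "\<exists>r. r \<in> R \<and> (\<exists>y\<in>Units K. x = ?emb r \<otimes>\<^bsub>K\<^esub> (y \<otimes>\<^bsub>K\<^esub> y))"
        using s(1) i c y(1) unfolding R_def
        by (intro exI[of _ "f (s, k mod 2)"] conjI imageI bexI[of _ "?emb c \<otimes>\<^bsub>K\<^esub> y"]) auto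
    }
    fix r r'
    assume *: "r \<in> R \<and> (\<exists>y\<in>Units K. x = ?emb r \<otimes>\<^bsub>K\<^esub> (y \<otimes>\<^bsub>K\<^esub> y))" "r' \<in> R \<and> (\<exists>y\<in>Units K. x = ?emb r' \<otimes>\<^bsub>K\<^esub> (y \<otimes>\<^bsub>K\<^esub> y))"
    then obtain y y' where y: "y \<in> Units K" "y' \<in> Units K"
      "x = ?emb r \<otimes>\<^bsub>K\<^esub> (y \<otimes>\<^bsub>K\<^esub> y)" "x = ?emb r' \<otimes>\<^bsub>K\<^esub> (y' \<otimes>\<^bsub>K\<^esub> y')" by blast
    define z where "z = y' \<otimes>\<^bsub>K\<^esub> inv\<^bsub>K\<^esub> y"
    have z: "z \<in> Units K" using y by (simp add: z_def)
    have "z \<otimes>\<^bsub>K\<^esub> y = y'" using y unit_cancel(1)[of y' y] by (simp add: z_def K.m_ac)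
    hence "?emb r \<otimes>\<^bsub>K\<^esub> (y \<otimes>\<^bsub>K\<^esub> y) = (?emb r' \<otimes>\<^bsub>K\<^esub> (z \<otimes>\<^bsub>K\<^esub> z)) \<otimes>\<^bsub>K\<^esub> (y \<otimes>\<^bsub>K\<^esub> y)"
      using y z by (metis (no_types, lifting) K.m_ac(1,2) K.m_closed emb_closed unit_closed)
    hence "?emb r = ?emb r' \<otimes>\<^bsub>K\<^esub> (z \<otimes>\<^bsub>K\<^esub> z)"
      using y z K.Units_l_cancel[of "y \<otimes>\<^bsub>K\<^esub> y" "?emb r" "?emb r' \<otimes>\<^bsub>K\<^esub> (z \<otimes>\<^bsub>K\<^esub> z)"]
      by (simp add: K.m_comm)
    moreover obtain s i where "r = f (s, i)" "s \<in> U" "i \<in> {0, 1}" using * by (auto simp: R_def)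
    moreover obtain s' j where "r' = f (s', j)" "s' \<in> U" "j \<in> {0, 1}" using * by (auto simp: R_def)
    ultimately show "r = r'" using uniq[of s s' i j z] z by blast
  qed
  thus ?thesis using that cR by blast
qed

end

lemma Qv_field: "v \<in> places \<Longrightarrow> field (Qv v)"
proof -
  assume "v \<in> places"
  then interpret completion v by unfold_locales
  show ?thesis by (rule K.field_axioms)
qed

lemma Qv_cring: "v \<in> places \<Longrightarrow> cring (Qv v)"
  by (rule fieldE(1)[OF Qv_field])

text \<open>The normalisation by the absolute value of 2 makes the count uniform: 2 * 2 at the real
  place, 8 * 1/2 at the prime 2, 4 * 1 at odd primes.\<close>

lemma square_reps_ex:
  assumes "v \<in> places"
  shows "\<exists>R. completion.square_reps v R \<and> real (card R) * rat_abs v 2 = 4"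
  using assms
proof (cases rule: place_cases)
  case 1
  interpret real_place .
  show ?thesis unfolding 1 by (rule exI[of _ "{1, -1}"]) (use inf_square_reps in auto)
next
  case (2 p)
  interpret padic p by unfold_locales (rule 2)
  obtain R where R: "square_reps R" "card R = (if p = 2 then 8 else 4)" by (rule padic_square_reps)
  have "rat_abs (FinPlace p) 2 = (if p = 2 then 1 / 2 else 1)"
    using vp_prime[OF prime_p two_is_prime_nat] p_gt_1 by (subst rat_abs_nonzero) (auto simp: power_int_minus)
  thus ?thesis using R unfolding 2(1) by (intro exI[of _ R]) auto
qed

section \<open>The ring attached to S and its square classes\<close>

locale place_set =
  fixes S :: "place set"
  assumes finS: "finite S" and S_sub: "S \<subseteq> places" and infS: "InfPlace \<in> S"
begin

lemma S_place: "v \<in> S \<Longrightarrow> v \<in> places"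
  using S_sub by auto

lemma S_completion: "v \<in> S \<Longrightarrow> completion v"
  by unfold_locales (rule S_place)

lemma S_cring: "v \<in> S \<Longrightarrow> cring (Qv v)"
  by (rule Qv_cring[OF S_place])

definition SP :: "nat set" where "SP = {p. FinPlace p \<in> S}"

lemma SP_iff: "p \<in> SP \<longleftrightarrow> FinPlace p \<in> S"
  by (simp add: SP_def)

lemma SP_prime: "p \<in> SP \<Longrightarrow> prime p"
  using S_place[of "FinPlace p"] by (simp add: SP_iff)

lemma S_eq: "S = insert InfPlace (FinPlace ` SP)"
proof (intro equalityI subsetI)
  fix v assume "v \<in> S"
  thus "v \<in> insert InfPlace (FinPlace ` SP)" by (cases v) (auto simp: SP_iff)
qed (auto simp: infS SP_iff)

lemma finSP: "finite SP"
proof -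
  have "finite (FinPlace ` SP)" by (rule finite_subset[OF _ finS]) (auto simp: SP_iff)
  thus ?thesis by (rule finite_imageD) (simp add: inj_on_def)
qed

lemma prod_S: "(\<Prod>v\<in>S. f v) = f InfPlace * (\<Prod>p\<in>SP. f (FinPlace p))"
proof -
  have "(\<Prod>v\<in>S. f v) = f InfPlace * (\<Prod>v\<in>FinPlace ` SP. f v)"
    by (subst S_eq, rule prod.insert) (auto simp: finSP)
  also have "(\<Prod>v\<in>FinPlace ` SP. f v) = (\<Prod>p\<in>SP. f (FinPlace p))"
    by (subst prod.reindex) (auto simp: inj_on_def)
  finally show ?thesis .
qed

lemma card_S: "card S = card SP + 1"
proof -
  have "card S = Suc (card (FinPlace ` SP))" by (subst S_eq, rule card_insert_disjoint) (auto simp: finSP)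
  also have "card (FinPlace ` SP) = card SP" by (rule card_image) (simp add: inj_on_def)
  finally show ?thesis by simp
qed

lemma QS_simps:
  "carrier (QS S) = (\<Pi>\<^sub>E v\<in>S. carrier (Qv v))"
  "x \<otimes>\<^bsub>QS S\<^esub> y = (\<lambda>v\<in>S. x v \<otimes>\<^bsub>Qv v\<^esub> y v)"
  "x \<oplus>\<^bsub>QS S\<^esub> y = (\<lambda>v\<in>S. x v \<oplus>\<^bsub>Qv v\<^esub> y v)"
  "\<one>\<^bsub>QS S\<^esub> = (\<lambda>v\<in>S. \<one>\<^bsub>Qv v\<^esub>)" "\<zero>\<^bsub>QS S\<^esub> = (\<lambda>v\<in>S. \<zero>\<^bsub>Qv v\<^esub>)"
  by (simp_all add: QS_def)

lemma QS_eqI: "x \<in> carrier (QS S) \<Longrightarrow> y \<in> carrier (QS S) \<Longrightarrow> (\<And>v. v \<in> S \<Longrightarrow> x v = y v) \<Longrightarrow> x = y"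
  unfolding QS_simps by (rule PiE_ext)

lemma QS_comp: "x \<in> carrier (QS S) \<Longrightarrow> v \<in> S \<Longrightarrow> x v \<in> carrier (Qv v)"
  by (auto simp: QS_simps)

lemma QS_closed:
  "x \<in> carrier (QS S) \<Longrightarrow> y \<in> carrier (QS S) \<Longrightarrow> x \<otimes>\<^bsub>QS S\<^esub> y \<in> carrier (QS S)"
  "x \<in> carrier (QS S) \<Longrightarrow> y \<in> carrier (QS S) \<Longrightarrow> x \<oplus>\<^bsub>QS S\<^esub> y \<in> carrier (QS S)"
  "\<one>\<^bsub>QS S\<^esub> \<in> carrier (QS S)" "\<zero>\<^bsub>QS S\<^esub> \<in> carrier (QS S)"
  using S_cring by (auto simp: QS_simps cring.cring_simprules PiE_iff)

lemma QS_cring: "cring (QS S)"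
proof (intro cringI abelian_groupI comm_monoidI)
  fix x assume x: "x \<in> carrier (QS S)"
  define y where "y = (\<lambda>v\<in>S. \<ominus>\<^bsub>Qv v\<^esub> x v)"
  have "y \<in> carrier (QS S)" using x S_cring by (auto simp: y_def QS_simps cring.cring_simprules PiE_iff)
  moreover from this have "y \<oplus>\<^bsub>QS S\<^esub> x = \<zero>\<^bsub>QS S\<^esub>"
    using x by (intro QS_eqI QS_closed)
      (auto simp: QS_simps y_def PiE_iff S_cring cring.cring_simprules)
  ultimately show "\<exists>y\<in>carrier (QS S). y \<oplus>\<^bsub>QS S\<^esub> x = \<zero>\<^bsub>QS S\<^esub>" by blast
next
  note [simp] = QS_closed S_cring cring.cring_simprules QS_comp
  fix x y z assume xyz: "x \<in> carrier (QS S)" "y \<in> carrier (QS S)" "z \<in> carrier (QS S)"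
  show "x \<oplus>\<^bsub>QS S\<^esub> y \<oplus>\<^bsub>QS S\<^esub> z = x \<oplus>\<^bsub>QS S\<^esub> (y \<oplus>\<^bsub>QS S\<^esub> z)"
    "x \<otimes>\<^bsub>QS S\<^esub> y \<otimes>\<^bsub>QS S\<^esub> z = x \<otimes>\<^bsub>QS S\<^esub> (y \<otimes>\<^bsub>QS S\<^esub> z)"
    "(x \<oplus>\<^bsub>QS S\<^esub> y) \<otimes>\<^bsub>QS S\<^esub> z = x \<otimes>\<^bsub>QS S\<^esub> z \<oplus>\<^bsub>QS S\<^esub> y \<otimes>\<^bsub>QS S\<^esub> z"
    using xyz by - (rule QS_eqI, simp, simp, simp add: QS_simps(2-5))+
next
  note [simp] = QS_closed S_cring cring.cring_simprules QS_comp
  fix x y assume xy: "x \<in> carrier (QS S)" "y \<in> carrier (QS S)"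
  show "x \<oplus>\<^bsub>QS S\<^esub> y = y \<oplus>\<^bsub>QS S\<^esub> x" "x \<otimes>\<^bsub>QS S\<^esub> y = y \<otimes>\<^bsub>QS S\<^esub> x"
    using xy by - (rule QS_eqI, simp, simp, simp add: QS_simps(2-5))+
next
  note [simp] = QS_closed S_cring cring.cring_simprules QS_comp
  fix x assume x: "x \<in> carrier (QS S)"
  have r_one: "x v \<otimes>\<^bsub>Qv v\<^esub> \<one>\<^bsub>Qv v\<^esub> = x v" if v: "v \<in> S" for v
  proof -
    interpret Kv: cring "Qv v" by (rule S_cring[OF v])
    show ?thesis using QS_comp[OF x v] by (rule Kv.r_one)
  qed
  note [simp] = r_one
  show "\<zero>\<^bsub>QS S\<^esub> \<oplus>\<^bsub>QS S\<^esub> x = x" "\<one>\<^bsub>QS S\<^esub> \<otimes>\<^bsub>QS S\<^esub> x = x"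
    using x by - (rule QS_eqI, simp, simp, simp add: QS_simps(2-5))+
qed (simp_all add: QS_closed)

sublocale KS: cring "QS S"
  by (rule QS_cring)

lemma QS_Units_iff: "x \<in> Units (QS S) \<longleftrightarrow> x \<in> carrier (QS S) \<and> (\<forall>v\<in>S. x v \<in> Units (Qv v))"
proof
  assume x: "x \<in> Units (QS S)"
  then obtain y where y: "y \<in> carrier (QS S)" "x \<otimes>\<^bsub>QS S\<^esub> y = \<one>\<^bsub>QS S\<^esub>" "y \<otimes>\<^bsub>QS S\<^esub> x = \<one>\<^bsub>QS S\<^esub>"
    "x \<in> carrier (QS S)" by (auto simp: Units_def)
  have "x v \<in> Units (Qv v)" if v: "v \<in> S" for v
    using fun_cong[OF y(2), of v] fun_cong[OF y(3), of v] v QS_comp[OF y(1) v] QS_comp[OF y(4) v]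
    by (auto simp: QS_simps Units_def)
  thus "x \<in> carrier (QS S) \<and> (\<forall>v\<in>S. x v \<in> Units (Qv v))" using y by blast
next
  assume x: "x \<in> carrier (QS S) \<and> (\<forall>v\<in>S. x v \<in> Units (Qv v))"
  hence "\<forall>v\<in>S. \<exists>y\<in>carrier (Qv v). y \<otimes>\<^bsub>Qv v\<^esub> x v = \<one>\<^bsub>Qv v\<^esub> \<and> x v \<otimes>\<^bsub>Qv v\<^esub> y = \<one>\<^bsub>Qv v\<^esub>"
    by (auto simp: Units_def)
  then obtain y where y: "\<forall>v\<in>S. y v \<in> carrier (Qv v) \<and> y v \<otimes>\<^bsub>Qv v\<^esub> x v = \<one>\<^bsub>Qv v\<^esub> \<and> x v \<otimes>\<^bsub>Qv v\<^esub> y v = \<one>\<^bsub>Qv v\<^esub>"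
    by metis
  let ?y = "restrict y S"
  have "?y \<in> carrier (QS S)" using y by (auto simp: QS_simps)
  moreover have "?y \<otimes>\<^bsub>QS S\<^esub> x = \<one>\<^bsub>QS S\<^esub>" "x \<otimes>\<^bsub>QS S\<^esub> ?y = \<one>\<^bsub>QS S\<^esub>"
    using y by (auto simp: QS_simps intro!: restrict_ext)
  ultimately show "x \<in> Units (QS S)" using x by (auto simp: Units_def)
qed

lemma QS_unit_closed [simp]: "x \<in> Units (QS S) \<Longrightarrow> x \<in> carrier (QS S)"
  by (simp add: QS_Units_iff)

lemma diag_carrier [simp]: "diag S q \<in> carrier (QS S)"
  using completion.emb_closed S_completion by (auto simp: diag_def QS_simps)

lemma diag_apply [simp]: "v \<in> S \<Longrightarrow> diag S q v = emb v q"
  by (simp add: diag_def)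

lemma diag_add: "diag S (q + r) = diag S q \<oplus>\<^bsub>QS S\<^esub> diag S r"
  and diag_mult: "diag S (q * r) = diag S q \<otimes>\<^bsub>QS S\<^esub> diag S r"
  and diag_0: "diag S 0 = \<zero>\<^bsub>QS S\<^esub>" and diag_1: "diag S 1 = \<one>\<^bsub>QS S\<^esub>"
  using S_completion by (auto simp: diag_def QS_simps completion.emb_add completion.emb_mult
      completion.emb_0 completion.emb_1 intro!: restrict_ext)

lemma diag_uminus: "diag S (- q) = \<ominus>\<^bsub>QS S\<^esub> diag S q"
  by (rule KS.minus_equality[symmetric]) (simp_all flip: diag_add diag_0)

lemma diag_diff: "diag S (q - r) = diag S q \<ominus>\<^bsub>QS S\<^esub> diag S r"
  using diag_add[of q "- r"] by (simp add: a_minus_def diag_uminus)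

lemma diag_Units [simp]: "diag S q \<in> Units (QS S) \<longleftrightarrow> q \<noteq> 0"
  using infS S_completion by (auto simp: QS_Units_iff completion.emb_unit_iff)

abbreviation "US \<equiv> units_of (QS S)"

sublocale US: comm_group US
  by (rule KS.units_comm_group)

lemma US_simps [simp]: "carrier US = Units (QS S)" "x \<otimes>\<^bsub>US\<^esub> y = x \<otimes>\<^bsub>QS S\<^esub> y" "\<one>\<^bsub>US\<^esub> = \<one>\<^bsub>QS S\<^esub>"
  by (simp_all add: units_of_def)

lemma QS_squares_iff:
  "x \<in> QS_squares S \<longleftrightarrow> x \<in> carrier (QS S) \<and> (\<forall>v\<in>S. completion.is_square v (x v))"
proof
  assume "x \<in> QS_squares S"
  then obtain y where y: "y \<in> Units (QS S)" "x = y \<otimes>\<^bsub>QS S\<^esub> y" by (auto simp: QS_squares_def)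
  have "completion.is_square v (x v)" if "v \<in> S" for v
    using y that S_completion[OF that] unfolding completion.is_square_def[OF S_completion[OF that]]
    by (auto simp: QS_Units_iff QS_simps)
  thus "x \<in> carrier (QS S) \<and> (\<forall>v\<in>S. completion.is_square v (x v))" using y by auto
next
  assume x: "x \<in> carrier (QS S) \<and> (\<forall>v\<in>S. completion.is_square v (x v))"
  hence "\<forall>v\<in>S. \<exists>y\<in>Units (Qv v). x v = y \<otimes>\<^bsub>Qv v\<^esub> y"
    using completion.is_square_def[OF S_completion] by blast
  then obtain y where y: "\<forall>v\<in>S. y v \<in> Units (Qv v) \<and> x v = y v \<otimes>\<^bsub>Qv v\<^esub> y v" by metis
  have "restrict y S \<in> Units (QS S)"
    using y completion.unit_closed[OF S_completion] by (auto simp: QS_Units_iff QS_simps)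
  moreover have "x = restrict y S \<otimes>\<^bsub>QS S\<^esub> restrict y S"
    using x y calculation by - (rule QS_eqI, simp, simp, simp add: QS_simps(2))
  ultimately show "x \<in> QS_squares S" by (auto simp: QS_squares_def)
qed

lemma squares_subgroup: "subgroup (QS_squares S) US"
proof (rule US.subgroupI)
  show "QS_squares S \<subseteq> carrier US" by (auto simp: QS_squares_def)
  show "QS_squares S \<noteq> {}" using KS.Units_one_closed by (auto simp: QS_squares_def)
next
  fix a assume "a \<in> QS_squares S"
  then obtain y where y: "y \<in> Units (QS S)" "a = y \<otimes>\<^bsub>QS S\<^esub> y" by (auto simp: QS_squares_def)
  have "inv\<^bsub>US\<^esub> a = inv\<^bsub>US\<^esub> y \<otimes>\<^bsub>US\<^esub> inv\<^bsub>US\<^esub> y"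
    using US.inv_mult[of y y] y by simp
  thus "inv\<^bsub>US\<^esub> a \<in> QS_squares S" using US.inv_closed[of y] y by (auto simp: QS_squares_def)
next
  fix a b assume "a \<in> QS_squares S" "b \<in> QS_squares S"
  then obtain y z where y: "y \<in> Units (QS S)" "a = y \<otimes>\<^bsub>QS S\<^esub> y"
    and z: "z \<in> Units (QS S)" "b = z \<otimes>\<^bsub>QS S\<^esub> z" by (auto simp: QS_squares_def)
  have "a \<otimes>\<^bsub>US\<^esub> b = (y \<otimes>\<^bsub>QS S\<^esub> z) \<otimes>\<^bsub>QS S\<^esub> (y \<otimes>\<^bsub>QS S\<^esub> z)"
    using y z by (simp add: KS.m_ac)
  moreover have "y \<otimes>\<^bsub>QS S\<^esub> z \<in> Units (QS S)" using y z by blast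
  ultimately show "a \<otimes>\<^bsub>US\<^esub> b \<in> QS_squares S" unfolding QS_squares_def by blast
qed

lemma squares_normal: "QS_squares S \<lhd> US"
  by (rule US.subgroup_imp_normal[OF squares_subgroup])

definition sqclass :: "(place \<Rightarrow> (nat \<Rightarrow> rat) set) \<Rightarrow> (place \<Rightarrow> (nat \<Rightarrow> rat) set) set" where
  "sqclass x = QS_squares S #>\<^bsub>US\<^esub> x"

lemma square_classes_carrier: "carrier (square_classes S) = sqclass ` Units (QS S)"
  by (auto simp: square_classes_def FactGroup_def RCOSETS_def sqclass_def)

lemma sqclass_hom: "sqclass \<in> hom US (square_classes S)"
  using normal.r_coset_hom_Mod[OF squares_normal] unfolding sqclass_def square_classes_def by simp

lemma sqclass_self: "x \<in> Units (QS S) \<Longrightarrow> x \<in> sqclass x"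
  using US.rcos_self[OF _ squares_subgroup] by (simp add: sqclass_def)

lemma mem_sqclass_iff:
  assumes "x \<in> Units (QS S)"
  shows "y \<in> sqclass x \<longleftrightarrow> y \<in> Units (QS S) \<and> sqclass y = sqclass x"
proof
  assume y: "y \<in> sqclass x"
  thus "y \<in> Units (QS S) \<and> sqclass y = sqclass x"
    using US.repr_independence[OF _ _ squares_subgroup, of y x] assms
      subgroup.elemrcos_carrier[OF squares_subgroup US.is_group, of x y]
    by (simp add: sqclass_def)
qed (use sqclass_self in auto)

lemma sqclass_eqI:
  assumes x: "x \<in> Units (QS S)" and y: "y \<in> QS_squares S"
  shows "sqclass (x \<otimes>\<^bsub>QS S\<^esub> y) = sqclass x"
proof -
  have "y \<in> Units (QS S)" using y by (auto simp: QS_squares_def)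
  moreover have "x \<otimes>\<^bsub>QS S\<^esub> y = y \<otimes>\<^bsub>US\<^esub> x" using x calculation by (simp add: KS.m_comm)
  moreover have "y \<otimes>\<^bsub>US\<^esub> x \<in> sqclass x" unfolding sqclass_def
    by (rule US.rcosI) (use x y in \<open>auto simp: QS_squares_def\<close>)
  ultimately show ?thesis using mem_sqclass_iff[OF x] by simp
qed

lemma sqclass_eqD:
  assumes x: "x \<in> Units (QS S)" and y: "y \<in> Units (QS S)" and eq: "sqclass x = sqclass y"
  obtains z where "z \<in> Units (QS S)" "x = y \<otimes>\<^bsub>QS S\<^esub> (z \<otimes>\<^bsub>QS S\<^esub> z)"
proof -
  have "x \<in> sqclass y" using sqclass_self[OF x] eq by simp
  then obtain h where "h \<in> QS_squares S" "x = h \<otimes>\<^bsub>US\<^esub> y" by (auto simp: sqclass_def r_coset_def)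
  moreover then obtain z where "z \<in> Units (QS S)" "h = z \<otimes>\<^bsub>QS S\<^esub> z" by (auto simp: QS_squares_def)
  ultimately show ?thesis using that[of z] y by (simp add: KS.m_comm)
qed

text \<open>Local representatives can be prescribed independently at the places of \<open>S\<close>,
  so square classes correspond to tuples of them, and the local identities with value 4 multiply
  up.\<close>

lemma order_square_classes:
  "real (order (square_classes S)) * S_abs S (diag S 2) = 4 ^ card S"
  and finite_square_classes: "finite (carrier (square_classes S))"
proof -
  obtain R where R: "\<And>v. v \<in> S \<Longrightarrow> completion.square_reps v (R v)"
    "\<And>v. v \<in> S \<Longrightarrow> real (card (R v)) * rat_abs v 2 = 4"
    using square_reps_ex S_place by metis
  have Rfin: "finite (R v)" and Rnz: "0 \<notin> R v"
    and Rex: "\<And>x. x \<in> Units (Qv v) \<Longrightarrow> \<exists>!r. r \<in> R v \<and> (\<exists>y\<in>Units (Qv v). x = emb v r \<otimes>\<^bsub>Qv v\<^esub> (y \<otimes>\<^bsub>Qv v\<^esub> y))"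
    if "v \<in> S" for v
    using R(1)[OF that] unfolding completion.square_reps_def[OF S_completion[OF that]] by auto
  define e where "e = (\<lambda>r. \<lambda>v\<in>S. emb v (r v))"
  have e: "e r \<in> Units (QS S)" if "r \<in> Pi\<^sub>E S R" for r
  proof -
    have "r v \<noteq> 0" if "v \<in> S" for v using \<open>r \<in> Pi\<^sub>E S R\<close> Rnz[OF that] that by (metis PiE_mem)
    thus ?thesis using completion.emb_unit_iff[OF S_completion] completion.emb_closed[OF S_completion]
      by (auto simp: QS_Units_iff QS_simps e_def)
  qed
  have "bij_betw (\<lambda>r. sqclass (e r)) (Pi\<^sub>E S R) (carrier (square_classes S))"
    unfolding bij_betw_def
  proof
    show "inj_on (\<lambda>r. sqclass (e r)) (Pi\<^sub>E S R)"
    proof (rule inj_onI, rule PiE_ext)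
      fix r r' v assume r: "r \<in> Pi\<^sub>E S R" "r' \<in> Pi\<^sub>E S R" "sqclass (e r) = sqclass (e r')" and v: "v \<in> S"
      interpret completion v by (rule S_completion[OF v])
      obtain z where z: "z \<in> Units (QS S)" "e r = e r' \<otimes>\<^bsub>QS S\<^esub> (z \<otimes>\<^bsub>QS S\<^esub> z)"
        using sqclass_eqD[OF e[OF r(1)] e[OF r(2)] r(3)] .
      have "emb v (r v) = emb v (r' v) \<otimes>\<^bsub>K\<^esub> (z v \<otimes>\<^bsub>K\<^esub> z v)"
        using fun_cong[OF z(2), of v] v by (simp add: e_def QS_simps)
      moreover have "emb v (r v) = emb v (r v) \<otimes>\<^bsub>K\<^esub> (\<one>\<^bsub>K\<^esub> \<otimes>\<^bsub>K\<^esub> \<one>\<^bsub>K\<^esub>)" by simp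
      moreover have "emb v (r v) \<in> Units K" using e[OF r(1)] v unfolding QS_Units_iff e_def by (metis restrict_apply')
      moreover have "z v \<in> Units K" using z v by (auto simp: QS_Units_iff)
      moreover have "r v \<in> R v" "r' v \<in> R v" using r v by auto
      ultimately show "r v = r' v" using Rex[OF v, of "emb v (r v)"] K.Units_one_closed by blast
    qed
    show "(\<lambda>r. sqclass (e r)) ` (Pi\<^sub>E S R) = carrier (square_classes S)"
    proof (intro equalityI subsetI)
      fix c assume "c \<in> carrier (square_classes S)"
      then obtain x where x: "x \<in> Units (QS S)" "c = sqclass x" by (auto simp: square_classes_carrier)
      have "\<forall>v\<in>S. \<exists>r y. r \<in> R v \<and> y \<in> Units (Qv v) \<and> x v = emb v r \<otimes>\<^bsub>Qv v\<^esub> (y \<otimes>\<^bsub>Qv v\<^esub> y)"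
        using x Rex by (meson QS_Units_iff)
      then obtain r y where ry: "\<forall>v\<in>S. r v \<in> R v \<and> y v \<in> Units (Qv v) \<and> x v = emb v (r v) \<otimes>\<^bsub>Qv v\<^esub> (y v \<otimes>\<^bsub>Qv v\<^esub> y v)"
        by metis
      let ?r = "restrict r S" let ?y = "restrict y S"
      have rP: "?r \<in> Pi\<^sub>E S R" using ry by auto
      have yU: "?y \<in> Units (QS S)"
        using ry completion.unit_closed[OF S_completion] by (auto simp: QS_Units_iff QS_simps)
      have "x = e ?r \<otimes>\<^bsub>QS S\<^esub> (?y \<otimes>\<^bsub>QS S\<^esub> ?y)"
        using x yU e[OF rP] ry by - (rule QS_eqI, simp, simp, simp add: QS_simps(2) e_def)
      hence "c = sqclass (e ?r)" using sqclass_eqI[OF e[OF rP], of "?y \<otimes>\<^bsub>QS S\<^esub> ?y"] yU x(2)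
        by (auto simp: QS_squares_def)
      thus "c \<in> (\<lambda>r. sqclass (e r)) ` (Pi\<^sub>E S R)" using rP by blast
    qed (use e in \<open>auto simp: square_classes_carrier\<close>)
  qed
  note bij = this
  have "finite (Pi\<^sub>E S R)" using finS Rfin by (rule finite_PiE)
  thus "finite (carrier (square_classes S))" using bij bij_betw_finite by blast
  have "order (square_classes S) = card (Pi\<^sub>E S R)" using bij_betw_same_card[OF bij] by (simp add: order_def)
  also have "\<dots> = (\<Prod>v\<in>S. card (R v))" by (rule card_PiE[OF finS])
  finally have "real (order (square_classes S)) * S_abs S (diag S 2) = (\<Prod>v\<in>S. real (card (R v)) * rat_abs v 2)"
    using completion.Qv_abs_emb[OF S_completion] by (simp add: S_abs_def prod.distrib)
  also have "\<dots> = 4 ^ card S" using R(2) by simp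
  finally show "real (order (square_classes S)) * S_abs S (diag S 2) = 4 ^ card S" .
qed

end

section \<open>Ideles\<close>

abbreviation ideles :: "(place \<Rightarrow> (nat \<Rightarrow> rat) set) set" where "ideles \<equiv> Units adeles"

lemma Qv_unit_closed: "x \<in> Units (Qv v) \<Longrightarrow> x \<in> carrier (Qv v)"
  by (simp add: Units_def)

lemma int_dvd_nat_abs_iff: "int k dvd z \<longleftrightarrow> k dvd nat \<bar>z\<bar>"
proof -
  have "int k dvd z \<longleftrightarrow> int k dvd int (nat \<bar>z\<bar>)" by simp
  thus ?thesis by (simp only: int_dvd_int_iff)
qed

lemma Zp_unit_prime: "prime p \<Longrightarrow> Units (Zp p) = {x \<in> carrier (Qv (FinPlace p)). Qv_abs (FinPlace p) x = 1}"
  by (rule padic.Zp_Units) (simp add: padic_def)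

lemma padicI: "prime p \<Longrightarrow> padic p"
  by (simp add: padic_def)

lemma completionI: "v \<in> places \<Longrightarrow> completion v"
  by (simp add: completion_def)

lemma adeles_simps:
  "carrier adeles = {x \<in> (\<Pi>\<^sub>E v\<in>places. carrier (Qv v)). finite {p. prime p \<and> x (FinPlace p) \<notin> carrier (Zp p)}}"
  "x \<otimes>\<^bsub>adeles\<^esub> y = (\<lambda>v\<in>places. x v \<otimes>\<^bsub>Qv v\<^esub> y v)"
  "\<one>\<^bsub>adeles\<^esub> = (\<lambda>v\<in>places. \<one>\<^bsub>Qv v\<^esub>)"
  by (simp_all add: adeles_def QS_def)

text \<open>An adele with an inverse adele is integral together with its inverse at almost all
  primes, and is then a local unit there. Conversely, inverting componentwise keeps the units of the
  integers at almost all primes.\<close>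

lemma idele_iff:
  "x \<in> ideles \<longleftrightarrow> x \<in> extensional places \<and> (\<forall>v\<in>places. x v \<in> Units (Qv v)) \<and>
     finite {p. prime p \<and> x (FinPlace p) \<notin> Units (Zp p)}"
proof
  assume "x \<in> ideles"
  then obtain y where y: "x \<in> carrier adeles" "y \<in> carrier adeles" "x \<otimes>\<^bsub>adeles\<^esub> y = \<one>\<^bsub>adeles\<^esub>" "y \<otimes>\<^bsub>adeles\<^esub> x = \<one>\<^bsub>adeles\<^esub>"
    by (auto simp: Units_def)
  have c: "x v \<in> carrier (Qv v)" "y v \<in> carrier (Qv v)" if "v \<in> places" for v
    using y that by (auto simp: adeles_simps)
  have xy: "x v \<otimes>\<^bsub>Qv v\<^esub> y v = \<one>\<^bsub>Qv v\<^esub>" "y v \<otimes>\<^bsub>Qv v\<^esub> x v = \<one>\<^bsub>Qv v\<^esub>" if v: "v \<in> places" for v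
    using fun_cong[OF y(3), of v] fun_cong[OF y(4), of v] v by (auto simp: adeles_simps)
  have "x v \<in> Units (Qv v)" if "v \<in> places" for v
    using c[OF that] xy[OF that] unfolding Units_def by blast
  moreover have "finite {p. prime p \<and> x (FinPlace p) \<notin> Units (Zp p)}"
  proof (rule finite_subset)
    show "{p. prime p \<and> x (FinPlace p) \<notin> Units (Zp p)}
        \<subseteq> {p. prime p \<and> x (FinPlace p) \<notin> carrier (Zp p)} \<union> {p. prime p \<and> y (FinPlace p) \<notin> carrier (Zp p)}"
    proof safe
      fix p assume p: "prime p" "y (FinPlace p) \<in> carrier (Zp p)" "x (FinPlace p) \<in> carrier (Zp p)"
        "x (FinPlace p) \<notin> Units (Zp p)"
      interpret padic p by (rule padicI[OF p(1)])
      have "x (FinPlace p) \<in> Units (Zp p)"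
        unfolding Units_def Zp_simps(2,3) using p(2,3) xy[OF place] by blast
      with p show False by simp
    qed
    show "finite ({p. prime p \<and> x (FinPlace p) \<notin> carrier (Zp p)} \<union> {p. prime p \<and> y (FinPlace p) \<notin> carrier (Zp p)})"
      using y by (auto simp: adeles_simps)
  qed
  ultimately show "x \<in> extensional places \<and> (\<forall>v\<in>places. x v \<in> Units (Qv v)) \<and>
     finite {p. prime p \<and> x (FinPlace p) \<notin> Units (Zp p)}"
    using y by (auto simp: adeles_simps PiE_def)
next
  assume x: "x \<in> extensional places \<and> (\<forall>v\<in>places. x v \<in> Units (Qv v)) \<and>
     finite {p. prime p \<and> x (FinPlace p) \<notin> Units (Zp p)}"
  define y where "y = (\<lambda>v\<in>places. inv\<^bsub>Qv v\<^esub> (x v))"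
  have xu: "x v \<in> Units (Qv v)" "x v \<in> carrier (Qv v)" if "v \<in> places" for v
    using x that Qv_unit_closed by auto
  have yu: "y v \<in> carrier (Qv v)" "x v \<otimes>\<^bsub>Qv v\<^esub> y v = \<one>\<^bsub>Qv v\<^esub>" "y v \<otimes>\<^bsub>Qv v\<^esub> x v = \<one>\<^bsub>Qv v\<^esub>" if v: "v \<in> places" for v
  proof -
    interpret completion v by (rule completionI[OF v])
    show "y v \<in> carrier (Qv v)" "x v \<otimes>\<^bsub>Qv v\<^esub> y v = \<one>\<^bsub>Qv v\<^esub>" "y v \<otimes>\<^bsub>Qv v\<^esub> x v = \<one>\<^bsub>Qv v\<^esub>"
      using xu(1)[OF v] v by (simp_all add: y_def)
  qed
  have sub: "{p. prime p \<and> z (FinPlace p) \<notin> carrier (Zp p)} \<subseteq> {p. prime p \<and> x (FinPlace p) \<notin> Units (Zp p)}"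
    if z: "z = x \<or> z = y" for z
  proof safe
    fix p assume p: "prime p" "z (FinPlace p) \<notin> carrier (Zp p)" "x (FinPlace p) \<in> Units (Zp p)"
    interpret padic p by (rule padicI[OF p(1)])
    have "nrm (x (FinPlace p)) = 1" using p(3) by (simp add: Zp_Units)
    moreover from this have "nrm (y (FinPlace p)) = 1"
      using Qv_abs_inv[OF xu(1)[OF place]] p(1) by (simp add: y_def)
    ultimately show False using p(2) z xu(2)[OF place] yu(1)[OF place] by (auto simp: Zp_simps)
  qed
  have "finite {p. prime p \<and> x (FinPlace p) \<notin> carrier (Zp p)}" "finite {p. prime p \<and> y (FinPlace p) \<notin> carrier (Zp p)}"
    using x finite_subset[OF sub] by auto
  moreover have "y \<in> extensional places" by (simp add: y_def)
  ultimately have "x \<in> carrier adeles" "y \<in> carrier adeles"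
    using x xu yu by (auto simp: adeles_simps PiE_def)
  moreover have "x \<otimes>\<^bsub>adeles\<^esub> y = \<one>\<^bsub>adeles\<^esub>" "y \<otimes>\<^bsub>adeles\<^esub> x = \<one>\<^bsub>adeles\<^esub>"
    using yu by (auto simp: adeles_simps intro!: restrict_ext)
  ultimately show "x \<in> ideles" unfolding Units_def by blast
qed

lemma idele_unit: "x \<in> ideles \<Longrightarrow> v \<in> places \<Longrightarrow> x v \<in> Units (Qv v)"
  by (simp add: idele_iff)

lemma idele_closed: "x \<in> ideles \<Longrightarrow> v \<in> places \<Longrightarrow> x v \<in> carrier (Qv v)"
  by (rule Qv_unit_closed[OF idele_unit])

lemma Zp_Units_mult: "prime p \<Longrightarrow> x \<in> Units (Zp p) \<Longrightarrow> y \<in> Units (Zp p) \<Longrightarrow> x \<otimes>\<^bsub>Qv (FinPlace p)\<^esub> y \<in> Units (Zp p)"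
proof -
  assume p: "prime p" and xy: "x \<in> Units (Zp p)" "y \<in> Units (Zp p)"
  interpret padic p by (rule padicI[OF p])
  show ?thesis using xy by (auto simp: Zp_Units Qv_abs_mult)
qed

lemma idele_eqI: "x \<in> ideles \<Longrightarrow> y \<in> ideles \<Longrightarrow> (\<And>v. v \<in> places \<Longrightarrow> x v = y v) \<Longrightarrow> x = y"
  by (meson extensionalityI idele_iff)

lemma Qv_Units_mult: "v \<in> places \<Longrightarrow> x \<in> Units (Qv v) \<Longrightarrow> y \<in> Units (Qv v) \<Longrightarrow> x \<otimes>\<^bsub>Qv v\<^esub> y \<in> Units (Qv v)"
  by (meson Qv_cring cring.axioms(1) monoid.Units_m_closed ring.is_monoid)

lemma idele_mult [simp]: assumes x: "x \<in> ideles" and y: "y \<in> ideles" shows "x \<otimes>\<^bsub>adeles\<^esub> y \<in> ideles"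
proof -
  have "finite {p. prime p \<and> (x \<otimes>\<^bsub>adeles\<^esub> y) (FinPlace p) \<notin> Units (Zp p)}"
    by (rule finite_subset[of _ "{p. prime p \<and> x (FinPlace p) \<notin> Units (Zp p)} \<union> {p. prime p \<and> y (FinPlace p) \<notin> Units (Zp p)}"])
      (use x y in \<open>auto simp: idele_iff adeles_simps Zp_Units_mult\<close>)
  thus ?thesis using x y by (auto simp: idele_iff adeles_simps Qv_Units_mult)
qed

lemma idele_mult_apply: "v \<in> places \<Longrightarrow> (x \<otimes>\<^bsub>adeles\<^esub> y) v = x v \<otimes>\<^bsub>Qv v\<^esub> y v"
  by (simp add: adeles_simps)

lemma Qv_one_unit: "v \<in> places \<Longrightarrow> \<one>\<^bsub>Qv v\<^esub> \<in> Units (Qv v)"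
  by (meson Qv_cring cring.axioms(1) monoid.Units_one_closed ring.is_monoid)

lemma Zp_one_unit: "prime p \<Longrightarrow> \<one>\<^bsub>Qv (FinPlace p)\<^esub> \<in> Units (Zp p)"
proof -
  assume p: "prime p"
  interpret padic p by (rule padicI[OF p])
  show ?thesis by (simp add: Zp_Units)
qed

text \<open>The set \<open>A\<close> may be infinite: an idele is cut into its parts on a finite set
  and on the complement, and both are ideles.\<close>

definition idele_part :: "place set \<Rightarrow> (place \<Rightarrow> (nat \<Rightarrow> rat) set) \<Rightarrow> place \<Rightarrow> (nat \<Rightarrow> rat) set" where
  "idele_part A x = (\<lambda>v\<in>places. if v \<in> A then x v else \<one>\<^bsub>Qv v\<^esub>)"

lemma idele_part_apply: "v \<in> places \<Longrightarrow> idele_part A x v = (if v \<in> A then x v else \<one>\<^bsub>Qv v\<^esub>)"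
  by (simp add: idele_part_def)

lemma idele_part_finite:
  assumes "finite A" "\<And>v. v \<in> A \<Longrightarrow> v \<in> places \<Longrightarrow> x v \<in> Units (Qv v)"
  shows "idele_part A x \<in> ideles"
proof -
  have "finite (FinPlace -` A)" using assms(1) by (rule finite_vimageI) (simp add: inj_on_def)
  hence "finite {p. prime p \<and> idele_part A x (FinPlace p) \<notin> Units (Zp p)}"
    by (rule finite_subset[rotated]) (auto simp: idele_part_def Zp_one_unit)
  thus ?thesis using assms by (auto simp: idele_iff idele_part_def Qv_one_unit)
qed

lemma idele_part_idele [simp]: assumes "x \<in> ideles" shows "idele_part A x \<in> ideles"
proof -
  have "finite {p. prime p \<and> idele_part A x (FinPlace p) \<notin> Units (Zp p)}"
    by (rule finite_subset[of _ "{p. prime p \<and> x (FinPlace p) \<notin> Units (Zp p)}"])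
      (use assms in \<open>auto simp: idele_iff idele_part_def Zp_one_unit\<close>)
  thus ?thesis using assms by (auto simp: idele_iff idele_part_def Qv_one_unit)
qed

lemma idele_at_part: "idele_at v (x v) = idele_part {v} x"
  by (auto simp: idele_at_def idele_part_def intro!: restrict_ext)

lemma idele_at_idele: "v \<in> places \<Longrightarrow> u \<in> Units (Qv v) \<Longrightarrow> idele_at v u \<in> ideles"
  using idele_part_finite[of "{v}" "\<lambda>_. u"] idele_at_part[of v "\<lambda>_. u"] by simp

lemma Qv_r_one: "v \<in> places \<Longrightarrow> x \<in> carrier (Qv v) \<Longrightarrow> x \<otimes>\<^bsub>Qv v\<^esub> \<one>\<^bsub>Qv v\<^esub> = x"
  by (meson Qv_cring cring.axioms(1) monoid.r_one ring.is_monoid)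

lemma Qv_l_one: "v \<in> places \<Longrightarrow> x \<in> carrier (Qv v) \<Longrightarrow> \<one>\<^bsub>Qv v\<^esub> \<otimes>\<^bsub>Qv v\<^esub> x = x"
  by (meson Qv_cring cring.axioms(1) monoid.l_one ring.is_monoid)

lemma Qv_one_closed: "v \<in> places \<Longrightarrow> \<one>\<^bsub>Qv v\<^esub> \<in> carrier (Qv v)"
  by (rule Qv_unit_closed[OF Qv_one_unit])

lemma idele_split:
  assumes x: "x \<in> ideles"
  shows "idele_part A x \<otimes>\<^bsub>adeles\<^esub> idele_part (- A) x = x"
  by (rule idele_eqI) (use x in \<open>auto simp: idele_mult_apply idele_part_apply Qv_r_one Qv_l_one idele_closed\<close>)

lemma idele_part_insert:
  assumes "v \<in> places" "v \<notin> A" "finite A" "\<And>u. u \<in> insert v A \<Longrightarrow> u \<in> places \<Longrightarrow> x u \<in> Units (Qv u)"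
  shows "idele_part (insert v A) x = idele_at v (x v) \<otimes>\<^bsub>adeles\<^esub> idele_part A x"
proof (rule idele_eqI)
  show "idele_part (insert v A) x \<in> ideles" using assms by (intro idele_part_finite) auto
  show "idele_at v (x v) \<otimes>\<^bsub>adeles\<^esub> idele_part A x \<in> ideles"
    using assms by (intro idele_mult idele_at_idele idele_part_finite) auto
  show "idele_part (insert v A) x u = (idele_at v (x v) \<otimes>\<^bsub>adeles\<^esub> idele_part A x) u" if u: "u \<in> places" for u
  proof (cases "u \<in> insert v A")
    case True
    hence "x u \<in> carrier (Qv u)" by (rule Qv_unit_closed[OF assms(4)[OF _ u]])
    thus ?thesis using assms(2) u True by (auto simp: idele_mult_apply idele_part_apply idele_at_def Qv_r_one Qv_l_one)
  qed (use u in \<open>auto simp: idele_mult_apply idele_part_apply idele_at_def Qv_r_one Qv_one_closed\<close>)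
qed

lemma diag_idele: assumes "q \<noteq> 0" shows "diag places q \<in> ideles"
proof -
  obtain a b where ab: "q = of_int a / of_int b" "b > 0" by (rule rat_frac_cases[of q])
  have a0: "a \<noteq> 0" using ab assms by auto
  have "finite {p. prime p \<and> diag places q (FinPlace p) \<notin> Units (Zp p)}"
  proof (rule finite_subset)
    show "{p. prime p \<and> diag places q (FinPlace p) \<notin> Units (Zp p)} \<subseteq> {p. p dvd nat (\<bar>a\<bar> * b)}"
    proof safe
      fix p assume p: "prime p" "diag places q (FinPlace p) \<notin> Units (Zp p)"
      interpret padic p by (rule padicI[OF p(1)])
      have "emb (FinPlace p) q \<notin> Units (Zp p)" using p by (simp add: diag_def)
      hence "vp p q \<noteq> 0" using rat_abs_eq_1_iff[OF assms] by (simp add: Zp_Units)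
      hence "int p dvd a \<or> int p dvd b"
        using vp_frac[OF p(1) a0, of b] ab not_dvd_imp_multiplicity_0 by (metis diff_zero less_irrefl of_nat_0)
      hence "int p dvd \<bar>a\<bar> * b" by (auto intro: dvd_mult2)
      thus "p dvd nat (\<bar>a\<bar> * b)" using ab by (simp add: int_dvd_nat_abs_iff abs_mult)
    qed
    show "finite {p. p dvd nat (\<bar>a\<bar> * b)}" using a0 ab by (intro finite_divisors_nat) auto
  qed
  moreover have "emb v q \<in> Units (Qv v)" if "v \<in> places" for v
    using completion.emb_unit_iff[OF completionI[OF that]] assms by simp
  ultimately show ?thesis by (auto simp: idele_iff diag_def)
qed

section \<open>Idele class characters\<close>

text \<open>The values are nonzero reals at this stage. That signs suffice is deduced later from
  finite groups, not built into the notion.\<close>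

definition ihom :: "((place \<Rightarrow> (nat \<Rightarrow> rat) set) \<Rightarrow> complex) \<Rightarrow> bool" where
  "ihom chi \<longleftrightarrow> (\<forall>x\<in>ideles. chi x \<in> \<real> \<and> chi x \<noteq> 0) \<and>
     (\<forall>x\<in>ideles. \<forall>y\<in>ideles. chi (x \<otimes>\<^bsub>adeles\<^esub> y) = chi x * chi y)"

lemma units_complex: "Units (ring_of_type_algebra :: complex ring) = {z. z \<noteq> 0}"
  "x \<otimes>\<^bsub>units_of (ring_of_type_algebra :: complex ring)\<^esub> y = x * y"
proof -
  show "Units (ring_of_type_algebra :: complex ring) = {z. z \<noteq> 0}"
  proof (intro equalityI subsetI)
    fix z :: complex assume "z \<in> {z. z \<noteq> 0}"
    thus "z \<in> Units (ring_of_type_algebra :: complex ring)"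
      by (auto simp: Units_def ring_of_type_algebra_def intro!: exI[of _ "inverse z"])
  qed (auto simp: Units_def ring_of_type_algebra_def)
qed (simp add: units_of_def ring_of_type_algebra_def)

lemma real_character_ideles: "real_character (units_of adeles) chi \<longleftrightarrow> ihom chi"
proof -
  have m: "x \<otimes>\<^bsub>(ring_of_type_algebra :: complex ring)\<^esub> y = x * y" for x y
    by (simp add: ring_of_type_algebra_def)
  show ?thesis by (auto simp: real_character_def ihom_def hom_def units_complex units_of_mult units_of_carrier m)
qed

lemma ihom_mult: "ihom chi \<Longrightarrow> x \<in> ideles \<Longrightarrow> y \<in> ideles \<Longrightarrow> chi (x \<otimes>\<^bsub>adeles\<^esub> y) = chi x * chi y"
  by (simp add: ihom_def)

lemma one_idele: "\<one>\<^bsub>adeles\<^esub> \<in> ideles"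
  by (auto simp: idele_iff adeles_simps Qv_one_unit Zp_one_unit)

lemma idele_part_empty: "idele_part {} x = \<one>\<^bsub>adeles\<^esub>"
  by (auto simp: idele_part_def adeles_simps)

lemma idele_l_one: "x \<in> ideles \<Longrightarrow> \<one>\<^bsub>adeles\<^esub> \<otimes>\<^bsub>adeles\<^esub> x = x"
  by (rule idele_eqI) (auto simp: one_idele idele_mult_apply Qv_l_one idele_closed, simp_all add: adeles_simps Qv_l_one idele_closed)

lemma ihom_one: assumes "ihom chi" shows "chi \<one>\<^bsub>adeles\<^esub> = 1"
proof -
  have "chi \<one>\<^bsub>adeles\<^esub> = chi \<one>\<^bsub>adeles\<^esub> * chi \<one>\<^bsub>adeles\<^esub>"
    using ihom_mult[OF assms one_idele one_idele] idele_l_one[OF one_idele] by simp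
  moreover have "chi \<one>\<^bsub>adeles\<^esub> \<noteq> 0" using assms one_idele by (simp add: ihom_def)
  ultimately show ?thesis by simp
qed

text \<open>Induction over \<open>A\<close>, which has to be finite: a homomorphism alone controls
  finitely many components only, and the others are reached through continuity.\<close>

lemma ihom_part:
  assumes chi: "ihom chi" and A: "finite A" "A \<subseteq> places" "\<And>v. v \<in> A \<Longrightarrow> x v \<in> Units (Qv v)"
  shows "chi (idele_part A x) = (\<Prod>v\<in>A. local_component chi v (x v))"
  using A
proof (induction A rule: finite_induct)
  case empty
  thus ?case by (simp add: idele_part_empty ihom_one[OF chi])
next
  case (insert v A)
  have "idele_at v (x v) \<in> ideles" "idele_part A x \<in> ideles"
    using insert by (auto intro!: idele_at_idele idele_part_finite)
  from ihom_mult[OF chi this]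
  have "chi (idele_part (insert v A) x) = chi (idele_at v (x v)) * chi (idele_part A x)"
    using insert by (subst idele_part_insert) auto
  thus ?case using insert by (simp add: local_component_def)
qed

lemma Qv_metric: assumes v: "v \<in> places" shows "Metric_space (carrier (Qv v)) (Qv_dist v)"
proof -
  interpret completion v by (rule completionI[OF v])
  show ?thesis
  proof
    show "0 \<le> Qv_dist v x y" for x y by (simp add: Qv_dist_def)
    show "Qv_dist v x y = Qv_dist v y x" for x y by (simp add: Qv_dist_def Qv_abs_minus_commute)
    show "Qv_dist v x y = 0 \<longleftrightarrow> x = y" if "x \<in> carrier K" "y \<in> carrier K" for x y
      using that by (simp add: Qv_dist_def Qv_abs_eq_0_iff)
    show "Qv_dist v x z \<le> Qv_dist v x y + Qv_dist v y z"
      if "x \<in> carrier K" "y \<in> carrier K" "z \<in> carrier K" for x y z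
      using that Qv_abs_add[of "x \<ominus>\<^bsub>K\<^esub> y" "y \<ominus>\<^bsub>K\<^esub> z"] by (simp add: Qv_dist_def flip: minus_split)
  qed
qed

lemma Qv_open_iff:
  assumes v: "v \<in> places"
  shows "openin (Qv_topology v) U \<longleftrightarrow> U \<subseteq> carrier (Qv v) \<and>
    (\<forall>x\<in>U. \<exists>r>0. \<forall>y\<in>carrier (Qv v). Qv_abs v (y \<ominus>\<^bsub>Qv v\<^esub> x) < r \<longrightarrow> y \<in> U)"
proof -
  interpret completion v by (rule completionI[OF v])
  interpret Metric_space "carrier K" "Qv_dist v" by (rule Qv_metric[OF v])
  have "mball x r \<subseteq> U \<longleftrightarrow> (\<forall>y\<in>carrier K. Qv_abs v (y \<ominus>\<^bsub>K\<^esub> x) < r \<longrightarrow> y \<in> U)" if "x \<in> carrier K" for x r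
    using that by (auto simp: mball_def Qv_dist_def Qv_abs_minus_commute)
  thus ?thesis unfolding Qv_topology_def openin_mtopology by blast
qed

section \<open>Neighbourhoods of 1 in the idele group\<close>

definition idele_box :: "(place \<Rightarrow> (nat \<Rightarrow> rat) set set) \<Rightarrow> bool" where
  "idele_box U \<longleftrightarrow> (\<forall>v\<in>places. openin (Qv_topology v) (U v) \<and> U v \<subseteq> Units (Qv v)) \<and>
     finite {p. prime p \<and> U (FinPlace p) \<noteq> Units (Zp p)}"

lemma idele_topology_eq: "idele_topology = topology_generated_by {Pi\<^sub>E places U | U. idele_box U}"
  by (simp add: idele_topology_def idele_box_def)

lemma idele_box_inter: assumes "idele_box U" "idele_box V" shows "idele_box (\<lambda>v. U v \<inter> V v)"
proof -
  have "finite {p. prime p \<and> U (FinPlace p) \<inter> V (FinPlace p) \<noteq> Units (Zp p)}"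
    by (rule finite_subset[of _ "{p. prime p \<and> U (FinPlace p) \<noteq> Units (Zp p)} \<union> {p. prime p \<and> V (FinPlace p) \<noteq> Units (Zp p)}"])
      (use assms in \<open>auto simp: idele_box_def\<close>)
  thus ?thesis using assms by (auto simp: idele_box_def)
qed

text \<open>Boxes are closed under intersection, so the generating family is a base of the topology
  and not merely a subbase.\<close>

lemma idele_nbhd_box:
  assumes "openin idele_topology W" "x \<in> W"
  obtains U where "idele_box U" "x \<in> Pi\<^sub>E places U" "Pi\<^sub>E places U \<subseteq> W"
proof -
  have "generate_topology_on {Pi\<^sub>E places U | U. idele_box U} W"
    using assms(1) unfolding idele_topology_eq by (rule openin_topology_generated_by)
  hence "x \<in> W \<Longrightarrow> \<exists>U. idele_box U \<and> x \<in> Pi\<^sub>E places U \<and> Pi\<^sub>E places U \<subseteq> W"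
  proof (induction rule: generate_topology_on.induct)
    case (Int a b)
    then obtain U V where UV: "idele_box U" "x \<in> Pi\<^sub>E places U" "Pi\<^sub>E places U \<subseteq> a"
      "idele_box V" "x \<in> Pi\<^sub>E places V" "Pi\<^sub>E places V \<subseteq> b" by blast
    have "Pi\<^sub>E places (\<lambda>v. U v \<inter> V v) = Pi\<^sub>E places U \<inter> Pi\<^sub>E places V" by (auto simp: PiE_iff)
    thus ?case using UV by (intro exI[of _ "\<lambda>v. U v \<inter> V v"]) (auto simp only: idele_box_inter)
  next
    case (UN K)
    then obtain k where k: "k \<in> K" "x \<in> k" by blast
    obtain U where "idele_box U" "x \<in> Pi\<^sub>E places U" "Pi\<^sub>E places U \<subseteq> k" using UN.IH[OF k] by blast
    thus ?case using k(1) by (intro exI[of _ U]) blast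
  next
    case (Basis s)
    thus ?case by blast
  qed simp
  thus ?thesis using that assms(2) by blast
qed

lemma idele_open_box: "idele_box U \<Longrightarrow> openin idele_topology (Pi\<^sub>E places U)"
  unfolding idele_topology_eq by (rule topology_generated_by_Basis) blast

lemma idele_box_subset: assumes "idele_box U" shows "Pi\<^sub>E places U \<subseteq> ideles"
proof
  fix x assume x: "x \<in> Pi\<^sub>E places U"
  have "finite {p. prime p \<and> x (FinPlace p) \<notin> Units (Zp p)}"
    by (rule finite_subset[of _ "{p. prime p \<and> U (FinPlace p) \<noteq> Units (Zp p)}"])
      (use assms x in \<open>auto simp: idele_box_def\<close>)
  thus "x \<in> ideles" using x assms by (auto simp: idele_iff idele_box_def PiE_iff)
qed

text \<open>At primes outside \<open>T\<close> arbitrary integral units are allowed, and at infinity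
  only 1. The set is closed under multiplication, so it contains all powers of its elements, while
  for suitable \<open>T\<close> and \<open>N\<close> it fits into a given neighbourhood of
  1.\<close>

definition small_ideles :: "nat set \<Rightarrow> nat \<Rightarrow> (place \<Rightarrow> (nat \<Rightarrow> rat) set) set" where
  "small_ideles T N = {x \<in> ideles. x InfPlace = \<one>\<^bsub>Qv InfPlace\<^esub> \<and>
     (\<forall>p. prime p \<longrightarrow> x (FinPlace p) \<in> Units (Zp p)) \<and>
     (\<forall>p\<in>T. prime p \<longrightarrow> Qv_abs (FinPlace p) (x (FinPlace p) \<ominus>\<^bsub>Qv (FinPlace p)\<^esub> \<one>\<^bsub>Qv (FinPlace p)\<^esub>) \<le> 1 / real p ^ N)}"

lemma (in padic) close_mult:
  assumes "x \<in> carrier K" "y \<in> carrier K" "a \<in> carrier K" "b \<in> carrier K" "nrm y \<le> 1" "nrm a \<le> 1"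
    "nrm (x \<ominus>\<^bsub>K\<^esub> a) \<le> e" "nrm (y \<ominus>\<^bsub>K\<^esub> b) \<le> e"
  shows "nrm (x \<otimes>\<^bsub>K\<^esub> y \<ominus>\<^bsub>K\<^esub> a \<otimes>\<^bsub>K\<^esub> b) \<le> e"
proof (rule nrm_ultra_trans)
  have e: "e \<ge> 0" using Qv_abs_nonneg[OF K.minus_closed[OF assms(1,3)]] assms(7) by linarith
  have "x \<otimes>\<^bsub>K\<^esub> y \<ominus>\<^bsub>K\<^esub> a \<otimes>\<^bsub>K\<^esub> y = (x \<ominus>\<^bsub>K\<^esub> a) \<otimes>\<^bsub>K\<^esub> y"
    using assms by (simp add: a_minus_def K.l_distr K.l_minus)
  hence "nrm (x \<otimes>\<^bsub>K\<^esub> y \<ominus>\<^bsub>K\<^esub> a \<otimes>\<^bsub>K\<^esub> y) = nrm (x \<ominus>\<^bsub>K\<^esub> a) * nrm y" using assms by (simp add: Qv_abs_mult)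
  also have "\<dots> \<le> e * 1" using assms e by (intro mult_mono) auto
  finally show "nrm (x \<otimes>\<^bsub>K\<^esub> y \<ominus>\<^bsub>K\<^esub> a \<otimes>\<^bsub>K\<^esub> y) \<le> e" by simp
  have "a \<otimes>\<^bsub>K\<^esub> y \<ominus>\<^bsub>K\<^esub> a \<otimes>\<^bsub>K\<^esub> b = a \<otimes>\<^bsub>K\<^esub> (y \<ominus>\<^bsub>K\<^esub> b)"
    using assms by (simp add: a_minus_def K.r_distr K.r_minus)
  hence "nrm (a \<otimes>\<^bsub>K\<^esub> y \<ominus>\<^bsub>K\<^esub> a \<otimes>\<^bsub>K\<^esub> b) = nrm a * nrm (y \<ominus>\<^bsub>K\<^esub> b)" using assms by (simp add: Qv_abs_mult)
  also have "\<dots> \<le> 1 * e" using assms e by (intro mult_mono) auto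
  finally show "nrm (a \<otimes>\<^bsub>K\<^esub> y \<ominus>\<^bsub>K\<^esub> a \<otimes>\<^bsub>K\<^esub> b) \<le> e" by simp
qed (use assms in auto)

lemma small_ideles_mult:
  assumes "x \<in> small_ideles T N" "y \<in> small_ideles T N" shows "x \<otimes>\<^bsub>adeles\<^esub> y \<in> small_ideles T N"
proof -
  have xy: "x \<in> ideles" "y \<in> ideles" using assms by (auto simp: small_ideles_def)
  have "Qv_abs (FinPlace p) ((x \<otimes>\<^bsub>adeles\<^esub> y) (FinPlace p) \<ominus>\<^bsub>Qv (FinPlace p)\<^esub> \<one>\<^bsub>Qv (FinPlace p)\<^esub>) \<le> 1 / real p ^ N"
    if p: "p \<in> T" "prime p" for p
  proof -
    interpret padic p by (rule padicI[OF p(2)])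
    have u: "x (FinPlace p) \<in> Units (Zp p)" "y (FinPlace p) \<in> Units (Zp p)"
      "nrm (x (FinPlace p) \<ominus>\<^bsub>K\<^esub> \<one>\<^bsub>K\<^esub>) \<le> 1 / real p ^ N" "nrm (y (FinPlace p) \<ominus>\<^bsub>K\<^esub> \<one>\<^bsub>K\<^esub>) \<le> 1 / real p ^ N"
      using assms p unfolding small_ideles_def by blast+
    have "nrm (x (FinPlace p) \<otimes>\<^bsub>K\<^esub> y (FinPlace p) \<ominus>\<^bsub>K\<^esub> \<one>\<^bsub>K\<^esub> \<otimes>\<^bsub>K\<^esub> \<one>\<^bsub>K\<^esub>) \<le> 1 / real p ^ N"
      using u by (intro close_mult) (auto simp: Zp_Units)
    thus ?thesis by (simp add: idele_mult_apply[OF place])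
  qed
  moreover have "(x \<otimes>\<^bsub>adeles\<^esub> y) (FinPlace p) \<in> Units (Zp p)" if "prime p" for p
    using assms that by (simp add: small_ideles_def idele_mult_apply Zp_Units_mult)
  moreover have "(x \<otimes>\<^bsub>adeles\<^esub> y) InfPlace = \<one>\<^bsub>Qv InfPlace\<^esub>"
    using assms by (simp add: small_ideles_def idele_mult_apply Qv_l_one Qv_one_closed)
  ultimately show ?thesis using xy unfolding small_ideles_def by simp
qed

text \<open>A neighbourhood of 1 contains an open subgroup, and \<open>\<real>\<^sup>\<times>\<close> has no small subgroups.\<close>
lemma continuous_character_trivial_near_one:
  assumes chi: "ihom chi" and cont: "continuous_map idele_topology euclidean chi"
  obtains T N where "finite T" "\<And>x. x \<in> small_ideles T N \<Longrightarrow> chi x = 1"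
proof -
  define W where "W = {x \<in> topspace idele_topology. chi x \<in> ball 1 (1/2)}"
  have W: "openin idele_topology W"
    unfolding W_def using cont by (rule openin_continuous_map_preimage) simp
  have whole: "\<one>\<^bsub>adeles\<^esub> \<in> topspace idele_topology"
  proof -
    have box: "idele_box (\<lambda>v. case v of InfPlace \<Rightarrow> Units (Qv v) | FinPlace p \<Rightarrow> Units (Zp p))"
      unfolding idele_box_def
    proof (intro conjI ballI)
      fix v assume v: "v \<in> places"
      let ?U = "case v of InfPlace \<Rightarrow> Units (Qv v) | FinPlace p \<Rightarrow> Units (Zp p)"
      show "?U \<subseteq> Units (Qv v)"
        using v by (cases v) (auto dest: padic.Zp_Units_subset[OF padicI, THEN subsetD])
      show "openin (Qv_topology v) ?U"
        using v
      proof (cases rule: place_cases)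
        case 1
        interpret completion InfPlace by (rule completionI) simp
        show ?thesis unfolding Qv_open_iff[OF v]
        proof (intro conjI ballI)
          fix x assume x: "x \<in> ?U"
          hence x: "x \<in> Units K" by (simp add: 1)
          have "y \<in> Units K" if y: "y \<in> carrier K" "Qv_abs InfPlace (y \<ominus>\<^bsub>K\<^esub> x) < Qv_abs InfPlace x" for y
          proof (rule ccontr)
            assume "y \<notin> Units K"
            hence "y = \<zero>\<^bsub>K\<^esub>" using y by (simp add: K_Units)
            hence "Qv_abs InfPlace (y \<ominus>\<^bsub>K\<^esub> x) = Qv_abs InfPlace x"
              using x by (simp add: a_minus_def Qv_abs_uminus)
            thus False using y by simp
          qed
          thus "\<exists>r>0. \<forall>y\<in>carrier (Qv v). Qv_abs v (y \<ominus>\<^bsub>Qv v\<^esub> x) < r \<longrightarrow> y \<in> ?U"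
            using unit_abs_pos[OF x] unfolding 1 by (intro exI[of _ "Qv_abs InfPlace x"]) auto
        qed (auto simp: 1)
      next
        case (2 p)
        interpret padic p by (rule padicI[OF 2(2)])
        show ?thesis unfolding Qv_open_iff[OF v]
        proof (intro conjI ballI)
          fix x assume "x \<in> ?U"
          hence x: "x \<in> carrier K" "nrm x = 1" by (auto simp: 2 Zp_Units)
          have "nrm y = 1" if y: "y \<in> carrier K" "nrm (y \<ominus>\<^bsub>K\<^esub> x) < 1" for y
            using nrm_eq_of_close[of x y] y x Qv_abs_minus_commute[of x y] by simp
          thus "\<exists>r>0. \<forall>y\<in>carrier (Qv v). Qv_abs v (y \<ominus>\<^bsub>Qv v\<^esub> x) < r \<longrightarrow> y \<in> ?U"
            unfolding 2 by (intro exI[of _ 1]) (auto simp: Zp_Units)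
        qed (auto simp: 2 Zp_Units)
      qed
    qed auto
    have "\<one>\<^bsub>adeles\<^esub> \<in> Pi\<^sub>E places (\<lambda>v. case v of InfPlace \<Rightarrow> Units (Qv v) | FinPlace p \<Rightarrow> Units (Zp p))"
      by (auto simp: adeles_simps Qv_one_unit Zp_one_unit split: place.split)
    thus ?thesis using openin_subset[OF idele_open_box[OF box]] by blast
  qed
  hence "\<one>\<^bsub>adeles\<^esub> \<in> W" using ihom_one[OF chi] by (simp add: W_def)
  then obtain U where U: "idele_box U" "\<one>\<^bsub>adeles\<^esub> \<in> Pi\<^sub>E places U" "Pi\<^sub>E places U \<subseteq> W"
    using idele_nbhd_box[OF W] by blast
  define T where "T = {p. prime p \<and> U (FinPlace p) \<noteq> Units (Zp p)}"
  have finT: "finite T" using U(1) by (simp add: T_def idele_box_def)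
  have "\<exists>n. \<forall>y\<in>carrier (Qv (FinPlace p)). Qv_abs (FinPlace p) (y \<ominus>\<^bsub>Qv (FinPlace p)\<^esub> \<one>\<^bsub>Qv (FinPlace p)\<^esub>) \<le> 1 / real p ^ n \<longrightarrow> y \<in> U (FinPlace p)"
    if p: "p \<in> T" for p
  proof -
    have pr: "prime p" using p by (simp add: T_def)
    interpret padic p by (rule padicI[OF pr])
    have "\<one>\<^bsub>K\<^esub> \<in> U (FinPlace p)" using U(2) place by (auto simp: adeles_simps PiE_iff)
    moreover have "openin (Qv_topology (FinPlace p)) (U (FinPlace p))" using U(1) place by (simp add: idele_box_def)
    ultimately obtain r where r: "r > 0" "\<forall>y\<in>carrier K. nrm (y \<ominus>\<^bsub>K\<^esub> \<one>\<^bsub>K\<^esub>) < r \<longrightarrow> y \<in> U (FinPlace p)"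
      unfolding Qv_open_iff[OF place] by blast
    obtain n where "(1 / real p) ^ n < r" using real_arch_pow_inv[OF r(1), of "1 / real p"] p_gt_1 by auto
    hence "1 / real p ^ n < r" by (simp add: power_divide)
    thus ?thesis using r(2) by (intro exI[of _ n]) (meson le_less_trans)
  qed
  then obtain g where g: "\<And>p y. p \<in> T \<Longrightarrow> y \<in> carrier (Qv (FinPlace p)) \<Longrightarrow>
      Qv_abs (FinPlace p) (y \<ominus>\<^bsub>Qv (FinPlace p)\<^esub> \<one>\<^bsub>Qv (FinPlace p)\<^esub>) \<le> 1 / real p ^ g p \<Longrightarrow> y \<in> U (FinPlace p)"
    by metis
  \<comment> \<open>The sum bounds every single exponent \<open>g p\<close>, so one \<open>N\<close>
    serves all of the finite set \<open>T\<close>.\<close>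
  define N where "N = (\<Sum>p\<in>T. g p)"
  have sub: "small_ideles T N \<subseteq> W"
  proof
    fix x assume x: "x \<in> small_ideles T N"
    have "x v \<in> U v" if v: "v \<in> places" for v
      using v
    proof (cases rule: place_cases)
      case 1
      thus ?thesis using x U(2) by (auto simp: small_ideles_def adeles_simps PiE_iff)
    next
      case (2 p)
      show ?thesis
      proof (cases "p \<in> T")
        case True
        have "g p \<le> N" unfolding N_def using finT True by (intro member_le_sum) auto
        hence "1 / real p ^ N \<le> 1 / real p ^ g p"
          using prime_gt_0_nat[OF 2(2)] by (intro divide_left_mono power_increasing) auto
        thus ?thesis using g[OF True, of "x (FinPlace p)"] x True 2 idele_closed[of x "FinPlace p"]
          by (fastforce simp: small_ideles_def)
      next
        case False
        thus ?thesis using x 2 by (auto simp: T_def small_ideles_def)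
      qed
    qed
    hence "x \<in> Pi\<^sub>E places U" using x by (auto simp: small_ideles_def idele_iff PiE_def)
    thus "x \<in> W" using U(3) by blast
  qed
  have "chi x = 1" if x: "x \<in> small_ideles T N" for x
  proof -
    \<comment> \<open>All powers of the real number \<open>chi x\<close> stay within 1/2 of 1. A
      number above 1 has powers exceeding 2 and a number between 1/2 and 1 has powers below 1/2, so
      \<open>chi x\<close> is 1.\<close>
    have "\<exists>y\<in>small_ideles T N. chi y = chi x ^ Suc n" for n
    proof (induction n)
      case (Suc n)
      then obtain y where y: "y \<in> small_ideles T N" "chi y = chi x ^ Suc n" by blast
      have "chi (x \<otimes>\<^bsub>adeles\<^esub> y) = chi x ^ Suc (Suc n)"
        using x y by (simp add: ihom_mult[OF chi] small_ideles_def)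
      thus ?case using small_ideles_mult[OF x y(1)] by blast
    qed (use x in auto)
    note pw = this
    have near: "dist 1 (chi x ^ Suc n) < 1 / 2" for n
    proof -
      obtain y where "y \<in> small_ideles T N" "chi y = chi x ^ Suc n" using pw[of n] by blast
      thus ?thesis using sub unfolding W_def by (auto simp del: power_Suc)
    qed
    have "chi x \<in> \<real>" using chi x by (simp add: ihom_def small_ideles_def)
    then obtain z where z: "chi x = of_real z" by (auto simp: Reals_def)
    have near': "\<bar>1 - z ^ Suc n\<bar> < 1 / 2" for n
    proof -
      have "dist 1 (chi x ^ Suc n) = norm (of_real (1 - z ^ Suc n) :: complex)"
        by (simp add: z dist_norm)
      thus ?thesis using near[of n] by (simp only: norm_of_real)
    qed
    have zpos: "z > 1 / 2" using near'[of 0] by (auto simp: abs_if split: if_splits)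
    have "\<not> z > 1"
    proof
      assume z1: "z > 1"
      obtain n where "2 < z ^ n" using real_arch_pow[OF z1] by blast
      moreover have "z ^ n \<le> z ^ Suc n" using z1 by (intro power_increasing) auto
      ultimately show False using near'[of n] unfolding abs_less_iff by linarith
    qed
    moreover have "\<not> z < 1"
    proof
      assume z1: "z < 1"
      obtain n where "z ^ n < 1 / 2" using real_arch_pow_inv[OF _ z1, of "1 / 2"] by auto
      moreover have "z ^ Suc n \<le> z ^ n" using z1 zpos by (intro power_decreasing) auto
      ultimately show False using near'[of n] unfolding abs_less_iff by linarith
    qed
    ultimately show ?thesis using z by simp
  qed
  thus ?thesis using that finT by blast
qed

lemma (in completion) minus_self [simp]: "x \<in> carrier K \<Longrightarrow> x \<ominus>\<^bsub>K\<^esub> x = \<zero>\<^bsub>K\<^esub>"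
  by (simp add: a_minus_def K.r_neg)

lemma idele_inverse:
  assumes b: "b \<in> ideles"
  obtains c where "c \<in> ideles" "\<And>v. v \<in> places \<Longrightarrow> c v = inv\<^bsub>Qv v\<^esub> (b v)"
proof -
  define c where "c = (\<lambda>v\<in>places. inv\<^bsub>Qv v\<^esub> (b v))"
  have cv: "c v \<in> Units (Qv v)" if v: "v \<in> places" for v
  proof -
    interpret completion v by (rule completionI[OF v])
    show ?thesis using idele_unit[OF b v] v by (simp add: c_def)
  qed
  have "finite {p. prime p \<and> c (FinPlace p) \<notin> Units (Zp p)}"
  proof (rule finite_subset)
    show "{p. prime p \<and> c (FinPlace p) \<notin> Units (Zp p)} \<subseteq> {p. prime p \<and> b (FinPlace p) \<notin> Units (Zp p)}"
    proof safe
      fix p assume p: "prime p" "b (FinPlace p) \<in> Units (Zp p)" "c (FinPlace p) \<notin> Units (Zp p)"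
      interpret padic p by (rule padicI[OF p(1)])
      have "nrm (c (FinPlace p)) = 1"
        using p(2) Qv_abs_inv[OF idele_unit[OF b place]] p(1) by (simp add: c_def Zp_Units)
      thus False using p(3) cv[OF place] by (auto simp: Zp_Units)
    qed
  qed (use b in \<open>simp add: idele_iff\<close>)
  hence "c \<in> ideles" using cv by (auto simp: idele_iff c_def)
  thus ?thesis using that by (simp add: c_def)
qed

lemma int_dvd_of_local:
  assumes n: "n > 0" and z: "\<And>p. prime p \<Longrightarrow> p dvd n \<Longrightarrow> int p ^ multiplicity p n dvd z"
  shows "int n dvd z"
proof (cases "z = 0")
  case False
  have "n dvd nat \<bar>z\<bar>"
  proof (rule multiplicity_le_imp_dvd)
    fix p :: nat assume p: "prime p"
    show "multiplicity p n \<le> multiplicity p (nat \<bar>z\<bar>)"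
    proof (cases "p dvd n")
      case True
      have "int (p ^ multiplicity p n) dvd z" unfolding of_nat_power by (rule z[OF p True])
      hence d: "p ^ multiplicity p n dvd nat \<bar>z\<bar>" unfolding int_dvd_nat_abs_iff .
      have "\<not> is_unit p" "nat \<bar>z\<bar> \<noteq> 0" using p False by auto
      thus ?thesis using d power_dvd_iff_le_multiplicity by blast
    qed (simp add: not_dvd_imp_multiplicity_0)
  qed (use n in auto)
  thus ?thesis unfolding int_dvd_nat_abs_iff .
qed simp

section \<open>Approximation of ideles by a rational number and a residue class\<close>

context place_set
begin

abbreviation "QQ \<equiv> coprime_nats SP"

lemma QQ_pos: "n \<in> QQ \<Longrightarrow> n > 0"
  by (simp add: coprime_nats_def)

lemma QQ_prime_notin: "n \<in> QQ \<Longrightarrow> prime p \<Longrightarrow> p dvd n \<Longrightarrow> p \<notin> SP"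
  by (auto simp: coprime_nats_def)

lemma prime_QQ: "prime p \<Longrightarrow> p \<notin> SP \<Longrightarrow> p \<in> QQ"
  using SP_prime by (auto simp: coprime_nats_def prime_gt_0_nat dest: primes_dvd_imp_eq)

text \<open>The component of x / q at \<open>v\<close>, kept as a function of the place so that the
  part on \<open>S\<close> and the parts at the other primes can be read off separately.\<close>

definition quot_comp :: "(place \<Rightarrow> (nat \<Rightarrow> rat) set) \<Rightarrow> rat \<Rightarrow> place \<Rightarrow> (nat \<Rightarrow> rat) set" where
  "quot_comp x q v = x v \<otimes>\<^bsub>Qv v\<^esub> emb v (inverse q)"

definition S_quot :: "(place \<Rightarrow> (nat \<Rightarrow> rat) set) \<Rightarrow> rat \<Rightarrow> place \<Rightarrow> (nat \<Rightarrow> rat) set" where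
  "S_quot x q = restrict (quot_comp x q) S"

text \<open>The idele \<open>x / q\<close> is a unit outside \<open>S\<close> and congruent to the integer \<open>r\<close> modulo \<open>n\<close>.\<close>
definition approx :: "nat \<Rightarrow> (place \<Rightarrow> (nat \<Rightarrow> rat) set) \<Rightarrow> rat \<Rightarrow> int \<Rightarrow> bool" where
  "approx n x q r \<longleftrightarrow> q \<noteq> 0 \<and> coprime r (int n) \<and>
     (\<forall>p. prime p \<longrightarrow> p \<notin> SP \<longrightarrow> Qv_abs (FinPlace p) (quot_comp x q (FinPlace p)) = 1 \<and>
        Qv_abs (FinPlace p) (quot_comp x q (FinPlace p) \<ominus>\<^bsub>Qv (FinPlace p)\<^esub> emb (FinPlace p) (of_int r))
          \<le> 1 / real p ^ multiplicity p n)"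

lemma quot_comp_closed:
  assumes "x \<in> ideles" "v \<in> places" shows "quot_comp x q v \<in> carrier (Qv v)"
proof -
  interpret completion v by (rule completionI[OF assms(2)])
  show ?thesis using assms by (simp add: quot_comp_def idele_closed)
qed

lemma quot_comp_unit:
  assumes "x \<in> ideles" "v \<in> places" "q \<noteq> 0" shows "quot_comp x q v \<in> Units (Qv v)"
proof -
  interpret completion v by (rule completionI[OF assms(2)])
  show ?thesis using assms by (simp add: quot_comp_def idele_unit)
qed

lemma quot_comp_mult:
  assumes "x \<in> ideles" "y \<in> ideles" "v \<in> places"
  shows "quot_comp (x \<otimes>\<^bsub>adeles\<^esub> y) (q * r) v = quot_comp x q v \<otimes>\<^bsub>Qv v\<^esub> quot_comp y r v"
proof -
  interpret completion v by (rule completionI[OF assms(3)])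
  have xy: "x v \<in> carrier K" "y v \<in> carrier K" using assms by (auto simp: idele_closed)
  have "emb v (inverse (q * r)) = emb v (inverse q) \<otimes>\<^bsub>K\<^esub> emb v (inverse r)"
    by (simp add: emb_mult)
  thus ?thesis using xy assms by (simp add: quot_comp_def idele_mult_apply K.m_ac)
qed

lemma quot_comp_diag:
  assumes "q \<noteq> 0" "v \<in> places"
  shows "quot_comp (diag places q) q v = \<one>\<^bsub>Qv v\<^esub>"
proof -
  interpret completion v by (rule completionI[OF assms(2)])
  show ?thesis using assms by (simp add: quot_comp_def diag_def flip: emb_mult)
qed

lemma quot_comp_one:
  assumes "x \<in> ideles" "v \<in> places"
  shows "quot_comp x 1 v = x v"
proof -
  interpret completion v by (rule completionI[OF assms(2)])
  show ?thesis using assms by (simp add: quot_comp_def idele_closed)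
qed

lemma S_quot_unit: assumes "x \<in> ideles" "q \<noteq> 0" shows "S_quot x q \<in> Units (QS S)"
  using assms quot_comp_unit[OF assms(1) S_place assms(2)] quot_comp_closed[OF assms(1) S_place]
  by (auto simp: QS_Units_iff QS_simps S_quot_def)

lemma S_quot_mult:
  assumes "x \<in> ideles" "y \<in> ideles"
  shows "S_quot (x \<otimes>\<^bsub>adeles\<^esub> y) (q * r) = S_quot x q \<otimes>\<^bsub>QS S\<^esub> S_quot y r"
  by (auto simp: S_quot_def QS_simps quot_comp_mult[OF assms S_place] intro!: restrict_ext)

lemma approx_mult:
  assumes x: "x \<in> ideles" and y: "y \<in> ideles" and "approx n x q r" "approx n y q' r'"
  shows "approx n (x \<otimes>\<^bsub>adeles\<^esub> y) (q * q') (r * r')"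
  unfolding approx_def
proof (intro conjI allI impI)
  fix p assume p: "prime p" "p \<notin> SP"
  interpret padic p by (rule padicI[OF p(1)])
  let ?v = "FinPlace p"
  have c: "quot_comp x q ?v \<in> carrier K" "quot_comp y q' ?v \<in> carrier K"
    using quot_comp_closed x y place by auto
  have a: "nrm (quot_comp x q ?v) = 1" "nrm (quot_comp y q' ?v) = 1"
    "nrm (quot_comp x q ?v \<ominus>\<^bsub>K\<^esub> emb ?v (of_int r)) \<le> 1 / real p ^ multiplicity p n"
    "nrm (quot_comp y q' ?v \<ominus>\<^bsub>K\<^esub> emb ?v (of_int r')) \<le> 1 / real p ^ multiplicity p n"
    using assms p by (auto simp: approx_def)
  show "nrm (quot_comp (x \<otimes>\<^bsub>adeles\<^esub> y) (q * q') ?v) = 1"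
    using a c by (simp add: quot_comp_mult[OF x y place] Qv_abs_mult)
  have "nrm (quot_comp x q ?v \<otimes>\<^bsub>K\<^esub> quot_comp y q' ?v \<ominus>\<^bsub>K\<^esub> emb ?v (of_int r) \<otimes>\<^bsub>K\<^esub> emb ?v (of_int r'))
      \<le> 1 / real p ^ multiplicity p n"
    using a c rat_abs_int_le_1 by (intro close_mult) auto
  thus "nrm (quot_comp (x \<otimes>\<^bsub>adeles\<^esub> y) (q * q') ?v \<ominus>\<^bsub>K\<^esub> emb ?v (of_int (r * r'))) \<le> 1 / real p ^ multiplicity p n"
    by (simp only: quot_comp_mult[OF x y place] of_int_mult emb_mult)
qed (use assms in \<open>auto simp: approx_def\<close>)

lemma approx_diag: assumes "q \<noteq> 0" shows "approx n (diag places q) q 1"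
  unfolding approx_def
proof (intro conjI allI impI)
  fix p assume p: "prime p" "p \<notin> SP"
  interpret padic p by (rule padicI[OF p(1)])
  show "nrm (quot_comp (diag places q) q (FinPlace p)) = 1"
    "nrm (quot_comp (diag places q) q (FinPlace p) \<ominus>\<^bsub>K\<^esub> emb (FinPlace p) (of_int 1)) \<le> 1 / real p ^ multiplicity p n"
    by (simp_all add: quot_comp_diag[OF assms place])
qed (use assms in auto)

text \<open>Here class number one enters: a single rational number cancels the valuations of
  \<open>x\<close> at all primes outside \<open>S\<close>. The unit components that remain are
  approximated by integers, and the Chinese remainder theorem merges these into one residue
  class.\<close>

lemma approx_ex:
  assumes x: "x \<in> ideles" and n: "n \<in> QQ"
  obtains q r where "approx n x q r"
proof -
  define B where "B = {p. prime p \<and> x (FinPlace p) \<notin> Units (Zp p)} - SP"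
  have finB: "finite B" using x by (simp add: B_def idele_iff)
  have "\<exists>k. Qv_abs (FinPlace p) (x (FinPlace p)) = real p powi (- k)" if p: "prime p" for p
  proof -
    interpret padic p by (rule padicI[OF p])
    obtain j where "nrm (x (FinPlace p)) = real p powi j" using unit_value[OF idele_unit[OF x place]] .
    thus ?thesis by (intro exI[of _ "- j"]) simp
  qed
  then obtain k where k: "\<And>p. prime p \<Longrightarrow> Qv_abs (FinPlace p) (x (FinPlace p)) = real p powi (- k p)" by metis
  \<comment> \<open>Only the finitely many primes outside \<open>S\<close> at which \<open>x\<close>
    is not a unit occur. The valuations of \<open>q\<close> at the primes of \<open>S\<close> are 0,
    and its sign is positive.\<close>
  define q :: rat where "q = (\<Prod>p\<in>B. of_nat p powi k p)"
  have Bp: "prime p" "p > 0" if "p \<in> B" for p using that prime_gt_0_nat by (auto simp: B_def)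
  have q0: "q \<noteq> 0" unfolding q_def using finB Bp by (auto simp: prod_zero_iff)
  have vq: "vp p q = (if p \<in> B then k p else 0)" if p: "prime p" for p
  proof -
    have "vp p q = (\<Sum>p'\<in>B. vp p (of_nat p' powi k p'))" unfolding q_def using p Bp by (intro vp_prod) auto
    also have "\<dots> = (\<Sum>p'\<in>B. if p' = p then k p else 0)"
      using p Bp by (intro sum.cong) (auto simp: vp_power_int vp_prime)
    finally show ?thesis using finB by simp
  qed
  have one: "Qv_abs (FinPlace p) (quot_comp x q (FinPlace p)) = 1" if p: "prime p" "p \<notin> SP" for p
  proof -
    interpret padic p by (rule padicI[OF p(1)])
    have xp: "x (FinPlace p) \<in> carrier K" using idele_closed[OF x place] .
    have "rat_abs (FinPlace p) (inverse q) = real p powi (vp p q)"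
      using q0 p by (simp add: rat_abs_nonzero vp_inverse)
    hence n1: "nrm (quot_comp x q (FinPlace p)) = nrm (x (FinPlace p)) * real p powi (vp p q)"
      using xp by (simp add: quot_comp_def Qv_abs_mult)
    show ?thesis
    proof (cases "p \<in> B")
      case True
      thus ?thesis using n1 k[OF p(1)] vq[OF p(1)] p_gt_1 by (simp add: power_int_minus)
    next
      case False
      hence "nrm (x (FinPlace p)) = 1" using p by (simp add: B_def Zp_Units)
      thus ?thesis using n1 vq[OF p(1)] False by simp
    qed
  qed
  have n0: "n > 0" using n QQ_pos by simp
  have "\<exists>a::nat. Qv_abs (FinPlace p) (quot_comp x q (FinPlace p) \<ominus>\<^bsub>Qv (FinPlace p)\<^esub> emb (FinPlace p) (of_nat a)) \<le> 1 / real p ^ multiplicity p n"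
    if p: "prime p" "p \<notin> SP" for p
  proof -
    interpret padic p by (rule padicI[OF p(1)])
    have c: "quot_comp x q (FinPlace p) \<in> carrier K" using quot_comp_closed[OF x place] .
    obtain a where a: "nrm (quot_comp x q (FinPlace p) \<ominus>\<^bsub>K\<^esub> emb (FinPlace p) (of_int a)) \<le> 1 / real p ^ multiplicity p n"
      using int_approx[OF c, of "multiplicity p n"] one[OF p] by auto
    define b where "b = nat (a mod int p ^ multiplicity p n)"
    have b: "int b = a mod int p ^ multiplicity p n" using p_gt_1 by (simp add: b_def)
    have "int p ^ multiplicity p n dvd a - int b" unfolding b by (simp add: mod_eq_dvd_iff[symmetric])
    hence "nrm (emb (FinPlace p) (of_int a) \<ominus>\<^bsub>K\<^esub> emb (FinPlace p) (of_int (int b))) \<le> 1 / real p ^ multiplicity p n"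
      by (simp only: emb_close_iff)
    hence "nrm (quot_comp x q (FinPlace p) \<ominus>\<^bsub>K\<^esub> emb (FinPlace p) (of_int (int b))) \<le> 1 / real p ^ multiplicity p n"
      by (intro nrm_ultra_trans[OF c _ _ a]) auto
    thus ?thesis by (intro exI[of _ b]) simp
  qed
  then obtain a :: "nat \<Rightarrow> nat" where a: "\<And>p. prime p \<Longrightarrow> p \<notin> SP \<Longrightarrow>
      Qv_abs (FinPlace p) (quot_comp x q (FinPlace p) \<ominus>\<^bsub>Qv (FinPlace p)\<^esub> emb (FinPlace p) (of_nat (a p))) \<le> 1 / real p ^ multiplicity p n"
    by metis
  \<comment> \<open>The local congruences concern only the primes dividing \<open>n\<close>;
    elsewhere the required closeness is 1, which holds for all integral elements.\<close>
  have "\<exists>z. \<forall>p\<in>prime_factors n. [z = a p] (mod p ^ multiplicity p n)"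
  proof (rule chinese_remainder_nat)
    show "\<forall>i\<in>prime_factors n. \<forall>j\<in>prime_factors n. i \<noteq> j \<longrightarrow> coprime (i ^ multiplicity i n) (j ^ multiplicity j n)"
      by (auto simp: in_prime_factors_iff primes_coprime)
  qed simp
  then obtain z where z: "\<And>p. prime p \<Longrightarrow> p dvd n \<Longrightarrow> [z = a p] (mod p ^ multiplicity p n)"
    using n0 by (metis in_prime_factors_iff not_gr_zero)
  have close: "Qv_abs (FinPlace p) (quot_comp x q (FinPlace p) \<ominus>\<^bsub>Qv (FinPlace p)\<^esub> emb (FinPlace p) (of_int (int z))) \<le> 1 / real p ^ multiplicity p n"
    if p: "prime p" "p \<notin> SP" for p
  proof -
    interpret padic p by (rule padicI[OF p(1)])
    have c: "quot_comp x q (FinPlace p) \<in> carrier K" using quot_comp_closed[OF x place] .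
    have "int p ^ multiplicity p n dvd int (a p) - int z"
    proof (cases "p dvd n")
      case True
      thus ?thesis using z[OF p(1) True] by (simp add: cong_iff_dvd_diff dvd_diff_commute flip: cong_int_iff)
    qed (simp add: not_dvd_imp_multiplicity_0)
    hence "nrm (emb (FinPlace p) (of_int (int (a p))) \<ominus>\<^bsub>K\<^esub> emb (FinPlace p) (of_int (int z))) \<le> 1 / real p ^ multiplicity p n"
      by (simp only: emb_close_iff)
    thus ?thesis using a[OF p] by (intro nrm_ultra_trans[OF c _ _ a[OF p]]) auto
  qed
  have "coprime (int z) (int n)"
  proof (rule ccontr)
    assume "\<not> coprime (int z) (int n)"
    hence "gcd z n \<noteq> 1" by (metis coprime_iff_gcd_eq_1 coprime_int_iff)
    then obtain p where p: "prime p" "p dvd gcd z n" using prime_factor_nat by blast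
    have pS: "p \<notin> SP" using p QQ_prime_notin[OF n] by auto
    interpret padic p by (rule padicI[OF p(1)])
    have "multiplicity p n > 0" using p n0 by (metis gcd_nat.boundedE not_prime_unit multiplicity_gt_zero_iff not_gr_zero)
    hence "\<not> int p dvd int z"
      using close_int_unit[OF quot_comp_closed[OF x place] one[OF p(1) pS] close[OF p(1) pS]] by blast
    thus False using p by auto
  qed
  hence "approx n x q (int z)" using q0 one close by (simp add: approx_def)
  thus ?thesis by (rule that)
qed

end

section \<open>Characters modulo n that agree with omega on the S-units\<close>

locale zeta_setup = place_set +
  fixes om :: "(place \<Rightarrow> (nat \<Rightarrow> rat) set) set \<Rightarrow> complex"
  assumes om: "real_character (square_classes S) om"
begin

definition Om :: "(place \<Rightarrow> (nat \<Rightarrow> rat) set) \<Rightarrow> complex" where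
  "Om x = om (sqclass x)"

lemma Om_mult: assumes "x \<in> Units (QS S)" "y \<in> Units (QS S)" shows "Om (x \<otimes>\<^bsub>QS S\<^esub> y) = Om x * Om y"
proof -
  have "sqclass (x \<otimes>\<^bsub>US\<^esub> y) = sqclass x \<otimes>\<^bsub>square_classes S\<^esub> sqclass y"
    using hom_mult[OF sqclass_hom, of x y] assms by simp
  moreover have "sqclass x \<in> carrier (square_classes S)" "sqclass y \<in> carrier (square_classes S)"
    using assms by (auto simp: square_classes_carrier)
  ultimately show ?thesis
    using om by (auto simp: Om_def real_character_def hom_def units_complex)
qed

lemma Om_nonzero: assumes "x \<in> Units (QS S)" shows "Om x \<noteq> 0"
proof -
  have "sqclass x \<in> carrier (square_classes S)" using assms by (auto simp: square_classes_carrier)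
  thus ?thesis using om by (auto simp: Om_def real_character_def hom_def units_complex units_of_carrier)
qed

lemma Om_one [simp]: "Om \<one>\<^bsub>QS S\<^esub> = 1"
proof -
  have "Om \<one>\<^bsub>QS S\<^esub> = Om \<one>\<^bsub>QS S\<^esub> * Om \<one>\<^bsub>QS S\<^esub>"
    using Om_mult[of "\<one>\<^bsub>QS S\<^esub>" "\<one>\<^bsub>QS S\<^esub>"] by simp
  thus ?thesis using Om_nonzero[of "\<one>\<^bsub>QS S\<^esub>"] by simp
qed

lemma Om_square: assumes "x \<in> QS_squares S" shows "Om x = 1"
  using sqclass_eqI[OF KS.Units_one_closed assms] assms Om_one by (simp add: Om_def QS_squares_iff)

lemma Om_pm: assumes "x \<in> Units (QS S)" shows "Om x \<in> {1, -1}"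
proof -
  have "x \<otimes>\<^bsub>QS S\<^esub> x \<in> QS_squares S" using assms by (auto simp: QS_squares_def)
  hence "Om x * Om x = 1" using Om_square Om_mult[OF assms assms] by simp
  thus ?thesis by (simp add: square_eq_1_iff)
qed

definition wq :: "rat \<Rightarrow> complex" where "wq q = Om (diag S q)"

lemma wq_mult: "q \<noteq> 0 \<Longrightarrow> r \<noteq> 0 \<Longrightarrow> wq (q * r) = wq q * wq r"
  by (simp add: wq_def diag_mult Om_mult)

lemma wq_1 [simp]: "wq 1 = 1"
  by (simp add: wq_def diag_1)

lemma wq_pm: "q \<noteq> 0 \<Longrightarrow> wq q \<in> {1, -1}"
  by (simp add: wq_def Om_pm del: insert_iff)

lemma wq_sq: "q \<noteq> 0 \<Longrightarrow> wq q * wq q = 1"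
  using wq_pm[of q] by auto

lemma wq_inverse: assumes "q \<noteq> 0" shows "wq (inverse q) = wq q"
proof -
  have "wq q * wq (inverse q) = 1" using wq_mult[of q "inverse q"] assms by simp
  moreover have "wq q * wq q = 1" using wq_sq assms by simp
  ultimately show ?thesis using assms by (metis mult_cancel_left zero_neq_one mult_zero_left)
qed

text \<open>The numbers -1 and p in \<open>SP\<close> generate the S-units. A character built from
  \<open>\<omega>\<close> on \<open>S\<close> and \<open>\<psi>\<close> modulo \<open>n\<close> is
  trivial on the rationals only if the two values at an S-unit are inverse to each other, which for
  signs means equal.\<close>

definition compat :: "nat \<Rightarrow> (int \<Rightarrow> complex) \<Rightarrow> bool" where
  "compat n \<psi> \<longleftrightarrow> \<psi> \<in> qchars n \<and> \<psi> ((-1) mod int n) = wq (-1) \<and>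
     (\<forall>p\<in>SP. \<psi> (int p mod int n) = wq (of_nat p))"

lemma qchar_mod_mult:
  assumes "\<psi> \<in> qchars n" "n > 0" "coprime a (int n)" "coprime b (int n)"
  shows "\<psi> (a * b mod int n) = \<psi> (a mod int n) * \<psi> (b mod int n)"
proof -
  have "a mod int n \<in> carrier (unit_group_mod n)" "b mod int n \<in> carrier (unit_group_mod n)"
    using assms by (auto simp: unit_group_mod_def coprime_mod_left_iff)
  moreover have "a mod int n \<otimes>\<^bsub>unit_group_mod n\<^esub> (b mod int n) = a * b mod int n"
    by (simp add: unit_group_mod_def mod_mult_eq)
  ultimately show ?thesis using assms(1) unfolding quad_chars_def by (metis (mono_tags, lifting) mem_Collect_eq)
qed

lemma qchar_mod_pm:
  assumes "\<psi> \<in> qchars n" "n > 0" "coprime a (int n)"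
  shows "\<psi> (a mod int n) \<in> {1, -1}"
proof -
  have "a mod int n \<in> carrier (unit_group_mod n)"
    using assms by (auto simp: unit_group_mod_def coprime_mod_left_iff)
  thus ?thesis using assms(1) unfolding quad_chars_def by blast
qed

lemma qchar_mod_1: assumes "\<psi> \<in> qchars n" "n > 0" shows "\<psi> (1 mod int n) = 1"
  using comm_group.quad_char_one[OF unit_group_mod_comm_group[OF assms(2)] assms(1)]
  by (simp add: unit_group_mod_def)

lemma compat_S_nat:
  assumes c: "compat n \<psi>" and n: "n \<in> QQ"
  shows "a > 0 \<Longrightarrow> (\<And>p. prime p \<Longrightarrow> p dvd a \<Longrightarrow> p \<in> SP) \<Longrightarrow>
    coprime (int a) (int n) \<and> \<psi> (int a mod int n) = wq (of_nat a)"
proof (induction a rule: less_induct)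
  case (less a)
  have psi: "\<psi> \<in> qchars n" using c by (simp add: compat_def)
  have n0: "n > 0" using n QQ_pos by auto
  show ?case
  proof (cases "a = 1")
    case True
    thus ?thesis using qchar_mod_1[OF psi n0] by simp
  next
    case False
    then obtain p where p: "prime p" "p dvd a" using prime_factor_nat by blast
    then obtain b where b: "a = p * b" by (auto simp: dvd_def)
    have pS: "p \<in> SP" using less p by blast
    have b0: "b > 0" "b < a" using b less p prime_gt_1_nat[OF p(1)] by auto
    have IH: "coprime (int b) (int n) \<and> \<psi> (int b mod int n) = wq (of_nat b)"
      using less.prems b b0 by (intro less.IH) auto
    have "\<not> p dvd n" using pS QQ_prime_notin[OF n p(1)] by blast
    hence cp: "coprime (int p) (int n)" using p by (simp add: prime_imp_coprime)
    have "\<psi> (int p * int b mod int n) = \<psi> (int p mod int n) * \<psi> (int b mod int n)"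
      using qchar_mod_mult[OF psi n0 cp] IH by blast
    also have "\<dots> = wq (of_nat p) * wq (of_nat b)" using c pS IH by (simp add: compat_def)
    also have "\<dots> = wq (of_nat a)" unfolding b using p b0 by (simp add: wq_mult prime_gt_0_nat)
    finally show ?thesis using cp IH b by simp
  qed
qed

text \<open>Write h = a / b; both \<open>a\<close> and \<open>b\<close> are products of primes of
  \<open>S\<close>, up to sign. Clearing the denominator turns the local congruences for h r and r'
  into r a = r' b modulo \<open>n\<close>, to which \<open>\<psi>\<close> can be applied.\<close>

lemma compat_S_unit:
  assumes c: "compat n \<psi>" and n: "n \<in> QQ" and h: "h \<noteq> 0" "\<And>p. prime p \<Longrightarrow> p \<notin> SP \<Longrightarrow> vp p h = 0"
    and r: "coprime r (int n)" "coprime r' (int n)"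
    and cong: "\<And>p. prime p \<Longrightarrow> p dvd n \<Longrightarrow> rat_abs (FinPlace p) (h * of_int r - of_int r') \<le> 1 / real p ^ multiplicity p n"
  shows "\<psi> (r' mod int n) = wq h * \<psi> (r mod int n)"
proof -
  have psi: "\<psi> \<in> qchars n" using c by (simp add: compat_def)
  have n0: "n > 0" using n QQ_pos by auto
  obtain a b where ab: "h = of_int a / of_int b" "b > 0" "coprime a b" by (rule rat_frac_cases[of h])
  have a0: "a \<noteq> 0" using ab h by auto
  have supp: "p \<in> SP" if p: "prime p" "int p dvd a \<or> int p dvd b" for p
  proof (rule ccontr)
    assume "p \<notin> SP"
    hence eq: "multiplicity (int p) a = multiplicity (int p) b"
      using h(2)[OF p(1)] vp_frac[OF p(1) a0, of b] ab by simp
    have pu: "\<not> is_unit (int p)" using p by auto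
    have "int p dvd a" "int p dvd b"
      using p(2) eq multiplicity_eq_zero_iff[OF a0 pu] multiplicity_eq_zero_iff[OF _ pu, of b] ab by auto
    thus False using ab(3) pu by (meson coprime_common_divisor)
  qed
  have Sab: "coprime (int (nat \<bar>a\<bar>)) (int n) \<and> \<psi> (int (nat \<bar>a\<bar>) mod int n) = wq (of_nat (nat \<bar>a\<bar>))"
    "coprime (int (nat b)) (int n) \<and> \<psi> (int (nat b) mod int n) = wq (of_nat (nat b))"
  proof (rule_tac [!] compat_S_nat[OF c n])
    show "nat \<bar>a\<bar> > 0" "nat b > 0" using a0 ab by auto
    show "p \<in> SP" if "prime p" "p dvd nat \<bar>a\<bar>" for p
      using supp[OF that(1)] that(2) int_dvd_nat_abs_iff[of p a] by blast
    show "p \<in> SP" if "prime p" "p dvd nat b" for p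
      using supp[OF that(1)] that(2) ab(2) int_dvd_nat_abs_iff[of p b] by simp
  qed
  have sgn: "\<psi> ((-1) mod int n) = wq (-1)" using c by (simp add: compat_def)
  have pa: "coprime a (int n) \<and> \<psi> (a mod int n) = wq (of_int a)"
  proof (cases "a > 0")
    case False
    hence a: "a = -1 * int (nat \<bar>a\<bar>)" using a0 by simp
    have "\<psi> ((-1) * int (nat \<bar>a\<bar>) mod int n) = \<psi> ((-1) mod int n) * \<psi> (int (nat \<bar>a\<bar>) mod int n)"
      using Sab by (intro qchar_mod_mult[OF psi n0]) auto
    also have "\<dots> = wq (- 1 * of_nat (nat \<bar>a\<bar>))" using Sab sgn a0 by (subst wq_mult) auto
    also have "- 1 * of_nat (nat \<bar>a\<bar>) = (of_int a :: rat)" using False by simp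
    finally show ?thesis using Sab a by simp
  qed (use Sab in auto)
  have pb: "coprime b (int n) \<and> \<psi> (b mod int n) = wq (of_int b)" using Sab ab by auto
  have wh: "wq h = wq (of_int a) * wq (of_int b)"
    using a0 ab wq_mult[of "of_int a" "inverse (of_int b)"] wq_inverse[of "of_int b"]
    by (simp add: divide_inverse)
  have "int n dvd r * a - r' * b"
  proof (rule int_dvd_of_local[OF n0])
    fix p assume p: "prime p" "p dvd n"
    interpret padic p by (rule padicI[OF p(1)])
    have "of_int (r * a - r' * b) = (h * of_int r - of_int r') * of_int b"
      using ab by (simp add: field_simps)
    hence "rat_abs (FinPlace p) (of_int (r * a - r' * b))
        = rat_abs (FinPlace p) (h * of_int r - of_int r') * rat_abs (FinPlace p) (of_int b)"
      by (simp only: rat_abs_mult[OF place])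
    also have "\<dots> \<le> 1 / real p ^ multiplicity p n * 1"
      using cong[OF p] rat_abs_int_le_1 by (intro mult_mono) auto
    finally show "int p ^ multiplicity p n dvd r * a - r' * b" by (simp only: rat_abs_int_le_iff mult_1_right)
  qed
  hence "r * a mod int n = r' * b mod int n" by (simp add: mod_eq_dvd_iff)
  hence "\<psi> (r mod int n) * wq (of_int a) = \<psi> (r' mod int n) * wq (of_int b)"
    using qchar_mod_mult[OF psi n0 r(1), of a] qchar_mod_mult[OF psi n0 r(2), of b] pa pb by simp
  hence "\<psi> (r mod int n) * wq (of_int a) * wq (of_int b) = \<psi> (r' mod int n) * (wq (of_int b) * wq (of_int b))" by simp
  also have "wq (of_int b) * wq (of_int b) = 1" using ab by (intro wq_sq) auto
  finally show ?thesis by (simp add: wh mult_ac)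
qed

text \<open>Two approximations of one idele differ by the S-unit h = q / q'. Passing from one to the
  other multiplies the S-part and the residue by h, and compatibility makes the two changes cancel
  because the sign \<open>wq h\<close> has square 1.\<close>

lemma approx_unique:
  assumes c: "compat n \<psi>" and n: "n \<in> QQ" and x: "x \<in> ideles" and a: "approx n x q r" "approx n x q' r'"
  shows "Om (S_quot x q) * \<psi> (r mod int n) = Om (S_quot x q') * \<psi> (r' mod int n)"
proof -
  define h where "h = q / q'"
  have q0: "q \<noteq> 0" "q' \<noteq> 0" using a by (auto simp: approx_def)
  hence h0: "h \<noteq> 0" by (simp add: h_def)
  have qc: "quot_comp x q' v = quot_comp x q v \<otimes>\<^bsub>Qv v\<^esub> emb v h" if v: "v \<in> places" for v
  proof -
    interpret completion v by (rule completionI[OF v])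
    have "inverse q' = inverse q * h" using q0 by (simp add: h_def field_simps)
    thus ?thesis using idele_closed[OF x v] by (simp add: quot_comp_def emb_mult K.m_assoc)
  qed
  have "S_quot x q' = S_quot x q \<otimes>\<^bsub>QS S\<^esub> diag S h"
    using qc[OF S_place] by (auto simp: S_quot_def QS_simps diag_def intro!: restrict_ext)
  hence O: "Om (S_quot x q') = Om (S_quot x q) * wq h"
    using S_quot_unit[OF x q0(1)] h0 by (simp add: Om_mult wq_def)
  have vh: "vp p h = 0" and cong: "rat_abs (FinPlace p) (h * of_int r - of_int r') \<le> 1 / real p ^ multiplicity p n"
    if p: "prime p" "p \<notin> SP" for p
  proof -
    interpret padic p by (rule padicI[OF p(1)])
    let ?y = "quot_comp x q (FinPlace p)" and ?z = "quot_comp x q' (FinPlace p)"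
    have y: "?y \<in> carrier K" "?z \<in> carrier K" using quot_comp_closed[OF x place] by auto
    have a': "nrm ?y = 1" "nrm ?z = 1"
      "nrm (?y \<ominus>\<^bsub>K\<^esub> emb (FinPlace p) (of_int r)) \<le> 1 / real p ^ multiplicity p n"
      "nrm (?z \<ominus>\<^bsub>K\<^esub> emb (FinPlace p) (of_int r')) \<le> 1 / real p ^ multiplicity p n"
      using a p by (auto simp: approx_def)
    have "nrm ?z = nrm ?y * rat_abs (FinPlace p) h" using y qc[OF place] by (simp add: Qv_abs_mult)
    hence rh: "rat_abs (FinPlace p) h = 1" using a' by simp
    thus "vp p h = 0" using rat_abs_eq_1_iff[OF h0] by simp
    have "nrm (?z \<ominus>\<^bsub>K\<^esub> emb (FinPlace p) (of_int r) \<otimes>\<^bsub>K\<^esub> emb (FinPlace p) h) \<le> 1 / real p ^ multiplicity p n"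
      unfolding qc[OF place] using y a' rat_abs_int_le_1 rh by (intro close_mult) auto
    hence "nrm (emb (FinPlace p) (of_int r * h) \<ominus>\<^bsub>K\<^esub> ?z) \<le> 1 / real p ^ multiplicity p n"
      using y Qv_abs_minus_commute[of ?z "emb (FinPlace p) (of_int r * h)"] by (simp add: emb_mult)
    hence "nrm (emb (FinPlace p) (of_int r * h) \<ominus>\<^bsub>K\<^esub> emb (FinPlace p) (of_int r')) \<le> 1 / real p ^ multiplicity p n"
      by (intro nrm_ultra_trans[OF _ y(2) _ _ a'(4)]) auto
    thus "rat_abs (FinPlace p) (h * of_int r - of_int r') \<le> 1 / real p ^ multiplicity p n"
      unfolding emb_diff[symmetric] Qv_abs_emb by (simp add: mult.commute)
  qed
  have "\<psi> (r' mod int n) = wq h * \<psi> (r mod int n)"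
    using a cong QQ_prime_notin[OF n] vh by (intro compat_S_unit[OF c n h0]) (auto simp: approx_def)
  hence "Om (S_quot x q') * \<psi> (r' mod int n) = Om (S_quot x q) * (wq h * wq h) * \<psi> (r mod int n)"
    by (simp add: O)
  thus ?thesis using wq_sq[OF h0] by simp
qed

end

lemma Qv_ball_open:
  assumes v: "v \<in> places" and x: "x \<in> carrier (Qv v)"
  shows "openin (Qv_topology v) {y \<in> carrier (Qv v). Qv_abs v (y \<ominus>\<^bsub>Qv v\<^esub> x) < d}"
proof -
  interpret completion v by (rule completionI[OF v])
  show ?thesis unfolding Qv_open_iff[OF v]
  proof (intro conjI ballI)
    fix z assume z: "z \<in> {y \<in> carrier K. Qv_abs v (y \<ominus>\<^bsub>K\<^esub> x) < d}"
    have "Qv_abs v (y \<ominus>\<^bsub>K\<^esub> x) < d" if y: "y \<in> carrier K" "Qv_abs v (y \<ominus>\<^bsub>K\<^esub> z) < d - Qv_abs v (z \<ominus>\<^bsub>K\<^esub> x)" for y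
      using Qv_abs_add[of "y \<ominus>\<^bsub>K\<^esub> z" "z \<ominus>\<^bsub>K\<^esub> x"] y z x minus_split[of y z x] by simp
    thus "\<exists>r>0. \<forall>y\<in>carrier K. Qv_abs v (y \<ominus>\<^bsub>K\<^esub> z) < r \<longrightarrow> y \<in> {y \<in> carrier K. Qv_abs v (y \<ominus>\<^bsub>K\<^esub> x) < d}"
      using z by (intro exI[of _ "d - Qv_abs v (z \<ominus>\<^bsub>K\<^esub> x)"]) auto
  qed auto
qed

lemma Zp_Units_open: assumes p: "prime p" shows "openin (Qv_topology (FinPlace p)) (Units (Zp p))"
proof -
  interpret padic p by (rule padicI[OF p])
  show ?thesis unfolding Qv_open_iff[OF place]
  proof (intro conjI ballI)
    fix x assume "x \<in> Units (Zp p)"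
    hence x: "x \<in> carrier K" "nrm x = 1" by (auto simp: Zp_Units)
    have "nrm y = 1" if y: "y \<in> carrier K" "nrm (y \<ominus>\<^bsub>K\<^esub> x) < 1" for y
      using nrm_eq_of_close[of x y] y x Qv_abs_minus_commute[of x y] by simp
    thus "\<exists>r>0. \<forall>y\<in>carrier K. nrm (y \<ominus>\<^bsub>K\<^esub> x) < r \<longrightarrow> y \<in> Units (Zp p)"
      by (intro exI[of _ 1]) (auto simp: Zp_Units)
  qed (auto simp: Zp_Units)
qed

lemma topspace_idele_subset: "topspace idele_topology \<subseteq> ideles"
  unfolding idele_topology_eq topology_generated_by_topspace using idele_box_subset by blast

lemma idele_unit_at: "prime p \<Longrightarrow> u \<in> Units (Zp p) \<Longrightarrow> u \<in> Units (Qv (FinPlace p))"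
  using padic.Zp_Units_subset[OF padicI] by blast

lemma prime_power_prod_dvd:
  fixes g :: "nat \<Rightarrow> nat"
  assumes n: "n > 0" and A: "\<And>p. p \<in> A \<Longrightarrow> prime p" "\<And>p. p \<in> A \<Longrightarrow> p ^ g p dvd n"
  shows "(\<Prod>p\<in>A. p ^ g p) dvd n"
  using A
proof (induction A rule: infinite_finite_induct)
  case (insert p A)
  have "coprime (p ^ g p) (\<Prod>p\<in>A. p ^ g p)"
    using insert by (intro prod_coprime_right) (auto intro!: primes_coprime)
  thus ?case using insert by (simp add: divides_mult)
qed auto

section \<open>Conductors and the evaluation of characters over omega\<close>

context zeta_setup
begin

abbreviation "Ch \<equiv> characters_over S om"
abbreviation "cnd \<equiv> conductor_outside S"

lemma ChD:
  assumes "chi \<in> Ch"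
  shows "ihom chi" "chi \<in> extensional ideles" "continuous_map idele_topology euclidean chi"
    "q \<noteq> 0 \<Longrightarrow> chi (diag places q) = 1"
    "x \<in> Units (QS S) \<Longrightarrow> (\<Prod>v\<in>S. local_component chi v (x v)) = Om x"
  using assms by (auto simp: characters_over_def real_idele_class_characters_def real_character_ideles Om_def sqclass_def)

lemma local_small:
  assumes p: "prime p" and u: "u \<in> Units (Zp p)"
    and T: "p \<in> T \<Longrightarrow> Qv_abs (FinPlace p) (u \<ominus>\<^bsub>Qv (FinPlace p)\<^esub> \<one>\<^bsub>Qv (FinPlace p)\<^esub>) \<le> 1 / real p ^ N"
  shows "idele_at (FinPlace p) u \<in> small_ideles T N"
proof -
  have "idele_at (FinPlace p) u (FinPlace l) \<in> Units (Zp l)" if "prime l" for l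
    using that u by (auto simp: idele_at_def Zp_one_unit)
  moreover have "Qv_abs (FinPlace l) (idele_at (FinPlace p) u (FinPlace l) \<ominus>\<^bsub>Qv (FinPlace l)\<^esub> \<one>\<^bsub>Qv (FinPlace l)\<^esub>) \<le> 1 / real l ^ N"
    if l: "l \<in> T" "prime l" for l
  proof (cases "l = p")
    case False
    interpret padic l by (rule padicI[OF l(2)])
    show ?thesis using False l by (simp add: idele_at_def)
  qed (use T l in \<open>auto simp: idele_at_def\<close>)
  ultimately show ?thesis
    using idele_at_idele[of "FinPlace p" u] p idele_unit_at[OF p u] by (auto simp: small_ideles_def idele_at_def)
qed

lemma prime_powers_QQ:
  assumes "finite A" "\<And>p. p \<in> A \<Longrightarrow> prime p \<and> p \<notin> SP"
  shows "(\<Prod>p\<in>A. p ^ g p) \<in> QQ"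
  using assms
proof (induction A rule: finite_induct)
  case empty
  show ?case using one_coprime_nats[OF SP_prime] by simp
next
  case (insert l A)
  have "l ^ g l \<in> QQ" using insert.prems by (intro coprime_nats_power[OF SP_prime] prime_QQ) auto
  moreover have "(\<Prod>p\<in>A. p ^ g p) \<in> QQ" using insert by simp
  ultimately show ?case using insert.hyps coprime_nats_mult[OF SP_prime] by simp
qed

text \<open>All claims come from one neighbourhood on which \<open>chi\<close> is trivial: it
  contains all units at primes outside the finite set \<open>T\<close>, and all units close to 1 to
  order \<open>N\<close> at the primes of \<open>T\<close>. So the conductor exponents exist, and
  only finitely many are nonzero.\<close>

lemma conductor:
  assumes chi: "chi \<in> Ch"
  shows "prime p \<Longrightarrow> u \<in> Units (Zp p) \<Longrightarrow>
      Qv_abs (FinPlace p) (u \<ominus>\<^bsub>Qv (FinPlace p)\<^esub> \<one>\<^bsub>Qv (FinPlace p)\<^esub>) \<le> 1 / real p ^ conductor_exponent chi p \<Longrightarrow>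
      local_component chi (FinPlace p) u = 1"
    and "finite {p. prime p \<and> conductor_exponent chi p \<noteq> 0}"
    and "prime p \<Longrightarrow> p \<notin> SP \<Longrightarrow> p ^ conductor_exponent chi p dvd cnd chi"
    and "cnd chi \<in> QQ"
    and "prime p \<Longrightarrow> unramified chi p \<longleftrightarrow> conductor_exponent chi p = 0"
proof -
  obtain T N where T: "finite T" "\<And>x. x \<in> small_ideles T N \<Longrightarrow> chi x = 1"
    by (rule continuous_character_trivial_near_one[OF ChD(1,3)[OF chi]]) (rule that, assumption+)
  let ?P = "\<lambda>p n. \<forall>u\<in>Units (Zp p). Qv_abs (FinPlace p) (u \<ominus>\<^bsub>Qv (FinPlace p)\<^esub> \<one>\<^bsub>Qv (FinPlace p)\<^esub>) \<le> 1 / real p ^ n \<longrightarrow>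
        local_component chi (FinPlace p) u = 1"
  have PN: "?P p N" if "prime p" for p
    using T(2) local_small[OF that] unfolding local_component_def by blast
  have P0: "?P p 0" if "prime p" "p \<notin> T" for p
    using T(2) local_small[OF that(1)] that(2) unfolding local_component_def by blast
  \<comment> \<open>The exponent is defined as a least number; \<open>N\<close> witnesses that one
    exists.\<close>
  have PL: "?P p (conductor_exponent chi p)" if "prime p" for p
    unfolding conductor_exponent_def by (rule LeastI[of "?P p", OF PN[OF that]])
  thus "prime p \<Longrightarrow> u \<in> Units (Zp p) \<Longrightarrow>
      Qv_abs (FinPlace p) (u \<ominus>\<^bsub>Qv (FinPlace p)\<^esub> \<one>\<^bsub>Qv (FinPlace p)\<^esub>) \<le> 1 / real p ^ conductor_exponent chi p \<Longrightarrow>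
      local_component chi (FinPlace p) u = 1" by blast
  have ce0: "conductor_exponent chi p = 0" if "?P p 0" for p
    unfolding conductor_exponent_def using that Least_le[of "?P p" 0] by simp
  show fin: "finite {p. prime p \<and> conductor_exponent chi p \<noteq> 0}"
  proof (rule finite_subset[OF _ T(1)], safe, rule ccontr)
    fix p assume "prime p" "0 < conductor_exponent chi p" "p \<notin> T"
    thus False using ce0[OF P0] by simp
  qed
  let ?B = "{p. prime p \<and> FinPlace p \<notin> S \<and> conductor_exponent chi p \<noteq> 0}"
  have finB: "finite ?B" by (rule finite_subset[OF _ fin]) auto
  show "p ^ conductor_exponent chi p dvd cnd chi" if "prime p" "p \<notin> SP"
    using that finB by (cases "conductor_exponent chi p = 0")
      (auto simp: conductor_outside_def SP_iff intro: dvd_prodI[of ?B p "\<lambda>p. p ^ conductor_exponent chi p"])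
  show "cnd chi \<in> QQ"
    unfolding conductor_outside_def by (rule prime_powers_QQ[OF finB]) (simp add: SP_iff)
  show "unramified chi p \<longleftrightarrow> conductor_exponent chi p = 0" if p: "prime p"
  proof
    assume "unramified chi p"
    thus "conductor_exponent chi p = 0" by (intro ce0) (auto simp: unramified_def)
  next
    assume z: "conductor_exponent chi p = 0"
    interpret padic p by (rule padicI[OF p])
    have "nrm (u \<ominus>\<^bsub>K\<^esub> \<one>\<^bsub>K\<^esub>) \<le> 1" if "u \<in> Units (Zp p)" for u
      using nrm_ultra_minus[of u "\<one>\<^bsub>K\<^esub>"] that by (auto simp: Zp_Units)
    thus "unramified chi p" using PL[OF p] unfolding z unramified_def by simp
  qed
qed

lemma conductor_le_multiplicity:
  assumes "chi \<in> Ch" "cnd chi dvd n" "n \<in> QQ" "prime p" "p \<notin> SP"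
  shows "conductor_exponent chi p \<le> multiplicity p n"
proof -
  have "p ^ conductor_exponent chi p dvd n" using conductor(3)[OF assms(1,4,5)] assms(2) by (rule dvd_trans)
  moreover have "\<not> is_unit p" using assms(4) by auto
  ultimately show ?thesis using QQ_pos[OF assms(3)] by (intro multiplicity_geI) auto
qed

text \<open>At the finitely many primes of \<open>T\<close> outside \<open>S\<close> the local
  components of \<open>chi\<close> are trivial by the conductor, as \<open>u\<close> is close enough
  to 1. After removing them, what is left lies in the neighbourhood on which \<open>chi\<close> is
  trivial.\<close>

lemma char_kernel:
  assumes chi: "chi \<in> Ch" and n: "cnd chi dvd n" "n \<in> QQ" and u: "u \<in> ideles"
    and uS: "\<And>v. v \<in> S \<Longrightarrow> u v = \<one>\<^bsub>Qv v\<^esub>"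
    and up: "\<And>p. prime p \<Longrightarrow> p \<notin> SP \<Longrightarrow> Qv_abs (FinPlace p) (u (FinPlace p)) = 1 \<and>
      Qv_abs (FinPlace p) (u (FinPlace p) \<ominus>\<^bsub>Qv (FinPlace p)\<^esub> \<one>\<^bsub>Qv (FinPlace p)\<^esub>) \<le> 1 / real p ^ multiplicity p n"
  shows "chi u = 1"
proof -
  note h = ChD(1)[OF chi]
  obtain T N where T: "finite T" "\<And>x. x \<in> small_ideles T N \<Longrightarrow> chi x = 1"
    by (rule continuous_character_trivial_near_one[OF ChD(1,3)[OF chi]]) (rule that, assumption+)
  define A where "A = FinPlace ` {p \<in> T. prime p \<and> p \<notin> SP}"
  have A: "finite A" "A \<subseteq> places" using T(1) by (auto simp: A_def)
  have uz: "u (FinPlace p) \<in> Units (Zp p)" if p: "prime p" for p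
  proof (cases "p \<in> SP")
    case True
    thus ?thesis using uS[of "FinPlace p"] p by (simp add: SP_iff Zp_one_unit)
  next
    case False
    thus ?thesis using up[OF p False] p idele_closed[OF u, of "FinPlace p"] by (simp add: Zp_unit_prime)
  qed
  have "chi (idele_part A u) = (\<Prod>v\<in>A. local_component chi v (u v))"
    using A u by (intro ihom_part[OF h]) (auto simp: idele_unit)
  also have "\<dots> = 1"
  proof (rule prod.neutral, safe)
    fix v assume "v \<in> A"
    then obtain p where p: "v = FinPlace p" "prime p" "p \<notin> SP" by (auto simp: A_def)
    have "1 / real p ^ multiplicity p n \<le> 1 / real p ^ conductor_exponent chi p"
      using conductor_le_multiplicity[OF chi n p(2,3)] prime_gt_0_nat[OF p(2)]
      by (intro divide_left_mono power_increasing) auto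
    thus "local_component chi v (u v) = 1"
      unfolding p(1) using up[OF p(2,3)] uz[OF p(2)] by (intro conductor(1)[OF chi p(2)]) auto
  qed
  finally have "chi (idele_part A u) = 1" .
  moreover have "idele_part (- A) u \<in> small_ideles T N"
  proof -
    have "idele_part (- A) u (FinPlace p) \<in> Units (Zp p)" if "prime p" for p
      using uz[OF that] that by (simp add: idele_part_apply Zp_one_unit)
    moreover have "Qv_abs (FinPlace p) (idele_part (- A) u (FinPlace p) \<ominus>\<^bsub>Qv (FinPlace p)\<^esub> \<one>\<^bsub>Qv (FinPlace p)\<^esub>) \<le> 1 / real p ^ N"
      if p: "p \<in> T" "prime p" for p
    proof -
      interpret padic p by (rule padicI[OF p(2)])
      have "idele_part (- A) u (FinPlace p) = \<one>\<^bsub>K\<^esub>"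
        using p uS[of "FinPlace p"] by (auto simp: idele_part_apply A_def SP_iff)
      thus ?thesis by simp
    qed
    moreover have "idele_part (- A) u InfPlace = \<one>\<^bsub>Qv InfPlace\<^esub>" using uS[OF infS] by (simp add: idele_part_apply)
    ultimately show ?thesis using u by (simp add: small_ideles_def)
  qed
  hence "chi (idele_part (- A) u) = 1" by (rule T(2))
  ultimately show ?thesis using ihom_mult[OF h, of "idele_part A u" "idele_part (- A) u"] u
    by (simp add: idele_split)
qed

text \<open>An idele realising the residue class \<open>r\<close>: the integer itself at the primes
  dividing \<open>n\<close>, where it is a unit if it is prime to \<open>n\<close>, and 1 everywhere
  else, in particular on \<open>S\<close>.\<close>

definition iota :: "nat \<Rightarrow> int \<Rightarrow> place \<Rightarrow> (nat \<Rightarrow> rat) set" where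
  "iota n r = (\<lambda>v\<in>places. case v of InfPlace \<Rightarrow> \<one>\<^bsub>Qv v\<^esub>
     | FinPlace p \<Rightarrow> if p dvd n then emb v (of_int r) else \<one>\<^bsub>Qv v\<^esub>)"

lemma iota_abs:
  assumes p: "prime p" and n: "n \<in> QQ" and r: "coprime r (int n)"
  shows "iota n r (FinPlace p) \<in> carrier (Qv (FinPlace p))" "Qv_abs (FinPlace p) (iota n r (FinPlace p)) = 1"
    "Qv_abs (FinPlace p) (iota n r (FinPlace p) \<ominus>\<^bsub>Qv (FinPlace p)\<^esub> emb (FinPlace p) (of_int r)) \<le> 1 / real p ^ multiplicity p n"
proof -
  interpret padic p by (rule padicI[OF p])
  show c: "iota n r (FinPlace p) \<in> carrier K" using p by (simp add: iota_def)
  have "\<not> int p dvd r" if "p dvd n"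
    using that r p_not_unit by (meson coprime_common_divisor int_dvd_int_iff)
  thus o: "nrm (iota n r (FinPlace p)) = 1" using p rat_abs_int_eq_1_iff[of r] by (simp add: iota_def)
  show "nrm (iota n r (FinPlace p) \<ominus>\<^bsub>K\<^esub> emb (FinPlace p) (of_int r)) \<le> 1 / real p ^ multiplicity p n"
  proof (cases "p dvd n")
    case True
    thus ?thesis using p by (simp add: iota_def)
  next
    case False
    thus ?thesis using nrm_ultra_minus[OF c emb_closed[of "of_int r"]] o rat_abs_int_le_1[of r]
      by (simp add: not_dvd_imp_multiplicity_0)
  qed
qed

lemma iota_idele: assumes n: "n \<in> QQ" and r: "coprime r (int n)" shows "iota n r \<in> ideles"
proof -
  have z: "iota n r (FinPlace p) \<in> Units (Zp p)" if "prime p" for p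
    using iota_abs[OF that n r] that by (simp add: Zp_unit_prime)
  hence "{p. prime p \<and> iota n r (FinPlace p) \<notin> Units (Zp p)} = {}" by blast
  moreover have "iota n r v \<in> Units (Qv v)" if "v \<in> places" for v
    using that
  proof (cases rule: place_cases)
    case (2 p)
    thus ?thesis using idele_unit_at[OF 2(2) z[OF 2(2)]] by simp
  qed (simp add: iota_def Qv_one_unit)
  ultimately show ?thesis unfolding idele_iff by (auto simp: iota_def)
qed

lemma iota_S: assumes "n \<in> QQ" "v \<in> S" shows "iota n r v = \<one>\<^bsub>Qv v\<^esub>"
proof (cases v)
  case (FinPlace p)
  hence "p \<in> SP" using assms by (simp add: SP_iff)
  hence "\<not> p dvd n" using QQ_prime_notin[OF assms(1)] SP_prime by blast
  thus ?thesis using FinPlace S_place[OF assms(2)] by (simp add: iota_def)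
qed (simp add: iota_def)

lemma approx_iota: assumes n: "n \<in> QQ" and r: "coprime r (int n)" shows "approx n (iota n r) 1 r"
  using iota_abs[OF _ n r] r by (simp add: approx_def quot_comp_one[OF iota_idele[OF n r]])

lemma S_quot_iota: assumes n: "n \<in> QQ" and r: "coprime r (int n)" shows "S_quot (iota n r) 1 = \<one>\<^bsub>QS S\<^esub>"
  using iota_S[OF n] quot_comp_one[OF iota_idele[OF n r] S_place]
  by (auto simp: S_quot_def QS_simps intro!: restrict_ext)

text \<open>Dividing by \<open>q\<close> does not change the value, as \<open>chi\<close> is trivial
  on the rationals. The part of x / q on \<open>S\<close> is evaluated by \<open>\<omega>\<close>;
  the part outside \<open>S\<close> differs from \<open>iota n r\<close> by an idele in the
  kernel.\<close>

lemma char_formula: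
  assumes chi: "chi \<in> Ch" and n: "cnd chi dvd n" "n \<in> QQ" and x: "x \<in> ideles" and a: "approx n x q r"
  shows "chi x = Om (S_quot x q) * chi (iota n r)"
proof -
  note h = ChD(1)[OF chi]
  have q0: "q \<noteq> 0" and r: "coprime r (int n)" using a by (auto simp: approx_def)
  define d where "d = diag places (inverse q)"
  have d: "d \<in> ideles" "chi d = 1" using diag_idele[of "inverse q"] ChD(4)[OF chi, of "inverse q"] q0 by (auto simp: d_def)
  define y where "y = x \<otimes>\<^bsub>adeles\<^esub> d"
  have y: "y \<in> ideles" using x d by (simp add: y_def)
  have yv: "y v = quot_comp x q v" if "v \<in> places" for v
    using that by (simp add: y_def idele_mult_apply d_def diag_def quot_comp_def)
  have "chi x = chi y" using ihom_mult[OF h x d(1)] d(2) by (simp add: y_def)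
  also have "\<dots> = chi (idele_part S y) * chi (idele_part (- S) y)"
    using ihom_mult[OF h, of "idele_part S y" "idele_part (- S) y"] y by (simp add: idele_split)
  also have "chi (idele_part S y) = Om (S_quot x q)"
  proof -
    have "chi (idele_part S y) = (\<Prod>v\<in>S. local_component chi v (y v))"
      using finS S_sub y by (intro ihom_part[OF h]) (auto simp: idele_unit S_place)
    also have "\<dots> = (\<Prod>v\<in>S. local_component chi v (S_quot x q v))"
      by (intro prod.cong) (auto simp: S_quot_def yv S_place)
    also have "\<dots> = Om (S_quot x q)" by (rule ChD(5)[OF chi S_quot_unit[OF x q0]])
    finally show ?thesis .
  qed
  also have "chi (idele_part (- S) y) = chi (iota n r)"
  proof -
    have io: "iota n r \<in> ideles" by (rule iota_idele[OF n(2) r])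
    obtain c where c: "c \<in> ideles" "\<And>v. v \<in> places \<Longrightarrow> c v = inv\<^bsub>Qv v\<^esub> (iota n r v)" by (rule idele_inverse[OF io]) (rule that, assumption+)
    define u where "u = idele_part (- S) y \<otimes>\<^bsub>adeles\<^esub> c"
    have u: "u \<in> ideles" using y c by (simp add: u_def)
    have "chi u = 1"
    proof (rule char_kernel[OF chi n u])
      fix v assume v: "v \<in> S"
      interpret completion v by (rule S_completion[OF v])
      show "u v = \<one>\<^bsub>K\<^esub>" using v iota_S[OF n(2) v] by (simp add: u_def idele_mult_apply idele_part_apply c S_place)
    next
      fix p assume p: "prime p" "p \<notin> SP"
      interpret padic p by (rule padicI[OF p(1)])
      let ?v = "FinPlace p"
      have vS: "?v \<notin> S" using p by (simp add: SP_iff)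
      have iu: "iota n r ?v \<in> Units K" by (rule idele_unit[OF io place])
      have uv: "u ?v = quot_comp x q ?v \<otimes>\<^bsub>K\<^esub> inv\<^bsub>K\<^esub> (iota n r ?v)"
        using vS p by (simp add: u_def idele_mult_apply idele_part_apply c yv)
      have qc: "quot_comp x q ?v \<in> carrier K" by (rule quot_comp_closed[OF x place])
      have ap: "nrm (quot_comp x q ?v) = 1" "nrm (quot_comp x q ?v \<ominus>\<^bsub>K\<^esub> emb ?v (of_int r)) \<le> 1 / real p ^ multiplicity p n"
        using a p by (auto simp: approx_def)
      have ia: "nrm (iota n r ?v) = 1" "nrm (emb ?v (of_int r) \<ominus>\<^bsub>K\<^esub> iota n r ?v) \<le> 1 / real p ^ multiplicity p n"
        using iota_abs[OF p(1) n(2) r] Qv_abs_minus_commute[of "iota n r ?v" "emb ?v (of_int r)"] by auto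
      have "nrm (quot_comp x q ?v \<ominus>\<^bsub>K\<^esub> iota n r ?v) \<le> 1 / real p ^ multiplicity p n"
        using iu by (intro nrm_ultra_trans[OF qc _ _ ap(2) ia(2)]) auto
      thus "nrm (u ?v) = 1 \<and> nrm (u ?v \<ominus>\<^bsub>K\<^esub> \<one>\<^bsub>K\<^esub>) \<le> 1 / real p ^ multiplicity p n"
        using Qv_abs_quotient_minus_one[OF qc iu] ap ia iu qc by (simp add: uv Qv_abs_mult Qv_abs_inv)
    qed
    moreover have "u \<otimes>\<^bsub>adeles\<^esub> iota n r = idele_part (- S) y"
    proof (rule idele_eqI)
      fix v assume v: "v \<in> places"
      interpret completion v by (rule completionI[OF v])
      have "idele_part (- S) y v \<in> carrier K" using y v by (simp add: idele_closed)
      thus "(u \<otimes>\<^bsub>adeles\<^esub> iota n r) v = idele_part (- S) y v"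
        using v idele_unit[OF io v] by (simp add: u_def idele_mult_apply c K.m_assoc)
    qed (use u io y in auto)
    ultimately show ?thesis using ihom_mult[OF h u io] by simp
  qed
  finally show ?thesis .
qed

text \<open>The character over \<open>\<omega>\<close> that restricts to \<open>\<psi>\<close>. Compatibility of \<open>\<psi>\<close> with \<open>\<omega>\<close> on the \<open>S\<close>-units makes the
  value independent of the approximation.\<close>
definition Lam :: "nat \<Rightarrow> (int \<Rightarrow> complex) \<Rightarrow> (place \<Rightarrow> (nat \<Rightarrow> rat) set) \<Rightarrow> complex" where
  "Lam n \<psi> = (\<lambda>x\<in>ideles. THE z. \<exists>q r. approx n x q r \<and> z = Om (S_quot x q) * \<psi> (r mod int n))"

lemma Lam_eq:
  assumes "compat n \<psi>" "n \<in> QQ" "x \<in> ideles" "approx n x q r"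
  shows "Lam n \<psi> x = Om (S_quot x q) * \<psi> (r mod int n)"
proof -
  have "(THE z. \<exists>q r. approx n x q r \<and> z = Om (S_quot x q) * \<psi> (r mod int n)) = Om (S_quot x q) * \<psi> (r mod int n)"
    by (rule the_equality) (use approx_unique[OF assms(1-3)] assms(4) in blast)+
  thus ?thesis using assms(3) by (simp add: Lam_def)
qed

lemma S_quot_one_square: assumes "\<And>v. v \<in> S \<Longrightarrow> completion.is_square v (x v)" "x \<in> ideles"
  shows "Om (S_quot x 1) = 1"
  using assms quot_comp_one[OF assms(2) S_place] idele_closed[OF assms(2) S_place]
  by (intro Om_square) (auto simp: QS_squares_iff S_quot_def QS_simps)

lemma approx_units:
  assumes x: "x \<in> ideles" and a: "\<And>p. prime p \<Longrightarrow> p \<notin> SP \<Longrightarrow> Qv_abs (FinPlace p) (x (FinPlace p)) = 1 \<and>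
      Qv_abs (FinPlace p) (x (FinPlace p) \<ominus>\<^bsub>Qv (FinPlace p)\<^esub> \<one>\<^bsub>Qv (FinPlace p)\<^esub>) \<le> 1 / real p ^ multiplicity p n"
  shows "approx n x 1 1"
  unfolding approx_def using a completion.emb_1[OF completionI] by (simp add: quot_comp_one[OF x])

text \<open>Near \<open>x\<close> the pair (q, r) remains an approximation, and on \<open>S\<close>
  the quotient y / x is close enough to 1 to be a square at each place, so \<open>\<omega>\<close>
  does not see it.\<close>

lemma Lam_locally_constant:
  assumes c: "compat n \<psi>" and n: "n \<in> QQ" and x: "x \<in> ideles"
  obtains U where "idele_box U" "x \<in> Pi\<^sub>E places U" "\<And>y. y \<in> Pi\<^sub>E places U \<Longrightarrow> Lam n \<psi> y = Lam n \<psi> x"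
proof -
  obtain q r where a: "approx n x q r" using approx_ex[OF x n] .
  have q0: "q \<noteq> 0" and r: "coprime r (int n)" using a by (auto simp: approx_def)
  define Bp where "Bp = SP \<union> {p. p dvd n} \<union> {p. prime p \<and> x (FinPlace p) \<notin> Units (Zp p)}"
  have finB: "finite Bp" using finSP QQ_pos[OF n] x by (auto simp: Bp_def idele_iff)
  \<comment> \<open>Radii relative to the size of \<open>x v\<close>. At a prime the summand 3 makes
    y / x a local square, also at 2, and the multiplicity preserves the congruence modulo
    \<open>n\<close>; at infinity the radius 1 preserves the sign.\<close>
  define ep where "ep = (\<lambda>v. case v of InfPlace \<Rightarrow> 1 | FinPlace p \<Rightarrow> 1 / real p ^ (3 + multiplicity p n))"
  define U where "U = (\<lambda>v. case v of InfPlace \<Rightarrow> {y \<in> carrier (Qv v). Qv_abs v (y \<ominus>\<^bsub>Qv v\<^esub> x v) < ep v * Qv_abs v (x v)}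
    | FinPlace p \<Rightarrow> if p \<in> Bp then {y \<in> carrier (Qv v). Qv_abs v (y \<ominus>\<^bsub>Qv v\<^esub> x v) < ep v * Qv_abs v (x v)} else Units (Zp p))"
  have ep: "ep v > 0" "ep v \<le> 1" if "v \<in> places" for v
    using that by (auto simp: ep_def prime_gt_0_nat divide_le_eq_1 Suc_le_eq split: place.split intro!: one_le_power)
  have near_unit: "y \<in> Units (Qv v)" if v: "v \<in> places" and y: "y \<in> carrier (Qv v)" "Qv_abs v (y \<ominus>\<^bsub>Qv v\<^esub> x v) < ep v * Qv_abs v (x v)" for v y
  proof -
    interpret completion v by (rule completionI[OF v])
    have xu: "x v \<in> Units K" by (rule idele_unit[OF x v])
    have "y \<noteq> \<zero>\<^bsub>K\<^esub>"
    proof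
      assume y0: "y = \<zero>\<^bsub>K\<^esub>"
      have "Qv_abs v (x v) = Qv_abs v (y \<ominus>\<^bsub>K\<^esub> x v)" using xu y0 by (simp add: a_minus_def Qv_abs_uminus)
      also have "\<dots> < 1 * Qv_abs v (x v)" using y(2) ep[OF v] unit_abs_pos[OF xu]
        by (meson less_le_trans mult_right_mono less_imp_le)
      finally show False by simp
    qed
    thus ?thesis using y by (simp add: K_Units)
  qed
  have box: "idele_box U"
    unfolding idele_box_def
  proof (intro conjI ballI)
    fix v assume v: "v \<in> places"
    show "openin (Qv_topology v) (U v)"
      using v Qv_ball_open[OF v idele_closed[OF x v]] Zp_Units_open by (auto simp: U_def split: place.split)
    show "U v \<subseteq> Units (Qv v)"
      using v near_unit[OF v] idele_unit_at by (auto simp: U_def split: place.splits if_splits)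
  next
    show "finite {p. prime p \<and> U (FinPlace p) \<noteq> Units (Zp p)}"
      by (rule finite_subset[OF _ finB]) (auto simp: U_def)
  qed
  have xU: "x \<in> Pi\<^sub>E places U"
  proof -
    have "x v \<in> U v" if v: "v \<in> places" for v
    proof -
      interpret completion v by (rule completionI[OF v])
      have "x v \<in> {y \<in> carrier K. Qv_abs v (y \<ominus>\<^bsub>K\<^esub> x v) < ep v * Qv_abs v (x v)}"
        using idele_unit[OF x v] unit_abs_pos ep[OF v] by simp
      moreover have "x (FinPlace p) \<in> Units (Zp p)" if "p \<notin> Bp" "v = FinPlace p" for p
        using v that by (simp add: Bp_def)
      ultimately show ?thesis by (cases v) (auto simp: U_def)
    qed
    thus ?thesis using x by (auto simp: idele_iff PiE_def)
  qed
  have "Lam n \<psi> y = Lam n \<psi> x" if yU: "y \<in> Pi\<^sub>E places U" for y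
  proof -
    have y: "y \<in> ideles" using yU idele_box_subset[OF box] by blast
    have near: "Qv_abs v (y v \<ominus>\<^bsub>Qv v\<^esub> x v) < ep v * Qv_abs v (x v)" if v: "v \<in> places" "v = InfPlace \<or> (\<exists>p\<in>Bp. v = FinPlace p)" for v
    proof -
      have "y v \<in> U v" using yU v by auto
      thus ?thesis using v by (auto simp: U_def)
    qed
    have "approx n y q r" unfolding approx_def
    proof (intro conjI allI impI q0 r)
      fix p assume p: "prime p" "p \<notin> SP"
      interpret padic p by (rule padicI[OF p(1)])
      let ?v = "FinPlace p"
      have xy: "x ?v \<in> carrier K" "y ?v \<in> carrier K" using x y place by (auto simp: idele_closed)
      have xq: "nrm (quot_comp x q ?v) = 1" "nrm (quot_comp x q ?v \<ominus>\<^bsub>K\<^esub> emb ?v (of_int r)) \<le> 1 / real p ^ multiplicity p n"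
        using a p by (auto simp: approx_def)
      have qx: "quot_comp x q ?v \<in> carrier K" "quot_comp y q ?v \<in> carrier K" using quot_comp_closed x y place by auto
      have "nrm (quot_comp y q ?v) = 1 \<and> nrm (quot_comp y q ?v \<ominus>\<^bsub>K\<^esub> quot_comp x q ?v) \<le> 1 / real p ^ multiplicity p n"
      proof (cases "p \<in> Bp")
        case True
        have "quot_comp y q ?v \<ominus>\<^bsub>K\<^esub> quot_comp x q ?v = (y ?v \<ominus>\<^bsub>K\<^esub> x ?v) \<otimes>\<^bsub>K\<^esub> emb ?v (inverse q)"
          using xy by (simp add: quot_comp_def a_minus_def K.l_distr K.l_minus)
        hence "nrm (quot_comp y q ?v \<ominus>\<^bsub>K\<^esub> quot_comp x q ?v) = nrm (y ?v \<ominus>\<^bsub>K\<^esub> x ?v) * rat_abs ?v (inverse q)"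
          using xy by (simp add: Qv_abs_mult)
        also have "\<dots> \<le> ep ?v * nrm (x ?v) * rat_abs ?v (inverse q)"
          using near[OF place] True by (intro mult_right_mono) auto
        also have "\<dots> = ep ?v * nrm (quot_comp x q ?v)" using xy by (simp add: quot_comp_def Qv_abs_mult)
        also have "\<dots> = 1 / real p ^ (3 + multiplicity p n)" using xq by (simp add: ep_def)
        finally have le: "nrm (quot_comp y q ?v \<ominus>\<^bsub>K\<^esub> quot_comp x q ?v) \<le> 1 / real p ^ (3 + multiplicity p n)" .
        have lt: "1 / real p ^ (3 + multiplicity p n) < 1" using p_gt_1(1) by (simp add: one_less_power del: power_Suc)
        have "1 / real p ^ (3 + multiplicity p n) \<le> 1 / real p ^ multiplicity p n"
          using p_gt_1 by (intro divide_left_mono power_increasing) auto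
        moreover have "nrm (quot_comp y q ?v) = nrm (quot_comp x q ?v)"
          using le lt xq qx Qv_abs_minus_commute[OF qx] by (intro nrm_eq_of_close) auto
        ultimately show ?thesis using le xq by simp
      next
        case False
        have "y ?v \<in> U ?v" using yU place by (rule PiE_mem)
        hence "y ?v \<in> Units (Zp p)" using False by (simp add: U_def)
        hence y1: "nrm (y ?v) = 1" by (simp add: Zp_Units)
        have x1: "nrm (x ?v) = 1" using False p by (auto simp: Bp_def Zp_Units)
        have "nrm (quot_comp y q ?v) = nrm (quot_comp x q ?v)" using xy x1 y1 by (simp add: quot_comp_def Qv_abs_mult)
        moreover have "multiplicity p n = 0" using False by (simp add: Bp_def not_dvd_imp_multiplicity_0)
        ultimately show ?thesis using nrm_ultra_minus[OF qx(2,1)] xq by simp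
      qed
      thus "nrm (quot_comp y q ?v) = 1" "nrm (quot_comp y q ?v \<ominus>\<^bsub>K\<^esub> emb ?v (of_int r)) \<le> 1 / real p ^ multiplicity p n"
        using nrm_ultra_trans[OF qx(2,1) _ _ xq(2)] by auto
    qed
    moreover have "Om (S_quot y q) = Om (S_quot x q)"
    proof -
      \<comment> \<open>The quotient y / x on \<open>S\<close>; being a square at every place of
        \<open>S\<close>, it is a square in the product ring.\<close>
      define t where "t = (\<lambda>v\<in>S. y v \<otimes>\<^bsub>Qv v\<^esub> inv\<^bsub>Qv v\<^esub> (x v))"
      have ty: "t v \<in> Units (Qv v)" "y v = x v \<otimes>\<^bsub>Qv v\<^esub> t v" "completion.is_square v (t v)" if vS: "v \<in> S" for v
      proof -
        have v: "v \<in> places" by (rule S_place[OF vS])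
        interpret completion v by (rule completionI[OF v])
        have xu: "x v \<in> Units K" "y v \<in> Units K" using x y v by (auto simp: idele_unit)
        show tu: "t v \<in> Units K" using xu vS by (simp add: t_def)
        show "y v = x v \<otimes>\<^bsub>K\<^esub> t v" using unit_cancel(1)[of "y v" "x v"] xu vS by (simp add: t_def K.m_comm)
        have "Qv_abs v (t v \<ominus>\<^bsub>K\<^esub> \<one>\<^bsub>K\<^esub>) = Qv_abs v (y v \<ominus>\<^bsub>K\<^esub> x v) / Qv_abs v (x v)"
          using Qv_abs_quotient_minus_one[of "y v" "x v"] xu vS by (simp add: t_def)
        moreover have "Qv_abs v (y v \<ominus>\<^bsub>K\<^esub> x v) < ep v * Qv_abs v (x v)"
          using vS by (intro near[OF v]) (cases v; auto simp: Bp_def SP_iff)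
        ultimately have lt: "Qv_abs v (t v \<ominus>\<^bsub>K\<^esub> \<one>\<^bsub>K\<^esub>) < ep v"
          using unit_abs_pos[OF xu(1)] by (simp add: divide_less_eq)
        show "is_square (t v)" using v
        proof (cases rule: place_cases)
          case 1
          interpret real_place .
          have tc: "t InfPlace \<in> Units (Qv InfPlace)" using tu unfolding 1 .
          have "\<bar>Qinf_to_real (t InfPlace) - 1\<bar> < 1"
            using lt tc Qinf_abs[of "t InfPlace \<ominus>\<^bsub>Qv InfPlace\<^esub> \<one>\<^bsub>Qv InfPlace\<^esub>"] Qinf_minus[of "t InfPlace" "\<one>\<^bsub>Qv InfPlace\<^esub>"]
            unfolding 1 by (simp add: ep_def)
          hence "Qinf_to_real (t InfPlace) > 0" by (simp add: abs_less_iff)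
          thus ?thesis unfolding 1 by (rule inf_square[OF tc])
        next
          case (2 p)
          interpret P: padic p by (rule padicI[OF 2(2)])
          have "1 / real p ^ (3 + multiplicity p n) \<le> 1 / real p ^ (if p = 2 then 3 else 1)"
            using P.p_gt_1 by (intro divide_left_mono power_increasing) auto
          hence "Qv_abs (FinPlace p) (t v \<ominus>\<^bsub>Qv (FinPlace p)\<^esub> \<one>\<^bsub>Qv (FinPlace p)\<^esub>) \<le> 1 / real p ^ (if p = 2 then 3 else 1)"
            using lt unfolding 2(1) ep_def by simp
          thus ?thesis using tu unfolding 2(1) by (intro P.square_of_close_to_one) auto
        qed
      qed
      have "t \<in> extensional S" by (simp add: t_def)
      moreover have "t v \<in> carrier (Qv v)" if "v \<in> S" for v
        using Qv_unit_closed[OF ty(1)[OF that]] .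
      ultimately have "t \<in> carrier (QS S)" by (simp add: QS_simps PiE_iff)
      hence tS: "t \<in> QS_squares S" unfolding QS_squares_iff using ty(3) by blast
      have "S_quot y q = S_quot x q \<otimes>\<^bsub>QS S\<^esub> t"
      proof -
        have "quot_comp y q v = quot_comp x q v \<otimes>\<^bsub>Qv v\<^esub> t v" if vS: "v \<in> S" for v
        proof -
          interpret completion v by (rule S_completion[OF vS])
          show ?thesis using idele_closed[OF x S_place[OF vS]] unit_closed[OF ty(1)[OF vS]]
            by (simp add: quot_comp_def ty(2)[OF vS] K.m_ac)
        qed
        thus ?thesis by (auto simp: S_quot_def QS_simps intro!: restrict_ext)
      qed
      thus ?thesis using Om_mult[OF S_quot_unit[OF x q0], of t] tS Om_square[OF tS] by (auto simp: QS_squares_def)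
    qed
    ultimately show ?thesis using Lam_eq[OF c n y] Lam_eq[OF c n x a] by simp
  qed
  thus ?thesis using that box xU by blast
qed

text \<open>Each property is read off from a convenient approximation: (q, 1) for the diagonal image
  of q, products of approximations for products of ideles, and (1, 1) for ideles that are units
  close to 1 outside \<open>S\<close>.\<close>

lemma Lam_char:
  assumes c: "compat n \<psi>" and n: "n \<in> QQ"
  shows "Lam n \<psi> \<in> Ch" "cnd (Lam n \<psi>) dvd n"
proof -
  have psi: "\<psi> \<in> qchars n" using c by (simp add: compat_def)
  have n0: "n > 0" using QQ_pos[OF n] .
  have pm: "Lam n \<psi> x \<in> {1, -1}" if x: "x \<in> ideles" for x
  proof -
    obtain q r where a: "approx n x q r" using approx_ex[OF x n] .
    have "Om (S_quot x q) \<in> {1, -1}" using a by (intro Om_pm S_quot_unit[OF x]) (auto simp: approx_def)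
    moreover have "\<psi> (r mod int n) \<in> {1, -1}" using a by (intro qchar_mod_pm[OF psi n0]) (auto simp: approx_def)
    ultimately show ?thesis unfolding Lam_eq[OF c n x a] by auto
  qed
  have mult: "Lam n \<psi> (x \<otimes>\<^bsub>adeles\<^esub> y) = Lam n \<psi> x * Lam n \<psi> y" if x: "x \<in> ideles" and y: "y \<in> ideles" for x y
  proof -
    obtain q r where a: "approx n x q r" using approx_ex[OF x n] .
    obtain q' r' where b: "approx n y q' r'" using approx_ex[OF y n] .
    have "q \<noteq> 0" "q' \<noteq> 0" "coprime r (int n)" "coprime r' (int n)" using a b by (auto simp: approx_def)
    thus ?thesis
      unfolding Lam_eq[OF c n idele_mult[OF x y] approx_mult[OF x y a b]] Lam_eq[OF c n x a] Lam_eq[OF c n y b] S_quot_mult[OF x y]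
      using S_quot_unit[OF x] S_quot_unit[OF y] qchar_mod_mult[OF psi n0] by (simp add: Om_mult mult_ac)
  qed
  have hom: "ihom (Lam n \<psi>)" unfolding ihom_def using pm mult by fastforce
  have diag1: "Lam n \<psi> (diag places q) = 1" if q: "q \<noteq> 0" for q
  proof -
    have "S_quot (diag places q) q = \<one>\<^bsub>QS S\<^esub>"
      using quot_comp_diag[OF q S_place] by (auto simp: S_quot_def QS_simps intro!: restrict_ext)
    thus ?thesis using Lam_eq[OF c n diag_idele[OF q] approx_diag[OF q]] qchar_mod_1[OF psi n0] by simp
  qed
  have one_close: "Qv_abs (FinPlace p) \<one>\<^bsub>Qv (FinPlace p)\<^esub> = 1 \<and>
      Qv_abs (FinPlace p) (\<one>\<^bsub>Qv (FinPlace p)\<^esub> \<ominus>\<^bsub>Qv (FinPlace p)\<^esub> \<one>\<^bsub>Qv (FinPlace p)\<^esub>) \<le> 1 / real p ^ multiplicity p n"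
    if p: "prime p" for p
  proof -
    interpret padic p by (rule padicI[OF p])
    show ?thesis by simp
  qed
  \<comment> \<open>Used twice: positive reals are squares at infinity, which gives triviality
    there, and units close to 1 at a prime outside \<open>S\<close> give the bound on the
    conductor.\<close>
  have at: "Lam n \<psi> (idele_at v u) = 1"
    if v: "v \<in> places" and u: "u \<in> Units (Qv v)" and sq: "v \<in> S \<Longrightarrow> completion.is_square v u"
      and cl: "\<And>p. v = FinPlace p \<Longrightarrow> p \<notin> SP \<Longrightarrow> Qv_abs v u = 1 \<and> Qv_abs v (u \<ominus>\<^bsub>Qv v\<^esub> \<one>\<^bsub>Qv v\<^esub>) \<le> 1 / real p ^ multiplicity p n" for v u
  proof -
    let ?x = "idele_at v u"
    have x: "?x \<in> ideles" by (rule idele_at_idele[OF v u])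
    have a: "approx n ?x 1 1"
      using cl one_close by (intro approx_units[OF x]) (auto simp: idele_at_def)
    have "Om (S_quot ?x 1) = 1"
      using sq completion.is_square_one[OF S_completion] S_place by (intro S_quot_one_square x) (auto simp: idele_at_def)
    thus ?thesis using Lam_eq[OF c n x a] qchar_mod_1[OF psi n0] by simp
  qed
  have inf1: "Lam n \<psi> (idele_at InfPlace x) = 1" if x: "x \<in> Units (Qv InfPlace)" "Qinf_to_real x > 0" for x
  proof -
    interpret real_place .
    show ?thesis using inf_square[OF x] x(1) by (intro at) auto
  qed
  have cont: "continuous_map idele_topology euclidean (Lam n \<psi>)"
    unfolding continuous_map
  proof (intro conjI allI impI)
    fix W :: "complex set" assume "openin euclidean W"
    show "openin idele_topology {x \<in> topspace idele_topology. Lam n \<psi> x \<in> W}"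
    proof (subst openin_subopen, intro ballI)
      fix x assume x: "x \<in> {x \<in> topspace idele_topology. Lam n \<psi> x \<in> W}"
      obtain U where U: "idele_box U" "x \<in> Pi\<^sub>E places U" "\<And>y. y \<in> Pi\<^sub>E places U \<Longrightarrow> Lam n \<psi> y = Lam n \<psi> x"
        using Lam_locally_constant[OF c n] x topspace_idele_subset by blast
      have "Pi\<^sub>E places U \<subseteq> topspace idele_topology" using openin_subset[OF idele_open_box[OF U(1)]] .
      thus "\<exists>T. openin idele_topology T \<and> x \<in> T \<and> T \<subseteq> {x \<in> topspace idele_topology. Lam n \<psi> x \<in> W}"
      proof (intro exI[of _ "Pi\<^sub>E places U"] conjI subsetI)
        fix y assume "y \<in> Pi\<^sub>E places U"
        thus "y \<in> {x \<in> topspace idele_topology. Lam n \<psi> x \<in> W}"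
          using U(3) x \<open>Pi\<^sub>E places U \<subseteq> _\<close> by (metis (mono_tags, lifting) mem_Collect_eq subsetD)
      qed (use idele_open_box[OF U(1)] U(2) in blast)+
    qed
  qed simp
  have over: "(\<Prod>v\<in>S. local_component (Lam n \<psi>) v (x v)) = Om x" if x: "x \<in> Units (QS S)" for x
  proof -
    have xv: "x v \<in> Units (Qv v)" if "v \<in> S" for v using x that by (simp add: QS_Units_iff)
    let ?y = "idele_part S x"
    have y: "?y \<in> ideles" using finS xv by (intro idele_part_finite) auto
    have "(\<Prod>v\<in>S. local_component (Lam n \<psi>) v (x v)) = Lam n \<psi> ?y"
      using finS S_sub xv by (intro ihom_part[OF hom, symmetric]) auto
    moreover have "approx n ?y 1 1"
      using one_close by (intro approx_units[OF y]) (auto simp: idele_part_apply SP_iff)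
    moreover have "S_quot ?y 1 = x"
      using x quot_comp_one[OF y S_place] S_place
      by (intro QS_eqI) (auto simp: S_quot_def idele_part_apply QS_simps QS_Units_iff)
    ultimately show ?thesis using Lam_eq[OF c n y] qchar_mod_1[OF psi n0] by simp
  qed
  show Ch: "Lam n \<psi> \<in> Ch"
    unfolding characters_over_def real_idele_class_characters_def real_character_ideles
    using hom cont diag1 inf1 over by (auto simp: Lam_def Om_def sqclass_def)
  have ce: "conductor_exponent (Lam n \<psi>) p \<le> multiplicity p n" if p: "prime p" "p \<notin> SP" for p
    unfolding conductor_exponent_def
  proof (rule Least_le, intro ballI impI)
    fix u assume u: "u \<in> Units (Zp p)" "Qv_abs (FinPlace p) (u \<ominus>\<^bsub>Qv (FinPlace p)\<^esub> \<one>\<^bsub>Qv (FinPlace p)\<^esub>) \<le> 1 / real p ^ multiplicity p n"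
    thus "local_component (Lam n \<psi>) (FinPlace p) u = 1"
      unfolding local_component_def using p idele_unit_at[OF p(1)] by (intro at) (auto simp: SP_iff Zp_unit_prime)
  qed
  have ced: "p ^ conductor_exponent (Lam n \<psi>) p dvd n" if p: "prime p" "p \<notin> SP" for p
    using ce[OF p] multiplicity_dvd[of p n] by (meson le_imp_power_dvd dvd_trans)
  show "cnd (Lam n \<psi>) dvd n"
    unfolding conductor_outside_def using ced by (intro prime_power_prod_dvd[OF n0]) (auto simp: SP_iff)
qed

lemma Lam_iota:
  assumes c: "compat n \<psi>" and n: "n \<in> QQ" and r: "coprime r (int n)"
  shows "Lam n \<psi> (iota n r) = \<psi> (r mod int n)"
  using Lam_eq[OF c n iota_idele[OF n r] approx_iota[OF n r]] by (simp add: S_quot_iota[OF n r])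

definition psi_of :: "nat \<Rightarrow> ((place \<Rightarrow> (nat \<Rightarrow> rat) set) \<Rightarrow> complex) \<Rightarrow> int \<Rightarrow> complex" where
  "psi_of n chi = (\<lambda>r\<in>carrier (unit_group_mod n). chi (iota n r))"

text \<open>\<open>iota n r\<close> is approximated by (1, r') for every \<open>r'\<close> in the
  same class modulo \<open>n\<close>, and the value depends only on the approximation.\<close>

lemma iota_mod:
  assumes chi: "chi \<in> Ch" "cnd chi dvd n" and n: "n \<in> QQ" and r: "coprime r (int n)" "coprime r' (int n)"
    and eq: "r mod int n = r' mod int n"
  shows "chi (iota n r) = chi (iota n r')"
proof -
  have d: "int n dvd r - r'" using eq by (simp add: mod_eq_dvd_iff)
  have "approx n (iota n r) 1 r'" unfolding approx_def
  proof (intro conjI allI impI)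
    fix p assume p: "prime p" "p \<notin> SP"
    interpret padic p by (rule padicI[OF p(1)])
    note ia = iota_abs[OF p(1) n r(1)]
    show "nrm (quot_comp (iota n r) 1 (FinPlace p)) = 1"
      using ia quot_comp_one[OF iota_idele[OF n r(1)] place] by simp
    have "int p ^ multiplicity p n dvd r - r'"
      using d multiplicity_dvd[of p n] by (metis dvd_trans int_dvd_int_iff of_nat_power)
    hence "nrm (emb (FinPlace p) (of_int r) \<ominus>\<^bsub>K\<^esub> emb (FinPlace p) (of_int r')) \<le> 1 / real p ^ multiplicity p n"
      by (simp only: emb_close_iff)
    thus "nrm (quot_comp (iota n r) 1 (FinPlace p) \<ominus>\<^bsub>K\<^esub> emb (FinPlace p) (of_int r')) \<le> 1 / real p ^ multiplicity p n"
      unfolding quot_comp_one[OF iota_idele[OF n r(1)] place]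
      by (intro nrm_ultra_trans[OF ia(1) _ _ ia(3)]) auto
  qed (use r in auto)
  thus ?thesis using char_formula[OF chi n iota_idele[OF n r(1)]] S_quot_iota[OF n r(1)] by simp
qed

lemma char_formula':
  assumes chi: "chi \<in> Ch" "cnd chi dvd n" and n: "n \<in> QQ" and x: "x \<in> ideles" and a: "approx n x q r"
  shows "chi x = Om (S_quot x q) * psi_of n chi (r mod int n)"
proof -
  have n0: "n > 0" and r: "coprime r (int n)" using a QQ_pos[OF n] by (auto simp: approx_def)
  have m: "r mod int n \<in> carrier (unit_group_mod n)" "coprime (r mod int n) (int n)"
    using n0 r by (auto simp: unit_group_mod_def coprime_mod_left_iff)
  have "chi (iota n r) = chi (iota n (r mod int n))" using m r by (intro iota_mod[OF chi n]) auto
  thus ?thesis using char_formula[OF chi n x a] m by (simp add: psi_of_def)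
qed

text \<open>The product of two lifts \<open>iota\<close> is approximated by the product of the
  residues, so multiplicativity follows from the evaluation formula, and compatibility follows from
  the triviality of \<open>chi\<close> on the rationals.\<close>

lemma psi_of_compat:
  assumes chi: "chi \<in> Ch" "cnd chi dvd n" and n: "n \<in> QQ"
  shows "compat n (psi_of n chi)"
proof -
  note h = ChD(1)[OF chi(1)]
  have n0: "n > 0" using QQ_pos[OF n] .
  interpret G: comm_group "unit_group_mod n" by (rule unit_group_mod_comm_group[OF n0])
  let ?G = "unit_group_mod n"
  have cop: "coprime r (int n)" if "r \<in> carrier ?G" for r using that by (simp add: unit_group_mod_def)
  have mult: "psi_of n chi (r \<otimes>\<^bsub>?G\<^esub> s) = psi_of n chi r * psi_of n chi s" if rs: "r \<in> carrier ?G" "s \<in> carrier ?G" for r s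
  proof -
    have io: "iota n r \<in> ideles" "iota n s \<in> ideles" using iota_idele[OF n] cop rs by auto
    have "approx n (iota n r \<otimes>\<^bsub>adeles\<^esub> iota n s) (1 * 1) (r * s)"
      using cop rs by (intro approx_mult io approx_iota n) auto
    hence "chi (iota n r \<otimes>\<^bsub>adeles\<^esub> iota n s) = Om (S_quot (iota n r \<otimes>\<^bsub>adeles\<^esub> iota n s) (1 * 1)) * psi_of n chi (r * s mod int n)"
      by (rule char_formula'[OF chi n idele_mult[OF io]])
    also have "S_quot (iota n r \<otimes>\<^bsub>adeles\<^esub> iota n s) (1 * 1) = \<one>\<^bsub>QS S\<^esub>"
      unfolding S_quot_mult[OF io] using S_quot_iota[OF n] cop rs by simp
    finally have "psi_of n chi (r * s mod int n) = chi (iota n r) * chi (iota n s)"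
      using ihom_mult[OF h io] by simp
    thus ?thesis using rs by (simp add: psi_of_def unit_group_mod_def)
  qed
  have one: "psi_of n chi \<one>\<^bsub>?G\<^esub> = 1"
  proof -
    have nz: "psi_of n chi \<one>\<^bsub>?G\<^esub> \<noteq> 0"
      using h iota_idele[OF n cop[OF G.one_closed]] by (simp add: psi_of_def ihom_def)
    moreover have "psi_of n chi \<one>\<^bsub>?G\<^esub> = psi_of n chi \<one>\<^bsub>?G\<^esub> * psi_of n chi \<one>\<^bsub>?G\<^esub>"
      using mult[OF G.one_closed G.one_closed] by simp
    ultimately show ?thesis by simp
  qed
  have pm: "psi_of n chi r \<in> {1, -1}" if r: "r \<in> carrier ?G" for r
  proof -
    \<comment> \<open>The finite order of the residue group makes the value a real root of unity,
      hence 1 or -1.\<close>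
    have pw: "psi_of n chi (r [^]\<^bsub>?G\<^esub> k) = psi_of n chi r ^ k" for k :: nat
      by (induction k) (use r one mult in auto)
    have "psi_of n chi r ^ order ?G = 1" using pw[of "order ?G"] G.pow_order_eq_1[OF r] one by simp
    moreover have "order ?G > 0" using finite_unit_group_mod G.one_closed by (auto simp: order_def card_gt_0_iff)
    moreover have "psi_of n chi r \<in> \<real>"
      using h iota_idele[OF n cop[OF r]] r by (simp add: psi_of_def ihom_def)
    then obtain z where z: "psi_of n chi r = of_real z" by (auto simp: Reals_def)
    ultimately have "\<bar>z\<bar> ^ order ?G = 1" by (metis norm_of_real norm_one norm_power)
    hence "\<bar>z\<bar> = 1" using \<open>order ?G > 0\<close> using power_eq_imp_eq_base[of "\<bar>z\<bar>" "order ?G" 1] by simp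
    thus ?thesis using z by (auto simp: abs_if split: if_splits)
  qed
  have q: "psi_of n chi \<in> qchars n"
  proof -
    have "psi_of n chi \<in> extensional (carrier ?G)" by (simp add: psi_of_def)
    thus ?thesis unfolding quad_chars_def using pm mult by blast
  qed
  \<comment> \<open>The diagonal image of \<open>e\<close> is approximated by (1, e), so the trivial
    value of \<open>chi\<close> there is the product of the sign from \<open>\<omega>\<close> and
    the value modulo \<open>n\<close>.\<close>
  have S_unit: "psi_of n chi (e mod int n) = wq (of_int e)"
    if e: "e \<noteq> 0" "coprime e (int n)" "\<And>p. prime p \<Longrightarrow> p \<notin> SP \<Longrightarrow> \<not> int p dvd e" for e
  proof -
    let ?d = "diag places (of_int e)"
    have d: "?d \<in> ideles" using e by (intro diag_idele) simp
    have qc: "quot_comp ?d 1 v = emb v (of_int e)" if "v \<in> places" for v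
      using quot_comp_one[OF d that] that by (simp add: diag_def)
    have "approx n ?d 1 e" unfolding approx_def
    proof (intro conjI allI impI)
      fix p assume p: "prime p" "p \<notin> SP"
      interpret padic p by (rule padicI[OF p(1)])
      show "nrm (quot_comp ?d 1 (FinPlace p)) = 1"
        "nrm (quot_comp ?d 1 (FinPlace p) \<ominus>\<^bsub>K\<^esub> emb (FinPlace p) (of_int e)) \<le> 1 / real p ^ multiplicity p n"
        unfolding qc[OF place] using e(3)[OF p] rat_abs_int_eq_1_iff[of e] by auto
    qed (use e in auto)
    from char_formula'[OF chi n d this] have "1 = Om (S_quot ?d 1) * psi_of n chi (e mod int n)"
      using ChD(4)[OF chi(1), of "of_int e"] e by simp
    moreover have "S_quot ?d 1 = diag S (of_int e)"
      using qc[OF S_place] by (auto simp: S_quot_def diag_def intro!: restrict_ext)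
    ultimately have "1 = wq (of_int e) * psi_of n chi (e mod int n)" by (simp add: wq_def)
    hence "wq (of_int e) * 1 = (wq (of_int e) * wq (of_int e)) * psi_of n chi (e mod int n)" by (simp add: mult.assoc)
    thus ?thesis using wq_sq[of "of_int e"] e by simp
  qed
  have "psi_of n chi ((-1) mod int n) = wq (of_int (-1))"
    by (rule S_unit) auto
  moreover have "psi_of n chi (int p mod int n) = wq (of_int (int p))" if p: "p \<in> SP" for p
  proof (rule S_unit)
    have pp: "prime p" by (rule SP_prime[OF p])
    show "int p \<noteq> 0" using pp by (simp add: prime_gt_0_nat)
    have "\<not> p dvd n" using p QQ_prime_notin[OF n pp] by blast
    thus "coprime (int p) (int n)" using pp by (simp add: prime_imp_coprime)
    show "\<not> int l dvd int p" if "prime l" "l \<notin> SP" for l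
      using that p pp primes_dvd_imp_eq by auto
  qed
  ultimately show ?thesis using q by (simp add: compat_def)
qed

text \<open>The two constructions are inverse because on both sides the value is computed from the
  same approximations; extensionality settles the arguments outside the respective groups.\<close>

lemma char_bij:
  assumes n: "n \<in> QQ"
  shows "bij_betw (psi_of n) {chi \<in> Ch. cnd chi dvd n} {\<psi>. compat n \<psi>}"
proof (rule bij_betwI[where g = "Lam n"])
  show "psi_of n \<in> {chi \<in> Ch. cnd chi dvd n} \<rightarrow> {\<psi>. compat n \<psi>}" using psi_of_compat n by auto
  show "Lam n \<in> {\<psi>. compat n \<psi>} \<rightarrow> {chi \<in> Ch. cnd chi dvd n}" using Lam_char n by auto
  show "Lam n (psi_of n chi) = chi" if chi: "chi \<in> {chi \<in> Ch. cnd chi dvd n}" for chi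
  proof
    fix x
    have c: "chi \<in> Ch" "cnd chi dvd n" using chi by auto
    show "Lam n (psi_of n chi) x = chi x"
    proof (cases "x \<in> ideles")
      case True
      obtain q r where a: "approx n x q r" using approx_ex[OF True n] .
      show ?thesis using Lam_eq[OF psi_of_compat[OF c n] n True a] char_formula'[OF c n True a] by simp
    next
      case False
      thus ?thesis using ChD(2)[OF c(1)] by (simp add: Lam_def extensional_def)
    qed
  qed
  show "psi_of n (Lam n \<psi>) = \<psi>" if "\<psi> \<in> {\<psi>. compat n \<psi>}" for \<psi>
  proof
    have c: "compat n \<psi>" using that by simp
    hence ext: "\<psi> \<in> extensional (carrier (unit_group_mod n))" by (simp add: compat_def quad_chars_def)
    fix r show "psi_of n (Lam n \<psi>) r = \<psi> r"
    proof (cases "r \<in> carrier (unit_group_mod n)")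
      case True
      hence "coprime r (int n)" "r mod int n = r" by (auto simp: unit_group_mod_def)
      thus ?thesis using Lam_iota[OF c n, of r] True by (simp add: psi_of_def)
    qed (use ext in \<open>simp add: psi_of_def extensional_def\<close>)
  qed
qed

section \<open>Characters as completely multiplicative functions of integers\<close>

definition local_value :: "((place \<Rightarrow> (nat \<Rightarrow> rat) set) \<Rightarrow> complex) \<Rightarrow> nat \<Rightarrow> complex" where
  "local_value chi p = (if p \<notin> SP \<and> unramified chi p
     then local_component chi (FinPlace p) (emb (FinPlace p) (of_nat p)) else 0)"

text \<open>The Dirichlet coefficients of the L-function: a product of local values, zero as soon as
  a prime of \<open>S\<close> or a ramified prime divides the argument.\<close>

definition Xc :: "((place \<Rightarrow> (nat \<Rightarrow> rat) set) \<Rightarrow> complex) \<Rightarrow> nat \<Rightarrow> complex" where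
  "Xc chi m = (if m = 0 then 0 else \<Prod>p\<in>prime_factors m. local_value chi p ^ multiplicity p m)"

text \<open>The idele that is p at the place p and 1 elsewhere becomes, after division by the
  rational p, equal to 1 at p and to 1/p at all other places. It is therefore approximated by (p, r)
  with r an inverse of p modulo \<open>n\<close>. Besides the residue character this leaves the sign
  of 1/p under \<open>\<omega>\<close>; inverses may be dropped since all values are signs.\<close>

lemma local_value_eq:
  assumes chi: "chi \<in> Ch" "cnd chi dvd n" and n: "n \<in> QQ" and p: "prime p" "p \<notin> SP" "\<not> p dvd n"
  shows "local_value chi p = wq (of_nat p) * psi_of n chi (int p mod int n)"
proof -
  have n0: "n > 0" using QQ_pos[OF n] .
  have un: "unramified chi p"
    using conductor_le_multiplicity[OF chi n p(1,2)] p(3) conductor(5)[OF chi(1) p(1)]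
    by (simp add: not_dvd_imp_multiplicity_0)
  let ?x = "idele_at (FinPlace p) (emb (FinPlace p) (of_nat p))"
  have p0: "(of_nat p :: rat) \<noteq> 0" using p by (simp add: prime_gt_0_nat)
  have x: "?x \<in> ideles" using p p0 completion.emb_unit_iff[OF completionI, of "FinPlace p"] by (intro idele_at_idele) auto
  have cp: "coprime (int p) (int n)" using p by (simp add: prime_imp_coprime)
  then obtain r where "[int p * r = 1] (mod int n)" using cong_solve_coprime_int by blast
  hence r: "int n dvd int p * r - 1" by (simp add: cong_iff_dvd_diff)
  have cr: "coprime r (int n)"
  proof (rule ccontr)
    assume "\<not> coprime r (int n)"
    then obtain l where l: "l dvd r" "l dvd int n" "\<not> is_unit l" by (auto simp: coprime_def)
    have "l dvd int p * r - (int p * r - 1)" by (rule dvd_diff[OF dvd_mult[OF l(1)] dvd_trans[OF l(2) r]])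
    moreover have "int p * r - (int p * r - 1) = 1" by simp
    ultimately show False using l(3) by metis
  qed
  have "approx n ?x (of_nat p) r" unfolding approx_def
  proof (intro conjI allI impI p0 cr)
    fix l assume l: "prime l" "l \<notin> SP"
    interpret padic l by (rule padicI[OF l(1)])
    have qc: "quot_comp ?x (of_nat p) (FinPlace l) = (if l = p then \<one>\<^bsub>K\<^esub> else emb (FinPlace l) (inverse (of_nat p)))"
    proof (cases "l = p")
      case True
      have "emb (FinPlace l) (of_nat p) \<otimes>\<^bsub>K\<^esub> emb (FinPlace l) (inverse (of_nat p)) = \<one>\<^bsub>K\<^esub>"
        using p0 by (simp flip: emb_mult)
      thus ?thesis using True l by (simp add: quot_comp_def idele_at_def)
    qed (use l in \<open>simp add: quot_comp_def idele_at_def\<close>)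
    show "nrm (quot_comp ?x (of_nat p) (FinPlace l)) = 1"
    proof (cases "l = p")
      case True
      show ?thesis unfolding qc if_P[OF True] by simp
    next
      case False
      show ?thesis unfolding qc if_not_P[OF False]
        using l p p0 False rat_abs_eq_1_iff[of "inverse (of_nat p)"] by (simp add: vp_inverse vp_prime)
    qed
    show "nrm (quot_comp ?x (of_nat p) (FinPlace l) \<ominus>\<^bsub>K\<^esub> emb (FinPlace l) (of_int r)) \<le> 1 / real l ^ multiplicity l n"
    proof (cases "l = p")
      case True
      have "nrm (\<one>\<^bsub>K\<^esub> \<ominus>\<^bsub>K\<^esub> emb (FinPlace l) (of_int r)) \<le> 1"
        using nrm_ultra_minus[of "\<one>\<^bsub>K\<^esub>" "emb (FinPlace l) (of_int r)"] rat_abs_int_le_1[of r] by simp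
      thus ?thesis unfolding qc if_P[OF True] using True p by (simp add: not_dvd_imp_multiplicity_0)
    next
      case False
      have ia: "rat_abs (FinPlace l) (inverse (of_nat p)) = 1"
        using l p False p0 rat_abs_eq_1_iff[of "inverse (of_nat p)"] by (auto simp: vp_inverse vp_prime)
      have "inverse (of_nat p) - of_int r = - (inverse (of_nat p) * of_int (int p * r - 1) :: rat)"
        using p0 by (simp add: field_simps)
      hence "rat_abs (FinPlace l) (inverse (of_nat p) - of_int r) = rat_abs (FinPlace l) (of_int (int p * r - 1))"
        using ia by (simp only: rat_abs_uminus rat_abs_mult[OF place] mult_1_left)
      also have "\<dots> \<le> 1 / real l ^ multiplicity l n"
      proof -
        have "int l ^ multiplicity l n dvd int n" using multiplicity_dvd[of l n] by (metis int_dvd_int_iff of_nat_power)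
        from dvd_trans[OF this r] show ?thesis by (simp only: rat_abs_int_le_iff)
      qed
      finally show ?thesis unfolding qc if_not_P[OF False] by (simp flip: emb_diff)
    qed
  qed
  from char_formula'[OF chi n x this]
  have "chi ?x = Om (S_quot ?x (of_nat p)) * psi_of n chi (r mod int n)" .
  also have "S_quot ?x (of_nat p) = diag S (inverse (of_nat p))"
  proof -
    have "quot_comp ?x (of_nat p) v = emb v (inverse (of_nat p))" if v: "v \<in> S" for v
    proof -
      interpret completion v by (rule S_completion[OF v])
      have "v \<noteq> FinPlace p" using v p by (auto simp: SP_iff)
      thus ?thesis using S_place[OF v] by (simp add: quot_comp_def idele_at_def)
    qed
    thus ?thesis by (auto simp: S_quot_def diag_def intro!: restrict_ext)
  qed
  also have "Om (diag S (inverse (of_nat p))) = wq (of_nat p)" using wq_inverse[OF p0] by (simp add: wq_def)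
  also have "psi_of n chi (r mod int n) = psi_of n chi (int p mod int n)"
  proof -
    have psi: "psi_of n chi \<in> qchars n" using psi_of_compat[OF chi n] by (simp add: compat_def)
    have "int p * r mod int n = 1 mod int n" using r by (simp add: mod_eq_dvd_iff)
    hence "psi_of n chi (int p mod int n) * psi_of n chi (r mod int n) = 1"
      using qchar_mod_mult[OF psi n0 cp cr] qchar_mod_1[OF psi n0] by simp
    thus ?thesis using qchar_mod_pm[OF psi n0 cp] qchar_mod_pm[OF psi n0 cr] by auto
  qed
  finally show ?thesis using un p by (simp add: local_value_def local_component_def)
qed

lemma Xc_1: "Xc chi 1 = 1"
  by (simp add: Xc_def)

lemma Xc_mult: assumes "m > 0" "k > 0" shows "Xc chi (m * k) = Xc chi m * Xc chi k"
proof -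
  let ?F = "prime_factors m \<union> prime_factors k"
  have *: "(\<Prod>p\<in>prime_factors j. local_value chi p ^ multiplicity p j) = (\<Prod>p\<in>?F. local_value chi p ^ multiplicity p j)"
    if "j = m \<or> j = k" for j
  proof (rule prod.mono_neutral_left)
    show "\<forall>i\<in>?F - prime_factors j. local_value chi i ^ multiplicity i j = 1"
    proof
      fix i assume i: "i \<in> ?F - prime_factors j"
      hence "\<not> i dvd j" using that assms by (auto simp: in_prime_factors_iff)
      thus "local_value chi i ^ multiplicity i j = 1" by (simp add: not_dvd_imp_multiplicity_0)
    qed
  qed (use that in auto)
  have "Xc chi (m * k) = (\<Prod>p\<in>?F. local_value chi p ^ multiplicity p (m * k))"
    using assms by (simp add: Xc_def prime_factors_product)
  also have "\<dots> = (\<Prod>p\<in>?F. local_value chi p ^ multiplicity p m * local_value chi p ^ multiplicity p k)"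
    using assms by (intro prod.cong) (auto simp: in_prime_factors_iff prime_elem_multiplicity_mult_distrib power_add)
  also have "\<dots> = Xc chi m * Xc chi k" using assms *[of m] *[of k] by (simp add: Xc_def prod.distrib)
  finally show ?thesis .
qed

lemma Xc_prime: "prime p \<Longrightarrow> Xc chi p = local_value chi p"
  by (simp add: Xc_def prime_factorization_prime prime_gt_0_nat multiplicity_prime)

lemma cnd_prime_dvd:
  assumes chi: "chi \<in> Ch" and p: "prime p" "p dvd cnd chi"
  shows "conductor_exponent chi p \<noteq> 0"
proof -
  let ?B = "{l. prime l \<and> FinPlace l \<notin> S \<and> conductor_exponent chi l \<noteq> 0}"
  have fin: "finite ?B" by (rule finite_subset[OF _ conductor(2)[OF chi]]) auto
  have "\<exists>l\<in>?B. p dvd l ^ conductor_exponent chi l"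
    using p(2) unfolding conductor_outside_def prime_dvd_prod_iff[OF fin p(1)] .
  then obtain l where l: "l \<in> ?B" "p dvd l ^ conductor_exponent chi l" by (elim bexE)
  hence "p dvd l" using prime_dvd_power[OF p(1)] by blast
  hence "p = l" using l(1) by (intro primes_dvd_imp_eq[OF p(1)]) simp_all
  thus ?thesis using l(1) by simp
qed

text \<open>Applied with \<open>n\<close> the conductor itself, the formula for the local value
  exhibits it as a product of two signs at an unramified prime outside \<open>S\<close>.\<close>

lemma local_value_le: assumes chi: "chi \<in> Ch" and p: "prime p" shows "norm (local_value chi p) \<le> 1"
proof (cases "p \<notin> SP \<and> unramified chi p")
  case True
  let ?n = "cnd chi"
  have n: "?n \<in> QQ" by (rule conductor(4)[OF chi])
  have np: "\<not> p dvd ?n"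
  proof
    assume "p dvd ?n"
    hence "conductor_exponent chi p \<noteq> 0" by (rule cnd_prime_dvd[OF chi p])
    thus False using True conductor(5)[OF chi p] by simp
  qed
  have psi: "psi_of ?n chi \<in> qchars ?n" using psi_of_compat[OF chi dvd_refl n] by (simp add: compat_def)
  have "coprime (int p) (int ?n)" using p np by (simp add: prime_imp_coprime)
  hence "psi_of ?n chi (int p mod int ?n) \<in> {1, -1}" using qchar_mod_pm[OF psi QQ_pos[OF n]] by blast
  moreover have "wq (of_nat p) \<in> {1, -1}" using p by (intro wq_pm) (simp add: prime_gt_0_nat)
  ultimately show ?thesis using local_value_eq[OF chi dvd_refl n p _ np] True by auto
qed (auto simp: local_value_def)

lemma Xc_le: assumes chi: "chi \<in> Ch" shows "norm (Xc chi m) \<le> 1"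
proof -
  have "(\<Prod>p\<in>prime_factors m. norm (local_value chi p) ^ multiplicity p m) \<le> 1"
  proof (intro prod_le_1 conjI)
    fix p assume "p \<in> prime_factors m"
    hence "prime p" by (simp add: in_prime_factors_iff)
    thus "norm (local_value chi p) ^ multiplicity p m \<le> 1" by (intro power_le_one local_value_le[OF chi]) auto
  qed simp
  thus ?thesis by (simp add: Xc_def norm_power flip: prod_norm)
qed

lemma Xc_0:
  assumes chi: "chi \<in> Ch" and nc: "\<not> coprime m (cnd chi)"
  shows "Xc chi m = 0"
proof (cases "m = 0")
  case False
  have "gcd m (cnd chi) \<noteq> 1" using nc by (metis coprime_iff_gcd_eq_1)
  then obtain p where p: "prime p" "p dvd m" "p dvd cnd chi" using prime_factor_nat by (metis gcd_nat.bounded_iff)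
  have "conductor_exponent chi p \<noteq> 0" by (rule cnd_prime_dvd[OF chi p(1,3)])
  hence "local_value chi p = 0" using conductor(5)[OF chi p(1)] by (simp add: local_value_def)
  moreover have "p \<in> prime_factors m" "multiplicity p m > 0"
    using p False by (auto simp: in_prime_factors_iff prime_multiplicity_gt_zero_iff)
  ultimately show ?thesis using False by (auto simp: Xc_def prod_zero_iff intro!: bexI[of _ p])
qed (simp add: Xc_def)

lemma Xc_eq:
  assumes chi: "chi \<in> Ch" "cnd chi dvd n" and n: "n \<in> QQ"
  shows "m \<in> QQ \<Longrightarrow> coprime m n \<Longrightarrow> Xc chi m = wq (of_nat m) * psi_of n chi (int m mod int n)"
proof (induction m rule: less_induct)
  case (less m)
  have n0: "n > 0" using QQ_pos[OF n] .
  have psi: "psi_of n chi \<in> qchars n" using psi_of_compat[OF chi n] by (simp add: compat_def)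
  show ?case
  proof (cases "m = 1")
    case True
    thus ?thesis using Xc_1 qchar_mod_1[OF psi n0] by simp
  next
    case False
    then obtain p where p: "prime p" "p dvd m" using prime_factor_nat by blast
    then obtain k where k: "m = p * k" by (auto simp: dvd_def)
    have m0: "m > 0" using less.prems QQ_pos by blast
    have k0: "k > 0" "k < m" using k m0 prime_gt_1_nat[OF p(1)] by auto
    have kQ: "k \<in> QQ" "p \<in> QQ" using less.prems(1) coprime_nats_mult[OF SP_prime, where m = p and n = k] k by auto
    have cop: "coprime p n" "coprime k n" using less.prems(2) k by auto
    have "\<not> p dvd n" using cop(1) p(1) by (metis coprime_absorb_left not_prime_unit)
    hence lv: "local_value chi p = wq (of_nat p) * psi_of n chi (int p mod int n)"
      using kQ(2) p(1) by (intro local_value_eq[OF chi n]) (auto simp: coprime_nats_def)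
    have "Xc chi m = Xc chi p * Xc chi k" unfolding k using p k0 by (intro Xc_mult) (auto simp: prime_gt_0_nat)
    also have "\<dots> = (wq (of_nat p) * wq (of_nat k)) * (psi_of n chi (int p mod int n) * psi_of n chi (int k mod int n))"
      using less.IH[OF k0(2) kQ(1) cop(2)] lv p by (simp add: Xc_prime)
    also have "psi_of n chi (int p mod int n) * psi_of n chi (int k mod int n) = psi_of n chi (int m mod int n)"
      using qchar_mod_mult[OF psi n0, of "int p" "int k"] cop k by simp
    also have "wq (of_nat p) * wq (of_nat k) = wq (of_nat m)"
      unfolding k using p k0 by (simp add: wq_mult prime_gt_0_nat)
    finally show ?thesis .
  qed
qed

text \<open>Sign and set of primes represent an \<open>S\<close>-unit modulo squares.\<close>
definition SE :: "(int \<times> nat set) set" where "SE = {1, -1} \<times> Pow SP"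

definition sev :: "int \<times> nat set \<Rightarrow> int" where "sev = (\<lambda>(s, A). s * int (\<Prod>A))"

lemma sev_unit: assumes "e \<in> SE" "prime p" "p \<notin> SP" shows "\<not> int p dvd sev e"
proof
  assume d: "int p dvd sev e"
  obtain s A where e: "e = (s, A)" "s \<in> {1, -1}" "A \<subseteq> SP" using assms by (auto simp: SE_def)
  have "int p dvd int (\<Prod>A)" using d e by (auto simp: sev_def)
  hence "p dvd \<Prod>A" by (simp only: int_dvd_int_iff)
  then obtain l where "l \<in> A" "p dvd l" using assms(2) finite_subset[OF e(3) finSP] by (auto simp: prime_dvd_prod_iff)
  thus False using assms e SP_prime primes_dvd_imp_eq by blast
qed

lemma sev_nz: assumes "e \<in> SE" shows "sev e \<noteq> 0"
proof -
  obtain s A where e: "e = (s, A)" "s \<in> {1, -1}" "A \<subseteq> SP" using assms by (auto simp: SE_def)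
  have "0 \<notin> A" using e(3) SP_prime[of 0] by auto
  hence "\<Prod>A \<noteq> 0" using finite_subset[OF e(3) finSP] by (simp add: prod_zero_iff)
  hence "int (\<Prod>A) \<noteq> 0" by (simp only: of_nat_eq_0_iff not_False_eq_True)
  moreover have "s \<noteq> 0" using e(2) by auto
  ultimately show ?thesis unfolding e(1) sev_def prod.case by (rule no_zero_divisors[rotated])
qed

lemma sev_coprime: assumes "e \<in> SE" "n \<in> QQ" shows "coprime (sev e) (int n)"
proof (rule ccontr)
  assume "\<not> coprime (sev e) (int n)"
  hence "gcd (sev e) (int n) \<noteq> 1" by (metis coprime_iff_gcd_eq_1)
  hence "nat (gcd (sev e) (int n)) \<noteq> 1" by (metis gcd_ge_0_int int_nat_eq of_nat_1)
  then obtain p where p: "prime p" "p dvd nat (gcd (sev e) (int n))" using prime_factor_nat by blast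
  hence "int p dvd gcd (sev e) (int n)" by (metis gcd_ge_0_int int_dvd_int_iff int_nat_eq)
  hence "int p dvd sev e" "p dvd n" by auto
  thus False using sev_unit[OF assms(1) p(1)] QQ_prime_notin[OF assms(2) p(1)] by blast
qed

text \<open>Orthogonality over the square classes of \<open>S\<close>-units selects the characters that glue with \<open>\<omega>\<close>.\<close>
lemma SE_orthogonality:
  assumes psi: "\<psi> \<in> qchars n" and n: "n \<in> QQ"
  shows "(\<Sum>e\<in>SE. wq (of_int (sev e)) * \<psi> (sev e mod int n)) = (if compat n \<psi> then 2 ^ card S else 0)"
proof -
  have n0: "n > 0" using QQ_pos[OF n] .
  define th where "th = (\<lambda>a::int. wq (of_int a) * \<psi> (a mod int n))"
  have th_mult: "th (a * b) = th a * th b" if "a \<noteq> 0" "b \<noteq> 0" "coprime a (int n)" "coprime b (int n)" for a b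
    using that qchar_mod_mult[OF psi n0] by (simp add: th_def wq_mult)
  have th_1: "th 1 = 1" using qchar_mod_1[OF psi n0] by (simp add: th_def)
  have pc: "coprime (int p) (int n)" "int p \<noteq> 0" if p: "p \<in> SP" for p
  proof -
    have pp: "prime p" by (rule SP_prime[OF p])
    show "int p \<noteq> 0" using pp by (simp add: prime_gt_0_nat)
    have "\<not> p dvd n" using p QQ_prime_notin[OF n pp] by blast
    thus "coprime (int p) (int n)" using pp by (simp add: prime_imp_coprime)
  qed
  have prodA: "th (int (\<Prod>A)) = (\<Prod>p\<in>A. th (int p)) \<and> coprime (int (\<Prod>A)) (int n) \<and> \<Prod>A \<noteq> 0" if "A \<subseteq> SP" for A
    using finite_subset[OF that finSP] that
  proof (induction A rule: finite_induct)
    case (insert p A)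
    thus ?case using pc[of p] th_mult[of "int p" "int (\<Prod>A)"] by simp
  qed (simp add: th_1)
  have pm: "th a = 1 \<or> th a = -1" if "a \<noteq> 0" "coprime a (int n)" for a
    using wq_pm[of "of_int a"] qchar_mod_pm[OF psi n0 that(2)] that by (auto simp: th_def)
  have th_iff: "th a = 1 \<longleftrightarrow> \<psi> (a mod int n) = wq (of_int a)" if "a \<noteq> 0" "coprime a (int n)" for a
    using wq_pm[of "of_int a"] qchar_mod_pm[OF psi n0 that(2)] that by (auto simp: th_def)
  have "(\<Sum>e\<in>SE. wq (of_int (sev e)) * \<psi> (sev e mod int n)) = (\<Sum>(s, A)\<in>{1, -1} \<times> Pow SP. th (s * int (\<Prod>A)))"
    by (auto simp: SE_def sev_def th_def intro!: sum.cong)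
  also have "\<dots> = (\<Sum>s\<in>{1, -1}. \<Sum>A\<in>Pow SP. th (s * int (\<Prod>A)))" by (rule sum.cartesian_product[symmetric])
  also have "\<dots> = (\<Sum>s\<in>{1, -1}. \<Sum>A\<in>Pow SP. th s * (\<Prod>p\<in>A. th (int p)))"
  proof (intro sum.cong refl)
    fix s :: int and A assume s: "s \<in> {1, -1}" and A: "A \<in> Pow SP"
    have "s \<noteq> 0" "coprime s (int n)" using s by auto
    moreover have "int (\<Prod>A) \<noteq> 0" unfolding of_nat_eq_0_iff using prodA A by blast
    moreover have "coprime (int (\<Prod>A)) (int n)" "th (int (\<Prod>A)) = (\<Prod>p\<in>A. th (int p))" using prodA A by blast+
    ultimately show "th (s * int (\<Prod>A)) = th s * (\<Prod>p\<in>A. th (int p))" using th_mult by presburger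
  qed
  also have "\<dots> = (th 1 + th (-1)) * (\<Sum>A\<in>Pow SP. \<Prod>p\<in>A. th (int p))"
    by (simp add: sum_distrib_left[symmetric] distrib_right)
  \<comment> \<open>Summing a multiplicative function over all subsets of \<open>SP\<close> factors
    into the product of 1 + th(p), which vanishes as soon as one value is -1.\<close>
  also have "(\<Sum>A\<in>Pow SP. \<Prod>p\<in>A. th (int p)) = (\<Prod>p\<in>SP. th (int p) + 1)"
    using prod_add[OF finSP, of "\<lambda>p. th (int p)" "\<lambda>_. 1"] by simp
  finally have eq: "(\<Sum>e\<in>SE. wq (of_int (sev e)) * \<psi> (sev e mod int n)) = (1 + th (-1)) * (\<Prod>p\<in>SP. th (int p) + 1)"
    by (simp add: th_1)
  have c_iff: "compat n \<psi> \<longleftrightarrow> th (-1) = 1 \<and> (\<forall>p\<in>SP. th (int p) = 1)"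
    using psi th_iff[of "-1"] th_iff[OF pc(2,1)] by (auto simp: compat_def)
  show ?thesis
  proof (cases "compat n \<psi>")
    case True
    hence "(\<Prod>p\<in>SP. th (int p) + 1) = (\<Prod>p\<in>SP. 2)" using c_iff by (intro prod.cong) auto
    thus ?thesis using True c_iff eq card_S by simp
  next
    case False
    hence "th (-1) = -1 \<or> (\<exists>p\<in>SP. th (int p) = -1)" using c_iff pm[of "-1"] pm[OF pc(2,1)] by fastforce
    hence "1 + th (-1) = 0 \<or> (\<exists>p\<in>SP. th (int p) + 1 = 0)"
    proof (elim disjE bexE)
      fix p assume p: "p \<in> SP" "th (int p) = -1"
      have "th (int p) + 1 = 0" using p(2) by simp
      thus ?thesis using p(1) by blast
    qed simp
    hence "1 + th (-1) = 0 \<or> (\<Prod>p\<in>SP. th (int p) + 1) = 0" by (simp only: prod_zero_iff[OF finSP])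
    hence "(1 + th (-1)) * (\<Prod>p\<in>SP. th (int p) + 1) = 0" by (simp only: mult_eq_0_iff)
    thus ?thesis using False eq by simp
  qed
qed

lemma finite_SE: "finite SE"
  by (simp add: SE_def finSP)

lemma compat_sub: "{\<psi>. compat n \<psi>} \<subseteq> qchars n"
  by (auto simp: compat_def)

text \<open>The orthogonality sum serves as the indicator of compatibility, so the sum runs over all
  quadratic characters modulo \<open>n\<close>. After interchanging, the inner sum counts the square
  roots of \<open>sev e * m\<close>, and the sign of \<open>m\<close> contained in \<open>Xc\<close>
  joins that of \<open>sev e\<close>.\<close>

lemma arithmetic_key:
  assumes m: "m \<in> QQ" and n: "n \<in> QQ" and cop: "coprime m n"
  shows "2 ^ card S * (\<Sum>chi\<in>{chi \<in> Ch. cnd chi dvd n}. Xc chi m)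
    = (\<Sum>e\<in>SE. wq (of_int (sev e * int m)) * of_nat (nsqrt (sev e * int m) n))"
proof -
  have n0: "n > 0" and m0: "m > 0" using QQ_pos m n by auto
  have "(\<Sum>chi\<in>{chi \<in> Ch. cnd chi dvd n}. Xc chi m)
      = (\<Sum>chi\<in>{chi \<in> Ch. cnd chi dvd n}. wq (of_nat m) * psi_of n chi (int m mod int n))"
    using Xc_eq[OF _ _ n m cop] by (intro sum.cong) auto
  also have "\<dots> = (\<Sum>\<psi>\<in>{\<psi>. compat n \<psi>}. wq (of_nat m) * \<psi> (int m mod int n))"
    by (rule sum.reindex_bij_betw[OF char_bij[OF n]])
  also have "\<dots> = (\<Sum>\<psi>\<in>qchars n. if compat n \<psi> then wq (of_nat m) * \<psi> (int m mod int n) else 0)"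
    using finite_qchars[OF n0] compat_sub by (intro sum.mono_neutral_cong_left) auto
  finally have "2 ^ card S * (\<Sum>chi\<in>{chi \<in> Ch. cnd chi dvd n}. Xc chi m)
      = (\<Sum>\<psi>\<in>qchars n. (if compat n \<psi> then 2 ^ card S else 0) * (wq (of_nat m) * \<psi> (int m mod int n)))"
    by (auto simp: sum_distrib_left intro!: sum.cong)
  also have "\<dots> = (\<Sum>\<psi>\<in>qchars n. \<Sum>e\<in>SE. wq (of_int (sev e * int m)) * \<psi> (sev e * int m mod int n))"
  proof (rule sum.cong[OF refl])
    fix \<psi> assume psi: "\<psi> \<in> qchars n"
    have "(if compat n \<psi> then 2 ^ card S else 0) * (wq (of_nat m) * \<psi> (int m mod int n))
        = (\<Sum>e\<in>SE. (wq (of_int (sev e)) * wq (of_nat m)) * (\<psi> (sev e mod int n) * \<psi> (int m mod int n)))"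
      unfolding SE_orthogonality[OF psi n, symmetric] sum_distrib_right by (intro sum.cong) (auto simp: mult_ac)
    also have "\<dots> = (\<Sum>e\<in>SE. wq (of_int (sev e * int m)) * \<psi> (sev e * int m mod int n))"
      using sev_nz m0 sev_coprime n cop qchar_mod_mult[OF psi n0]
      by (intro sum.cong refl) (simp add: wq_mult)
    finally show "(if compat n \<psi> then 2 ^ card S else 0) * (wq (of_nat m) * \<psi> (int m mod int n))
        = (\<Sum>e\<in>SE. wq (of_int (sev e * int m)) * \<psi> (sev e * int m mod int n))" .
  qed
  also have "\<dots> = (\<Sum>e\<in>SE. \<Sum>\<psi>\<in>qchars n. wq (of_int (sev e * int m)) * \<psi> (sev e * int m mod int n))"
    by (rule sum.swap)
  also have "\<dots> = (\<Sum>e\<in>SE. wq (of_int (sev e * int m)) * of_nat (nsqrt (sev e * int m) n))"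
    using sev_coprime[OF _ n] cop by (intro sum.cong refl) (simp add: qchars_sum[OF n0] flip: sum_distrib_left)
  finally show ?thesis .
qed

lemma char_count:
  assumes n: "n \<in> QQ"
  shows "finite {chi \<in> Ch. cnd chi dvd n}" "card {chi \<in> Ch. cnd chi dvd n} \<le> 2 * tau n"
proof -
  have n0: "n > 0" using QQ_pos[OF n] .
  have fin: "finite {\<psi>. compat n \<psi>}" by (rule finite_subset[OF compat_sub finite_qchars[OF n0]])
  thus "finite {chi \<in> Ch. cnd chi dvd n}" using bij_betw_finite[OF char_bij[OF n]] by simp
  have "card {chi \<in> Ch. cnd chi dvd n} = card {\<psi>. compat n \<psi>}" by (rule bij_betw_same_card[OF char_bij[OF n]])
  also have "\<dots> \<le> card (qchars n)" by (rule card_mono[OF finite_qchars[OF n0] compat_sub])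
  also have "\<dots> \<le> 2 * tau n" by (rule card_qchars_le[OF n0])
  finally show "card {chi \<in> Ch. cnd chi dvd n} \<le> 2 * tau n" .
qed

text \<open>The weight is set to 0 at m = 0 because the bound on weights is demanded for every
  \<open>m\<close>, while \<open>\<omega>\<close> says nothing about the zero element.\<close>

sublocale dirichlet_data SP Ch cnd Xc SE sev "\<lambda>e m. if m = 0 then 0 else wq (of_int (sev e * int m))" "2 ^ card S"
proof
  show "(if g\<^sup>2 * m = 0 then 0 else wq (of_int (sev e * int (g\<^sup>2 * m)))) = (if m = 0 then 0 else wq (of_int (sev e * int m)))"
    if "e \<in> SE" "g > 0" "m > 0" for e g m
  proof -
    have "(of_int (sev e * int (g\<^sup>2 * m)) :: rat) = (of_nat g * of_nat g) * of_int (sev e * int m)"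
      by (simp add: power2_eq_square mult_ac)
    thus ?thesis using that sev_nz[of e] wq_sq[of "of_nat g"] by (simp add: wq_mult)
  qed
  show "norm (if m = 0 then 0 else wq (of_int (sev e * int m))) \<le> 1" if "e \<in> SE" for e m
  proof (cases "m = 0")
    case False
    hence "wq (of_int (sev e * int m)) \<in> {1, -1}" using sev_nz[OF that] by (intro wq_pm) simp
    thus ?thesis using False by auto
  qed simp
  show "2 ^ card S * (\<Sum>x\<in>{x \<in> Ch. cnd x dvd n}. Xc x m) =
      (\<Sum>e\<in>SE. (if m = 0 then 0 else wq (of_int (sev e * int m))) * of_nat (nsqrt (sev e * int m) n))"
    if "m \<in> QQ" "n \<in> QQ" "coprime m n" for m n
    using arithmetic_key[OF that] QQ_pos[OF that(1)] by simp
qed (use SP_prime conductor(4) Xc_1 Xc_mult Xc_0 Xc_le finite_SE sev_nz sev_unit char_count in auto)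

end

section \<open>Orbits of binary quadratic forms\<close>

definition mat22 :: "'a \<Rightarrow> 'a \<Rightarrow> 'a \<Rightarrow> 'a \<Rightarrow> 'a^2^2" where
  "mat22 a b c d = (\<chi> i j. if i = 1 then (if j = 1 then a else b) else (if j = 1 then c else d))"

lemma mat22_nth [simp]:
  "mat22 a b c d $ 1 $ 1 = a" "mat22 a b c d $ 1 $ 2 = b" "mat22 a b c d $ 2 $ 1 = c" "mat22 a b c d $ 2 $ 2 = d"
  by (simp_all add: mat22_def)

lemma mat22_eq_iff: "(A :: 'a^2^2) = B \<longleftrightarrow>
    A $ 1 $ 1 = B $ 1 $ 1 \<and> A $ 1 $ 2 = B $ 1 $ 2 \<and> A $ 2 $ 1 = B $ 2 $ 1 \<and> A $ 2 $ 2 = B $ 2 $ 2"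
  by (simp add: vec_eq_iff forall_2)

lemma map_matrix_nth [simp]: "map_matrix f A $ i $ j = f (A $ i $ j)"
  by (simp add: map_matrix_def)

context cring
begin

lemma mat2_mult_nth:
  assumes "A \<in> carrier (mat2 R)" "B \<in> carrier (mat2 R)"
  shows "mat2_mult R A B $ i $ j = A $ i $ 1 \<otimes> B $ 1 $ j \<oplus> A $ i $ 2 \<otimes> B $ 2 $ j"
proof -
  have "A $ i $ k \<otimes> B $ k $ j \<in> carrier R" for k using assms by (simp add: mat2_def)
  thus ?thesis by (simp add: mat2_mult_def UNIV_2)
qed

text \<open>For first row (1, 0) the inverse matrix also has 0 in the upper right corner, so
  invertibility reduces to the lower right entry; the inverse is then explicit.\<close>

lemma GR_iff:
  "(a, h) \<in> carrier (GR R) \<longleftrightarrow>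
    a \<in> Units R \<and> h $ 1 $ 1 = \<one> \<and> h $ 1 $ 2 = \<zero> \<and> h $ 2 $ 1 \<in> carrier R \<and> h $ 2 $ 2 \<in> Units R"
proof -
  have M: "A \<otimes>\<^bsub>mat2 R\<^esub> B = mat2_mult R A B" "\<one>\<^bsub>mat2 R\<^esub> $ 1 $ 1 = \<one>" "\<one>\<^bsub>mat2 R\<^esub> $ 1 $ 2 = \<zero>"
    "\<one>\<^bsub>mat2 R\<^esub> $ 2 $ 1 = \<zero>" "\<one>\<^bsub>mat2 R\<^esub> $ 2 $ 2 = \<one>" for A B
    by (simp_all add: mat2_def)
  have c: "A \<in> carrier (mat2 R) \<longleftrightarrow> A $ 1 $ 1 \<in> carrier R \<and> A $ 1 $ 2 \<in> carrier R \<and> A $ 2 $ 1 \<in> carrier R \<and> A $ 2 $ 2 \<in> carrier R" for A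
    by (auto simp: mat2_def forall_2)
  have "h \<in> Units (mat2 R) \<longleftrightarrow> h $ 2 $ 1 \<in> carrier R \<and> h $ 2 $ 2 \<in> Units R" if h: "h $ 1 $ 1 = \<one>" "h $ 1 $ 2 = \<zero>"
  proof
    assume "h \<in> Units (mat2 R)"
    then obtain k where hk: "h \<in> carrier (mat2 R)" "k \<in> carrier (mat2 R)" "mat2_mult R h k = \<one>\<^bsub>mat2 R\<^esub>"
      unfolding Units_def M by blast
    note cc = hk(1,2)[unfolded c]
    have e: "h $ i $ 1 \<otimes> k $ 1 $ j \<oplus> h $ i $ 2 \<otimes> k $ 2 $ j = \<one>\<^bsub>mat2 R\<^esub> $ i $ j" for i j
      using mat2_mult_nth[OF hk(1,2), of i j] unfolding hk(3) by simp
    have k0: "k $ 1 $ 2 = \<zero>" using e[of 1 2] cc h by (simp add: M)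
    have "h $ 2 $ 2 \<otimes> k $ 2 $ 2 = \<one>" using e[of 2 2] cc by (simp add: M k0)
    thus "h $ 2 $ 1 \<in> carrier R \<and> h $ 2 $ 2 \<in> Units R"
      using cc m_comm[of "h $ 2 $ 2" "k $ 2 $ 2"] unfolding Units_def by auto
  next
    assume a: "h $ 2 $ 1 \<in> carrier R \<and> h $ 2 $ 2 \<in> Units R"
    define k where "k = mat22 \<one> \<zero> (\<ominus> (inv (h $ 2 $ 2) \<otimes> h $ 2 $ 1)) (inv (h $ 2 $ 2))"
    have u: "h $ 2 $ 2 \<in> carrier R" using a by blast
    have hc: "h \<in> carrier (mat2 R)" "k \<in> carrier (mat2 R)" using a h u by (simp_all add: c k_def)
    have z: "h $ 2 $ 2 \<otimes> (inv (h $ 2 $ 2) \<otimes> h $ 2 $ 1) = h $ 2 $ 1"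
      using a u by (simp add: m_assoc[symmetric])
    have "mat2_mult R h k = \<one>\<^bsub>mat2 R\<^esub>" "mat2_mult R k h = \<one>\<^bsub>mat2 R\<^esub>"
      unfolding mat22_eq_iff mat2_mult_nth[OF hc] mat2_mult_nth[OF hc(2,1)] M
      using a h u z by (simp_all add: k_def r_minus r_neg l_neg)
    thus "h \<in> Units (mat2 R)" unfolding Units_def M using hc by blast
  qed
  thus ?thesis by (auto simp: GR_def units_of_def)
qed

end

lemma ratring_simps [simp]:
  "carrier ratring = UNIV" "a \<otimes>\<^bsub>ratring\<^esub> b = a * b" "a \<oplus>\<^bsub>ratring\<^esub> b = a + b"
  "\<one>\<^bsub>ratring\<^esub> = 1" "\<zero>\<^bsub>ratring\<^esub> = 0"
  by (simp_all add: ring_of_type_algebra_def)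

lemma ratring_cring: "cring ratring"
  by (rule cring_from_type_algebra)

lemma ratring_Units: "a \<in> Units ratring \<longleftrightarrow> a \<noteq> 0"
proof
  assume "a \<in> Units ratring"
  thus "a \<noteq> 0" by (auto simp: Units_def)
next
  assume "a \<noteq> 0"
  thus "a \<in> Units ratring" by (auto simp: Units_def intro!: exI[of _ "inverse a"])
qed

lemma ratring_minus [simp]: "a \<ominus>\<^bsub>ratring\<^esub> b = a - b"
proof -
  interpret cring ratring by (rule ratring_cring)
  have "\<ominus>\<^bsub>ratring\<^esub> b = - b" by (rule minus_equality) simp_all
  thus ?thesis by (simp add: a_minus_def)
qed

definition qf :: "rat \<Rightarrow> rat \<Rightarrow> rat \<Rightarrow> rat^2^2" where "qf x y z = mat22 x y y z"

lemma qf_eq_iff [simp]: "qf x y z = qf x' y' z' \<longleftrightarrow> x = x' \<and> y = y' \<and> z = z'"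
  by (auto simp: qf_def mat22_eq_iff)

lemma P_qf: "P1 (qf x y z) = x" "P2 ratring (qf x y z) = y\<^sup>2 - x * z"
  by (simp_all add: qf_def P1_def P2_def power2_eq_square)

lemma G_act_qf:
  "G_act ratring (a, mat22 1 0 u t) (qf x y z) = qf (a * x) (a * (u * x + t * y)) (a * (u\<^sup>2 * x + 2 * u * t * y + t\<^sup>2 * z))"
proof -
  have c: "A \<in> carrier (mat2 ratring)" for A by (simp add: mat2_def)
  note n = cring.mat2_mult_nth[OF ratring_cring c c]
  show ?thesis
    by (simp add: G_act_def qf_def mat22_eq_iff n transpose_def power2_eq_square algebra_simps)
qed

text \<open>\<open>P2\<close> is minus the determinant and is multiplied by the square of a t, so
  its square class is invariant. The identity also recovers the last entry of a form from the other
  two.\<close>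

lemma P2_action:
  fixes a :: rat
  shows "(a * (u * x + t * y))\<^sup>2 - a * x * (a * (u\<^sup>2 * x + 2 * u * t * y + t\<^sup>2 * z)) = (a * t)\<^sup>2 * (y\<^sup>2 - x * z)"
  by (simp add: power2_eq_square algebra_simps)

context padic
begin

lemma Zp_cring: "cring (Zp p)"
proof -
  have "subring {x \<in> carrier K. nrm x \<le> 1} K"
  proof (rule K.subringI)
    fix x y assume xy: "x \<in> {x \<in> carrier K. nrm x \<le> 1}" "y \<in> {x \<in> carrier K. nrm x \<le> 1}"
    show "x \<otimes>\<^bsub>K\<^esub> y \<in> {x \<in> carrier K. nrm x \<le> 1}" using xy by (auto simp: Qv_abs_mult intro: mult_le_one)
    show "x \<oplus>\<^bsub>K\<^esub> y \<in> {x \<in> carrier K. nrm x \<le> 1}" using xy nrm_ultra[of x y] by auto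
  qed (auto simp: Qv_abs_uminus)
  hence "subcring {x \<in> carrier K. nrm x \<le> 1} K" by (rule K.subcringI')
  thus ?thesis unfolding Zp_def by (subst (asm) K.subcring_iff) auto
qed

lemma Zp_zero: "\<zero>\<^bsub>Zp p\<^esub> = \<zero>\<^bsub>K\<^esub>"
  by (simp add: Zp_def)

end

section \<open>S-integers, S-units and normal forms of rational numbers\<close>

context zeta_setup
begin

definition sint :: "rat \<Rightarrow> bool" where
  "sint q \<longleftrightarrow> (\<forall>p. prime p \<longrightarrow> p \<notin> SP \<longrightarrow> rat_abs (FinPlace p) q \<le> 1)"

definition sunit :: "rat \<Rightarrow> bool" where
  "sunit q \<longleftrightarrow> q \<noteq> 0 \<and> (\<forall>p. prime p \<longrightarrow> p \<notin> SP \<longrightarrow> rat_abs (FinPlace p) q = 1)"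

lemma sint_add: "sint q \<Longrightarrow> sint r \<Longrightarrow> sint (q + r)"
  unfolding sint_def by (meson rat_abs_ultra max.bounded_iff order.trans)

lemma sint_mult: "sint q \<Longrightarrow> sint r \<Longrightarrow> sint (q * r)"
  unfolding sint_def by (auto simp: rat_abs_mult intro!: mult_le_one)

lemma sint_uminus: "sint q \<Longrightarrow> sint (- q)"
  by (simp add: sint_def)

lemma sint_diff: "sint q \<Longrightarrow> sint r \<Longrightarrow> sint (q - r)"
  using sint_add[of q "- r"] sint_uminus by simp

lemma sint_of_int [simp]: "sint (of_int z)"
  unfolding sint_def using padic.rat_abs_int_le_1[OF padicI] by blast

lemma sint_of_nat [simp]: "sint (of_nat n)" and sint_01 [simp]: "sint 0" "sint 1" "sint 2"
  using sint_of_int[of "int n"] sint_of_int[of 0] sint_of_int[of 1] sint_of_int[of 2] by simp_all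

lemma sunit_sint: "sunit q \<Longrightarrow> sint q"
  by (simp add: sunit_def sint_def)

lemma sunit_nz: "sunit q \<Longrightarrow> q \<noteq> 0"
  by (simp add: sunit_def)

lemma sunit_1 [simp]: "sunit 1" "sunit (-1)"
  by (simp_all add: sunit_def)

lemma sunit_mult: "sunit q \<Longrightarrow> sunit r \<Longrightarrow> sunit (q * r)"
  by (simp add: sunit_def rat_abs_mult)

lemma sunit_inverse: "sunit q \<Longrightarrow> sunit (inverse q)"
  by (simp add: sunit_def rat_abs_inverse)

lemma sunit_divide: "sunit q \<Longrightarrow> sunit r \<Longrightarrow> sunit (q / r)"
  by (simp add: divide_inverse sunit_mult sunit_inverse)

lemma sint_divide: "sint q \<Longrightarrow> sunit r \<Longrightarrow> sint (q / r)"
  by (simp add: divide_inverse sint_mult sunit_sint sunit_inverse)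

lemma sint_iff_vp: "q \<noteq> 0 \<Longrightarrow> sint q \<longleftrightarrow> (\<forall>p. prime p \<longrightarrow> p \<notin> SP \<longrightarrow> vp p q \<ge> 0)"
  unfolding sint_def using padic.rat_abs_le_iff[OF padicI, of _ q 0] by auto

lemma sunit_iff_vp: "q \<noteq> 0 \<Longrightarrow> sunit q \<longleftrightarrow> (\<forall>p. prime p \<longrightarrow> p \<notin> SP \<longrightarrow> vp p q = 0)"
  unfolding sunit_def using padic.rat_abs_eq_1_iff[OF padicI, of _ q] by auto

lemma sint_frac:
  assumes q: "sint q" and n: "n \<in> QQ"
  obtains a D where "q = of_int a / of_int D" "D > 0" "coprime D (int n)" "sunit (of_int D)"
proof -
  obtain a D where aD: "q = of_int a / of_int D" "D > 0" "coprime a D" by (rule rat_frac_cases[of q])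
  have D: "\<not> int p dvd D" if p: "prime p" "p \<notin> SP" for p
  proof
    assume d: "int p dvd D"
    interpret padic p by (rule padicI[OF p(1)])
    have na: "\<not> int p dvd a"
    proof
      assume "int p dvd a"
      hence "int p dvd 1" using d aD(3) coprime_common_divisor by blast
      thus False using p_not_unit by simp
    qed
    hence a1: "rat_abs (FinPlace p) (of_int a) = 1" by (simp only: rat_abs_int_eq_1_iff not_False_eq_True)
    have "rat_abs (FinPlace p) (of_int a) = rat_abs (FinPlace p) q * rat_abs (FinPlace p) (of_int D)"
      using aD(1,2) rat_abs_mult[OF place, of q "of_int D"] by simp
    moreover have "rat_abs (FinPlace p) (of_int D) < 1"
      using rat_abs_int_eq_1_iff[of D] d rat_abs_int_le_1[of D] by linarith
    moreover have "rat_abs (FinPlace p) q \<le> 1" using q p by (simp add: sint_def)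
    moreover have "rat_abs (FinPlace p) q \<ge> 0" by simp
    ultimately show False using a1 mult_left_le_one_le[of "rat_abs (FinPlace p) (of_int D)" "rat_abs (FinPlace p) q"]
      by simp
  qed
  have "coprime D (int n)"
  proof (rule ccontr)
    assume "\<not> coprime D (int n)"
    hence "nat (gcd D (int n)) \<noteq> 1" by (metis coprime_iff_gcd_eq_1 gcd_ge_0_int int_nat_eq of_nat_1)
    then obtain p where p: "prime p" "p dvd nat (gcd D (int n))" using prime_factor_nat by blast
    hence "int p dvd gcd D (int n)" by (metis gcd_ge_0_int int_dvd_int_iff int_nat_eq)
    hence "int p dvd D" "p dvd n" by auto
    thus False using D[OF p(1)] QQ_prime_notin[OF n p(1)] by blast
  qed
  moreover have "sunit (of_int D)"
    using aD(2) D padic.rat_abs_int_eq_1_iff[OF padicI] by (simp add: sunit_def)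
  ultimately show ?thesis using aD that by blast
qed

text \<open>The denominator of an S-integer is prime to \<open>n\<close>, so divisibility by
  \<open>n\<close> among S-integers descends to ordinary integers.\<close>

lemma sint_dvd:
  assumes u: "sint u" and n: "n \<in> QQ" and eq: "u * of_nat n = of_int z"
  shows "int n dvd z"
proof -
  obtain a D where aD: "u = of_int a / of_int D" "D > 0" "coprime D (int n)" by (rule sint_frac[OF u n])
  have "(of_int (z * D) :: rat) = of_int (a * int n)" using eq aD(1,2) by (simp add: field_simps)
  hence "z * D = a * int n" by (simp only: of_int_eq_iff)
  hence "int n dvd z * D" by simp
  thus ?thesis using aD(3) by (simp add: coprime_dvd_mult_left_iff coprime_commute)
qed

text \<open>The S-integers modulo \<open>n\<close> are the integers modulo \<open>n\<close>: the
  denominator, prime to \<open>n\<close>, is inverted there.\<close>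

lemma sint_mod:
  assumes b: "sint b" and n: "n \<in> QQ"
  obtains r u where "b = of_int r + u * of_nat n" "sint u" "r \<in> {0..<int n}"
proof -
  have n0: "n > 0" by (rule QQ_pos[OF n])
  obtain a D where aD: "b = of_int a / of_int D" "D > 0" "coprime D (int n)" "sunit (of_int D)" by (rule sint_frac[OF b n])
  obtain D' where D': "[D * D' = 1] (mod int n)" using cong_solve_coprime_int[OF aD(3)] by blast
  define r where "r = a * D' mod int n"
  have "[D * r = a * (D * D')] (mod int n)" by (simp add: r_def cong_def mod_mult_right_eq mult_ac)
  also have "[a * (D * D') = a * 1] (mod int n)" using D' by (rule cong_mult[OF cong_refl])
  finally have "int n dvd a - D * r" by (simp add: cong_iff_dvd_diff dvd_diff_commute)
  then obtain k where k: "a - D * r = int n * k" by (auto simp: dvd_def)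
  have "(of_int (a - D * r) :: rat) = of_nat n * of_int k" unfolding k by simp
  hence "of_int a = (of_int D * of_int r + of_nat n * of_int k :: rat)" by (simp add: algebra_simps)
  hence "b = of_int r + of_int k / of_int D * of_nat n" unfolding aD(1) using aD(2) by (simp add: add_divide_distrib)
  moreover have "sint (of_int k / of_int D)" using aD(4) by (intro sint_divide) auto
  moreover have "r \<in> {0..<int n}" using n0 by (simp add: r_def)
  ultimately show ?thesis by (rule that)
qed

lemma Gamma_iff:
  "g \<in> carrier (Gamma S) \<longleftrightarrow> (\<exists>a u t. g = (a, mat22 1 0 u t) \<and> sunit a \<and> sunit t \<and> sint u)"
proof -
  obtain a h where g: "g = (a, h)" by (cases g)
  have Z: "(emb (FinPlace p) a, map_matrix (emb (FinPlace p)) h) \<in> carrier (GR (Zp p)) \<longleftrightarrow>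
      rat_abs (FinPlace p) a = 1 \<and> h $ 1 $ 1 = 1 \<and> h $ 1 $ 2 = 0 \<and> rat_abs (FinPlace p) (h $ 2 $ 1) \<le> 1
        \<and> rat_abs (FinPlace p) (h $ 2 $ 2) = 1" if p: "prime p" for p
  proof -
    interpret padic p by (rule padicI[OF p])
    have e: "emb (FinPlace p) q = \<one>\<^bsub>K\<^esub> \<longleftrightarrow> q = 1" for q using emb_eq_iff[of q 1] unfolding emb_1 .
    show ?thesis unfolding cring.GR_iff[OF Zp_cring] map_matrix_nth Zp_Units Zp_simps Zp_zero e emb_eq_0_iff by simp
  qed
  have "g \<in> carrier (Gamma S) \<longleftrightarrow> h $ 1 $ 1 = 1 \<and> h $ 1 $ 2 = 0 \<and> sunit a \<and> sunit (h $ 2 $ 2) \<and> sint (h $ 2 $ 1)"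
    using Z by (auto simp: g Gamma_def cring.GR_iff[OF ratring_cring] KS.GR_iff ratring_Units diag_0 diag_1 sunit_def sint_def SP_iff)
  also have "\<dots> \<longleftrightarrow> (\<exists>a u t. g = (a, mat22 1 0 u t) \<and> sunit a \<and> sunit t \<and> sint u)"
    by (auto simp: g mat22_eq_iff)
  finally show ?thesis .
qed

definition qcl :: "rat \<Rightarrow> (place \<Rightarrow> (nat \<Rightarrow> rat) set) set" where "qcl q = sqclass (diag S q)"

lemma qcl_square: "q \<noteq> 0 \<Longrightarrow> t \<noteq> 0 \<Longrightarrow> qcl (t\<^sup>2 * q) = qcl q" (is "_ \<Longrightarrow> _ \<Longrightarrow> ?thesis")
proof -
  assume "q \<noteq> 0" "t \<noteq> 0"
  hence "diag S t \<otimes>\<^bsub>QS S\<^esub> diag S t \<in> QS_squares S" unfolding QS_squares_def by fastforce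
  moreover have "diag S (t\<^sup>2 * q) = diag S q \<otimes>\<^bsub>QS S\<^esub> (diag S t \<otimes>\<^bsub>QS S\<^esub> diag S t)"
    by (simp add: power2_eq_square mult_ac flip: diag_mult)
  ultimately show ?thesis using sqclass_eqI[of "diag S q"] \<open>q \<noteq> 0\<close> by (simp add: qcl_def)
qed

text \<open>\<open>P1\<close> and \<open>P2\<close> commute with the diagonal embedding, so the
  condition over the product ring becomes a condition on the rational discriminant alone, and the
  local conditions outside \<open>S\<close> say that the entries are S-integers.\<close>

lemma L_set_iff:
  assumes "\<delta> \<in> carrier (square_classes S)"
  shows "x \<in> L_set S \<delta> \<longleftrightarrow> (\<exists>X1 Y1 Z1. x = qf X1 Y1 Z1 \<and> sint X1 \<and> sint Y1 \<and> sint Z1 \<and> X1 \<noteq> 0 \<and>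
      Y1\<^sup>2 - X1 * Z1 \<noteq> 0 \<and> qcl (Y1\<^sup>2 - X1 * Z1) = \<delta>)"
proof -
  obtain y where y: "y \<in> Units (QS S)" "\<delta> = sqclass y" using assms by (auto simp: square_classes_carrier)
  have V: "A \<in> VR R \<longleftrightarrow> A $ 1 $ 1 \<in> carrier R \<and> A $ 1 $ 2 \<in> carrier R \<and> A $ 2 $ 2 \<in> carrier R \<and> A $ 2 $ 1 = A $ 1 $ 2"
    for A :: "'x^2^2" and R :: "'x ring"
    by (auto simp: VR_def mat2_def forall_2 mat22_eq_iff transpose_def)
  have Z: "map_matrix (emb (FinPlace p)) A \<in> VR (Zp p) \<longleftrightarrow> rat_abs (FinPlace p) (A $ 1 $ 1) \<le> 1 \<and>
      rat_abs (FinPlace p) (A $ 1 $ 2) \<le> 1 \<and> rat_abs (FinPlace p) (A $ 2 $ 2) \<le> 1"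
    if "prime p" "A $ 2 $ 1 = A $ 1 $ 2" for p A
  proof -
    interpret padic p by (rule padicI[OF that(1)])
    show ?thesis using that(2) by (simp add: V Zp_simps)
  qed
  have P: "P2 (QS S) (map_matrix (diag S) x) = diag S (P2 ratring x)" "P1 (map_matrix (diag S) x) = diag S (x $ 1 $ 1)"
    by (simp_all add: P1_def P2_def diag_mult diag_diff)
  have D: "map_matrix (diag S) x \<in> VR (QS S) \<longleftrightarrow> x $ 2 $ 1 = x $ 1 $ 2" if "x $ 2 $ 1 = x $ 1 $ 2"
    using that by (simp add: V)
  have "x \<in> L_set S \<delta> \<longleftrightarrow> x $ 2 $ 1 = x $ 1 $ 2 \<and> x $ 1 $ 1 \<noteq> 0 \<and> P2 ratring x \<noteq> 0 \<and> qcl (P2 ratring x) = \<delta> \<and>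
      (\<forall>p. prime p \<and> FinPlace p \<notin> S \<longrightarrow> map_matrix (emb (FinPlace p)) x \<in> VR (Zp p))"
    unfolding L_set_def V0_QS_class_def V0_QS_def mem_Collect_eq P y(2) mem_sqclass_iff[OF y(1)] diag_Units qcl_def
    using D V[of x ratring] by auto
  also have "\<dots> \<longleftrightarrow> x $ 2 $ 1 = x $ 1 $ 2 \<and> sint (x $ 1 $ 1) \<and> sint (x $ 1 $ 2) \<and> sint (x $ 2 $ 2) \<and>
      x $ 1 $ 1 \<noteq> 0 \<and> P2 ratring x \<noteq> 0 \<and> qcl (P2 ratring x) = \<delta>"
    unfolding sint_def SP_iff using Z[of _ x] by blast
  also have "\<dots> \<longleftrightarrow> (\<exists>X1 Y1 Z1. x = qf X1 Y1 Z1 \<and> sint X1 \<and> sint Y1 \<and> sint Z1 \<and> X1 \<noteq> 0 \<and>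
      Y1\<^sup>2 - X1 * Z1 \<noteq> 0 \<and> qcl (Y1\<^sup>2 - X1 * Z1) = \<delta>)" (is "?l \<longleftrightarrow> ?r")
  proof
    assume ?l
    thus ?r by (intro exI[of _ "x $ 1 $ 1"] exI[of _ "x $ 1 $ 2"] exI[of _ "x $ 2 $ 2"])
      (auto simp: qf_def mat22_eq_iff P2_def power2_eq_square)
  next
    assume ?r
    then obtain X1 Y1 Z1 where "x = qf X1 Y1 Z1" "sint X1" "sint Y1" "sint Z1" "X1 \<noteq> 0"
      "Y1\<^sup>2 - X1 * Z1 \<noteq> 0" "qcl (Y1\<^sup>2 - X1 * Z1) = \<delta>" by blast
    thus ?l unfolding P_qf(2)[of X1 Y1 Z1, symmetric] by (simp add: qf_def)
  qed
  finally show ?thesis .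
qed

text \<open>The positive rational composed of the primes of \<open>S\<close> that has the valuations
  of \<open>q\<close> there. Dividing by it leaves only primes outside \<open>S\<close>.\<close>

definition spart :: "rat \<Rightarrow> rat" where "spart q = (\<Prod>p\<in>SP. of_nat p powi vp p q)"

lemma SP_nz: "p \<in> SP \<Longrightarrow> (of_nat p :: 'a :: linordered_field) \<noteq> 0"
  using SP_prime[of p] by (simp add: prime_gt_0_nat)

lemma vp_SP_prod:
  assumes "prime p" "A \<subseteq> SP"
  shows "vp p (\<Prod>l\<in>A. of_nat l powi k l) = (if p \<in> A then k p else 0)"
proof -
  have nz: "(of_nat l :: rat) \<noteq> 0" if "l \<in> A" for l using SP_nz[of l] that assms(2) by auto
  have "vp p (\<Prod>l\<in>A. of_nat l powi k l) = (\<Sum>l\<in>A. vp p (of_nat l powi k l))"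
    using assms(1) nz by (intro vp_prod) simp_all
  also have "\<dots> = (\<Sum>l\<in>A. if l = p then k l else 0)"
  proof (rule sum.cong[OF refl])
    fix l assume l: "l \<in> A"
    hence "prime l" using SP_prime assms(2) by blast
    thus "vp p (of_nat l powi k l) = (if l = p then k l else 0)"
      unfolding vp_power_int[OF assms(1) nz[OF l]] using vp_prime[OF assms(1)] by simp
  qed
  finally show ?thesis using finite_subset[OF assms(2) finSP] by simp
qed

lemma spart_nz [simp]: "spart q \<noteq> 0"
  unfolding spart_def prod_zero_iff[OF finSP] using SP_nz by (auto simp: power_int_eq_0_iff)

text \<open>The quotient by \<open>spart q\<close> has nonnegative valuation at every prime and
  valuation 0 on \<open>S\<close>, so up to sign it is a positive integer prime to
  \<open>S\<close>.\<close>

lemma sint_cases: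
  assumes q: "sint q" "q \<noteq> 0"
  obtains s m where "s \<in> {1, -1}" "m \<in> QQ" "q = of_int s * of_nat m * spart q"
proof -
  define r where "r = q / spart q"
  have r0: "r \<noteq> 0" using q by (simp add: r_def)
  have vr: "vp p r = (if p \<in> SP then 0 else vp p q)" if p: "prime p" for p
    using vp_SP_prod[OF p order.refl, of "\<lambda>p. vp p q"] vp_divide[OF p q(2) spart_nz[of q]] by (simp add: r_def spart_def)
  hence vr0: "vp p r \<ge> 0" if "prime p" for p using q that by (simp add: sint_iff_vp)
  obtain a b where ab: "r = of_int a / of_int b" "b > 0" "coprime a b" by (rule rat_frac_cases[of r])
  have a0: "a \<noteq> 0" using r0 ab by auto
  have "b = 1"
  proof (rule ccontr)
    assume "b \<noteq> 1"
    hence "nat b \<noteq> 1" using ab(2) by auto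
    then obtain p where p: "prime p" "p dvd nat b" using prime_factor_nat by blast
    have pb: "int p dvd b" using p(2) ab(2) by (metis int_dvd_int_iff int_nat_eq less_imp_le)
    hence "\<not> int p dvd a" using ab(3) p(1) by (meson coprime_common_divisor not_prime_unit prime_nat_int_transfer)
    hence "multiplicity (int p) a = 0" by (rule not_dvd_imp_multiplicity_0)
    moreover have "multiplicity (int p) b > 0" using pb p(1) ab(2) by (simp add: prime_multiplicity_gt_zero_iff)
    ultimately show False using vr0[OF p(1)] vp_frac[OF p(1) a0, of b] ab(1,2) by simp
  qed
  hence ra: "r = of_int a" using ab(1) by simp
  have "\<not> p dvd nat \<bar>a\<bar>" if p: "p \<in> SP" for p
  proof
    assume "p dvd nat \<bar>a\<bar>"
    hence "int p dvd a" unfolding int_dvd_nat_abs_iff .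
    hence "multiplicity (int p) a > 0" using SP_prime[OF p] a0 by (simp add: prime_multiplicity_gt_zero_iff)
    thus False using vr[OF SP_prime[OF p]] p vp_of_int[OF SP_prime[OF p] a0] ra by simp
  qed
  hence "nat \<bar>a\<bar> \<in> QQ" using a0 by (simp add: coprime_nats_def)
  moreover have "a = sgn a * int (nat \<bar>a\<bar>)" by (simp add: sgn_mult_abs)
  hence "r = of_int (sgn a) * of_nat (nat \<bar>a\<bar>)" unfolding ra by (metis of_int_mult of_int_of_nat_eq)
  hence "q = of_int (sgn a) * of_nat (nat \<bar>a\<bar>) * spart q" by (simp add: r_def field_simps)
  moreover have "sgn a \<in> {1, -1}" using a0 by (simp add: sgn_if)
  ultimately show ?thesis using that by blast
qed

definition sabs :: "rat \<Rightarrow> real" where "sabs q = S_abs S (diag S q)"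

lemma sabs_prod: "sabs q = (\<Prod>v\<in>S. rat_abs v q)"
  unfolding sabs_def S_abs_def using completion.Qv_abs_emb[OF S_completion] by (intro prod.cong) auto

lemma sabs_mult: "sabs (q * r) = sabs q * sabs r"
  unfolding sabs_prod prod.distrib[symmetric] using rat_abs_mult[OF S_place] by (intro prod.cong) auto

text \<open>The absolute values of \<open>q\<close> at the primes of \<open>S\<close> multiply to
  the inverse of \<open>spart q\<close>. For an S-integer this leaves the positive integer prime to
  \<open>S\<close>, so the S-absolute values are the Dirichlet variables \<open>n\<close> and
  \<open>m\<close>.\<close>

lemma sabs_eq:
  assumes "q \<noteq> 0"
  shows "sabs q = \<bar>real_of_rat q\<bar> / \<bar>real_of_rat (spart q)\<bar>"
proof -
  have r: "real_of_rat (of_nat p powi k) = real p powi k" for p :: nat and k :: int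
    by (simp add: power_int_def of_rat_power of_rat_inverse)
  have "(\<Prod>p\<in>SP. rat_abs (FinPlace p) q) = (\<Prod>p\<in>SP. inverse (real p powi vp p q))"
    using assms by (intro prod.cong) (auto simp: rat_abs_fin power_int_minus)
  also have "\<dots> = inverse (\<Prod>p\<in>SP. real p powi vp p q)"
    using prod_inversef[of "\<lambda>p. real p powi vp p q" SP] by (simp add: o_def)
  also have "(\<Prod>p\<in>SP. real p powi vp p q) = \<bar>real_of_rat (spart q)\<bar>"
    unfolding spart_def of_rat_prod r by (rule abs_of_nonneg[symmetric]) (simp add: prod_nonneg)
  finally show ?thesis unfolding sabs_prod prod_S by (simp add: divide_inverse)
qed

lemma sabs_val:
  assumes "s \<in> {1, -1}" "q \<noteq> 0" "q = of_int s * of_nat m * spart q"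
  shows "sabs q = real m"
proof -
  have "real_of_rat q = real_of_int s * real m * real_of_rat (spart q)"
    by (subst assms(3)) (simp add: of_rat_mult)
  hence "\<bar>real_of_rat q\<bar> = real m * \<bar>real_of_rat (spart q)\<bar>" using assms(1) by (auto simp: abs_mult)
  thus ?thesis using sabs_eq[OF assms(2)] by simp
qed

lemma sabs_QQ: assumes n: "n \<in> QQ" shows "sabs (of_nat n) = real n"
proof (rule sabs_val)
  have n0: "n > 0" by (rule QQ_pos[OF n])
  have "vp p (of_nat n) = 0" if "p \<in> SP" for p
  proof -
    have "\<not> p dvd n" using QQ_prime_notin[OF n SP_prime[OF that]] that by blast
    thus ?thesis using n0 vp_of_nat[OF SP_prime[OF that], of n] by (simp add: not_dvd_imp_multiplicity_0)
  qed
  thus "of_nat n = of_int 1 * of_nat n * spart (of_nat n)" by (simp add: spart_def)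
qed (use QQ_pos[OF n] in auto)

lemma sabs_sunit: assumes a: "sunit a" shows "sabs a = 1"
proof -
  obtain s m where m: "s \<in> {1, -1}" "m \<in> QQ" "a = of_int s * of_nat m * spart a"
    by (rule sint_cases[OF sunit_sint[OF a] sunit_nz[OF a]])
  have m0: "m > 0" by (rule QQ_pos[OF m(2)])
  have "m = 1"
  proof (rule ccontr)
    assume "m \<noteq> 1"
    then obtain p where p: "prime p" "p dvd m" using prime_factor_nat by blast
    have pS: "p \<notin> SP" using QQ_prime_notin[OF m(2) p] .
    have s: "vp p (of_int s) = 0" "(of_int s :: rat) \<noteq> 0" using m(1) by auto
    have "vp p (of_int s * of_nat m * spart a) = int (multiplicity p m)"
      using m0 s vp_SP_prod[OF p(1) order.refl, of "\<lambda>p. vp p a"] pS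
      by (simp add: vp_mult[OF p(1)] vp_of_nat[OF p(1)] spart_def[symmetric])
    moreover have "vp p a = 0" using a p(1) pS sunit_iff_vp[OF sunit_nz[OF a]] by blast
    moreover have "multiplicity p m > 0" using p m0 by (simp add: prime_multiplicity_gt_zero_iff)
    ultimately show False using m(3) by simp
  qed
  thus ?thesis using sabs_val[OF m(1) sunit_nz[OF a] m(3)] by simp
qed

lemma sev_sunit: assumes "e \<in> SE" shows "sunit (of_int (sev e))"
  unfolding sunit_def using sev_nz[OF assms] padic.rat_abs_int_eq_1_iff[OF padicI] sev_unit[OF assms] by auto

lemma sabs_sev: "e \<in> SE \<Longrightarrow> m \<in> QQ \<Longrightarrow> sabs (of_int (sev e * int m)) = real m"
  using sabs_mult[of "of_int (sev e)" "of_nat m"] sabs_sunit[OF sev_sunit] sabs_QQ by simp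

lemma vp_sev:
  assumes "(s, A) \<in> SE" "p \<in> SP"
  shows "vp p (of_int (sev (s, A))) = (if p \<in> A then 1 else 0)"
proof -
  have A: "A \<subseteq> SP" "s \<in> {1, -1}" using assms(1) by (auto simp: SE_def)
  have pp: "prime p" by (rule SP_prime[OF assms(2)])
  have eq: "(of_int (sev (s, A)) :: rat) = of_int s * (\<Prod>l\<in>A. of_nat l powi 1)" by (simp add: sev_def)
  have nz: "(\<Prod>l\<in>A. of_nat l powi 1) \<noteq> (0 :: rat)" using sev_nz[OF assms(1)] eq by (metis mult_zero_right of_int_eq_0_iff)
  have s: "vp p (of_int s) = 0" "(of_int s :: rat) \<noteq> 0" using A(2) by auto
  show ?thesis unfolding eq vp_mult[OF pp s(2) nz] s(1) vp_SP_prod[OF pp A(1)] by simp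
qed

text \<open>The S-absolute value recovers \<open>m\<close>, the parity of the valuations on
  \<open>S\<close> recovers the set of primes, and the positivity of t^2 recovers the sign.\<close>

lemma sev_unique:
  assumes e: "e \<in> SE" "e' \<in> SE" and m: "m \<in> QQ" "m' \<in> QQ" and t: "sunit t"
    and eq: "of_int (sev e' * int m') = t\<^sup>2 * of_int (sev e * int m)"
  shows "e' = e \<and> m' = m \<and> t\<^sup>2 = 1"
proof -
  have t0: "t \<noteq> 0" by (rule sunit_nz[OF t])
  have mm: "m' = m"
    using arg_cong[OF eq, of sabs] sabs_sev e m sabs_mult sabs_sunit[OF t] by (simp add: power2_eq_square)
  obtain s A s' A' where ee: "e = (s, A)" "e' = (s', A')" by (cases e; cases e')
  have eq': "of_int (sev e') = t\<^sup>2 * (of_int (sev e) :: rat)" using eq QQ_pos[OF m(1)] by (simp add: mm)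
  have sub: "A \<subseteq> SP" "A' \<subseteq> SP" "s \<in> {1, -1}" "s' \<in> {1, -1}" using e by (auto simp: ee SE_def)
  have "p \<in> A' \<longleftrightarrow> p \<in> A" if p: "p \<in> SP" for p
  proof -
    have pp: "prime p" by (rule SP_prime[OF p])
    have "vp p (of_int (sev e')) = 2 * vp p t + vp p (of_int (sev e))"
      unfolding eq' using t0 sev_nz[OF e(1)] by (simp add: vp_mult[OF pp] vp_power[OF pp])
    hence "(if p \<in> A' then 1 else 0) = 2 * vp p t + (if p \<in> A then 1 else 0)"
      using vp_sev[of s' A' p] vp_sev[of s A p] e p unfolding ee by simp
    thus ?thesis by (cases "p \<in> A'"; cases "p \<in> A"; simp; presburger)
  qed
  hence AA: "A' = A" using sub by blast
  have P0: "int (\<Prod>A) \<noteq> 0" using sev_nz[OF e(1)] by (auto simp: ee sev_def)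
  have "(of_int s' :: rat) = t\<^sup>2 * of_int s" using eq' P0 by (simp add: ee AA sev_def flip: of_nat_prod)
  moreover have "t\<^sup>2 > 0" using t0 by simp
  moreover have "s' = s"
  proof (rule ccontr)
    assume "s' \<noteq> s"
    hence "s' = - s" using sub(3,4) by auto
    hence "(t\<^sup>2 + 1) * (of_int s :: rat) = 0" using calculation(1) by (simp add: algebra_simps)
    thus False using calculation(2) sub(3) by auto
  qed
  ultimately have "s' = s \<and> t\<^sup>2 = 1" using sub(3) by auto
  thus ?thesis using mm AA ee by simp
qed

text \<open>The S-part of \<open>d\<close> is a square times the product of the primes of
  \<open>S\<close> with odd valuation.\<close>

lemma sev_rep:
  assumes d: "sint d" "d \<noteq> 0"
  obtains e m t where "e \<in> SE" "m \<in> QQ" "sunit t" "d = t\<^sup>2 * of_int (sev e * int m)"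
proof -
  obtain s m where m: "s \<in> {1, -1}" "m \<in> QQ" "d = of_int s * of_nat m * spart d" by (rule sint_cases[OF d])
  define A where "A = {p \<in> SP. odd (vp p d)}"
  define t :: rat where "t = (\<Prod>p\<in>SP. of_nat p powi (vp p d div 2))"
  have t0: "t \<noteq> 0" unfolding t_def prod_zero_iff[OF finSP] using SP_nz by (auto simp: power_int_eq_0_iff)
  have st: "sunit t" unfolding sunit_iff_vp[OF t0] unfolding t_def using vp_SP_prod[OF _ order.refl] by simp
  have "spart d = (\<Prod>p\<in>SP. (of_nat p powi (vp p d div 2))\<^sup>2 * (if odd (vp p d) then of_nat p else 1))"
    unfolding spart_def
  proof (rule prod.cong[OF refl])
    fix p assume p: "p \<in> SP"
    have "(of_nat p :: rat) powi vp p d = of_nat p powi (vp p d div 2 + vp p d div 2 + vp p d mod 2)"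
      by (rule arg_cong[where f = "\<lambda>k. of_nat p powi k"]) presburger
    also have "\<dots> = (of_nat p powi (vp p d div 2))\<^sup>2 * of_nat p powi (vp p d mod 2)"
      using SP_nz[OF p, where ?'a = rat] by (simp only: power_int_add power2_eq_square not_False_eq_True simp_thms)
    also have "(of_nat p :: rat) powi (vp p d mod 2) = (if odd (vp p d) then of_nat p else 1)"
      by (cases "odd (vp p d)") (simp_all add: odd_iff_mod_2_eq_one even_iff_mod_2_eq_zero)
    finally show "(of_nat p :: rat) powi vp p d = (of_nat p powi (vp p d div 2))\<^sup>2 * (if odd (vp p d) then of_nat p else 1)" .
  qed
  also have "\<dots> = t\<^sup>2 * (\<Prod>p\<in>A. of_nat p)"
    unfolding prod.distrib t_def A_def prod.inter_filter[OF finSP] prod_power_distrib ..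
  finally have sp: "spart d = t\<^sup>2 * of_nat (\<Prod>A)" by simp
  have "d = t\<^sup>2 * of_int (sev (s, A) * int m)"
    by (subst m(3)) (simp add: sp sev_def flip: of_nat_prod)
  moreover have "(s, A) \<in> SE" using m(1) by (auto simp: SE_def A_def)
  ultimately show ?thesis using that m(2) st by blast
qed

section \<open>Orbits and stabilizers of forms\<close>

abbreviation orb :: "rat^2^2 \<Rightarrow> (rat^2^2) set" where "orb \<equiv> orbit (Gamma S) (G_act ratring)"

lemma orb_qf: "orb (qf x y z) = {qf (a * x) (a * (u * x + t * y)) (a * (u\<^sup>2 * x + 2 * u * t * y + t\<^sup>2 * z)) | a u t.
    sunit a \<and> sunit t \<and> sint u}"
proof (intro equalityI subsetI)
  fix w assume "w \<in> orb (qf x y z)"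
  then obtain a u t where "sunit a" "sunit t" "sint u" "w = G_act ratring (a, mat22 1 0 u t) (qf x y z)"
    unfolding orbit_def Gamma_iff by blast
  thus "w \<in> {qf (a * x) (a * (u * x + t * y)) (a * (u\<^sup>2 * x + 2 * u * t * y + t\<^sup>2 * z)) | a u t. sunit a \<and> sunit t \<and> sint u}"
    unfolding G_act_qf by blast
next
  fix w assume "w \<in> {qf (a * x) (a * (u * x + t * y)) (a * (u\<^sup>2 * x + 2 * u * t * y + t\<^sup>2 * z)) | a u t. sunit a \<and> sunit t \<and> sint u}"
  then obtain a u t where "sunit a" "sunit t" "sint u" "w = G_act ratring (a, mat22 1 0 u t) (qf x y z)"
    unfolding G_act_qf by blast
  thus "w \<in> orb (qf x y z)" unfolding orbit_def Gamma_iff by blast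
qed

text \<open>One inclusion composes two transformations. For the other, (A, T, U) are the coordinates
  of the second transformation times the inverse of the first, and S-units allow the
  divisions.\<close>

lemma orb_eq:
  assumes "sunit a" "sunit t" "sint u"
  shows "orb (qf (a * x) (a * (u * x + t * y)) (a * (u\<^sup>2 * x + 2 * u * t * y + t\<^sup>2 * z))) = orb (qf x y z)" (is "orb ?q = _")
proof (intro equalityI subsetI)
  fix w assume "w \<in> orb ?q"
  then obtain a' u' t' where w: "sunit a'" "sunit t'" "sint u'"
    "w = qf (a' * (a * x)) (a' * (u' * (a * x) + t' * (a * (u * x + t * y))))
      (a' * (u'\<^sup>2 * (a * x) + 2 * u' * t' * (a * (u * x + t * y)) + t'\<^sup>2 * (a * (u\<^sup>2 * x + 2 * u * t * y + t\<^sup>2 * z))))"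
    unfolding orb_qf by blast
  have "w = qf ((a' * a) * x) ((a' * a) * ((u' + t' * u) * x + (t' * t) * y))
      ((a' * a) * ((u' + t' * u)\<^sup>2 * x + 2 * (u' + t' * u) * (t' * t) * y + (t' * t)\<^sup>2 * z))"
    unfolding w(4) qf_eq_iff by (simp add: power2_eq_square algebra_simps)
  moreover have "sunit (a' * a)" "sunit (t' * t)" "sint (u' + t' * u)"
    using w assms by (auto intro: sunit_mult sint_add sint_mult sunit_sint)
  ultimately show "w \<in> orb (qf x y z)" unfolding orb_qf by blast
next
  fix w assume "w \<in> orb (qf x y z)"
  then obtain a' u' t' where w: "sunit a'" "sunit t'" "sint u'"
    "w = qf (a' * x) (a' * (u' * x + t' * y)) (a' * (u'\<^sup>2 * x + 2 * u' * t' * y + t'\<^sup>2 * z))"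
    unfolding orb_qf by blast
  define A T U where "A = a' / a" and "T = t' / t" and "U = u' - T * u"
  have e: "a' = A * a" "t' = T * t" "u' = U + T * u"
    using sunit_nz[OF assms(1)] sunit_nz[OF assms(2)] by (auto simp: A_def T_def U_def)
  have "w = qf (A * (a * x)) (A * (U * (a * x) + T * (a * (u * x + t * y))))
      (A * (U\<^sup>2 * (a * x) + 2 * U * T * (a * (u * x + t * y)) + T\<^sup>2 * (a * (u\<^sup>2 * x + 2 * u * t * y + t\<^sup>2 * z))))"
    unfolding w(4) qf_eq_iff e by (simp add: power2_eq_square algebra_simps)
  moreover have "sunit A" "sunit T" "sint U"
    unfolding A_def T_def U_def using w assms by (auto intro!: sunit_divide sint_diff sint_mult intro: sunit_sint sunit_divide simp del: times_divide_eq_left)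
  ultimately show "w \<in> orb ?q" unfolding orb_qf by blast
qed

lemma orb_self: "qf x y z \<in> orb (qf x y z)"
  unfolding orb_qf by (intro CollectI exI[of _ 1] exI[of _ 0]) simp

text \<open>Invariance of \<open>P1\<close> forces a = 1, that of \<open>P2\<close> then forces t =
  1 or t = -1, and the middle entry determines u. For t = 1 this is the identity; for t = -1 it is
  the reflection with u = 2 y / x, which belongs to the group exactly when that number is an
  S-integer.\<close>

lemma card_stabilizer:
  assumes x: "x \<noteq> 0" and d: "y\<^sup>2 - x * z \<noteq> 0"
  shows "card (stabilizer (Gamma S) (G_act ratring) (qf x y z)) = (if sint (2 * y / x) then 2 else 1)"
proof -
  let ?i = "(1, mat22 1 0 0 1) :: rat \<times> (rat^2^2)" and ?j = "(1, mat22 1 0 (2 * y / x) (- 1)) :: rat \<times> (rat^2^2)"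
  have "stabilizer (Gamma S) (G_act ratring) (qf x y z) = {?i} \<union> (if sint (2 * y / x) then {?j} else {})" (is "?l = ?r")
  proof (intro equalityI subsetI)
    fix g assume "g \<in> ?l"
    then obtain a u t where g: "g = (a, mat22 1 0 u t)" "sunit a" "sunit t" "sint u" and fx: "G_act ratring g (qf x y z) = qf x y z"
      by (auto simp: stabilizer_def Gamma_iff)
    note eqs = fx[unfolded g(1) G_act_qf qf_eq_iff]
    have a: "a = 1" using eqs x by simp
    have "(a * t)\<^sup>2 * (y\<^sup>2 - x * z) = y\<^sup>2 - x * z" using P2_action[of a u x t y z] eqs by simp
    hence "t\<^sup>2 = 1" using d a by simp
    hence "t = 1 \<or> t = -1" by (simp add: power2_eq_1_iff)
    moreover have "u * x + t * y = y" using eqs a by simp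
    ultimately have "t = 1 \<and> u = 0 \<or> t = -1 \<and> u = 2 * y / x" using x by (auto simp: field_simps)
    thus "g \<in> ?r" using g a by auto
  next
    fix g assume "g \<in> ?r"
    hence "g = ?i \<or> g = ?j \<and> sint (2 * y / x)" by (auto split: if_splits)
    thus "g \<in> ?l"
    proof
      assume "g = ?i"
      thus ?thesis by (auto simp: stabilizer_def Gamma_iff G_act_qf mat22_eq_iff)
    next
      assume g: "g = ?j \<and> sint (2 * y / x)"
      have "g \<in> carrier (Gamma S)" unfolding Gamma_iff using g sunit_1 by blast
      moreover have "G_act ratring g (qf x y z) = qf x y z"
        using g x by (auto simp: G_act_qf power2_eq_square field_simps)
      ultimately show ?thesis by (simp add: stabilizer_def)
    qed
  qed
  moreover have "?i \<noteq> ?j" by (auto simp: mat22_eq_iff)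
  ultimately show ?thesis by simp
qed

end

section \<open>Summation over the orbits\<close>

text \<open>Regroups a sum over reduced forms by the orbit or class of each form; the family is
  indexed by the graph of \<open>g\<close>.\<close>

lemma infsum_fibres:
  fixes f :: "'a \<Rightarrow> complex"
  assumes f: "f summable_on T"
  shows "(\<lambda>B. infsum f {x \<in> T. g x = B}) summable_on g ` T"
    and "infsum (\<lambda>B. infsum f {x \<in> T. g x = B}) (g ` T) = infsum f T"
proof -
  let ?A = "Sigma (g ` T) (\<lambda>B. {x \<in> T. g x = B})"
  have b: "bij_betw snd ?A T"
    by (rule bij_betwI[where g = "\<lambda>x. (g x, x)"]) auto
  have s: "(\<lambda>z. f (snd z)) summable_on ?A" using f summable_on_reindex_bij_betw[OF b, of f] by simp
  hence "(\<lambda>(B, x). f x) summable_on ?A" by (simp add: case_prod_unfold)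
  from summable_on_Sigma_banach[OF this] show "(\<lambda>B. infsum f {x \<in> T. g x = B}) summable_on g ` T" .
  show "infsum (\<lambda>B. infsum f {x \<in> T. g x = B}) (g ` T) = infsum f T"
    using infsum_Sigma_banach[OF s] infsum_reindex_bij_betw[OF b, of f] by simp
qed

lemma diff_eq_divide:
  fixes t :: rat
  assumes "t \<noteq> 0" "t\<^sup>2 * x - z = t\<^sup>2 * y"
  shows "x - y = z / t\<^sup>2"
proof -
  have "z = t\<^sup>2 * (x - y)" using assms(2) by (simp add: right_diff_distrib)
  thus ?thesis using assms(1) by simp
qed

context zeta_setup
begin

text \<open>The last entry is forced by the prescribed discriminant; it is integral when
  \<open>b\<close> is a square root of that discriminant modulo \<open>n\<close>.\<close>

definition frm :: "((int \<times> nat set) \<times> nat \<times> nat) \<times> int \<Rightarrow> rat^2^2" where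
  "frm = (\<lambda>((e, n, m), b). qf (of_nat n) (of_int b) (((of_int b)\<^sup>2 - of_int (sev e * int m)) / of_nat n))"

definition params :: "(place \<Rightarrow> (nat \<Rightarrow> rat) set) set \<Rightarrow> ((int \<times> nat set) \<times> nat \<times> nat) set" where
  "params \<delta> = {(e, n, m). e \<in> SE \<and> n \<in> QQ \<and> m \<in> QQ \<and> qcl (of_int (sev e * int m)) = \<delta>}"

definition reduced :: "(place \<Rightarrow> (nat \<Rightarrow> rat) set) set \<Rightarrow> (((int \<times> nat set) \<times> nat \<times> nat) \<times> int) set" where
  "reduced \<delta> = Sigma (params \<delta>) (\<lambda>(e, n, m). sqrts (sev e * int m) n)"

lemma reduced_iff:
  "((e, n, m), b) \<in> reduced \<delta> \<longleftrightarrow> e \<in> SE \<and> n \<in> QQ \<and> m \<in> QQ \<and> qcl (of_int (sev e * int m)) = \<delta> \<and> b \<in> sqrts (sev e * int m) n"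
  by (auto simp: reduced_def params_def)

lemma disc_nz: "e \<in> SE \<Longrightarrow> m \<in> QQ \<Longrightarrow> (of_int (sev e * int m) :: rat) \<noteq> 0"
  using sev_nz[of e] QQ_pos[of m] by simp

lemma frm_disc: "n \<in> QQ \<Longrightarrow> (of_int b)\<^sup>2 - of_nat n * (((of_int b)\<^sup>2 - d) / of_nat n) = (d :: rat)"
  using QQ_pos[of n] by simp

lemma frm_L:
  assumes d: "\<delta> \<in> carrier (square_classes S)" and z: "((e, n, m), b) \<in> reduced \<delta>"
  shows "frm ((e, n, m), b) \<in> L_set S \<delta>"
proof -
  note z' = z[unfolded reduced_iff]
  have n0: "n > 0" using QQ_pos z' by blast
  have "int n dvd b\<^sup>2 - sev e * int m" using z' by (simp add: sqrts_def)
  then obtain k where "b\<^sup>2 - sev e * int m = int n * k" by (auto simp: dvd_def)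
  hence "(of_int (b\<^sup>2 - sev e * int m) :: rat) = of_nat n * of_int k" by simp
  hence k: "((of_int b)\<^sup>2 - of_int (sev e * int m)) / of_nat n = (of_int k :: rat)" using n0 by (simp add: field_simps)
  have "sint (((of_int b)\<^sup>2 - of_int (sev e * int m)) / of_nat n)" unfolding k by simp
  thus ?thesis unfolding L_set_iff[OF d] frm_def prod.case
    using n0 z' frm_disc[of n b "of_int (sev e * int m)"] disc_nz[of e m]
    by (intro exI[of _ "of_nat n"] exI[of _ "of_int b"] exI[of _ "((of_int b)\<^sup>2 - of_int (sev e * int m)) / of_nat n"]) simp
qed

text \<open>The unit part of \<open>P1\<close> is absorbed by the scalar, the square part of the
  discriminant by the diagonal entry of the matrix, and the middle entry is reduced modulo
  \<open>n\<close> by a unipotent matrix.\<close>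

lemma L_frm:
  assumes d: "\<delta> \<in> carrier (square_classes S)" and x: "x \<in> L_set S \<delta>"
  shows "\<exists>z\<in>reduced \<delta>. orb x = orb (frm z)"
proof -
  obtain x1 y1 z1 where xq: "x = qf x1 y1 z1" and s: "sint x1" "sint y1" "sint z1" and x0: "x1 \<noteq> 0"
    and d0: "y1\<^sup>2 - x1 * z1 \<noteq> 0" and cl: "qcl (y1\<^sup>2 - x1 * z1) = \<delta>"
    using x unfolding L_set_iff[OF d] by blast
  obtain s0 n where sn: "s0 \<in> {1, -1}" "n \<in> QQ" "x1 = of_int s0 * of_nat n * spart x1" by (rule sint_cases[OF s(1) x0])
  have n0: "(of_nat n :: rat) \<noteq> 0" using QQ_pos[OF sn(2)] by simp
  define a where "a = of_int s0 * spart x1"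
  have xa: "x1 = a * of_nat n" unfolding a_def by (subst sn(3)) simp
  have a: "sunit a"
  proof -
    have p0: "spart x1 \<noteq> 0" by simp
    have "sunit (spart x1)" unfolding sunit_iff_vp[OF p0] using vp_SP_prod[OF _ order.refl] by (simp add: spart_def)
    thus ?thesis using sn(1) by (auto simp: a_def intro!: sunit_mult)
  qed
  have a0: "a \<noteq> 0" by (rule sunit_nz[OF a])
  have "sint (y1\<^sup>2 - x1 * z1)" unfolding power2_eq_square by (intro sint_diff sint_mult s)
  then obtain e m t where em: "e \<in> SE" "m \<in> QQ" "sunit t" "y1\<^sup>2 - x1 * z1 = t\<^sup>2 * of_int (sev e * int m)"
    using d0 by (rule sev_rep)
  define d1 :: rat where "d1 = of_int (sev e * int m)"
  have t0: "t \<noteq> 0" by (rule sunit_nz[OF em(3)])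
  have dd: "y1\<^sup>2 - x1 * z1 = t\<^sup>2 * d1" using em(4) by (simp add: d1_def)
  obtain b v where b: "y1 / t = of_int b + v * of_nat n" "sint v" "b \<in> {0..<int n}"
    by (rule sint_mod[OF sint_divide[OF s(2) em(3)] sn(2)])
  have yb: "y1 = t * (of_int b + v * of_nat n)" using b(1) t0 by (simp add: field_simps)
  have "t\<^sup>2 * (of_int b + v * of_nat n)\<^sup>2 - a * of_nat n * z1 = t\<^sup>2 * d1"
    using dd unfolding yb xa by (simp add: power_mult_distrib)
  hence "(of_int b + v * of_nat n)\<^sup>2 - d1 = a * of_nat n * z1 / t\<^sup>2" by (rule diff_eq_divide[OF t0])
  hence bd: "(of_int b)\<^sup>2 - d1 = (a * z1 / t\<^sup>2 - 2 * of_int b * v - v\<^sup>2 * of_nat n) * of_nat n"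
    by (simp add: power2_eq_square algebra_simps)
  have "int n dvd b\<^sup>2 - sev e * int m"
  proof (rule sint_dvd[OF _ sn(2)])
    show "(a * z1 / t\<^sup>2 - 2 * of_int b * v - v\<^sup>2 * of_nat n) * of_nat n = of_int (b\<^sup>2 - sev e * int m)"
      unfolding bd[symmetric] d1_def by simp
    show "sint (a * z1 / t\<^sup>2 - 2 * of_int b * v - v\<^sup>2 * of_nat n)"
      unfolding power2_eq_square using s b(2) em(3) a
      by (intro sint_diff sint_mult sint_divide sunit_mult) (auto intro: sunit_sint)
  qed
  hence red: "((e, n, m), b) \<in> reduced \<delta>"
    unfolding reduced_iff sqrts_def using em sn(2) b(3) cl qcl_square[OF disc_nz[OF em(1,2)] t0] by simp
  \<comment> \<open>The discriminant scales by (a T)^2, and this has to equal t^2.\<close>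
  define T where "T = t / a"
  define U where "U = v * T"
  have T: "sunit T" unfolding T_def using em(3) a by (rule sunit_divide)
  have TU: "sunit T" "sint U" unfolding U_def using T sint_mult[OF b(2) sunit_sint[OF T]] by simp_all
  let ?z = "((of_int b)\<^sup>2 - d1) / of_nat n"
  have y: "y1 = a * (U * of_nat n + T * of_int b)" using a0 unfolding yb U_def T_def by (simp add: algebra_simps)
  \<comment> \<open>The last entry is not expanded directly: it is determined by the discriminant
    and the other two entries, since x1 is nonzero.\<close>
  have "z1 * x1 = y1\<^sup>2 - t\<^sup>2 * d1" using dd mult.commute[of z1 x1] by linarith
  also have "\<dots> = y1\<^sup>2 - (a * T)\<^sup>2 * ((of_int b)\<^sup>2 - of_nat n * ?z)" using a0 n0 by (simp add: T_def)
  also have "\<dots> = x1 * (a * (U\<^sup>2 * of_nat n + 2 * U * T * of_int b + T\<^sup>2 * ?z))"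
    using P2_action[of a U "of_nat n" T "of_int b" ?z] unfolding y xa by simp
  finally have z: "z1 = a * (U\<^sup>2 * of_nat n + 2 * U * T * of_int b + T\<^sup>2 * ?z)" using x0 by simp
  have "orb x = orb (frm ((e, n, m), b))"
    unfolding xq frm_def prod.case d1_def[symmetric] using orb_eq[OF a TU, of "of_nat n" "of_int b" ?z]
    unfolding y[symmetric] z[symmetric] xa[symmetric] .
  thus ?thesis using red by blast
qed

lemma xi_orbits_eq:
  assumes d: "\<delta> \<in> carrier (square_classes S)"
  shows "xi_orbits S \<delta> = (\<lambda>z. orb (frm z)) ` reduced \<delta>"
proof (intro equalityI subsetI)
  fix B assume "B \<in> xi_orbits S \<delta>"
  then obtain x where "x \<in> L_set S \<delta>" "B = orb x" by (auto simp: xi_orbits_def orbits_def)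
  thus "B \<in> (\<lambda>z. orb (frm z)) ` reduced \<delta>" using L_frm[OF d] by blast
next
  fix B assume "B \<in> (\<lambda>z. orb (frm z)) ` reduced \<delta>"
  then obtain e n m b where "((e, n, m), b) \<in> reduced \<delta>" "B = orb (frm ((e, n, m), b))" by force
  thus "B \<in> xi_orbits S \<delta>" using frm_L[OF d] unfolding xi_orbits_def orbits_def by blast
qed

text \<open>The S-absolute value of \<open>P1\<close> fixes \<open>n\<close>, which forces the
  scalar to be 1; the discriminant fixes \<open>e\<close> and \<open>m\<close> up to t^2 = 1. What
  remains is the sign t and a translation of the middle entry by S-integral, hence integral,
  multiples of \<open>n\<close>.\<close>

lemma frm_orbit_iff:
  assumes z: "((e, n, m), b) \<in> reduced \<delta>" and z': "((e', n', m'), b') \<in> reduced \<delta>"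
  shows "orb (frm ((e', n', m'), b')) = orb (frm ((e, n, m), b)) \<longleftrightarrow>
    (e', n', m') = (e, n, m) \<and> (b' = b \<or> b' = (- b) mod int n)"
proof
  note r = z[unfolded reduced_iff] and r' = z'[unfolded reduced_iff]
  have n0: "n > 0" using r QQ_pos by blast
  have bm: "b mod int n = b" using r by (simp add: sqrts_def)
  assume "orb (frm ((e', n', m'), b')) = orb (frm ((e, n, m), b))"
  hence "frm ((e', n', m'), b') \<in> orb (frm ((e, n, m), b))" using orb_self unfolding frm_def prod.case by blast
  then obtain a u t where g: "sunit a" "sunit t" "sint u" and eqs: "of_nat n' = a * of_nat n" "of_int b' = a * (u * of_nat n + t * of_int b)"
    "((of_int b')\<^sup>2 - of_int (sev e' * int m')) / of_nat n'
      = a * (u\<^sup>2 * of_nat n + 2 * u * t * of_int b + t\<^sup>2 * (((of_int b)\<^sup>2 - of_int (sev e * int m)) / of_nat n))"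
    unfolding frm_def prod.case orb_qf by auto
  have "real n' = real n" using sabs_mult[of a "of_nat n"] sabs_sunit[OF g(1)] sabs_QQ r r' by (simp add: eqs(1)[symmetric])
  hence nn: "n' = n" by simp
  hence a1: "a = 1" using eqs(1) n0 by simp
  have "of_int (sev e' * int m') = t\<^sup>2 * of_int (sev e * int m)"
    using P2_action[of a u "of_nat n" t "of_int b" "((of_int b)\<^sup>2 - of_int (sev e * int m)) / of_nat n"]
      frm_disc[of n b "of_int (sev e * int m)"] frm_disc[of n' b' "of_int (sev e' * int m')"] r r'
    unfolding eqs(1,2,3)[symmetric] by (simp add: a1)
  hence u: "e' = e \<and> m' = m \<and> t\<^sup>2 = 1" using r r' g(2) by (intro sev_unique) auto
  have b'm: "b' mod int n = b'" using r' nn by (simp add: sqrts_def)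
  have "t = 1 \<or> t = -1" using u by (simp add: power2_eq_1_iff)
  hence "b' = b \<or> b' = (- b) mod int n"
  proof
    assume "t = 1"
    hence "u * of_nat n = of_int (b' - b)" using eqs(2) a1 by simp
    hence "int n dvd b' - b" using r by (intro sint_dvd[OF g(3)]) auto
    hence "b' mod int n = b mod int n" by (simp add: mod_eq_dvd_iff)
    thus ?thesis using bm b'm by simp
  next
    assume "t = -1"
    hence "u * of_nat n = of_int (b' - (- b))" using eqs(2) a1 by simp
    hence "int n dvd b' - (- b)" using r by (intro sint_dvd[OF g(3)]) auto
    hence "b' mod int n = (- b) mod int n" by (simp only: mod_eq_dvd_iff)
    thus ?thesis using b'm by simp
  qed
  thus "(e', n', m') = (e, n, m) \<and> (b' = b \<or> b' = (- b) mod int n)" using u nn by simp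
next
  assume a: "(e', n', m') = (e, n, m) \<and> (b' = b \<or> b' = (- b) mod int n)"
  have n0: "(of_nat n :: rat) \<noteq> 0" using z[unfolded reduced_iff] QQ_pos[of n] by auto
  show "orb (frm ((e', n', m'), b')) = orb (frm ((e, n, m), b))"
  proof (cases "b' = b")
    case False
    \<comment> \<open>The quotient in the division of -b by \<open>n\<close>, so that the
      representative of -b is k n - b and the reflection with u = k maps one form to the
      other.\<close>
    define k where "k = - ((- b) div int n)"
    have "b' = k * int n - b" using a False minus_div_mult_eq_mod[of "- b" "int n"] by (simp add: k_def)
    hence bk: "(of_int b' :: rat) = of_int k * of_nat n - of_int b" by simp
    let ?d = "of_int (sev e * int m) :: rat"
    have z': "((of_int b')\<^sup>2 - ?d) / of_nat n = (of_int k)\<^sup>2 * of_nat n + 2 * of_int k * (- 1) * of_int b + (- 1)\<^sup>2 * (((of_int b)\<^sup>2 - ?d) / of_nat n)"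
      unfolding bk using n0 by (simp add: power2_eq_square field_simps)
    let ?w = "((of_int b)\<^sup>2 - ?d) / of_nat n"
    have "frm ((e, n, m), b') = qf (1 * of_nat n) (1 * (of_int k * of_nat n + (- 1) * of_int b))
        (1 * ((of_int k)\<^sup>2 * of_nat n + 2 * of_int k * (- 1) * of_int b + (- 1)\<^sup>2 * ?w))"
      unfolding frm_def prod.case qf_eq_iff z' using bk by simp
    hence "orb (frm ((e, n, m), b')) = orb (qf (of_nat n) (of_int b) ?w)"
      using orb_eq[of 1 "-1" "of_int k" "of_nat n" "of_int b" ?w] by (simp only: sunit_1 sint_of_int)
    thus ?thesis using a by (simp only: frm_def prod.case prod.inject simp_thms)
  qed (use a in simp)
qed

text \<open>The size of a fibre times the order of the stabilizer is 2.\<close>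
lemma fibre_card:
  assumes z: "((e, n, m), b) \<in> reduced \<delta>"
  shows "finite {z' \<in> reduced \<delta>. orb (frm z') = orb (frm ((e, n, m), b))}" (is "finite ?F")
    and "card {z' \<in> reduced \<delta>. orb (frm z') = orb (frm ((e, n, m), b))} = (if int n dvd 2 * b then 1 else 2)"
    and "z' \<in> reduced \<delta> \<Longrightarrow> orb (frm z') = orb (frm ((e, n, m), b)) \<Longrightarrow> fst z' = (e, n, m)"
proof -
  note r = z[unfolded reduced_iff]
  have n0: "n > 0" using r QQ_pos by blast
  have bm: "b mod int n = b" using r by (simp add: sqrts_def)
  have "(- b) mod int n \<in> sqrts (sev e * int m) n"
    using r n0 dvd_square_mod[of n "- b" "sev e * int m"] by (simp add: sqrts_def)
  hence z2: "((e, n, m), (- b) mod int n) \<in> reduced \<delta>" using r by (simp add: reduced_iff)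
  have F: "?F = Pair (e, n, m) ` {b, (- b) mod int n}"
  proof (intro equalityI subsetI)
    fix w assume w: "w \<in> ?F"
    obtain e' n' m' b' where wd: "w = ((e', n', m'), b')" by (cases w) auto
    show "w \<in> Pair (e, n, m) ` {b, (- b) mod int n}" using w frm_orbit_iff[OF z, of e' n' m' b'] unfolding wd by auto
  next
    fix w assume "w \<in> Pair (e, n, m) ` {b, (- b) mod int n}"
    thus "w \<in> ?F" using z z2 frm_orbit_iff[OF z z] frm_orbit_iff[OF z z2] by auto
  qed
  show "finite ?F" unfolding F by simp
  have "(- b) mod int n = b \<longleftrightarrow> (- b) mod int n = b mod int n" using bm by simp
  also have "\<dots> \<longleftrightarrow> int n dvd - b - b" by (rule mod_eq_dvd_iff)
  also have "- b - b = - (2 * b)" by simp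
  finally have "(- b) mod int n = b \<longleftrightarrow> int n dvd 2 * b" by (simp only: dvd_minus_iff)
  moreover have "card ?F = card {b, (- b) mod int n}" unfolding F by (rule card_image) (simp add: inj_on_def)
  ultimately show "card ?F = (if int n dvd 2 * b then 1 else 2)" by auto
  show "fst z' = (e, n, m)" if "z' \<in> reduced \<delta>" "orb (frm z') = orb (frm ((e, n, m), b))"
  proof -
    have "z' \<in> ?F" using that by blast
    thus ?thesis unfolding F by auto
  qed
qed

text \<open>The summand uses an arbitrary element of the orbit, so the S-absolute values and the
  stabilizer are computed for a general transform of the reduced form. The reflection exists exactly
  when 2 b / n is integral.\<close>

lemma summand_orbit:
  assumes z: "((e, n, m), b) \<in> reduced \<delta>"
  shows "xi_orbit_summand S s1 s2 (orb (frm ((e, n, m), b)))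
    = (if int n dvd 2 * b then 1 / 2 else 1) * (nterm s1 n * nterm s2 m)"
proof -
  note r = z[unfolded reduced_iff]
  have n0: "n > 0" using r QQ_pos by blast
  define x where "x = (SOME x. x \<in> orb (frm ((e, n, m), b)))"
  let ?d = "of_int (sev e * int m) :: rat"
  let ?z = "((of_int b)\<^sup>2 - ?d) / of_nat n"
  have "x \<in> orb (frm ((e, n, m), b))"
    unfolding x_def by (rule someI[of _ "frm ((e, n, m), b)"]) (simp only: frm_def prod.case orb_self)
  then obtain a u t where g: "sunit a" "sunit t" "sint u"
    and x: "x = qf (a * of_nat n) (a * (u * of_nat n + t * of_int b)) (a * (u\<^sup>2 * of_nat n + 2 * u * t * of_int b + t\<^sup>2 * ?z))"
    unfolding frm_def prod.case orb_qf by blast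
  have nz: "a \<noteq> 0" "t \<noteq> 0" "(of_nat n :: rat) \<noteq> 0" using g sunit_nz n0 by auto
  have p2: "P2 ratring x = (a * t)\<^sup>2 * ?d" unfolding x P_qf P2_action using frm_disc r by simp
  have p1: "P1 x = a * of_nat n" by (simp add: x P_qf)
  have s1: "sabs (P1 x) = real n" unfolding p1 sabs_mult using sabs_sunit[OF g(1)] sabs_QQ r by simp
  have s2: "sabs (P2 ratring x) = real m"
    unfolding p2 power2_eq_square sabs_mult[of _ ?d] sabs_mult[of "a * t"] using sabs_sunit[OF sunit_mult[OF g(1,2)]] sabs_sev r by simp
  have "sint (2 * (a * (u * of_nat n + t * of_int b)) / (a * of_nat n)) \<longleftrightarrow> int n dvd 2 * b"
  proof -
    have e: "2 * (a * (u * of_nat n + t * of_int b)) / (a * of_nat n) = 2 * u + t * (2 * of_int b / of_nat n)"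
      using nz by (simp add: field_simps)
    show ?thesis unfolding e
    proof
      assume s: "sint (2 * u + t * (2 * of_int b / of_nat n))"
      have "sint (((2 * u + t * (2 * of_int b / of_nat n)) - 2 * u) / t)"
        using s g by (intro sint_divide sint_diff sint_mult) auto
      hence "sint (2 * of_int b / of_nat n)" using nz by simp
      thus "int n dvd 2 * b" using r nz by (intro sint_dvd[of "2 * of_int b / of_nat n"]) auto
    next
      assume "int n dvd 2 * b"
      then obtain k where "2 * b = int n * k" by (auto simp: dvd_def)
      hence "(of_int (2 * b) :: rat) = of_nat n * of_int k" by simp
      hence "2 * of_int b / of_nat n = (of_int k :: rat)" using nz by (simp add: field_simps)
      thus "sint (2 * u + t * (2 * of_int b / of_nat n))"
        using g by (auto intro!: sint_add sint_mult intro: sunit_sint)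
    qed
  qed
  moreover have "(a * (u * of_nat n + t * of_int b))\<^sup>2 - a * of_nat n * (a * (u\<^sup>2 * of_nat n + 2 * u * t * of_int b + t\<^sup>2 * ?z)) \<noteq> 0"
    unfolding P2_action using frm_disc[of n b ?d] nz disc_nz[of e m] r by simp
  ultimately have "card (stabilizer (Gamma S) (G_act ratring) x) = (if int n dvd 2 * b then 2 else 1)"
    unfolding x using nz by (subst card_stabilizer) auto
  thus ?thesis
    unfolding xi_orbit_summand_def x_def[symmetric] xi_summand_def sabs_def[symmetric] s1 s2
    by (simp add: nterm_def powr_minus_divide)
qed

lemma params_sub: "params \<delta> \<subseteq> SE \<times> QQ \<times> QQ"
  by (auto simp: params_def)

lemma W_params:
  assumes s: "Re s1 > 1" "Re s2 > 1" and z: "(e, n, m) \<in> params \<delta>"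
  shows "W s1 s2 (e, n, m) = om \<delta> * (of_nat (nsqrt (sev e * int m) n) * (nterm s1 n * nterm s2 m))"
    and "norm (om \<delta>) = 1"
proof -
  note r = z[unfolded params_def mem_Collect_eq prod.case]
  have m0: "m > 0" using r QQ_pos by blast
  have w: "wq (of_int (sev e * int m)) = om \<delta>" using r by (simp add: wq_def Om_def qcl_def)
  show "W s1 s2 (e, n, m) = om \<delta> * (of_nat (nsqrt (sev e * int m) n) * (nterm s1 n * nterm s2 m))"
    unfolding W_def[OF s] prod.case tt_def[OF s] w using m0 by (simp add: mult.assoc)
  have "wq (of_int (sev e * int m)) \<in> {1, -1}" using disc_nz r by (intro wq_pm) blast
  thus "norm (om \<delta>) = 1" unfolding w by auto
qed

text \<open>Summing over reduced forms counts each orbit with the size of its fibre, and this size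
  times the order of the stabilizer is 2: hence the factor 1/2 and the term-by-term agreement with
  the weights 1 / #stabilizer. The sum over \<open>b\<close> for fixed parameters gives the number
  of square roots.\<close>

lemma xi_eq:
  assumes d: "\<delta> \<in> carrier (square_classes S)" and s: "Re s1 > 1" "Re s2 > 1"
  shows "xi_orbit_summand S s1 s2 summable_on xi_orbits S \<delta>"
    and "om \<delta> * xi S s1 s2 \<delta> = 1 / 2 * infsum (W s1 s2) (params \<delta>)"
proof -
  define g where "g = (\<lambda>w :: ((int \<times> nat set) \<times> nat \<times> nat) \<times> int. nterm s1 (fst (snd (fst w))) * nterm s2 (snd (snd (fst w))))"
  let ?B = "\<lambda>(e, n, m). sqrts (sev e * int m) n"
  have fin: "finite (?B z)" for z by (simp add: case_prod_unfold)
  have inner: "infsum (\<lambda>b. f z) (?B z) = of_nat (nsqrt (sev (fst z) * int (snd (snd z))) (fst (snd z))) * f z"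
    for f :: "(int \<times> nat set) \<times> nat \<times> nat \<Rightarrow> 'b :: {real_normed_field}" and z
    using fin[of z] by (simp add: case_prod_unfold nsqrt_def)
  have Wn: "norm (W s1 s2 z) = infsum (\<lambda>b. norm (g (z, b))) (?B z)" if "z \<in> params \<delta>" for z
  proof -
    obtain e n m where z: "z = (e, n, m)" by (cases z)
    show ?thesis
      using inner[of "\<lambda>z. norm (g (z, 0))" z] W_params[OF s that[unfolded z]]
      unfolding z by (simp add: g_def norm_mult nsqrt_def)
  qed
  have "W s1 s2 abs_summable_on params \<delta>"
    using double_series(1)[OF s] params_sub by (rule summable_on_subset_banach)
  hence "(\<lambda>z. infsum (\<lambda>b. norm (g (z, b))) (?B z)) summable_on params \<delta>"
    using Wn by (subst (asm) summable_on_cong) auto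
  hence abs: "(\<lambda>z. infsum (\<lambda>b. norm (g (z, b))) (?B z)) abs_summable_on params \<delta>"
    by (rule summable_on_iff_abs_summable_on_real[THEN iffD1])
  have "g abs_summable_on reduced \<delta>"
    unfolding reduced_def Infinite_Sum.abs_summable_on_Sigma_iff using abs fin by (simp add: summable_on_finite)
  hence gs: "g summable_on reduced \<delta>" by (rule abs_summable_summable)
  let ?Phi = "\<lambda>z. orb (frm z)"
  \<comment> \<open>The summand \<open>g\<close> depends only on the parameters (e, n, m), which are
    constant on a fibre.\<close>
  have X: "infsum g {z' \<in> reduced \<delta>. ?Phi z' = B} = 2 * xi_orbit_summand S s1 s2 B" if B: "B \<in> xi_orbits S \<delta>" for B
  proof -
    obtain e n m b where z: "((e, n, m), b) \<in> reduced \<delta>" and B: "B = ?Phi ((e, n, m), b)"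
      using B unfolding xi_orbits_eq[OF d] by force
    let ?F = "{z' \<in> reduced \<delta>. ?Phi z' = ?Phi ((e, n, m), b)}"
    have "infsum g ?F = (\<Sum>z'\<in>?F. nterm s1 n * nterm s2 m)"
      unfolding infsum_finite[OF fibre_card(1)[OF z]]
      using fibre_card(3)[OF z] by (intro sum.cong) (auto simp: g_def)
    also have "\<dots> = of_nat (card ?F) * (nterm s1 n * nterm s2 m)" by simp
    finally show ?thesis unfolding B summand_orbit[OF z] fibre_card(2)[OF z] by simp
  qed
  have "(\<lambda>B. 2 * xi_orbit_summand S s1 s2 B) summable_on xi_orbits S \<delta>"
    using infsum_fibres(1)[OF gs, of ?Phi] X unfolding xi_orbits_eq[OF d, symmetric] by (subst (asm) summable_on_cong) auto
  thus sm: "xi_orbit_summand S s1 s2 summable_on xi_orbits S \<delta>" by (simp add: summable_on_cmult_right')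
  have "2 * xi S s1 s2 \<delta> = infsum g (reduced \<delta>)"
    using infsum_fibres(2)[OF gs, of ?Phi] X infsum_cong[of "xi_orbits S \<delta>"] unfolding xi_orbits_eq[OF d, symmetric] xi_def
    by (metis (mono_tags, lifting) infsum_cmult_right')
  also have "\<dots> = infsum (\<lambda>z. infsum (\<lambda>b. g (z, b)) (?B z)) (params \<delta>)"
    unfolding reduced_def by (rule infsum_Sigma_banach[symmetric]) (use gs in \<open>simp add: reduced_def\<close>)
  finally have "om \<delta> * (2 * xi S s1 s2 \<delta>) = infsum (\<lambda>z. om \<delta> * infsum (\<lambda>b. g (z, b)) (?B z)) (params \<delta>)"
    by (simp add: infsum_cmult_right')
  also have "\<dots> = infsum (W s1 s2) (params \<delta>)"
  proof (rule infsum_cong)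
    fix z assume zp: "z \<in> params \<delta>"
    obtain e n m where z: "z = (e, n, m)" by (cases z)
    show "om \<delta> * infsum (\<lambda>b. g (z, b)) (?B z) = W s1 s2 z"
      using inner[of "\<lambda>z. g (z, 0)" z] W_params(1)[OF s zp[unfolded z]]
      unfolding z by (simp add: g_def nsqrt_def)
  qed
  finally have f: "om \<delta> * (2 * xi S s1 s2 \<delta>) = infsum (W s1 s2) (params \<delta>)" .
  show "om \<delta> * xi S s1 s2 \<delta> = 1 / 2 * infsum (W s1 s2) (params \<delta>)" unfolding f[symmetric] by simp
qed

text \<open>The parameter triples are partitioned by the square class of the discriminant; a class
  that does not occur contributes an empty sum.\<close>

lemma sum_xi:
  assumes s: "Re s1 > 1" "Re s2 > 1"
  shows "(\<Sum>\<delta>\<in>carrier (square_classes S). om \<delta> * xi S s1 s2 \<delta>) = 1 / 2 * infsum (W s1 s2) (SE \<times> QQ \<times> QQ)"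
proof -
  let ?g = "\<lambda>(e, n :: nat, m). qcl (of_int (sev e * int m))"
  let ?T = "SE \<times> QQ \<times> QQ" and ?C = "carrier (square_classes S)"
  have fib: "{x \<in> ?T. ?g x = \<delta>} = params \<delta>" for \<delta> by (auto simp: params_def)
  have sub: "?g ` ?T \<subseteq> ?C" using disc_nz by (auto simp: square_classes_carrier qcl_def simp del: of_int_mult)
  have "W s1 s2 summable_on ?T" using double_series(1)[OF s] by (rule abs_summable_summable)
  from infsum_fibres(2)[OF this, of ?g]
  have "infsum (W s1 s2) ?T = infsum (\<lambda>\<delta>. infsum (W s1 s2) (params \<delta>)) (?g ` ?T)" unfolding fib by simp
  also have "\<dots> = infsum (\<lambda>\<delta>. infsum (W s1 s2) (params \<delta>)) ?C"
  proof (rule infsum_cong_neutral)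
    fix \<delta> assume "\<delta> \<in> ?C - ?g ` ?T"
    hence "params \<delta> = {}" unfolding fib[symmetric] by blast
    thus "infsum (W s1 s2) (params \<delta>) = 0" by simp
  qed (use sub in auto)
  also have "\<dots> = (\<Sum>\<delta>\<in>?C. infsum (W s1 s2) (params \<delta>))" by (rule infsum_finite[OF finite_square_classes])
  also have "\<dots> = (\<Sum>\<delta>\<in>?C. 2 * (om \<delta> * xi S s1 s2 \<delta>))" by (intro sum.cong refl) (simp add: xi_eq(2)[OF _ s])
  finally show ?thesis by (simp add: sum_distrib_left[symmetric])
qed

section \<open>L-functions as Dirichlet series, and the final comparison\<close>

lemma L_outside_eq:
  assumes s: "Re s > 1" and h1: "h 1 = 1" and hm: "\<And>m n. m > 0 \<Longrightarrow> n > 0 \<Longrightarrow> h (m * n) = h m * h n"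
    and hle: "\<And>m. norm (h m) \<le> 1"
    and loc: "\<And>p. prime p \<Longrightarrow> p \<notin> SP \<Longrightarrow>
      h p = (if unramified chi p then local_component chi (FinPlace p) (emb (FinPlace p) (of_nat p)) else 0)"
  shows "L_outside S s chi = infsum (\<lambda>m. h m * nterm s m) QQ"
proof -
  let ?h = "\<lambda>m. h m * nterm s m"
  have le: "norm (?h m) \<le> norm (nterm s m)" for m using hle[of m] by (simp add: norm_mult mult_left_le_one_le)
  have half: "norm (?h p) \<le> 1 / 2" if p: "prime p" for p
  proof -
    have "norm (?h p) \<le> real p powr (- Re s)" using le[of p] by (simp only: norm_nterm)
    also have "\<dots> \<le> real p powr (- 1)" using s prime_ge_2_nat[OF p] by (intro powr_mono) auto
    also have "\<dots> \<le> 1 / 2" using prime_ge_2_nat[OF p] by (simp add: powr_minus field_simps)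
    finally show ?thesis .
  qed
  have sm: "?h abs_summable_on QQ"
    by (rule Infinite_Sum.abs_summable_on_comparison_test[OF nterm_abs_summable[OF s] le])
  have "prodinf (\<lambda>p. if prime p \<and> p \<notin> SP then inverse (1 - ?h p) else 1) = infsum ?h QQ"
    by (rule euler_product(1)[OF SP_prime _ _ sm half]) (simp_all add: h1[simplified] hm nterm_mult)
  moreover have "(\<lambda>p. if prime p \<and> FinPlace p \<notin> S then local_L p s chi else 1)
      = (\<lambda>p. if prime p \<and> p \<notin> SP then inverse (1 - ?h p) else 1)"
  proof
    fix p :: nat
    show "(if prime p \<and> FinPlace p \<notin> S then local_L p s chi else 1)
      = (if prime p \<and> p \<notin> SP then inverse (1 - ?h p) else 1)"
      using loc[of p] by (auto simp: SP_iff local_L_def nterm_def)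
  qed
  ultimately show ?thesis by (simp only: L_outside_def)
qed

lemma L_outside_chi:
  assumes chi: "chi \<in> Ch" and s: "Re s > 1"
  shows "L_outside S s chi = sL SP s (Xc chi)"
  unfolding sL_def
  by (rule L_outside_eq[OF s Xc_1 Xc_mult Xc_le[OF chi]]) (simp_all add: Xc_prime local_value_def)

text \<open>The trivial character need not lie over \<open>\<omega>\<close>, so its Euler product is
  evaluated directly, with constant coefficients 1.\<close>

lemma zeta_outside_eq:
  assumes s: "Re s > 1"
  shows "zeta_outside S s = infsum (nterm s) QQ"
proof -
  have one: "local_component trivial_character (FinPlace p) u = 1" if "prime p" "u \<in> Units (Qv (FinPlace p))" for p u
    using idele_at_idele[of "FinPlace p" u] that by (simp add: local_component_def trivial_character_def)
  have "L_outside S s trivial_character = infsum (\<lambda>m. 1 * nterm s m) QQ"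
  proof (rule L_outside_eq[OF s])
    fix p :: nat assume p: "prime p"
    interpret padic p by (rule padicI[OF p])
    have "unramified trivial_character p" unfolding unramified_def using one[OF p] Zp_Units_subset by blast
    moreover have "emb (FinPlace p) (of_nat p) \<in> Units K" using p emb_unit_iff by (simp add: prime_gt_0_nat)
    ultimately show "1 = (if unramified trivial_character p then local_component trivial_character (FinPlace p) (emb (FinPlace p) (of_nat p)) else 0)"
      using one[OF p] by simp
  qed simp_all
  thus ?thesis by (simp add: zeta_outside_def)
qed

lemma L_quotient_eq:
  assumes "Re s1 > 1" "Re s2 > 1" "chi \<in> Ch"
  shows "L_outside S s2 chi / (L_outside S (2 * s1 + s2) chi * of_nat (cnd chi) powr s1)
    = sL SP s2 (Xc chi) / (sL SP (2 * s1 + s2) (Xc chi) * of_nat (cnd chi) powr s1)"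
  using L_outside_chi[OF assms(3)] assms(1,2) by simp

lemma L_quotient_summable:
  assumes s: "Re s1 > 1" "Re s2 > 1"
  shows "(\<lambda>chi. L_outside S s2 chi / (L_outside S (2 * s1 + s2) chi * of_nat (cnd chi) powr s1)) summable_on Ch"
  using double_series(2)[OF s] L_quotient_eq[OF s] by (subst summable_on_cong) auto

lemma xi_tilde_eq:
  assumes s: "Re s1 > 1" "Re s2 > 1"
  shows "xi_tilde S s1 s2 om = zeta_outside S s1 * zeta_outside S (2 * s1 + 2 * s2 - 1) *
      (\<Sum>\<^sub>\<infinity>chi\<in>Ch. L_outside S s2 chi / (L_outside S (2 * s1 + s2) chi * of_nat (cnd chi) powr s1))"
    (is "_ = _ * _ * infsum ?f Ch")
proof -
  let ?g = "\<lambda>chi. sL SP s2 (Xc chi) / (sL SP (2 * s1 + s2) (Xc chi) * of_nat (cnd chi) powr s1)"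
  have e: "infsum ?f Ch = infsum ?g Ch" using L_quotient_eq[OF s] by (rule infsum_cong)
  have z: "zeta_outside S s1 = infsum (nterm s1) QQ"
    "zeta_outside S (2 * s1 + 2 * s2 - 1) = infsum (nterm (2 * s1 + 2 * s2 - 1)) QQ"
    using s by (simp_all add: zeta_outside_eq)
  have I: "infsum (W s1 s2) (SE \<times> QQ \<times> QQ) = 2 ^ card S * (zeta_outside S s1 * zeta_outside S (2 * s1 + 2 * s2 - 1) * infsum ?f Ch)"
    unfolding double_series(3)[OF s] z e by (simp only: mult.assoc)
  have o: "of_nat (order (square_classes S)) * of_real (S_abs S (diag S 2)) = (4 ^ card S :: complex)"
    using arg_cong[OF order_square_classes, of complex_of_real] by simp
  have four: "(4 :: complex) ^ card S = 2 ^ card S * 2 ^ card S"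
    by (simp flip: power_mult_distrib)
  \<comment> \<open>The numerical factors cancel: 2^(card S + 1) from the normalisation, 1/2 from
    orbits and stabilizers, 2^(card S) from orthogonality over the S-units, against 4^(card S) in
    the denominator.\<close>
  show ?thesis unfolding xi_tilde_def sum_xi[OF s] o I four by simp
qed

end

text \<open>Both kinds of summability are asserted with the identity because \<open>infsum\<close>
  is 0 on a family that is not summable; without them the equation would not speak of the intended
  series.\<close>

theorem theorem1p1:
  fixes S :: "place set"
    and \<omega> :: "(place \<Rightarrow> (nat \<Rightarrow> rat) set) set \<Rightarrow> complex"
    and s1 s2 :: complex
  assumes "finite S" and "S \<subseteq> places" and "InfPlace \<in> S"
    and "real_character (square_classes S) \<omega>"
    and "Re s1 > 1" and "Re s2 > 1"
  shows "(\<forall>\<delta>\<in>carrier (square_classes S). xi_orbit_summand S s1 s2 summable_on xi_orbits S \<delta>) \<and>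
    (\<lambda>chi. L_outside S s2 chi /
        (L_outside S (2 * s1 + s2) chi * of_nat (conductor_outside S chi) powr s1))
      summable_on characters_over S \<omega> \<and>
    xi_tilde S s1 s2 \<omega> =
      zeta_outside S s1 * zeta_outside S (2 * s1 + 2 * s2 - 1) *
      (\<Sum>\<^sub>\<infinity>chi\<in>characters_over S \<omega>. L_outside S s2 chi /
        (L_outside S (2 * s1 + s2) chi * of_nat (conductor_outside S chi) powr s1))"
proof -
  interpret zeta_setup S \<omega> using assms by unfold_locales
  show ?thesis using xi_eq(1)[OF _ assms(5,6)] L_quotient_summable[OF assms(5,6)] xi_tilde_eq[OF assms(5,6)] by blast
qed

end
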